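(* Let $(\Sigma,D)$ be an affine surface equipped with a $D$-parallel (nonzero) nilpotent $(1,1)$-tensor field $T$ and a $D$-parallel symmetric $(0,2)$-tensor field $\Phi$. Suppose the Ricci tensor $\rho^D$ is symmetric and let $h\in\mathcal{C}^\infty(\Sigma)$. Then $h$ is (the potential function of) an affine gradient Ricci soliton with $dh(\ker T)=0$ if and only if $(T^*\Sigma,g_{D,\widehat\Phi,T},f=h\circ\pi)$ is an anti-self-dual steady gradient Ricci soliton which is not locally conformally flat. Moreover, in this situation there exist local coordinates $(u^1,u^2)$ on $\Sigma$ so that the only non-zero Christoffel symbol of $D$ is given by ${}^u\Gamma_{11}{}^2=\alpha(u^1)+u^2\beta(u^1)$ and the potential function $h=h(u^1)$ is determined by $h''(u^1)=-2\beta(u^1)$, where $\alpha,\beta$ are (arbitrary) smooth functions of $u^1$.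
   Context: An affine surface $(\Sigma,D)$ is a smooth connected surface with a torsion free affine connection $D$, with Christoffel symbols ${}^D\Gamma_{ij}{}^k$. Its Ricci tensor is $\rho^D(X,Y)=\operatorname{tr}\{Z\mapsto R^D(Z,X)Y\}$ with $R^D(X,Y)=[D_X,D_Y]-D_{[X,Y]}$, and $\rho^D_{sym}$ is its symmetric part. $\operatorname{Hes}^D_h=D\,dh$. A function $h\in\mathcal{C}^\infty(\Sigma)$ is an affine gradient Ricci soliton if $\operatorname{Hes}^D_h+2\rho^D_{sym}=0$. Nilpotent means $T^2=0$, $T\neq0$. For a symmetric $(0,2)$-tensor field $\Phi$ set $\widehat\Phi(X,Y)=\Phi(TX,TY)$. Let $\pi\colon T^*\Sigma\to\Sigma$ be the cotangent bundle. Local coordinates $(x^i)$ on $\Sigma$ induce coordinates $(x^i,x_{i'})$ on $T^*\Sigma$ by writing a covector as $\sum x_{i'}dx^i$. For a vector field $X$ on $\Sigma$, $\iota X(p,\alpha)=\alpha(X_p)$, and the complete lift $X^C$ is determined by $X^C(\iota Z)=\iota[X,Z]$ for all $Z$; $\iota T$ is the one-form with $\iota T(X^C)=\iota(TX)$; $g_D$ is the metric with $g_D(X^C,Y^C)=-\iota(D_XY+D_YX)$. For a symmetric $(0,2)$-tensor field $\Psi$, $g_{D,\Psi,T}=\iota T\circ\iota T+g_D+\pi^*\Psi$, where $\omega_1\circ\omega_2=\frac12(\omega_1\otimes\omega_2+\omega_2\otimes\omega_1)$; it has neutral signature. In induced coordinates, with $T\partial_i=T_i^k\partial_k$, $$g_{D,\Psi,T}=2\,dx^i\circ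 dx_{i'}+\{\tfrac12x_{r'}x_{s'}(T_i^rT_j^s+T_j^rT_i^s)-2x_{k'}{}^D\Gamma_{ij}{}^k+\Psi_{ij}\}\,dx^i\circ dx^j .$$ A triple $(M,g,f)$ is a gradient Ricci soliton if $\operatorname{Hes}_f+\rho=\lambda g$ for some $\lambda\in\mathbb{R}$ ($\operatorname{Hes}_f=\nabla df$, $\rho$ the Ricci tensor); it is steady if $\lambda=0$. $T^*\Sigma$ carries the orientation for which, for any basis $u,v$ of the null distribution $\ker\pi_*$, the bivector $u\wedge v$ is self-dual. A metric is anti-self-dual if the self-dual Weyl curvature operator $W^+$ vanishes. *)

theory Defs
  imports "HOL-Analysis.Analysis"
begin

section \<open>Smooth functions on open sets\<close>

text \<open>Meant for open \<open>S\<close>; the value of \<open>f\<close> outside \<open>S\<close> is then irrelevant.\<close>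

primrec Ck_on :: "nat \<Rightarrow> 'a::euclidean_space set \<Rightarrow> ('a \<Rightarrow> 'b::real_normed_vector) \<Rightarrow> bool" where
  "Ck_on 0 S f \<longleftrightarrow> continuous_on S f"
| "Ck_on (Suc k) S f \<longleftrightarrow>
     (\<forall>x\<in>S. f differentiable (at x)) \<and> (\<forall>v. Ck_on k S (\<lambda>x. frechet_derivative f (at x) v))"

definition smooth_on :: "'a::euclidean_space set \<Rightarrow> ('a \<Rightarrow> 'b::real_normed_vector) \<Rightarrow> bool" where
  "smooth_on S f \<longleftrightarrow> (\<forall>k. Ck_on k S f)"

definition pd :: "'n::finite \<Rightarrow> (real^'n \<Rightarrow> real) \<Rightarrow> real^'n \<Rightarrow> real" where
  "pd i f x = frechet_derivative f (at x) (axis i 1)"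


section \<open>Smooth manifolds\<close>

text \<open>
  A manifold is given by an indexed atlas; its points are those covered by the charts and its topology
  is the one determined by the charts.  A chart is a pair of its domain and its coordinate map (whose
  values outside the domain are irrelevant).
\<close>

type_synonym ('p, 'n) chart = "'p set \<times> ('p \<Rightarrow> real^'n)"

definition chart_image :: "('p, 'n::finite) chart \<Rightarrow> (real^'n) set" where
  "chart_image c = snd c ` fst c"

definition chart_inv :: "('p, 'n::finite) chart \<Rightarrow> real^'n \<Rightarrow> 'p" where
  "chart_inv c = inv_into (fst c) (snd c)"

definition is_chart :: "('p, 'n::finite) chart \<Rightarrow> bool" where
  "is_chart c \<longleftrightarrow> inj_on (snd c) (fst c) \<and> open (chart_image c)"

definition overlap :: "('p, 'n::finite) chart \<Rightarrow> ('p, 'n) chart \<Rightarrow> (real^'n) set" where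
  "overlap c c' = snd c ` (fst c \<inter> fst c')"

definition transition :: "('p, 'n::finite) chart \<Rightarrow> ('p, 'n) chart \<Rightarrow> real^'n \<Rightarrow> real^'n" where
  "transition c c' = snd c' \<circ> chart_inv c"

text \<open>If \<open>y = y(x)\<close> is the transition from \<open>c\<close> to \<open>c'\<close>, then \<open>jac c c' x $ a $ i\<close> is the partial
  derivative of \<open>y\<^sup>a\<close> in direction \<open>x\<^sup>i\<close>.\<close>

definition jac :: "('p, 'n::finite) chart \<Rightarrow> ('p, 'n) chart \<Rightarrow> real^'n \<Rightarrow> real^'n^'n" where
  "jac c c' x = matrix (frechet_derivative (transition c c') (at x))"

definition compatible :: "('p, 'n::finite) chart \<Rightarrow> ('p, 'n) chart \<Rightarrow> bool" where
  "compatible c c' \<longleftrightarrow>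
     open (overlap c c') \<and> smooth_on (overlap c c') (transition c c') \<and>
     open (overlap c' c) \<and> smooth_on (overlap c' c) (transition c' c)"

record ('i, 'p, 'n::finite) atlas =
  index :: "'i set"
  chart :: "'i \<Rightarrow> ('p, 'n) chart"

definition points :: "('i, 'p, 'n::finite) atlas \<Rightarrow> 'p set" where
  "points M = (\<Union>i\<in>index M. fst (chart M i))"

definition atlas_topology :: "('i, 'p, 'n::finite) atlas \<Rightarrow> 'p topology" where
  "atlas_topology M = topology (\<lambda>V. V \<subseteq> points M \<and>
     (\<forall>i\<in>index M. open (snd (chart M i) ` (fst (chart M i) \<inter> V))))"

definition second_countable_space :: "'p topology \<Rightarrow> bool" where
  "second_countable_space X \<longleftrightarrow>
     (\<exists>B. countable B \<and> (\<forall>V\<in>B. openin X V) \<and>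
          (\<forall>U x. openin X U \<and> x \<in> U \<longrightarrow> (\<exists>V\<in>B. x \<in> V \<and> V \<subseteq> U)))"

definition smooth_manifold :: "('i, 'p, 'n::finite) atlas \<Rightarrow> bool" where
  "smooth_manifold M \<longleftrightarrow>
     (\<forall>i\<in>index M. is_chart (chart M i)) \<and>
     (\<forall>i\<in>index M. \<forall>j\<in>index M. compatible (chart M i) (chart M j)) \<and>
     Hausdorff_space (atlas_topology M) \<and> second_countable_space (atlas_topology M)"

text \<open>A member of the maximal atlas.\<close>

definition local_coordinates :: "('i, 'p, 'n::finite) atlas \<Rightarrow> ('p, 'n) chart \<Rightarrow> bool" where
  "local_coordinates M c \<longleftrightarrow>
     is_chart c \<and> fst c \<subseteq> points M \<and> (\<forall>i\<in>index M. compatible (chart M i) c)"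

definition local_rep :: "('p, 'n::finite) chart \<Rightarrow> ('p \<Rightarrow> real) \<Rightarrow> real^'n \<Rightarrow> real" where
  "local_rep c h = h \<circ> chart_inv c"

definition smooth_function :: "('i, 'p, 'n::finite) atlas \<Rightarrow> ('p \<Rightarrow> real) \<Rightarrow> bool" where
  "smooth_function M h \<longleftrightarrow>
     (\<forall>i\<in>index M. smooth_on (chart_image (chart M i)) (local_rep (chart M i) h))"


section \<open>Tensor fields and connections\<close>

text \<open>
  Tensor fields and connections are families of components, indexed by the charts of the atlas and
  obeying the classical transformation laws.  The components of a \<open>(0,2)\<close>-tensor field \<open>\<Phi>\<close> are
  \<open>\<Phi> i j = \<Phi>(\<partial>\<^sub>i,\<partial>\<^sub>j)\<close>, those of a \<open>(1,1)\<close>-tensor field \<open>T\<close> are given by \<open>T \<partial>\<^sub>i = \<Sum>\<^sub>k T i k \<partial>\<^sub>k\<close>, and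
  the Christoffel symbols \<open>\<Gamma>\<close> of a connection \<open>D\<close> by \<open>D\<^sub>\<partial>\<^sub>i \<partial>\<^sub>j = \<Sum>\<^sub>k \<Gamma> i j k \<partial>\<^sub>k\<close>.
\<close>

type_synonym 'n field2 = "'n \<Rightarrow> 'n \<Rightarrow> real^'n \<Rightarrow> real"
type_synonym 'n field3 = "'n \<Rightarrow> 'n \<Rightarrow> 'n \<Rightarrow> real^'n \<Rightarrow> real"

definition tensor02_law ::
    "('p, 'n::finite) chart \<Rightarrow> ('p, 'n) chart \<Rightarrow> 'n field2 \<Rightarrow> 'n field2 \<Rightarrow> bool" where
  "tensor02_law c c' \<Phi> \<Phi>' \<longleftrightarrow>
     (\<forall>x\<in>overlap c c'. \<forall>i j.
        \<Phi> i j x = (\<Sum>a\<in>UNIV. \<Sum>b\<in>UNIV.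
          \<Phi>' a b (transition c c' x) * jac c c' x $ a $ i * jac c c' x $ b $ j))"

definition tensor11_law ::
    "('p, 'n::finite) chart \<Rightarrow> ('p, 'n) chart \<Rightarrow> 'n field2 \<Rightarrow> 'n field2 \<Rightarrow> bool" where
  "tensor11_law c c' T T' \<longleftrightarrow>
     (\<forall>x\<in>overlap c c'. \<forall>i a.
        (\<Sum>k\<in>UNIV. T i k x * jac c c' x $ a $ k) =
        (\<Sum>b\<in>UNIV. jac c c' x $ b $ i * T' b a (transition c c' x)))"

definition connection_law ::
    "('p, 'n::finite) chart \<Rightarrow> ('p, 'n) chart \<Rightarrow> 'n field3 \<Rightarrow> 'n field3 \<Rightarrow> bool" where
  "connection_law c c' \<Gamma> \<Gamma>' \<longleftrightarrow>
     (\<forall>x\<in>overlap c c'. \<forall>i j a.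
        (\<Sum>k\<in>UNIV. \<Gamma> i j k x * jac c c' x $ a $ k) =
        pd i (\<lambda>y. jac c c' y $ a $ j) x +
        (\<Sum>b\<in>UNIV. \<Sum>d\<in>UNIV.
          \<Gamma>' b d a (transition c c' x) * jac c c' x $ b $ i * jac c c' x $ d $ j))"

definition tensor02_field ::
    "('i, 'p, 'n::finite) atlas \<Rightarrow> ('i \<Rightarrow> 'n field2) \<Rightarrow> bool" where
  "tensor02_field M \<Phi> \<longleftrightarrow>
     (\<forall>i\<in>index M. \<forall>a b. smooth_on (chart_image (chart M i)) (\<Phi> i a b)) \<and>
     (\<forall>i\<in>index M. \<forall>j\<in>index M. tensor02_law (chart M i) (chart M j) (\<Phi> i) (\<Phi> j))"

definition symmetric_field ::
    "('i, 'p, 'n::finite) atlas \<Rightarrow> ('i \<Rightarrow> 'n field2) \<Rightarrow> bool" where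
  "symmetric_field M \<Phi> \<longleftrightarrow>
     (\<forall>i\<in>index M. \<forall>x\<in>chart_image (chart M i). \<forall>a b. \<Phi> i a b x = \<Phi> i b a x)"

definition tensor11_field ::
    "('i, 'p, 'n::finite) atlas \<Rightarrow> ('i \<Rightarrow> 'n field2) \<Rightarrow> bool" where
  "tensor11_field M T \<longleftrightarrow>
     (\<forall>i\<in>index M. \<forall>a b. smooth_on (chart_image (chart M i)) (T i a b)) \<and>
     (\<forall>i\<in>index M. \<forall>j\<in>index M. tensor11_law (chart M i) (chart M j) (T i) (T j))"

text \<open>\<open>T\<^sup>2 = 0\<close> and \<open>T\<close> is not the zero tensor field.\<close>

definition nilpotent_field ::
    "('i, 'p, 'n::finite) atlas \<Rightarrow> ('i \<Rightarrow> 'n field2) \<Rightarrow> bool" where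
  "nilpotent_field M T \<longleftrightarrow>
     (\<forall>i\<in>index M. \<forall>x\<in>chart_image (chart M i). \<forall>a b. (\<Sum>k\<in>UNIV. T i a k x * T i k b x) = 0) \<and>
     (\<exists>i\<in>index M. \<exists>x\<in>chart_image (chart M i). \<exists>a b. T i a b x \<noteq> 0)"

definition torsion_free_connection ::
    "('i, 'p, 'n::finite) atlas \<Rightarrow> ('i \<Rightarrow> 'n field3) \<Rightarrow> bool" where
  "torsion_free_connection M D \<longleftrightarrow>
     (\<forall>i\<in>index M. \<forall>a b k. smooth_on (chart_image (chart M i)) (D i a b k)) \<and>
     (\<forall>i\<in>index M. \<forall>j\<in>index M. connection_law (chart M i) (chart M j) (D i) (D j)) \<and>
     (\<forall>i\<in>index M. \<forall>x\<in>chart_image (chart M i). \<forall>a b k. D i a b k x = D i b a k x)"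

definition parallel02 ::
    "('i, 'p, 'n::finite) atlas \<Rightarrow> ('i \<Rightarrow> 'n field3) \<Rightarrow> ('i \<Rightarrow> 'n field2) \<Rightarrow> bool" where
  "parallel02 M D \<Phi> \<longleftrightarrow>
     (\<forall>i\<in>index M. \<forall>x\<in>chart_image (chart M i). \<forall>k a b.
        pd k (\<Phi> i a b) x
        - (\<Sum>m\<in>UNIV. D i k a m x * \<Phi> i m b x) - (\<Sum>m\<in>UNIV. D i k b m x * \<Phi> i a m x) = 0)"

definition parallel11 ::
    "('i, 'p, 'n::finite) atlas \<Rightarrow> ('i \<Rightarrow> 'n field3) \<Rightarrow> ('i \<Rightarrow> 'n field2) \<Rightarrow> bool" where
  "parallel11 M D T \<longleftrightarrow>
     (\<forall>i\<in>index M. \<forall>x\<in>chart_image (chart M i). \<forall>k a b.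
        pd k (T i a b) x
        + (\<Sum>m\<in>UNIV. T i a m x * D i k m b x) - (\<Sum>m\<in>UNIV. D i k a m x * T i m b x) = 0)"

text \<open>\<open>curvature \<Gamma> i j k l\<close> is the \<open>\<partial>\<^sub>l\<close>-component of \<open>R(\<partial>\<^sub>i,\<partial>\<^sub>j)\<partial>\<^sub>k = D\<^sub>\<partial>\<^sub>i D\<^sub>\<partial>\<^sub>j \<partial>\<^sub>k - D\<^sub>\<partial>\<^sub>j D\<^sub>\<partial>\<^sub>i \<partial>\<^sub>k\<close>.\<close>

definition curvature :: "'n::finite field3 \<Rightarrow> 'n \<Rightarrow> 'n \<Rightarrow> 'n \<Rightarrow> 'n \<Rightarrow> real^'n \<Rightarrow> real" where
  "curvature \<Gamma> i j k l x =
     pd i (\<Gamma> j k l) x - pd j (\<Gamma> i k l) x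
     + (\<Sum>m\<in>UNIV. \<Gamma> j k m x * \<Gamma> i m l x - \<Gamma> i k m x * \<Gamma> j m l x)"

text \<open>\<open>\<rho>(X,Y)\<close> is the trace of \<open>Z \<mapsto> R(Z,X)Y\<close>.\<close>

definition ricci :: "'n::finite field3 \<Rightarrow> 'n field2" where
  "ricci \<Gamma> j k x = (\<Sum>i\<in>UNIV. curvature \<Gamma> i j k i x)"

definition ricci_sym :: "'n::finite field3 \<Rightarrow> 'n field2" where
  "ricci_sym \<Gamma> j k x = (ricci \<Gamma> j k x + ricci \<Gamma> k j x) / 2"

definition hessian :: "'n::finite field3 \<Rightarrow> (real^'n \<Rightarrow> real) \<Rightarrow> 'n field2" where
  "hessian \<Gamma> f i j x = pd i (pd j f) x - (\<Sum>k\<in>UNIV. \<Gamma> i j k x * pd k f x)"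


section \<open>Affine surfaces\<close>

definition affine_surface :: "('i, 'p, 2) atlas \<Rightarrow> ('i \<Rightarrow> 2 field3) \<Rightarrow> bool" where
  "affine_surface M D \<longleftrightarrow>
     smooth_manifold M \<and> connected_space (atlas_topology M) \<and> torsion_free_connection M D"

definition affine_gradient_Ricci_soliton ::
    "('i, 'p, 2) atlas \<Rightarrow> ('i \<Rightarrow> 2 field3) \<Rightarrow> ('p \<Rightarrow> real) \<Rightarrow> bool" where
  "affine_gradient_Ricci_soliton M D h \<longleftrightarrow>
     smooth_function M h \<and>
     (\<forall>i\<in>index M. \<forall>x\<in>chart_image (chart M i). \<forall>a b.
        hessian (D i) (local_rep (chart M i) h) a b x + 2 * ricci_sym (D i) a b x = 0)"

definition differential_vanishes_on_kernel ::
    "('i, 'p, 'n::finite) atlas \<Rightarrow> ('i \<Rightarrow> 'n field2) \<Rightarrow> ('p \<Rightarrow> real) \<Rightarrow> bool" where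
  "differential_vanishes_on_kernel M T h \<longleftrightarrow>
     (\<forall>i\<in>index M. \<forall>x\<in>chart_image (chart M i). \<forall>v :: real^'n.
        (\<forall>k. (\<Sum>a\<in>UNIV. v $ a * T i a k x) = 0) \<longrightarrow>
        (\<Sum>a\<in>UNIV. v $ a * pd a (local_rep (chart M i) h) x) = 0)"

text \<open>The tensor field \<open>(X,Y) \<mapsto> \<Phi>(TX,TY)\<close>.\<close>

definition hat_field :: "('i \<Rightarrow> 'n::finite field2) \<Rightarrow> ('i \<Rightarrow> 'n field2) \<Rightarrow> 'i \<Rightarrow> 'n field2" where
  "hat_field T \<Phi> i a b x = (\<Sum>r\<in>UNIV. \<Sum>s\<in>UNIV. T i a r x * T i b s x * \<Phi> i r s x)"


section \<open>The cotangent bundle\<close>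

text \<open>
  A covector at \<open>p\<close> is the family of its components in the charts around \<open>p\<close>, related by the
  transformation law of covectors (and, for uniqueness, zero at all other indices).
\<close>

definition cotangent_space :: "('i, 'p, 'n::finite) atlas \<Rightarrow> 'p \<Rightarrow> ('i \<Rightarrow> real^'n) set" where
  "cotangent_space M p = {\<omega>.
     (\<forall>i\<in>index M. \<forall>j\<in>index M. p \<in> fst (chart M i) \<and> p \<in> fst (chart M j) \<longrightarrow>
        \<omega> i = transpose (jac (chart M i) (chart M j) (snd (chart M i) p)) *v \<omega> j) \<and>
     (\<forall>i. \<not> (i \<in> index M \<and> p \<in> fst (chart M i)) \<longrightarrow> \<omega> i = 0)}"

text \<open>
  In the induced charts, \<open>Inl i\<close> is the index of the coordinate \<open>x\<^sup>i\<close> and \<open>Inr i\<close> that of the fibre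
  coordinate \<open>x\<^sub>i\<^sub>'\<close>.  The bundle projection is \<open>fst\<close>.
\<close>

definition cotangent_bundle ::
    "('i, 'p, 'n::finite) atlas \<Rightarrow> ('i, 'p \<times> ('i \<Rightarrow> real^'n), 'n + 'n) atlas" where
  "cotangent_bundle M =
     \<lparr> index = index M,
       chart = (\<lambda>i. ({(p, \<omega>). p \<in> fst (chart M i) \<and> \<omega> \<in> cotangent_space M p},
                     \<lambda>(p, \<omega>). \<chi> a. case a of Inl k \<Rightarrow> snd (chart M i) p $ k | Inr k \<Rightarrow> \<omega> i $ k)) \<rparr>"

definition base_part :: "real^('n::finite + 'n) \<Rightarrow> real^'n" where
  "base_part z = (\<chi> k. z $ Inl k)"

text \<open>
  The metric \<open>g\<^bsub>D,\<Psi>,T\<^esub>\<close> in induced coordinates.  As \<open>\<omega>\<^sub>1 \<circ> \<omega>\<^sub>2\<close> carries the factor \<open>1/2\<close>, the term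
  \<open>2 dx\<^sup>i \<circ> dx\<^sub>i\<^sub>'\<close> pairs \<open>\<partial>\<^sub>i\<close> with \<open>\<partial>\<^sub>i\<^sub>'\<close> to \<open>1\<close>, and \<open>A\<^sub>i\<^sub>j dx\<^sup>i \<circ> dx\<^sup>j\<close> with symmetric \<open>A\<close> has the components
  \<open>A\<^sub>i\<^sub>j\<close>.
\<close>

definition modified_riemann_extension ::
    "('i \<Rightarrow> 'n::finite field3) \<Rightarrow> ('i \<Rightarrow> 'n field2) \<Rightarrow> ('i \<Rightarrow> 'n field2) \<Rightarrow> 'i \<Rightarrow> ('n + 'n) field2" where
  "modified_riemann_extension D \<Psi> T c a b z =
     (case (a, b) of
        (Inl i, Inl j) \<Rightarrow>
          1/2 * (\<Sum>r\<in>UNIV. \<Sum>s\<in>UNIV. z $ Inr r * z $ Inr s *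
            (T c i r (base_part z) * T c j s (base_part z) +
             T c j r (base_part z) * T c i s (base_part z)))
          - 2 * (\<Sum>k\<in>UNIV. z $ Inr k * D c i j k (base_part z))
          + \<Psi> c i j (base_part z)
      | (Inl i, Inr j) \<Rightarrow> if i = j then 1 else 0
      | (Inr i, Inl j) \<Rightarrow> if i = j then 1 else 0
      | (Inr i, Inr j) \<Rightarrow> 0)"


section \<open>Pseudo-Riemannian metrics\<close>

definition gmat :: "'n::finite field2 \<Rightarrow> real^'n \<Rightarrow> real^'n^'n" where
  "gmat g x = (\<chi> i j. g i j x)"

definition ginv :: "'n::finite field2 \<Rightarrow> real^'n \<Rightarrow> real^'n^'n" where
  "ginv g x = matrix_inv (gmat g x)"

definition pseudo_Riemannian_metric ::
    "('i, 'p, 'n::finite) atlas \<Rightarrow> ('i \<Rightarrow> 'n field2) \<Rightarrow> bool" where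
  "pseudo_Riemannian_metric M g \<longleftrightarrow>
     tensor02_field M g \<and> symmetric_field M g \<and>
     (\<forall>i\<in>index M. \<forall>x\<in>chart_image (chart M i). invertible (gmat (g i) x))"

definition levi_civita :: "'n::finite field2 \<Rightarrow> 'n field3" where
  "levi_civita g i j k x =
     1/2 * (\<Sum>l\<in>UNIV. ginv g x $ k $ l * (pd i (g j l) x + pd j (g i l) x - pd l (g i j) x))"

text \<open>\<open>R\<^sub>i\<^sub>j\<^sub>k\<^sub>l = g(R(\<partial>\<^sub>i,\<partial>\<^sub>j)\<partial>\<^sub>k,\<partial>\<^sub>l)\<close>\<close>

definition riemann :: "'n::finite field2 \<Rightarrow> 'n \<Rightarrow> 'n \<Rightarrow> 'n \<Rightarrow> 'n \<Rightarrow> real^'n \<Rightarrow> real" where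
  "riemann g i j k l x = (\<Sum>m\<in>UNIV. curvature (levi_civita g) i j k m x * g m l x)"

definition scalar_curvature :: "'n::finite field2 \<Rightarrow> real^'n \<Rightarrow> real" where
  "scalar_curvature g x = (\<Sum>i\<in>UNIV. \<Sum>j\<in>UNIV. ginv g x $ i $ j * ricci (levi_civita g) i j x)"

definition weyl :: "'n::finite field2 \<Rightarrow> 'n \<Rightarrow> 'n \<Rightarrow> 'n \<Rightarrow> 'n \<Rightarrow> real^'n \<Rightarrow> real" where
  "weyl g i j k l x =
     (let \<rho> = ricci (levi_civita g); n = real CARD('n) in
      riemann g i j k l x
      - (g i l x * \<rho> j k x - g i k x * \<rho> j l x + \<rho> i l x * g j k x - \<rho> i k x * g j l x) / (n - 2)
      + scalar_curvature g x * (g i l x * g j k x - g i k x * g j l x) / ((n - 1) * (n - 2)))"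

definition gradient_Ricci_soliton ::
    "('i, 'p, 'n::finite) atlas \<Rightarrow> ('i \<Rightarrow> 'n field2) \<Rightarrow> ('p \<Rightarrow> real) \<Rightarrow> real \<Rightarrow> bool" where
  "gradient_Ricci_soliton M g f lam \<longleftrightarrow>
     pseudo_Riemannian_metric M g \<and> smooth_function M f \<and>
     (\<forall>i\<in>index M. \<forall>x\<in>chart_image (chart M i). \<forall>a b.
        hessian (levi_civita (g i)) (local_rep (chart M i) f) a b x + ricci (levi_civita (g i)) a b x
        = lam * g i a b x)"

abbreviation steady_gradient_Ricci_soliton ::
    "('i, 'p, 'n::finite) atlas \<Rightarrow> ('i \<Rightarrow> 'n field2) \<Rightarrow> ('p \<Rightarrow> real) \<Rightarrow> bool" where
  "steady_gradient_Ricci_soliton M g f \<equiv> gradient_Ricci_soliton M g f 0"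

definition flat_on :: "(real^'n) set \<Rightarrow> 'n::finite field2 \<Rightarrow> bool" where
  "flat_on V g \<longleftrightarrow> (\<forall>x\<in>V. \<forall>i j k l. curvature (levi_civita g) i j k l x = 0)"

definition locally_conformally_flat ::
    "('i, 'p, 'n::finite) atlas \<Rightarrow> ('i \<Rightarrow> 'n field2) \<Rightarrow> bool" where
  "locally_conformally_flat M g \<longleftrightarrow>
     (\<forall>i\<in>index M. \<forall>x\<in>chart_image (chart M i). \<exists>V \<sigma>.
        open V \<and> x \<in> V \<and> V \<subseteq> chart_image (chart M i) \<and> smooth_on V \<sigma> \<and>
        flat_on V (\<lambda>a b y. exp (2 * \<sigma> y) * g i a b y))"


section \<open>Self-duality in dimension four\<close>

text \<open>
  An orientation assigns to the coordinate frame of each chart, in the order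
  \<open>\<partial>\<^bsub>Inl 1\<^esub>, \<partial>\<^bsub>Inl 2\<^esub>, \<partial>\<^bsub>Inr 1\<^esub>, \<partial>\<^bsub>Inr 2\<^esub>\<close>, the sign \<open>1\<close> (positive) or \<open>-1\<close> (negative).
\<close>

definition orientation ::
    "('i, 'p, 2 + 2) atlas \<Rightarrow> ('i \<Rightarrow> real^(2 + 2) \<Rightarrow> real) \<Rightarrow> bool" where
  "orientation M orn \<longleftrightarrow>
     (\<forall>i\<in>index M. continuous_on (chart_image (chart M i)) (orn i) \<and>
        (\<forall>x\<in>chart_image (chart M i). orn i x \<in> {1, -1})) \<and>
     (\<forall>i\<in>index M. \<forall>j\<in>index M. \<forall>x\<in>overlap (chart M i) (chart M j).
        orn i x = orn j (transition (chart M i) (chart M j) x) *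
                  sgn (det (jac (chart M i) (chart M j) x)))"

definition levi_civita_symbol :: "2 + 2 \<Rightarrow> 2 + 2 \<Rightarrow> 2 + 2 \<Rightarrow> 2 + 2 \<Rightarrow> real" where
  "levi_civita_symbol i j k l =
     det ((\<chi> r. if r = Inl 1 then axis i 1 else if r = Inl 2 then axis j 1
               else if r = Inr 1 then axis k 1 else axis l 1) :: real^(2 + 2)^(2 + 2))"

definition volume_form ::
    "(2 + 2) field2 \<Rightarrow> real \<Rightarrow> real^(2 + 2) \<Rightarrow> 2 + 2 \<Rightarrow> 2 + 2 \<Rightarrow> 2 + 2 \<Rightarrow> 2 + 2 \<Rightarrow> real" where
  "volume_form g s x i j k l = s * sqrt \<bar>det (gmat g x)\<bar> * levi_civita_symbol i j k l"

text \<open>A bivector \<open>B\<close> is given by its skew-symmetric matrix of components \<open>B\<^sup>i\<^sup>j\<close>; the argument \<open>s\<close> is the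
  sign of the coordinate frame at \<open>x\<close>.\<close>

definition bivector :: "real^'n^'n \<Rightarrow> bool" where
  "bivector B \<longleftrightarrow> transpose B = - B"

definition wedge :: "real^'n \<Rightarrow> real^'n \<Rightarrow> real^'n^'n" where
  "wedge u v = (\<chi> i j. u $ i * v $ j - u $ j * v $ i)"

definition hodge_star ::
    "(2 + 2) field2 \<Rightarrow> real \<Rightarrow> real^(2 + 2) \<Rightarrow> real^(2 + 2)^(2 + 2) \<Rightarrow> real^(2 + 2)^(2 + 2)" where
  "hodge_star g s x B =
     (\<chi> i j. 1/2 * (\<Sum>a\<in>UNIV. \<Sum>b\<in>UNIV. \<Sum>k\<in>UNIV. \<Sum>l\<in>UNIV.
        ginv g x $ i $ a * ginv g x $ j $ b * volume_form g s x k l a b * B $ k $ l))"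

definition self_dual ::
    "(2 + 2) field2 \<Rightarrow> real \<Rightarrow> real^(2 + 2) \<Rightarrow> real^(2 + 2)^(2 + 2) \<Rightarrow> bool" where
  "self_dual g s x B \<longleftrightarrow> bivector B \<and> hodge_star g s x B = B"

definition weyl_operator ::
    "'n::finite field2 \<Rightarrow> real^'n \<Rightarrow> real^'n^'n \<Rightarrow> real^'n^'n" where
  "weyl_operator g x B =
     (\<chi> i j. 1/2 * (\<Sum>a\<in>UNIV. \<Sum>b\<in>UNIV. \<Sum>k\<in>UNIV. \<Sum>l\<in>UNIV.
        ginv g x $ i $ a * ginv g x $ j $ b * weyl g k l a b x * B $ k $ l))"

text \<open>\<open>W\<^sup>+\<close> is the restriction of the Weyl operator to self-dual bivectors.\<close>

definition anti_self_dual ::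
    "('i, 'p, 2 + 2) atlas \<Rightarrow> ('i \<Rightarrow> (2 + 2) field2) \<Rightarrow> ('i \<Rightarrow> real^(2 + 2) \<Rightarrow> real) \<Rightarrow> bool" where
  "anti_self_dual M g orn \<longleftrightarrow>
     (\<forall>i\<in>index M. \<forall>x\<in>chart_image (chart M i). \<forall>B.
        self_dual (g i) (orn i x) x B \<longrightarrow> weyl_operator (g i) x B = 0)"

text \<open>In induced coordinates, the kernel of the differential of the projection consists of the vectors
  whose \<open>Inl\<close>-components vanish.\<close>

definition vertical :: "real^('n::finite + 'n) \<Rightarrow> bool" where
  "vertical v \<longleftrightarrow> base_part v = 0"

definition cotangent_orientation ::
    "('i, 'p, 2) atlas \<Rightarrow> ('i \<Rightarrow> (2 + 2) field2) \<Rightarrow> ('i \<Rightarrow> real^(2 + 2) \<Rightarrow> real) \<Rightarrow> bool" where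
  "cotangent_orientation M g orn \<longleftrightarrow>
     orientation (cotangent_bundle M) orn \<and>
     (\<forall>i\<in>index M. \<forall>z\<in>chart_image (chart (cotangent_bundle M) i). \<forall>u v.
        vertical u \<and> vertical v \<and> u \<noteq> v \<and> independent {u, v} \<longrightarrow>
        self_dual (g i) (orn i z) z (wedge u v))"


section \<open>The local model\<close>

definition model_connection :: "(real \<Rightarrow> real) \<Rightarrow> (real \<Rightarrow> real) \<Rightarrow> 2 field3" where
  "model_connection \<alpha> \<beta> i j k u =
     (if i = 1 \<and> j = 1 \<and> k = 2 then \<alpha> (u $ 1) + u $ 2 * \<beta> (u $ 1) else 0)"

definition model_strip :: "real set \<Rightarrow> (unit, real^2, 2) atlas" where
  "model_strip J = \<lparr> index = UNIV, chart = (\<lambda>_. ({u. u $ 1 \<in> J}, id)) \<rparr>"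

text \<open>The potential function, as a function of \<open>u\<^sup>1\<close>, solves \<open>k'' = -2 \<beta>\<close> on the interval \<open>J\<close>.\<close>

definition model_data :: "real set \<Rightarrow> (real \<Rightarrow> real) \<Rightarrow> (real \<Rightarrow> real) \<Rightarrow> (real \<Rightarrow> real) \<Rightarrow> bool" where
  "model_data J \<alpha> \<beta> k \<longleftrightarrow>
     open J \<and> is_interval J \<and> J \<noteq> {} \<and> smooth_on J \<alpha> \<and> smooth_on J \<beta> \<and> smooth_on J k \<and>
     (\<forall>t\<in>J. deriv (deriv k) t = - 2 * \<beta> t)"

end

theory Submission
  imports Defs
begin

text \<open>
  In induced coordinates \<open>g\<^bsub>D,\<Psi>,T\<^esub>\<close> is a Walker metric whose Ricci tensor is the pullback of \<open>2 \<rho>\<^sub>s\<^sub>y\<^sub>m\<close>.  The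
  Hessian of \<open>h \<circ> \<pi>\<close> is the pullback of the affine Hessian plus a term linear in the fibre, which
  vanishes iff \<open>dh \<circ> T = 0\<close>; this settles the soliton equations.  Since \<open>T\<close> is parallel and \<open>\<rho>\<close> is
  symmetric, the curvature is a multiple of \<open>T\<close>, and \<open>W\<^sup>+\<close> reduces to the Codazzi tensor of the curvature,
  which the soliton equation annihilates.  A conformally flat representative would force the quadratic
  fibre term of the metric, hence \<open>T\<close>, to vanish.

  For the coordinates, write \<open>T = \<omega> \<otimes> V\<close> with \<open>\<omega>\<close> and \<open>V\<close> parallel, where \<open>\<omega> = du\<^sup>1\<close>, and choose \<open>u\<^sup>2\<close> with
  \<open>du\<^sup>2(V) = 1\<close>.  Then \<open>D du\<^sup>2 = -F \<omega> \<otimes> \<omega>\<close> is the only remaining Christoffel symbol, \<open>\<rho> = V(F) \<omega> \<otimes> \<omega>\<close>, and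
  the soliton equation for \<open>h = k(u\<^sup>1)\<close> reads \<open>k'' + 2 V(F) = 0\<close>, so that \<open>F\<close> is affine in \<open>u\<^sup>2\<close>.
\<close>

section \<open>Calculus of smooth functions\<close>

text \<open>The tensor identities become polynomial identities between jets of \<Gamma>, T and
  \<Phi>, and the work goes into making them checkable by ring normalisation. Side conditions are
  solved in advance instead of being carried along: T^2 = 0 by the rank-one form T_i^k = w_i v^k
  with w(v) = 0; parallelism by expressing every derivative of T and of the lifted \<Phi> through
  \<Gamma>; torsion-freeness by ordering indices; R = r T by eliminating two derivatives of
  \<Gamma>. Only the Weyl component with indices 1, 2, 1, 2 is still too large and is split into
  coefficients that vanish separately. Nilpotency gives T \<noteq> 0 at one point, whereas the
  rank-one arguments need it everywhere; connectedness of the surface supplies this. The orientation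
  hypothesis enters through the bivector of the two fibre directions, which makes every induced
  frame positive. Potentials, primitives and inverse maps are constructed with a derivative that is
  built from known smooth functions or from the construction itself, so that smoothness follows by
  raising the order one step at a time.\<close>

lemma has_derivative_cong_open:
  assumes "open S" "x \<in> S" "\<And>y. y \<in> S \<Longrightarrow> f y = g y"
  shows "(f has_derivative D) (at x) \<longleftrightarrow> (g has_derivative D) (at x)"
proof
  show "(f has_derivative D) (at x) \<Longrightarrow> (g has_derivative D) (at x)"
    by (erule has_derivative_transform_within_open[OF _ assms(1,2)]) (simp add: assms(3))
  show "(g has_derivative D) (at x) \<Longrightarrow> (f has_derivative D) (at x)"
    by (erule has_derivative_transform_within_open[OF _ assms(1,2)]) (simp add: assms(3))
qed

lemma differentiable_cong_open:
  assumes "open S" "x \<in> S" "\<And>y. y \<in> S \<Longrightarrow> f y = g y"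
  shows "f differentiable (at x) \<longleftrightarrow> g differentiable (at x)"
  by (simp add: differentiable_def has_derivative_cong_open[OF assms])

lemma frechet_derivative_cong_open:
  assumes "open S" "x \<in> S" "\<And>y. y \<in> S \<Longrightarrow> f y = g y"
  shows "frechet_derivative f (at x) = frechet_derivative g (at x)"
  by (simp add: frechet_derivative_def has_derivative_cong_open[OF assms])

lemma Ck_on_cong:
  assumes "open S" "\<And>x. x \<in> S \<Longrightarrow> f x = g x"
  shows "Ck_on k S f \<longleftrightarrow> Ck_on k S g"
  using assms(2)
proof (induction k arbitrary: f g)
  case 0
  then show ?case by (auto cong: continuous_on_cong)
next
  case (Suc k)
  have "Ck_on k S (\<lambda>x. frechet_derivative f (at x) v) \<longleftrightarrow> Ck_on k S (\<lambda>x. frechet_derivative g (at x) v)" for v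
    by (rule Suc.IH) (simp add: frechet_derivative_cong_open[OF assms(1) _ Suc.prems])
  moreover have "\<forall>x\<in>S. f differentiable (at x) \<longleftrightarrow> g differentiable (at x)"
    by (simp add: differentiable_cong_open[OF assms(1) _ Suc.prems])
  ultimately show ?case by auto
qed

lemma Ck_on_subset: "Ck_on k S f \<Longrightarrow> S' \<subseteq> S \<Longrightarrow> Ck_on k S' f"
  by (induction k arbitrary: f) (auto intro: continuous_on_subset)

text \<open>\<open>Ck_on\<close> speaks of \<open>frechet_derivative\<close>, a chosen value; on an
  open set any explicitly known derivative may replace it. The inductive closure proofs below use
  this form.\<close>

lemma Ck_on_SucI:
  assumes "open S" "\<And>x. x \<in> S \<Longrightarrow> (f has_derivative f' x) (at x)" "\<And>v. Ck_on k S (\<lambda>x. f' x v)"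
  shows "Ck_on (Suc k) S f"
proof -
  have "frechet_derivative f (at x) = f' x" if "x \<in> S" for x
    using assms(2)[OF that] by (simp add: frechet_derivative_at[symmetric])
  then have "Ck_on k S (\<lambda>x. frechet_derivative f (at x) v)" for v
    using assms(3)[of v] by (subst Ck_on_cong[OF assms(1), where g = "\<lambda>x. f' x v"]) auto
  then show ?thesis using assms(2) by (auto simp: differentiable_def)
qed

lemma Ck_on_SucD:
  assumes "Ck_on (Suc k) S f" "x \<in> S"
  shows "(f has_derivative frechet_derivative f (at x)) (at x)"
  using assms by (simp add: frechet_derivative_works)

lemma Ck_on_mono: "Ck_on (Suc k) S f \<Longrightarrow> Ck_on k S f"
  by (induction k arbitrary: f)
    (auto simp: continuous_at_imp_continuous_on differentiable_imp_continuous_within)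

lemma Ck_on_const [simp]: "Ck_on k S (\<lambda>x. c)"
  by (induction k arbitrary: c) (auto simp: frechet_derivative_const)

lemma Ck_on_linear:
  assumes "bounded_linear f" "open S"
  shows "Ck_on k S f"
proof (cases k)
  case 0
  then show ?thesis using assms by (simp add: linear_continuous_on)
next
  case (Suc n)
  show ?thesis unfolding Suc
    by (rule Ck_on_SucI[where f' = "\<lambda>x. f"]) (use assms in \<open>auto intro: bounded_linear_imp_has_derivative\<close>)
qed

lemma Ck_on_add:
  assumes "open S" "Ck_on k S f" "Ck_on k S g"
  shows "Ck_on k S (\<lambda>x. f x + g x)"
  using assms(2,3)
proof (induction k arbitrary: f g)
  case 0
  then show ?case by (auto intro: continuous_on_add)
next
  case (Suc k)
  show ?case
    by (rule Ck_on_SucI[OF assms(1) has_derivative_add[OF Ck_on_SucD[OF Suc.prems(1)] Ck_on_SucD[OF Suc.prems(2)]]])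
      (use Suc in auto)
qed

lemma Ck_on_sum:
  assumes "open S" "\<And>i. i \<in> I \<Longrightarrow> Ck_on k S (f i)"
  shows "Ck_on k S (\<lambda>x. \<Sum>i\<in>I. f i x)"
  using assms(2) by (induction I rule: infinite_finite_induct) (auto intro: Ck_on_add[OF assms(1)])

text \<open>The Leibniz rule produces one term with f and one with g undifferentiated; these are
  lowered by one order with \<open>Ck_on_mono\<close>. A general bilinear \<open>B\<close> covers
  products, scaling and inner products at once.\<close>

lemma Ck_on_bilinear:
  assumes "bounded_bilinear B" "open S" "Ck_on k S f" "Ck_on k S g"
  shows "Ck_on k S (\<lambda>x. B (f x) (g x))"
  using assms(3,4)
proof (induction k arbitrary: f g)
  case 0
  then show ?case using assms(1) by (auto intro: bounded_bilinear.continuous_on)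
next
  case (Suc k)
  show ?case
    by (rule Ck_on_SucI[OF assms(2) bounded_bilinear.FDERIV[OF assms(1) Ck_on_SucD[OF Suc.prems(1)] Ck_on_SucD[OF Suc.prems(2)]]])
      (use Suc.prems Ck_on_mono[OF Suc.prems(1)] Ck_on_mono[OF Suc.prems(2)] in
        \<open>auto intro!: Ck_on_add[OF assms(2)] Suc.IH\<close>)
qed

lemmas Ck_on_mult = Ck_on_bilinear[OF bounded_bilinear_mult]
lemmas Ck_on_scaleR = Ck_on_bilinear[OF bounded_bilinear_scaleR]

lemma Ck_on_compose:
  fixes g :: "'b::euclidean_space \<Rightarrow> 'c::real_normed_vector" and f :: "'a::euclidean_space \<Rightarrow> 'b"
  assumes "open S" "open U" "f ` S \<subseteq> U" "Ck_on k S f" "Ck_on k U g"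
  shows "Ck_on k S (\<lambda>x. g (f x))"
  using assms(4,5)
proof (induction k arbitrary: g)
  case 0
  then show ?case using assms(3) by (auto intro: continuous_on_compose2)
next
  case (Suc k)
  let ?f' = "\<lambda>x. frechet_derivative f (at x)" and ?g' = "\<lambda>x. frechet_derivative g (at x)"
  have fS: "f x \<in> U" if "x \<in> S" for x using assms(3) that by auto
  have f': "(f has_derivative ?f' x) (at x)" if "x \<in> S" for x
    using Ck_on_SucD[OF Suc.prems(1) that] .
  have g': "(g has_derivative ?g' (f x)) (at (f x))" if "x \<in> S" for x
    using Ck_on_SucD[OF Suc.prems(2) fS[OF that]] .
  \<comment> \<open>The direction \<open>?f' x v\<close> varies with x, which the induction
    hypothesis does not permit. Expansion in the basis leaves fixed directions b with scalar
    coefficients.\<close>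
  have eq: "?g' (f x) (?f' x v) = (\<Sum>b\<in>Basis. (?f' x v \<bullet> b) *\<^sub>R ?g' (f x) b)" if "x \<in> S" for x v
  proof -
    interpret bounded_linear "?g' (f x)" using g'[OF that] by (rule has_derivative_bounded_linear)
    have "?g' (f x) (?f' x v) = ?g' (f x) (\<Sum>b\<in>Basis. (?f' x v \<bullet> b) *\<^sub>R b)"
      by (simp add: euclidean_representation)
    then show ?thesis by (simp add: sum scaleR)
  qed
  show ?case
  proof (rule Ck_on_SucI[OF assms(1)])
    show "((\<lambda>x. g (f x)) has_derivative (\<lambda>v. ?g' (f x) (?f' x v))) (at x)" if "x \<in> S" for x
      by (rule has_derivative_compose[OF f'[OF that] g'[OF that]])
    fix v
    have "Ck_on k S (\<lambda>x. \<Sum>b\<in>Basis. (?f' x v \<bullet> b) *\<^sub>R ?g' (f x) b)"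
    proof (intro Ck_on_sum[OF assms(1)] Ck_on_scaleR[OF assms(1)])
      fix b :: 'b
      show "Ck_on k S (\<lambda>x. ?f' x v \<bullet> b)"
        using Ck_on_bilinear[OF bounded_bilinear_inner assms(1), of k "\<lambda>x. ?f' x v" "\<lambda>x. b"] Suc.prems(1) by simp
      show "Ck_on k S (\<lambda>x. ?g' (f x) b)"
        using Suc.IH[of "\<lambda>y. ?g' y b"] Suc.prems Ck_on_mono by auto
    qed
    then show "Ck_on k S (\<lambda>x. ?g' (f x) (?f' x v))"
      by (subst Ck_on_cong[OF assms(1) eq])
  qed
qed

text \<open>The derivative of 1/f is again built from 1/f and f', so order k for 1/f yields order k
  + 1.\<close>

lemma Ck_on_inverse:
  fixes f :: "'a::euclidean_space \<Rightarrow> real"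
  assumes "open S" "\<And>x. x \<in> S \<Longrightarrow> f x \<noteq> 0" "Ck_on k S f"
  shows "Ck_on k S (\<lambda>x. inverse (f x))"
  using assms(3)
proof (induction k)
  case 0
  then show ?case using assms by (auto intro: continuous_on_inverse)
next
  case (Suc k)
  have IH: "Ck_on k S (\<lambda>x. inverse (f x))" using Suc Ck_on_mono by blast
  show ?case
  proof (rule Ck_on_SucI[OF assms(1)])
    show "((\<lambda>x. inverse (f x)) has_derivative
        (\<lambda>v. - (inverse (f x) * frechet_derivative f (at x) v * inverse (f x)))) (at x)" if "x \<in> S" for x
      by (rule Deriv.has_derivative_inverse[OF assms(2)[OF that] Ck_on_SucD[OF Suc.prems that]])
    have *: "- (inverse (f x) * frechet_derivative f (at x) v * inverse (f x)) =
      (-1) * (inverse (f x) * (frechet_derivative f (at x) v * inverse (f x)))" for x v by simp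
    show "Ck_on k S (\<lambda>x. - (inverse (f x) * frechet_derivative f (at x) v * inverse (f x)))" for v
      unfolding * using Suc.prems IH by (intro Ck_on_mult[OF assms(1)]) auto
  qed
qed

lemma Ck_on_exp: "Ck_on k UNIV (exp :: real \<Rightarrow> real)"
proof (induction k)
  case 0
  then show ?case by (simp add: continuous_on_exp)
next
  case (Suc k)
  have "Ck_on k UNIV (\<lambda>x. exp x * v :: real)" for v
    using Ck_on_mult[OF open_UNIV Suc, of "\<lambda>x. v"] by simp
  then show ?case
    by (intro Ck_on_SucI[where f' = "\<lambda>x v. exp x * v"])
      (auto intro: has_field_derivative_imp_has_derivative[OF DERIV_exp])
qed

lemma smooth_on_cong:
  assumes "open S" "\<And>x. x \<in> S \<Longrightarrow> f x = g x"
  shows "smooth_on S f \<longleftrightarrow> smooth_on S g"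
  using Ck_on_cong[OF assms] by (simp add: smooth_on_def)

lemma smooth_on_subset: "smooth_on S f \<Longrightarrow> S' \<subseteq> S \<Longrightarrow> smooth_on S' f"
  by (auto simp: smooth_on_def intro: Ck_on_subset)

lemma smooth_on_differentiable: "smooth_on S f \<Longrightarrow> x \<in> S \<Longrightarrow> f differentiable (at x)"
  unfolding smooth_on_def by (metis Ck_on.simps(2))

lemma smooth_on_has_derivative:
  "smooth_on S f \<Longrightarrow> x \<in> S \<Longrightarrow> (f has_derivative frechet_derivative f (at x)) (at x)"
  using smooth_on_differentiable frechet_derivative_works by blast

lemma smooth_on_continuous: "smooth_on S f \<Longrightarrow> continuous_on S f"
  unfolding smooth_on_def by (metis Ck_on.simps(1))

lemma smooth_on_frechet: "smooth_on S f \<Longrightarrow> smooth_on S (\<lambda>x. frechet_derivative f (at x) v)"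
  unfolding smooth_on_def by (metis Ck_on.simps(2))

text \<open>Useful for functions given by integrals: once the first derivative is recognised as a
  smooth expression, no further differentiation under the integral is required.\<close>

lemma smooth_onI:
  assumes "open S" "\<And>x. x \<in> S \<Longrightarrow> (f has_derivative f' x) (at x)" "\<And>v. smooth_on S (\<lambda>x. f' x v)"
  shows "smooth_on S f"
  unfolding smooth_on_def
proof
  fix k
  have "Ck_on (Suc k) S f"
    using assms by (intro Ck_on_SucI[where f' = f']) (auto simp: smooth_on_def)
  then show "Ck_on k S f" by (rule Ck_on_mono)
qed

lemma smooth_on_pd: "smooth_on S f \<Longrightarrow> smooth_on S (pd i f)"
  unfolding pd_def[abs_def] by (rule smooth_on_frechet)

lemma smooth_on_const [simp]: "smooth_on S (\<lambda>x. c)"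
  by (simp add: smooth_on_def)

lemma smooth_on_linear: "bounded_linear f \<Longrightarrow> open S \<Longrightarrow> smooth_on S f"
  by (simp add: smooth_on_def Ck_on_linear)

lemma smooth_on_add: "open S \<Longrightarrow> smooth_on S f \<Longrightarrow> smooth_on S g \<Longrightarrow> smooth_on S (\<lambda>x. f x + g x)"
  by (simp add: smooth_on_def Ck_on_add)

lemma smooth_on_sum: "open S \<Longrightarrow> (\<And>i. i \<in> I \<Longrightarrow> smooth_on S (f i)) \<Longrightarrow> smooth_on S (\<lambda>x. \<Sum>i\<in>I. f i x)"
  by (simp add: smooth_on_def Ck_on_sum)

lemma smooth_on_mult:
  fixes f g :: "'a::euclidean_space \<Rightarrow> real"
  shows "open S \<Longrightarrow> smooth_on S f \<Longrightarrow> smooth_on S g \<Longrightarrow> smooth_on S (\<lambda>x. f x * g x)"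
  by (simp add: smooth_on_def Ck_on_mult)

lemma smooth_on_scaleR:
  "open S \<Longrightarrow> smooth_on S f \<Longrightarrow> smooth_on S g \<Longrightarrow> smooth_on S (\<lambda>x. f x *\<^sub>R g x)"
  by (simp add: smooth_on_def Ck_on_scaleR)

lemma smooth_on_uminus: "open S \<Longrightarrow> smooth_on S f \<Longrightarrow> smooth_on S (\<lambda>x. - f x)"
  using smooth_on_scaleR[of S "\<lambda>x. -1" f] by simp

lemma smooth_on_diff: "open S \<Longrightarrow> smooth_on S f \<Longrightarrow> smooth_on S g \<Longrightarrow> smooth_on S (\<lambda>x. f x - g x)"
  using smooth_on_add[of S f "\<lambda>x. - g x"] smooth_on_uminus[of S g] by simp

lemma smooth_on_divide:
  fixes f g :: "'a::euclidean_space \<Rightarrow> real"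
  assumes "open S" "smooth_on S f" "smooth_on S g" "\<And>x. x \<in> S \<Longrightarrow> g x \<noteq> 0"
  shows "smooth_on S (\<lambda>x. f x / g x)"
  using assms unfolding divide_inverse smooth_on_def by (simp add: Ck_on_mult Ck_on_inverse)

lemma smooth_on_compose:
  fixes g :: "'b::euclidean_space \<Rightarrow> 'c::real_normed_vector" and f :: "'a::euclidean_space \<Rightarrow> 'b"
  assumes "open S" "open U" "f ` S \<subseteq> U" "smooth_on S f" "smooth_on U g"
  shows "smooth_on S (\<lambda>x. g (f x))"
  using assms by (auto simp: smooth_on_def intro: Ck_on_compose)

lemma smooth_on_exp: "open S \<Longrightarrow> smooth_on S f \<Longrightarrow> smooth_on S (\<lambda>x. exp (f x) :: real)"
  by (rule smooth_on_compose[OF _ open_UNIV]) (auto simp: smooth_on_def Ck_on_exp)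

lemma smooth_on_vec:
  fixes f :: "'n::finite \<Rightarrow> 'a::euclidean_space \<Rightarrow> real"
  assumes "open S" "\<And>i. smooth_on S (f i)"
  shows "smooth_on S (\<lambda>x. \<chi> i. f i x)"
proof -
  have "(\<lambda>x. \<chi> i. f i x) = (\<lambda>x. \<Sum>i\<in>UNIV. f i x *\<^sub>R axis i 1)"
    by (simp add: fun_eq_iff vec_eq_iff axis_def if_distrib[of "\<lambda>u. _ * u"] cong: if_cong)
  then show ?thesis using assms by (auto intro!: smooth_on_sum smooth_on_scaleR)
qed

lemma smooth_on_vec_nth:
  fixes f :: "'a::euclidean_space \<Rightarrow> real^'n::finite"
  assumes "open S" "smooth_on S f"
  shows "smooth_on S (\<lambda>x. f x $ i)"
  by (rule smooth_on_compose[OF assms(1) open_UNIV _ assms(2)])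
    (auto intro: smooth_on_linear bounded_linear_vec_nth)

lemmas smooth_intros = smooth_on_const smooth_on_add smooth_on_diff smooth_on_uminus smooth_on_mult
  smooth_on_divide smooth_on_sum smooth_on_scaleR smooth_on_exp smooth_on_vec smooth_on_pd

section \<open>Partial derivatives\<close>

lemma pd_cong_open:
  assumes "open S" "x \<in> S" "\<And>y. y \<in> S \<Longrightarrow> f y = g y"
  shows "pd i f x = pd i g x"
  by (simp add: pd_def frechet_derivative_cong_open[OF assms])

lemma has_derivative_pd: "(f has_derivative f') (at x) \<Longrightarrow> pd i f x = f' (axis i 1)"
  unfolding pd_def by (simp add: frechet_derivative_at[symmetric])

lemma frechet_derivative_pd:
  assumes "(f::real^'n::finite \<Rightarrow> real) differentiable (at x)"
  shows "frechet_derivative f (at x) v = (\<Sum>i\<in>UNIV. v $ i * pd i f x)"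
proof -
  interpret bounded_linear "frechet_derivative f (at x)"
    using assms frechet_derivative_works has_derivative_bounded_linear by blast
  have "frechet_derivative f (at x) v = frechet_derivative f (at x) (\<Sum>i\<in>UNIV. v $ i *\<^sub>R axis i 1)"
    using basis_expansion[of v] by (simp add: scalar_mult_eq_scaleR)
  then show ?thesis by (simp add: sum scaleR pd_def)
qed

lemma has_derivative_via_pd:
  assumes "(f::real^'n::finite \<Rightarrow> real) differentiable (at x)"
  shows "(f has_derivative (\<lambda>v. \<Sum>i\<in>UNIV. v $ i * pd i f x)) (at x)"
  using assms[unfolded frechet_derivative_works]
  by (rule has_derivative_eq_rhs) (simp add: frechet_derivative_pd[OF assms] fun_eq_iff)

lemma pd_const [simp]: "pd i (\<lambda>x. c) x = 0"
  by (simp add: pd_def)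

lemma pd_add:
  assumes "f differentiable (at x)" "g differentiable (at x)"
  shows "pd i (\<lambda>x. f x + g x) x = pd i f x + pd i g x"
  using has_derivative_pd[OF has_derivative_add[OF assms[unfolded frechet_derivative_works]]]
  by (simp add: pd_def)

lemma pd_diff:
  assumes "f differentiable (at x)" "g differentiable (at x)"
  shows "pd i (\<lambda>x. f x - g x) x = pd i f x - pd i g x"
  using has_derivative_pd[OF has_derivative_diff[OF assms[unfolded frechet_derivative_works]]]
  by (simp add: pd_def)

lemma pd_uminus:
  assumes "f differentiable (at x)"
  shows "pd i (\<lambda>x. - f x) x = - pd i f x"
  using has_derivative_pd[OF has_derivative_minus[OF assms[unfolded frechet_derivative_works]]]
  by (simp add: pd_def)

lemma pd_mult:
  assumes "f differentiable (at x)" "g differentiable (at x)"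
  shows "pd i (\<lambda>x. f x * g x) x = f x * pd i g x + pd i f x * g x"
  using has_derivative_pd[OF has_derivative_mult[OF assms[unfolded frechet_derivative_works]]]
  by (simp add: pd_def)

lemma pd_cmult: "f differentiable (at x) \<Longrightarrow> pd i (\<lambda>x. c * f x) x = c * pd i f x"
  by (simp add: pd_mult)

lemma pd_sum:
  assumes "\<And>j. j \<in> J \<Longrightarrow> f j differentiable (at x)"
  shows "pd i (\<lambda>x. \<Sum>j\<in>J. f j x) x = (\<Sum>j\<in>J. pd i (f j) x)"
proof (cases "finite J")
  case True
  have "((\<lambda>x. \<Sum>j\<in>J. f j x) has_derivative (\<lambda>v. \<Sum>j\<in>J. frechet_derivative (f j) (at x) v)) (at x)"
    using assms by (intro has_derivative_sum) (simp add: frechet_derivative_works)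
  from has_derivative_pd[OF this] show ?thesis by (simp add: pd_def)
qed simp

lemma pd_exp:
  assumes "f differentiable (at x)"
  shows "pd i (\<lambda>x. exp (f x)) x = exp (f x) * pd i f x"
proof -
  have "((\<lambda>x. exp (f x)) has_derivative (\<lambda>v. exp (f x) * frechet_derivative f (at x) v)) (at x)"
    using assms unfolding frechet_derivative_works by (auto intro!: derivative_eq_intros)
  from has_derivative_pd[OF this] show ?thesis by (simp add: pd_def)
qed

lemma pd_coordinate: "pd i (\<lambda>x. x $ j) x = (if i = j then 1 else 0)"
  by (subst has_derivative_pd[OF bounded_linear_imp_has_derivative[OF bounded_linear_vec_nth]]) (auto simp: axis_def)

text \<open>Both mixed second derivatives are values of one and the same second difference.\<close>

lemma second_difference_mean_value:
  fixes f :: "real^'n::finite \<Rightarrow> real"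
  assumes f: "smooth_on (ball x r) f" and t: "0 < t" "2 * t < r"
  obtains y where "y \<in> ball x r"
    "f (x + t *\<^sub>R axis i 1 + t *\<^sub>R axis j 1) - f (x + t *\<^sub>R axis i 1) - f (x + t *\<^sub>R axis j 1) + f x
      = t\<^sup>2 * pd j (pd i f) y"
proof -
  have inb: "x + s *\<^sub>R axis i 1 + u *\<^sub>R axis j 1 \<in> ball x r" if "0 \<le> s" "s \<le> t" "0 \<le> u" "u \<le> t" for s u
  proof -
    have "norm (s *\<^sub>R axis i (1::real) + u *\<^sub>R axis j 1) \<le> s + u"
      by (rule order_trans[OF norm_triangle_ineq]) (use that in simp)
    then have "norm (x - (x + s *\<^sub>R axis i 1 + u *\<^sub>R axis j 1)) \<le> s + u"
      by (metis (no_types, opaque_lifting) add.assoc add_diff_cancel_left' norm_minus_commute)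
    then show ?thesis using that t by (simp add: dist_norm)
  qed
  have line: "((\<lambda>s. F (y + s *\<^sub>R axis k 1)) has_real_derivative pd k F (y + s *\<^sub>R axis k 1)) (at s)"
    if "smooth_on (ball x r) F" "y + s *\<^sub>R axis k 1 \<in> ball x r" for F s and y :: "real^'n" and k
  proof -
    have "((\<lambda>s. y + s *\<^sub>R axis k 1) has_derivative (\<lambda>h. h *\<^sub>R axis k 1)) (at s)"
      by (auto intro!: derivative_eq_intros)
    from has_derivative_compose[OF this smooth_on_has_derivative[OF that]]
    have D: "((\<lambda>s. F (y + s *\<^sub>R axis k 1)) has_derivative
       (\<lambda>h. frechet_derivative F (at (y + s *\<^sub>R axis k 1)) (h *\<^sub>R axis k 1))) (at s)" .
    have "frechet_derivative F (at (y + s *\<^sub>R axis k 1)) (h *\<^sub>R axis k 1) = h * pd k F (y + s *\<^sub>R axis k 1)" for h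
      using linear_frechet_derivative[OF smooth_on_differentiable[OF that]]
      by (simp add: pd_def linear_cmul)
    with D show ?thesis by (simp add: has_field_derivative_def mult.commute[of _ "pd k F _"])
  qed
  \<comment> \<open>The mean value theorem is applied twice: in direction i to the increment of
    \<open>f\<close> over a step in direction j, then in direction j to
    \<open>pd i f\<close>.\<close>
  define g where "g = (\<lambda>s. f (x + s *\<^sub>R axis i 1 + t *\<^sub>R axis j 1) - f (x + s *\<^sub>R axis i 1))"
  define g' where "g' = (\<lambda>s. pd i f (x + s *\<^sub>R axis i 1 + t *\<^sub>R axis j 1) - pd i f (x + s *\<^sub>R axis i 1))"
  have gd: "(g has_real_derivative g' s) (at s)" if "0 \<le> s" "s \<le> t" for s
  proof -
    have "x + t *\<^sub>R axis j 1 + s *\<^sub>R axis i 1 \<in> ball x r" "x + s *\<^sub>R axis i 1 \<in> ball x r"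
      using inb[of s t] inb[of s 0] that by (auto simp: add.commute add.left_commute)
    from DERIV_diff[OF line[OF f this(1)] line[OF f this(2)]] show ?thesis
      unfolding g_def g'_def by (simp add: add.commute add.left_commute)
  qed
  obtain s where s: "0 < s" "s < t" "g t - g 0 = (t - 0) * g' s"
    using MVT2[of 0 t g g'] gd t by auto
  have hd: "((\<lambda>u. pd i f (x + s *\<^sub>R axis i 1 + u *\<^sub>R axis j 1)) has_real_derivative
      pd j (pd i f) (x + s *\<^sub>R axis i 1 + u *\<^sub>R axis j 1)) (at u)" if "0 \<le> u" "u \<le> t" for u
    by (rule line[OF smooth_on_pd[OF f]]) (use inb s that in auto)
  obtain u where u: "0 < u" "u < t"
    "pd i f (x + s *\<^sub>R axis i 1 + t *\<^sub>R axis j 1) - pd i f (x + s *\<^sub>R axis i 1 + 0 *\<^sub>R axis j 1)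
      = (t - 0) * pd j (pd i f) (x + s *\<^sub>R axis i 1 + u *\<^sub>R axis j 1)"
    using MVT2[OF t(1) hd] by blast
  show ?thesis
  proof (rule that)
    show "x + s *\<^sub>R axis i 1 + u *\<^sub>R axis j 1 \<in> ball x r" using inb s u by simp
    show "f (x + t *\<^sub>R axis i 1 + t *\<^sub>R axis j 1) - f (x + t *\<^sub>R axis i 1) - f (x + t *\<^sub>R axis j 1) + f x
      = t\<^sup>2 * pd j (pd i f) (x + s *\<^sub>R axis i 1 + u *\<^sub>R axis j 1)"
      using s(3) u(3) by (simp add: g_def g'_def power2_eq_square)
  qed
qed

lemma pd_commute:
  fixes f :: "real^'n::finite \<Rightarrow> real"
  assumes "open S" "x \<in> S" "smooth_on S f"
  shows "pd i (pd j f) x = pd j (pd i f) x"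
proof (rule ccontr)
  assume ne: "pd i (pd j f) x \<noteq> pd j (pd i f) x"
  define e where "e = \<bar>pd i (pd j f) x - pd j (pd i f) x\<bar> / 2"
  have e: "e > 0" using ne by (simp add: e_def)
  obtain r where r: "r > 0" "ball x r \<subseteq> S" using assms(1,2) open_contains_ball by blast
  have c: "continuous (at x) (pd a (pd b f))" for a b
    using smooth_on_continuous[OF smooth_on_pd[OF smooth_on_pd[OF assms(3)]]] assms(1,2)
    by (simp add: continuous_on_eq_continuous_at)
  obtain r1 where r1: "r1 > 0" "\<And>y. dist y x < r1 \<Longrightarrow> dist (pd i (pd j f) y) (pd i (pd j f) x) < e"
    using c[of i j] e unfolding continuous_at_eps_delta by blast
  obtain r2 where r2: "r2 > 0" "\<And>y. dist y x < r2 \<Longrightarrow> dist (pd j (pd i f) y) (pd j (pd i f) x) < e"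
    using c[of j i] e unfolding continuous_at_eps_delta by blast
  \<comment> \<open>Below this radius both mixed derivatives stay within e, half of the assumed gap,
    of their values at x; the choice t = r'/3 ensures 2 t < r'.\<close>
  define r' where "r' = min r (min r1 r2)"
  define t where "t = r' / 3"
  have t: "0 < t" "2 * t < r'" using r r1 r2 by (auto simp: t_def r'_def)
  have f: "smooth_on (ball x r') f" by (rule smooth_on_subset[OF assms(3)]) (use r in \<open>auto simp: r'_def\<close>)
  obtain y where y: "y \<in> ball x r'" "f (x + t *\<^sub>R axis i 1 + t *\<^sub>R axis j 1) - f (x + t *\<^sub>R axis i 1) - f (x + t *\<^sub>R axis j 1) + f x
      = t\<^sup>2 * pd j (pd i f) y"
    using second_difference_mean_value[OF f t] .
  obtain z where z: "z \<in> ball x r'" "f (x + t *\<^sub>R axis j 1 + t *\<^sub>R axis i 1) - f (x + t *\<^sub>R axis j 1) - f (x + t *\<^sub>R axis i 1) + f x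
      = t\<^sup>2 * pd i (pd j f) z"
    using second_difference_mean_value[OF f t] .
  have swap: "x + t *\<^sub>R axis j 1 + t *\<^sub>R axis i 1 = x + t *\<^sub>R axis i 1 + t *\<^sub>R axis j 1" by simp
  have "t\<^sup>2 * pd j (pd i f) y = t\<^sup>2 * pd i (pd j f) z"
    using y(2) z(2) unfolding swap by linarith
  then have eq: "pd j (pd i f) y = pd i (pd j f) z" using t by simp
  have "dist (pd j (pd i f) y) (pd j (pd i f) x) < e" "dist (pd i (pd j f) z) (pd i (pd j f) x) < e"
    using r2(2)[of y] r1(2)[of z] y(1) z(1) by (auto simp: r'_def dist_commute)
  then show False unfolding eq e_def dist_real_def by (smt (verit) field_sum_of_halves)
qed

section \<open>Integration along rays and closed one-forms\<close>

text \<open>One statement for both integral constructions below: N = 0 and M the identity integrate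
  along rays from c, while the two coordinate projections of the plane integrate along vertical
  segments.\<close>

lemma leibniz_affine:
  fixes F :: "'a::euclidean_space \<Rightarrow> real" and c :: 'a
  assumes F: "smooth_on S F" "open S" and NM: "bounded_linear N" "bounded_linear M"
    and U: "open U" "convex U" "\<And>w t. w \<in> U \<Longrightarrow> t \<in> {0..1} \<Longrightarrow> c + N (w - c) + t *\<^sub>R M (w - c) \<in> S"
    and w: "w \<in> U"
  shows "((\<lambda>w. integral {0..1} (\<lambda>t. F (c + N (w - c) + t *\<^sub>R M (w - c)))) has_derivative
    (\<lambda>v. integral {0..1} (\<lambda>t. frechet_derivative F (at (c + N (w - c) + t *\<^sub>R M (w - c))) (N v + t *\<^sub>R M v)))) (at w)"
proof -
  define p where "p w t = c + N (w - c) + t *\<^sub>R M (w - c)" for w t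
  define F' where "F' x = frechet_derivative F (at x)" for x
  interpret N: bounded_linear N by fact
  interpret M: bounded_linear M by fact
  have pS: "p w t \<in> S" if "w \<in> U" "t \<in> {0..1}" for w t using U(3) that by (simp add: p_def)
  have linF: "bounded_linear (F' x)" if "x \<in> S" for x
    unfolding F'_def by (rule has_derivative_bounded_linear[OF smooth_on_has_derivative[OF F(1) that]])
  have linP: "bounded_linear (\<lambda>v. N v + t *\<^sub>R M v)" for t
    by (intro bounded_linear_add bounded_linear_compose[OF bounded_linear_scaleR_right] NM)
  \<comment> \<open>\<open>leibniz_rule\<close> takes the derivative as a bounded linear map that is
    jointly continuous in w and t; this continuity is checked on basis vectors.\<close>
  define fx where "fx w t = Blinfun (\<lambda>v. F' (p w t) (N v + t *\<^sub>R M v))" for w t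
  have fx: "blinfun_apply (fx w t) = (\<lambda>v. F' (p w t) (N v + t *\<^sub>R M v))" if "w \<in> U" "t \<in> {0..1}" for w t
    unfolding fx_def
    by (rule bounded_linear_Blinfun_apply) (rule bounded_linear_compose[OF linF[OF pS[OF that]] linP])
  have contp: "continuous_on (U \<times> {0..1}) (\<lambda>(w, t). p w t)"
    unfolding p_def split_def by (intro continuous_intros N.continuous_on M.continuous_on)
  have contF': "continuous_on (U \<times> {0..1}) (\<lambda>(w, t). F' (p w t) v)" for v
    using continuous_on_compose2[OF smooth_on_continuous[OF smooth_on_frechet[OF F(1), of v]] contp] pS
    by (force simp: F'_def split_def)
  have cont_fx: "continuous_on (U \<times> cbox 0 1) (\<lambda>(w, t). fx w t)"
  proof (rule continuous_on_blinfun_componentwise)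
    fix b :: 'a
    have "continuous_on (U \<times> {0..1}) (\<lambda>z. F' (p (fst z) (snd z)) (N b) + snd z * F' (p (fst z) (snd z)) (M b))"
      using contF'[of "N b"] contF'[of "M b"] by (auto simp: split_def intro!: continuous_intros)
    moreover have "F' (p (fst z) (snd z)) (N b) + snd z * F' (p (fst z) (snd z)) (M b) = blinfun_apply (case z of (w, t) \<Rightarrow> fx w t) b"
      if "z \<in> U \<times> {0..1}" for z
    proof -
      have "bounded_linear (F' (p (fst z) (snd z)))" using that by (intro linF pS) auto
      then show ?thesis using that
        by (auto simp: fx split_def bounded_linear.linear linear_add linear_cmul)
    qed
    ultimately show "continuous_on (U \<times> cbox 0 1) (\<lambda>z. blinfun_apply (case z of (w, t) \<Rightarrow> fx w t) b)"
      by (simp cong: continuous_on_cong)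
  qed
  have int: "(\<lambda>t. F (p w t)) integrable_on cbox 0 1" if "w \<in> U" for w
  proof -
    have "continuous_on {0..1} (\<lambda>t. F (p w t))"
      by (rule continuous_on_compose2[OF smooth_on_continuous[OF F(1)]])
        (use pS that in \<open>auto simp: p_def intro!: continuous_intros\<close>)
    then show ?thesis by (simp add: integrable_continuous_real)
  qed
  have derp: "((\<lambda>w. p w t) has_derivative (\<lambda>v. N v + t *\<^sub>R M v)) (at w)" for w t
    unfolding p_def
    by (auto intro!: derivative_eq_intros N.has_derivative M.has_derivative)
  have leib: "((\<lambda>w. integral (cbox 0 1) (\<lambda>t. F (p w t))) has_derivative
      blinfun_apply (integral (cbox 0 1) (fx w))) (at w within U)"
  proof (rule leibniz_rule[OF _ int cont_fx w U(2)])
    fix x t assume x: "x \<in> U" and t: "t \<in> cbox (0::real) 1"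
    have "(F has_derivative F' (p x t)) (at (p x t))"
      using smooth_on_has_derivative[OF F(1) pS] x t by (simp add: F'_def)
    from has_derivative_compose[OF derp this]
    show "((\<lambda>w. F (p w t)) has_derivative blinfun_apply (fx x t)) (at x within U)"
      using fx x t by (auto intro: has_derivative_at_withinI)
  qed
  have eq: "blinfun_apply (integral (cbox 0 1) (fx w)) v = integral {0..1} (\<lambda>t. F' (p w t) (N v + t *\<^sub>R M v))" for v
  proof -
    have "continuous_on (cbox 0 1) (fx w)"
      using continuous_on_compose2[OF cont_fx, of "cbox 0 1" "\<lambda>t. (w, t)"] w
      by (force intro!: continuous_intros)
    then have "fx w integrable_on cbox 0 1" by (rule integrable_continuous)
    from integral_linear[OF this blinfun.bounded_linear_left, of v]
    have "blinfun_apply (integral (cbox 0 1) (fx w)) v = integral (cbox 0 1) (\<lambda>t. blinfun_apply (fx w t) v)"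
      by (simp add: o_def)
    also have "\<dots> = integral (cbox 0 1) (\<lambda>t. F' (p w t) (N v + t *\<^sub>R M v))"
      by (rule integral_cong) (use w in \<open>simp add: fx\<close>)
    finally show ?thesis by simp
  qed
  have "((\<lambda>w. integral (cbox 0 1) (\<lambda>t. F (p w t))) has_derivative
      (\<lambda>v. integral {0..1} (\<lambda>t. F' (p w t) (N v + t *\<^sub>R M v)))) (at w)"
    by (rule has_derivative_eq_rhs[OF leib[unfolded at_within_open[OF w U(1)]]]) (rule ext, rule eq)
  then show ?thesis by (simp add: p_def F'_def)
qed

text \<open>The combined integrand is the derivative of t F(a + t b), so the fundamental theorem
  applies. Both homotopy formulas below rest on this identity.\<close>

lemma integral_ray:
  fixes F :: "'a::euclidean_space \<Rightarrow> real"
  assumes F: "smooth_on S F" and ab: "\<And>t. t \<in> {0..1} \<Longrightarrow> a + t *\<^sub>R b \<in> S"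
  shows "integral {0..1} (\<lambda>t. F (a + t *\<^sub>R b)) +
    integral {0..1} (\<lambda>t. t * frechet_derivative F (at (a + t *\<^sub>R b)) b) = F (a + b)"
proof -
  let ?F' = "\<lambda>t. frechet_derivative F (at (a + t *\<^sub>R b)) b"
  have d: "((\<lambda>t. t * F (a + t *\<^sub>R b)) has_vector_derivative F (a + t *\<^sub>R b) + t * ?F' t) (at t within {0..1})"
    if "t \<in> {0..1}" for t
  proof -
    have "((\<lambda>t. a + t *\<^sub>R b) has_derivative (\<lambda>h. h *\<^sub>R b)) (at t within {0..1})"
      by (auto intro!: derivative_eq_intros)
    from has_derivative_compose[OF this smooth_on_has_derivative[OF F ab[OF that]]]
    have "((\<lambda>t. F (a + t *\<^sub>R b)) has_derivative (\<lambda>h. h * ?F' t)) (at t within {0..1})"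
      using linear_frechet_derivative[OF smooth_on_differentiable[OF F ab[OF that]]]
      by (simp add: linear_cmul)
    then have "((\<lambda>t. F (a + t *\<^sub>R b)) has_real_derivative ?F' t) (at t within {0..1})"
      by (simp add: has_field_derivative_def mult.commute[of _ "?F' t"])
    then have "((\<lambda>t. t * F (a + t *\<^sub>R b)) has_real_derivative F (a + t *\<^sub>R b) + t * ?F' t) (at t within {0..1})"
      by (auto intro!: derivative_eq_intros)
    then show ?thesis by (simp add: has_real_derivative_iff_has_vector_derivative)
  qed
  have c: "continuous_on {0..1} (\<lambda>t. F (a + t *\<^sub>R b))" "continuous_on {0..1} ?F'"
    by (rule continuous_on_compose2[OF smooth_on_continuous[OF F]] continuous_on_compose2[OF smooth_on_continuous[OF smooth_on_frechet[OF F]]],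
       use ab in \<open>auto intro!: continuous_intros\<close>)+
  have "integral {0..1} (\<lambda>t. F (a + t *\<^sub>R b) + t * ?F' t) = F (a + b)"
    using fundamental_theorem_of_calculus[of 0 1 "\<lambda>t. t * F (a + t *\<^sub>R b)", OF _ d] by (simp add: integral_unique)
  moreover have "integral {0..1} (\<lambda>t. F (a + t *\<^sub>R b) + t * ?F' t) =
     integral {0..1} (\<lambda>t. F (a + t *\<^sub>R b)) + integral {0..1} (\<lambda>t. t * ?F' t)"
    by (intro Henstock_Kurzweil_Integration.integral_add integrable_continuous_real c continuous_intros)
  ultimately show ?thesis by simp
qed

text \<open>The potential is the standard homotopy operator of a star-shaped set: the sum of (w -
  c)_i times the mean of \<open>\<omega> i\<close> over the ray from c to w. Its smoothness needs no
  separate work, because its partial derivatives turn out to be the smooth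
  \<open>\<omega> i\<close>.\<close>

lemma poincare_lemma_ball:
  fixes \<omega> :: "'n::finite \<Rightarrow> real^'n \<Rightarrow> real"
  assumes \<omega>: "\<And>i. smooth_on (ball c r) (\<omega> i)"
    and closed: "\<And>i j x. x \<in> ball c r \<Longrightarrow> pd i (\<omega> j) x = pd j (\<omega> i) x"
  obtains f where "smooth_on (ball c r) f" "\<And>i x. x \<in> ball c r \<Longrightarrow> pd i f x = \<omega> i x"
proof -
  define f where "f w = (\<Sum>i\<in>UNIV. (w - c) $ i * integral {0..1} (\<lambda>t. \<omega> i (c + t *\<^sub>R (w - c))))" for w
  have ray: "c + t *\<^sub>R (w - c) \<in> ball c r" if "w \<in> ball c r" "t \<in> {0..1}" for w t
  proof -
    have "t * norm (w - c) \<le> 1 * norm (w - c)" using that by (intro mult_right_mono) auto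
    then show ?thesis using that by (simp add: dist_norm norm_minus_commute)
  qed
  have fd: "(f has_derivative (\<lambda>v. \<Sum>i\<in>UNIV. v $ i * \<omega> i w)) (at w)" if w: "w \<in> ball c r" for w
  proof -
    have b: "((\<lambda>w. integral {0..1} (\<lambda>t. \<omega> i (c + t *\<^sub>R (w - c)))) has_derivative
      (\<lambda>v. integral {0..1} (\<lambda>t. frechet_derivative (\<omega> i) (at (c + t *\<^sub>R (w - c))) (t *\<^sub>R v)))) (at w)" for i
      using leibniz_affine[OF \<omega> open_ball bounded_linear_zero bounded_linear_ident open_ball convex_ball _ w, of c i] ray
      by simp
    have "(f has_derivative (\<lambda>v. \<Sum>i\<in>UNIV.
        (w - c) $ i * integral {0..1} (\<lambda>t. frechet_derivative (\<omega> i) (at (c + t *\<^sub>R (w - c))) (t *\<^sub>R v))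
        + v $ i * integral {0..1} (\<lambda>t. \<omega> i (c + t *\<^sub>R (w - c))))) (at w)"
      unfolding f_def
      by (intro has_derivative_sum has_derivative_mult b)
        (auto intro!: derivative_eq_intros bounded_linear.has_derivative[OF bounded_linear_vec_nth])
    moreover have "(\<Sum>i\<in>UNIV.
        (w - c) $ i * integral {0..1} (\<lambda>t. frechet_derivative (\<omega> i) (at (c + t *\<^sub>R (w - c))) (t *\<^sub>R v))
        + v $ i * integral {0..1} (\<lambda>t. \<omega> i (c + t *\<^sub>R (w - c)))) = (\<Sum>i\<in>UNIV. v $ i * \<omega> i w)" for v
    proof -
      let ?p = "\<lambda>t. c + t *\<^sub>R (w - c)"
      have cont: "continuous_on {0..1} (\<lambda>t. pd i (\<omega> j) (?p t))" for i j
        by (rule continuous_on_compose2[OF smooth_on_continuous[OF smooth_on_pd[OF \<omega>]]])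
          (use ray[OF w] in \<open>auto intro!: continuous_intros\<close>)
      have fr: "frechet_derivative (\<omega> i) (at (?p t)) u = (\<Sum>j\<in>UNIV. u $ j * pd j (\<omega> i) (?p t))" if "t \<in> {0..1}" for i t u
        by (rule frechet_derivative_pd[OF smooth_on_differentiable[OF \<omega> ray[OF w that]]])
      have "integral {0..1} (\<lambda>t. frechet_derivative (\<omega> i) (at (?p t)) (t *\<^sub>R v)) =
          (\<Sum>j\<in>UNIV. v $ j * integral {0..1} (\<lambda>t. t * pd j (\<omega> i) (?p t)))" for i
      proof -
        have "integral {0..1} (\<lambda>t. frechet_derivative (\<omega> i) (at (?p t)) (t *\<^sub>R v)) =
            integral {0..1} (\<lambda>t. \<Sum>j\<in>UNIV. v $ j * (t * pd j (\<omega> i) (?p t)))"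
          by (rule integral_cong) (simp add: fr mult_ac)
        also have "\<dots> = (\<Sum>j\<in>UNIV. integral {0..1} (\<lambda>t. v $ j * (t * pd j (\<omega> i) (?p t))))"
          by (rule integral_sum) (auto intro!: integrable_continuous_real continuous_intros cont)
        finally show ?thesis by simp
      qed
      \<comment> \<open>Closedness turns the sum of (w - c)_j d_i \<omega>_j into the derivative of
        \<open>\<omega> i\<close> along the ray, and \<open>integral_ray\<close> evaluates the
        result.\<close>
      moreover have "integral {0..1} (\<lambda>t. \<omega> i (?p t)) + (\<Sum>j\<in>UNIV. (w - c) $ j * integral {0..1} (\<lambda>t. t * pd i (\<omega> j) (?p t))) = \<omega> i w" for i
      proof -
        have "(\<Sum>j\<in>UNIV. (w - c) $ j * integral {0..1} (\<lambda>t. t * pd i (\<omega> j) (?p t))) =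
          (\<Sum>j\<in>UNIV. integral {0..1} (\<lambda>t. (w - c) $ j * (t * pd i (\<omega> j) (?p t))))" by simp
        also have "\<dots> = integral {0..1} (\<lambda>t. \<Sum>j\<in>UNIV. (w - c) $ j * (t * pd i (\<omega> j) (?p t)))"
          by (rule integral_sum[symmetric]) (auto intro!: integrable_continuous_real continuous_intros cont)
        also have "\<dots> = integral {0..1} (\<lambda>t. t * frechet_derivative (\<omega> i) (at (?p t)) (w - c))"
        proof (rule integral_cong)
          fix t :: real assume t: "t \<in> {0..1}"
          show "(\<Sum>j\<in>UNIV. (w - c) $ j * (t * pd i (\<omega> j) (?p t))) = t * frechet_derivative (\<omega> i) (at (?p t)) (w - c)"
            by (simp add: fr[OF t] closed[OF ray[OF w t], of i] sum_distrib_left mult_ac)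
        qed
        finally show ?thesis using integral_ray[OF \<omega>, of c "w - c" i] ray[OF w] by simp
      qed
      ultimately show ?thesis
        by (simp add: sum.distrib sum_distrib_left flip: \<open>\<And>i. _ = \<omega> i w\<close>)
          (subst sum.swap, simp add: sum_distrib_left mult_ac distrib_left sum.distrib)
    qed
    ultimately show ?thesis by simp
  qed
  show ?thesis
  proof (rule that)
    show "smooth_on (ball c r) f"
      by (rule smooth_onI[OF open_ball fd]) (auto intro!: smooth_intros \<omega>)
    show "pd i f x = \<omega> i x" if "x \<in> ball c r" for i x
      using has_derivative_pd[OF fd[OF that], of i] by (simp add: axis_def if_distrib[of "\<lambda>u. u * _"] cong: if_cong)
  qed
qed

text \<open>Integration in the second coordinate from the line w_2 = c_2, rescaled to the unit
  interval; \<open>star\<close> says that these vertical segments stay in \<open>S\<close>.\<close>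

lemma primitive_second_coordinate:
  fixes F :: "real^2 \<Rightarrow> real" and c :: "real^2"
  assumes F: "smooth_on S F" and S: "open S" "convex S"
    and star: "\<And>w t. w \<in> S \<Longrightarrow> t \<in> {0..1} \<Longrightarrow> (\<chi> i. if i = 1 then w $ 1 else c $ 2 + t * (w $ 2 - c $ 2)) \<in> S"
  obtains G where "smooth_on S G" "\<And>w. w \<in> S \<Longrightarrow> pd 2 G w = F w"
proof -
  define N M :: "real^2 \<Rightarrow> real^2" where "N v = v $ 1 *\<^sub>R axis 1 1" and "M v = v $ 2 *\<^sub>R axis 2 1" for v
  have NM: "bounded_linear N" "bounded_linear M"
    unfolding N_def M_def by (auto intro!: bounded_linear_scaleR_left[THEN bounded_linear_compose] bounded_linear_vec_nth)
  let ?p = "\<lambda>w t. c + N (w - c) + t *\<^sub>R M (w - c)"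
  have pS: "?p w t \<in> S" if "w \<in> S" "t \<in> {0..1}" for w t
  proof -
    have "?p w t = (\<chi> i. if i = 1 then w $ 1 else c $ 2 + t * (w $ 2 - c $ 2))"
      by (simp add: vec_eq_iff forall_2 N_def M_def axis_def)
    then show ?thesis using star[OF that] by simp
  qed
  have p1: "c + N (w - c) + M (w - c) = w" for w
    by (simp add: vec_eq_iff forall_2 N_def M_def axis_def)
  define I where "I F w = (w - c) $ 2 * integral {0..1} (\<lambda>t. F (?p w t))" for F w
  \<comment> \<open>The operator I commutes with the first partial derivative, and the second
    partial derivative inverts it.\<close>
  have dI: "(I F has_derivative (\<lambda>v. v $ 1 * I (pd 1 F) w + v $ 2 * F w)) (at w)"
    if F: "smooth_on S F" and w: "w \<in> S" for F w
  proof -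
    let ?F' = "\<lambda>t. frechet_derivative F (at (?p w t))"
    have lin: "linear (?F' t)" if "t \<in> {0..1}" for t
      by (rule linear_frechet_derivative[OF smooth_on_differentiable[OF F pS[OF w that]]])
    have "(I F has_derivative (\<lambda>v. (w - c) $ 2 * integral {0..1} (\<lambda>t. ?F' t (N v + t *\<^sub>R M v))
        + v $ 2 * integral {0..1} (\<lambda>t. F (?p w t)))) (at w)"
      unfolding I_def
      by (intro has_derivative_mult leibniz_affine[OF F S(1) NM S pS w])
        (auto intro!: derivative_eq_intros bounded_linear.has_derivative[OF bounded_linear_vec_nth])
    moreover have "(w - c) $ 2 * integral {0..1} (\<lambda>t. ?F' t (N v + t *\<^sub>R M v))
        + v $ 2 * integral {0..1} (\<lambda>t. F (?p w t)) = v $ 1 * I (pd 1 F) w + v $ 2 * F w" for v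
    proof -
      have cont: "continuous_on {0..1} (\<lambda>t. pd i F (?p w t))" for i
        by (rule continuous_on_compose2[OF smooth_on_continuous[OF smooth_on_pd[OF F]]])
          (use pS[OF w] in \<open>auto intro!: continuous_intros\<close>)
      have "integral {0..1} (\<lambda>t. ?F' t (N v + t *\<^sub>R M v)) =
          integral {0..1} (\<lambda>t. v $ 1 * pd 1 F (?p w t) + v $ 2 * (t * pd 2 F (?p w t)))"
        by (rule integral_cong) (use lin in \<open>simp add: linear_add linear_cmul N_def M_def pd_def\<close>)
      also have "\<dots> = v $ 1 * integral {0..1} (\<lambda>t. pd 1 F (?p w t)) + v $ 2 * integral {0..1} (\<lambda>t. t * pd 2 F (?p w t))"
        by (subst Henstock_Kurzweil_Integration.integral_add)
          (auto intro!: integrable_continuous_real continuous_intros cont)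
      finally have e1: "integral {0..1} (\<lambda>t. ?F' t (N v + t *\<^sub>R M v)) = \<dots>" .
      have "integral {0..1} (\<lambda>t. t * ?F' t (M (w - c))) = integral {0..1} (\<lambda>t. (w - c) $ 2 * (t * pd 2 F (?p w t)))"
        by (rule integral_cong) (use lin in \<open>simp add: linear_cmul M_def pd_def\<close>)
      then have e2: "integral {0..1} (\<lambda>t. F (?p w t)) + (w - c) $ 2 * integral {0..1} (\<lambda>t. t * pd 2 F (?p w t)) = F w"
        using integral_ray[OF F, of "c + N (w - c)" "M (w - c)"] pS[OF w] by (simp add: p1)
      show ?thesis unfolding e1 I_def e2[symmetric] by (simp add: algebra_simps)
    qed
    ultimately show ?thesis by simp
  qed
  \<comment> \<open>The derivative of I F contains I (pd 1 F), so the induction on the order has to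
    run over all integrands.\<close>
  have "Ck_on k S (I F)" if "smooth_on S F" for k F
    using that
  proof (induction k arbitrary: F)
    case 0
    have "continuous (at w) (I F)" if "w \<in> S" for w
      using has_derivative_continuous[OF dI[OF 0 that]] .
    then show ?case by (simp add: continuous_at_imp_continuous_on)
  next
    case (Suc k)
    show ?case
      by (rule Ck_on_SucI[OF S(1) dI[OF Suc.prems]])
        (use Suc.IH[OF smooth_on_pd[OF Suc.prems]] Suc.prems in
          \<open>auto intro!: Ck_on_add Ck_on_mult S(1) simp: smooth_on_def\<close>)
  qed
  then have "smooth_on S (I F)" using F by (simp add: smooth_on_def)
  moreover have "pd 2 (I F) w = F w" if "w \<in> S" for w
    using has_derivative_pd[OF dI[OF F that], of 2] by (simp add: axis_def)
  ultimately show ?thesis by (rule that)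
qed

section \<open>Smooth inverse functions\<close>

text \<open>The inverse function theorem gives G with derivative A(G y), where A is the inverse
  Jacobian by Cramer's rule. As A depends smoothly on the point, G of class k has a derivative of
  class k, and all orders follow by induction.\<close>

lemma smooth_local_inverse_2:
  fixes F :: "real^2 \<Rightarrow> real^2"
  assumes F: "smooth_on S F" and S: "open S" and x0: "x0 \<in> S"
    and det: "pd 1 (\<lambda>x. F x $ 1) x0 * pd 2 (\<lambda>x. F x $ 2) x0 - pd 2 (\<lambda>x. F x $ 1) x0 * pd 1 (\<lambda>x. F x $ 2) x0 \<noteq> 0"
  obtains U W G where "open U" "x0 \<in> U" "U \<subseteq> S" "open W" "F ` U = W" "G ` W = U"
    "\<And>x. x \<in> U \<Longrightarrow> G (F x) = x" "\<And>y. y \<in> W \<Longrightarrow> F (G y) = y" "smooth_on W G"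
proof -
  define P where "P i j x = pd j (\<lambda>x. F x $ i) x" for i j x
  have Fi: "smooth_on S (\<lambda>x. F x $ i)" for i by (rule smooth_on_vec_nth[OF S F])
  have P: "smooth_on S (P i j)" for i j
    unfolding P_def by (rule smooth_on_pd[OF Fi])
  define f' where "f' x = Blinfun (frechet_derivative F (at x))" for x
  have Fd: "(F has_derivative blinfun_apply (f' x)) (at x)" if "x \<in> S" for x
    using smooth_on_has_derivative[OF F that]
    by (simp add: f'_def bounded_linear_Blinfun_apply has_derivative_bounded_linear[OF smooth_on_has_derivative[OF F that]])
  have f'P: "blinfun_apply (f' x) v $ i = v $ 1 * P i 1 x + v $ 2 * P i 2 x" if "x \<in> S" for x v i
  proof -
    have "((\<lambda>x. F x $ i) has_derivative (\<lambda>v. blinfun_apply (f' x) v $ i)) (at x)"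
      using bounded_linear.has_derivative[OF bounded_linear_vec_nth Fd[OF that]] .
    then have "blinfun_apply (f' x) v $ i = frechet_derivative (\<lambda>x. F x $ i) (at x) v"
      using frechet_derivative_at by (metis (no_types))
    then show ?thesis
      by (simp add: frechet_derivative_pd[OF smooth_on_differentiable[OF Fi that]] P_def sum_2)
  qed
  define d where "d x = P 1 1 x * P 2 2 x - P 1 2 x * P 2 1 x" for x
  have d: "smooth_on S d" unfolding d_def by (intro smooth_intros P S)
  \<comment> \<open>Cramer's rule divides by the Jacobian determinant, so the domain shrinks to the
    open set on which \<open>d\<close> does not vanish.\<close>
  define S' where "S' = S \<inter> d -` (- {0})"
  have S': "open S'" unfolding S'_def
    by (rule continuous_open_preimage[OF smooth_on_continuous[OF d] S]) auto
  have x0': "x0 \<in> S'" using x0 det by (simp add: S'_def d_def P_def)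
  define A :: "real^2 \<Rightarrow> real^2 \<Rightarrow> real^2" where "A x v = (\<chi> i. if i = 1 then (P 2 2 x * v $ 1 - P 1 2 x * v $ 2) / d x
      else (P 1 1 x * v $ 2 - P 2 1 x * v $ 1) / d x)" for x v
  have linA: "bounded_linear (A x)" for x
    by (rule linear_conv_bounded_linear[THEN iffD1], rule linearI)
      (auto simp: A_def vec_eq_iff algebra_simps add_divide_distrib diff_divide_distrib)
  have A1: "A x (blinfun_apply (f' x) v) = v" if "x \<in> S'" for x v
    using that by (simp add: A_def vec_eq_iff forall_2 f'P S'_def field_simps) (simp add: d_def algebra_simps)
  have A2: "blinfun_apply (f' x) (A x v) = v" if "x \<in> S'" for x v
    using that by (simp add: A_def vec_eq_iff forall_2 f'P S'_def field_simps) (simp add: d_def algebra_simps)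
  have cont: "continuous_on S' f'"
  proof (rule continuous_on_blinfun_componentwise)
    fix b :: "real^2"
    have "continuous_on S' (\<lambda>x. \<chi> i. b $ 1 * P i 1 x + b $ 2 * P i 2 x)"
      by (intro continuous_intros continuous_on_subset[OF smooth_on_continuous[OF P]]) (auto simp: S'_def)
    moreover have "(\<chi> i. b $ 1 * P i 1 x + b $ 2 * P i 2 x) = blinfun_apply (f' x) b" if "x \<in> S'" for x
      using that by (simp add: vec_eq_iff f'P S'_def)
    ultimately show "continuous_on S' (\<lambda>x. blinfun_apply (f' x) b)"
      by (simp cong: continuous_on_cong)
  qed
  have inv: "Blinfun (A x0) o\<^sub>L f' x0 = id_blinfun"
    by (rule blinfun_eqI) (simp add: bounded_linear_Blinfun_apply[OF linA] A1[OF x0'])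
  obtain U W G G' where UW: "open U" "U \<subseteq> S'" "x0 \<in> U" "open W" "F x0 \<in> W" and hom: "homeomorphism U W F G"
    and G': "\<And>y. y \<in> W \<Longrightarrow> (G has_derivative (G' y)) (at y)" "\<And>y. y \<in> W \<Longrightarrow> G' y = Hilbert_Choice.inv (blinfun_apply (f' (G y)))"
    using inverse_function_theorem[OF S' Fd cont x0' inv] by (metis (no_types, lifting) IntE S'_def)
  have GU: "G y \<in> U" if "y \<in> W" for y using hom that by (auto simp: homeomorphism_def)
  have GA: "(G has_derivative A (G y)) (at y)" if "y \<in> W" for y
  proof -
    have y: "G y \<in> S'" using GU[OF that] UW by auto
    have "Hilbert_Choice.inv (blinfun_apply (f' (G y))) = A (G y)"
      by (rule inv_unique_comp) (auto simp: A1[OF y] A2[OF y])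
    then show ?thesis using G'[OF that] by simp
  qed
  have "Ck_on k W G" for k
  proof (induction k)
    case 0
    then show ?case using hom by (simp add: homeomorphism_def)
  next
    case (Suc k)
    have PG: "Ck_on k W (\<lambda>y. P i j (G y))" for i j
      by (rule Ck_on_compose[OF UW(4) S _ Suc]) (use GU UW P in \<open>auto simp: S'_def smooth_on_def\<close>)
    have dG: "Ck_on k W (\<lambda>y. inverse (d (G y)))"
    proof (rule Ck_on_inverse[OF UW(4)])
      show "d (G y) \<noteq> 0" if "y \<in> W" for y using GU[OF that] UW by (auto simp: S'_def)
      show "Ck_on k W (\<lambda>y. d (G y))"
        by (rule Ck_on_compose[OF UW(4) S _ Suc]) (use GU UW d in \<open>auto simp: S'_def smooth_on_def\<close>)
    qed
    have eq: "A x v = (P 2 2 x * v $ 1 + P 1 2 x * - v $ 2) *\<^sub>R (inverse (d x) *\<^sub>R axis 1 1)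
       + (P 1 1 x * v $ 2 + P 2 1 x * - v $ 1) *\<^sub>R (inverse (d x) *\<^sub>R axis 2 1)" for x v
      by (simp add: A_def vec_eq_iff forall_2 axis_def divide_inverse)
    show ?case
    proof (rule Ck_on_SucI[OF UW(4) GA])
      show "Ck_on k W (\<lambda>y. A (G y) v)" for v
        unfolding eq by (intro Ck_on_add Ck_on_scaleR Ck_on_mult UW(4) PG dG Ck_on_const)
    qed
  qed
  then have "smooth_on W G" by (simp add: smooth_on_def)
  then show ?thesis
    using that[of U W G] UW hom by (auto simp: homeomorphism_def S'_def)
qed

section \<open>Walker metrics\<close>

lemma sum_UNIV_Plus:
  fixes f :: "'m::finite + 'n::finite \<Rightarrow> 'a::comm_monoid_add"
  shows "sum f UNIV = (\<Sum>i\<in>UNIV. f (Inl i)) + (\<Sum>i\<in>UNIV. f (Inr i))"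
  by (simp add: UNIV_Plus_UNIV[symmetric] sum.Plus del: UNIV_Plus_UNIV)

lemma matrix_inv_eqI:
  fixes A B :: "real^'n::finite^'n"
  assumes "A ** B = mat 1" "B ** A = mat 1"
  shows "matrix_inv A = B"
proof -
  have "A ** matrix_inv A = mat 1"
    unfolding matrix_inv_def by (rule someI2[where a = B]) (use assms in auto)
  then have "B ** (A ** matrix_inv A) = B" by simp
  then show ?thesis by (simp add: matrix_mul_assoc assms(2))
qed

text \<open>The \<open>Inr\<close> directions span a null distribution paired with the
  \<open>Inl\<close> directions by the identity. Leaving the block A arbitrary separates the
  curvature formulas from the particular coefficients of the extension.\<close>

definition walker :: "('n::finite \<Rightarrow> 'n \<Rightarrow> real^('n + 'n) \<Rightarrow> real) \<Rightarrow> ('n + 'n) field2" where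
  "walker A a b z =
     (case (a, b) of
        (Inl i, Inl j) \<Rightarrow> A i j z
      | (Inl i, Inr j) \<Rightarrow> if i = j then 1 else 0
      | (Inr i, Inl j) \<Rightarrow> if i = j then 1 else 0
      | (Inr i, Inr j) \<Rightarrow> 0)"

lemma walker_simps [simp]:
  "walker A (Inl i) (Inl j) = A i j"
  "walker A (Inl i) (Inr j) = (\<lambda>z. if i = j then 1 else 0)"
  "walker A (Inr i) (Inl j) = (\<lambda>z. if i = j then 1 else 0)"
  "walker A (Inr i) (Inr j) = (\<lambda>z. 0)"
  by (simp_all add: walker_def fun_eq_iff)

definition walker_inv :: "('n::finite \<Rightarrow> 'n \<Rightarrow> real^('n + 'n) \<Rightarrow> real) \<Rightarrow> ('n + 'n) field2" where
  "walker_inv A a b z =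
     (case (a, b) of
        (Inl i, Inl j) \<Rightarrow> 0
      | (Inl i, Inr j) \<Rightarrow> if i = j then 1 else 0
      | (Inr i, Inl j) \<Rightarrow> if i = j then 1 else 0
      | (Inr i, Inr j) \<Rightarrow> - A i j z)"

lemma walker_inv_simps [simp]:
  "walker_inv A (Inl i) (Inl j) z = 0"
  "walker_inv A (Inl i) (Inr j) z = (if i = j then 1 else 0)"
  "walker_inv A (Inr i) (Inl j) z = (if i = j then 1 else 0)"
  "walker_inv A (Inr i) (Inr j) z = - A i j z"
  by (simp_all add: walker_inv_def)

lemma if_mult_real: "(if P then 1 else 0) * (x::real) = (if P then x else 0)"
  "x * (if P then 1 else 0) = (if P then x else 0)" by auto

lemma walker_mult_inv:
  "gmat (walker A) z ** (\<chi> i j. walker_inv A i j z) = mat 1"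
  "(\<chi> i j. walker_inv A i j z) ** gmat (walker A) z = mat 1"
proof -
  have "(\<Sum>k\<in>UNIV. walker A a k z * walker_inv A k b z) = (if a = b then 1 else 0)"
    and "(\<Sum>k\<in>UNIV. walker_inv A a k z * walker A k b z) = (if a = b then 1 else 0)" for a b
    by (cases a; cases b; simp add: sum_UNIV_Plus if_mult_real sum_negf)+
  then show "gmat (walker A) z ** (\<chi> i j. walker_inv A i j z) = mat 1"
    "(\<chi> i j. walker_inv A i j z) ** gmat (walker A) z = mat 1"
    by (simp_all add: gmat_def matrix_matrix_mult_def mat_def vec_eq_iff)
qed

lemma ginv_walker: "ginv (walker A) z = (\<chi> i j. walker_inv A i j z)"
  unfolding ginv_def by (rule matrix_inv_eqI walker_mult_inv)+

lemma invertible_walker: "invertible (gmat (walker A) z)"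
  using walker_mult_inv invertible_def by blast

text \<open>The closed form of the inverse metric makes the Christoffel symbols polynomial in the
  1-jet of A, and hence the curvature polynomial in its 2-jet.\<close>

lemma levi_civita_walker:
  "levi_civita (walker A) (Inl i) (Inl j) (Inl k) = (\<lambda>z. - (1/2) * pd (Inr k) (A i j) z)"
  "levi_civita (walker A) (Inl i) (Inr j) (Inl k) = (\<lambda>z. 0)"
  "levi_civita (walker A) (Inr j) (Inl i) (Inl k) = (\<lambda>z. 0)"
  "levi_civita (walker A) (Inr i) (Inr j) c = (\<lambda>z. 0)"
  "levi_civita (walker A) (Inl i) (Inr j) (Inr k) = (\<lambda>z. 1/2 * pd (Inr j) (A i k) z)"
  "levi_civita (walker A) (Inr j) (Inl i) (Inr k) = (\<lambda>z. 1/2 * pd (Inr j) (A i k) z)"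
  "levi_civita (walker A) (Inl i) (Inl j) (Inr k) = (\<lambda>z.
     1/2 * (pd (Inl i) (A j k) z + pd (Inl j) (A i k) z - pd (Inl k) (A i j) z)
     + 1/2 * (\<Sum>l\<in>UNIV. A k l z * pd (Inr l) (A i j) z))"
  subgoal by (simp add: fun_eq_iff levi_civita_def ginv_walker sum_UNIV_Plus if_mult_real sum_negf)
  subgoal by (simp add: fun_eq_iff levi_civita_def ginv_walker sum_UNIV_Plus if_mult_real sum_negf)
  subgoal by (simp add: fun_eq_iff levi_civita_def ginv_walker sum_UNIV_Plus if_mult_real sum_negf)
  subgoal by (cases c) (simp_all add: fun_eq_iff levi_civita_def ginv_walker sum_UNIV_Plus if_mult_real sum_negf)
  subgoal by (simp add: fun_eq_iff levi_civita_def ginv_walker sum_UNIV_Plus if_mult_real sum_negf)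
  subgoal by (simp add: fun_eq_iff levi_civita_def ginv_walker sum_UNIV_Plus if_mult_real sum_negf)
  subgoal by (simp add: fun_eq_iff levi_civita_def ginv_walker sum_UNIV_Plus if_mult_real sum_negf)
  done

lemma curvature_swap: "curvature \<Gamma> j i k l x = - curvature \<Gamma> i j k l x"
  by (simp add: curvature_def sum_subtractf)

context
  fixes U :: "(real^('n::finite + 'n)) set" and A :: "'n \<Rightarrow> 'n \<Rightarrow> real^('n + 'n) \<Rightarrow> real" and z
  assumes U: "open U" and z: "z \<in> U" and A: "\<And>i j. smooth_on U (A i j)"
begin

lemma walker_differentiable [simp]:
  "A i j differentiable (at z)" "pd a (A i j) differentiable (at z)"
  using smooth_on_differentiable[OF _ z] smooth_on_pd A by blast+

lemma pd_levi_civita_walker: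
  "pd a (levi_civita (walker A) (Inl i) (Inl j) (Inl k)) z = - (1/2) * pd a (pd (Inr k) (A i j)) z"
  "pd a (levi_civita (walker A) (Inl i) (Inr j) (Inl k)) z = 0"
  "pd a (levi_civita (walker A) (Inr j) (Inl i) (Inl k)) z = 0"
  "pd a (levi_civita (walker A) (Inr i) (Inr j) c) z = 0"
  "pd a (levi_civita (walker A) (Inl i) (Inr j) (Inr k)) z = 1/2 * pd a (pd (Inr j) (A i k)) z"
  "pd a (levi_civita (walker A) (Inr j) (Inl i) (Inr k)) z = 1/2 * pd a (pd (Inr j) (A i k)) z"
  "pd a (levi_civita (walker A) (Inl i) (Inl j) (Inr k)) z =
   1/2 * (pd a (pd (Inl i) (A j k)) z + pd a (pd (Inl j) (A i k)) z - pd a (pd (Inl k) (A i j)) z)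
     + 1/2 * (\<Sum>l\<in>UNIV. A k l z * pd a (pd (Inr l) (A i j)) z + pd a (A k l) z * pd (Inr l) (A i j) z)"
proof -
  have "(\<lambda>z. pd (Inl i) (A j k) z + pd (Inl j) (A i k) z - pd (Inl k) (A i j) z) differentiable (at z)"
    "(\<lambda>z. pd (Inl i) (A j k) z + pd (Inl j) (A i k) z) differentiable (at z)"
    "\<And>l. (\<lambda>z. A k l z * pd (Inr l) (A i j) z) differentiable (at z)"
    by (intro differentiable_add differentiable_diff differentiable_mult walker_differentiable)+
  moreover from this(3) have "(\<lambda>z. \<Sum>l\<in>UNIV. A k l z * pd (Inr l) (A i j) z) differentiable (at z)"
    by (intro differentiable_sum) auto
  ultimately show "pd a (levi_civita (walker A) (Inl i) (Inl j) (Inr k)) z =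
   1/2 * (pd a (pd (Inl i) (A j k)) z + pd a (pd (Inl j) (A i k)) z - pd a (pd (Inl k) (A i j)) z)
     + 1/2 * (\<Sum>l\<in>UNIV. A k l z * pd a (pd (Inr l) (A i j)) z + pd a (A k l) z * pd (Inr l) (A i j) z)"
    unfolding levi_civita_walker
    by (subst pd_add) (simp_all only: pd_cmult pd_add pd_diff pd_sum pd_mult differentiable_mult
        differentiable_const walker_differentiable)
qed (simp_all only: levi_civita_walker pd_cmult pd_const walker_differentiable)

lemmas walker_sum_simps = sum_negf sum_subtractf sum.distrib sum_distrib_left sum_divide_distrib[symmetric]

text \<open>Differentiation in a vertical direction kills vertical vectors and sends horizontal ones
  to vertical ones, so the quadratic terms drop out; the rest is the symmetry of second vertical
  derivatives of A.\<close>

lemma curvature_walker_vertical: "curvature (levi_civita (walker A)) (Inr i) (Inr j) c d z = 0"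
  unfolding curvature_def
  by (cases c; cases d) (simp_all only: pd_levi_civita_walker, simp_all add: sum_UNIV_Plus levi_civita_walker
      pd_commute[OF U z A, of "Inr i"])

lemma curvature_walker_mixed:
  "curvature (levi_civita (walker A)) (Inl i) (Inr j) (Inr k) (Inl l) z = 0"
  "curvature (levi_civita (walker A)) (Inl i) (Inr j) (Inr k) (Inr l) z = - (1/2) * pd (Inr j) (pd (Inr k) (A i l)) z"
  "curvature (levi_civita (walker A)) (Inl i) (Inr j) (Inl k) (Inl l) z = 1/2 * pd (Inr j) (pd (Inr l) (A i k)) z"
  "curvature (levi_civita (walker A)) (Inl i) (Inr j) (Inl k) (Inr l) z =
     1/2 * pd (Inl i) (pd (Inr j) (A k l)) z
     - 1/2 * (pd (Inr j) (pd (Inl i) (A k l)) z + pd (Inr j) (pd (Inl k) (A i l)) z - pd (Inr j) (pd (Inl l) (A i k)) z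
         + (\<Sum>m\<in>UNIV. A l m z * pd (Inr j) (pd (Inr m) (A i k)) z + pd (Inr j) (A l m) z * pd (Inr m) (A i k) z))
     + 1/4 * (\<Sum>m\<in>UNIV. pd (Inr j) (A k m) z * pd (Inr m) (A i l) z + pd (Inr m) (A i k) z * pd (Inr j) (A m l) z)"
  unfolding curvature_def pd_levi_civita_walker sum_UNIV_Plus
  by (simp_all add: levi_civita_walker walker_sum_simps algebra_simps)

lemma curvature_walker_horizontal:
  "curvature (levi_civita (walker A)) (Inl i) (Inl j) (Inr k) (Inl l) z = 0"
  "curvature (levi_civita (walker A)) (Inl i) (Inl j) (Inr k) (Inr l) z =
     1/2 * pd (Inl i) (pd (Inr k) (A j l)) z - 1/2 * pd (Inl j) (pd (Inr k) (A i l)) z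
     + 1/4 * (\<Sum>m\<in>UNIV. pd (Inr k) (A j m) z * pd (Inr m) (A i l) z - pd (Inr k) (A i m) z * pd (Inr m) (A j l) z)"
  "curvature (levi_civita (walker A)) (Inl i) (Inl j) (Inl k) (Inl l) z =
     - (1/2) * pd (Inl i) (pd (Inr l) (A j k)) z + 1/2 * pd (Inl j) (pd (Inr l) (A i k)) z
     + 1/4 * (\<Sum>m\<in>UNIV. pd (Inr m) (A j k) z * pd (Inr l) (A i m) z - pd (Inr m) (A i k) z * pd (Inr l) (A j m) z)"
  unfolding curvature_def pd_levi_civita_walker sum_UNIV_Plus
  by (simp_all add: levi_civita_walker walker_sum_simps algebra_simps)

text \<open>\<open>G\<close> and \<open>H\<close> keep the longest Christoffel symbol and its
  derivative folded; they are expanded only after the coefficients of the extension have been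
  inserted.\<close>

lemma curvature_walker_horizontal_vertical:
  fixes G H
  defines "G \<equiv> \<lambda>i j k. levi_civita (walker A) (Inl i) (Inl j) (Inr k) z"
    and "H \<equiv> \<lambda>i j k l. 1/2 * (pd (Inl i) (pd (Inl j) (A k l)) z + pd (Inl i) (pd (Inl k) (A j l)) z - pd (Inl i) (pd (Inl l) (A j k)) z)
     + 1/2 * (\<Sum>m\<in>UNIV. A l m z * pd (Inl i) (pd (Inr m) (A j k)) z + pd (Inl i) (A l m) z * pd (Inr m) (A j k) z)"
  shows "curvature (levi_civita (walker A)) (Inl i) (Inl j) (Inl k) (Inr l) z =
    H i j k l - H j i k l
    + 1/2 * (\<Sum>m\<in>UNIV. G j k m * pd (Inr m) (A i l) z - pd (Inr m) (A j k) z * G i m l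
        - G i k m * pd (Inr m) (A j l) z + pd (Inr m) (A i k) z * G j m l)"
  unfolding G_def H_def curvature_def pd_levi_civita_walker sum_UNIV_Plus levi_civita_walker(1,4,5,6)
  by (simp add: walker_sum_simps diff_divide_distrib add_divide_distrib)

lemma ricci_walker:
  "ricci (levi_civita (walker A)) (Inr j) (Inr k) z = 0"
  "ricci (levi_civita (walker A)) (Inl j) (Inr k) z = 1/2 * (\<Sum>l\<in>UNIV. pd (Inr l) (pd (Inr k) (A j l)) z)"
  "ricci (levi_civita (walker A)) (Inr j) (Inl k) z = 1/2 * (\<Sum>l\<in>UNIV. pd (Inr j) (pd (Inr l) (A l k)) z)"
  "ricci (levi_civita (walker A)) (Inl j) (Inl k) z =
     (\<Sum>l\<in>UNIV. curvature (levi_civita (walker A)) (Inl l) (Inl j) (Inl k) (Inl l) z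
       - curvature (levi_civita (walker A)) (Inl j) (Inr l) (Inl k) (Inr l) z)"
  by (simp_all add: ricci_def sum_UNIV_Plus curvature_walker_vertical curvature_walker_mixed(1-3)
      curvature_walker_horizontal(1) curvature_swap[of _ "Inr _" "Inl j"] walker_sum_simps)

end

section \<open>The modified Riemann extension\<close>

definition extension_coeff ::
    "'n::finite field3 \<Rightarrow> 'n field2 \<Rightarrow> 'n field2 \<Rightarrow> 'n \<Rightarrow> 'n \<Rightarrow> real^('n + 'n) \<Rightarrow> real" where
  "extension_coeff \<Gamma> \<Psi> T i j z =
     1/2 * (\<Sum>r\<in>UNIV. \<Sum>s\<in>UNIV. z $ Inr r * z $ Inr s *
            (T i r (base_part z) * T j s (base_part z) + T j r (base_part z) * T i s (base_part z)))
     - 2 * (\<Sum>k\<in>UNIV. z $ Inr k * \<Gamma> i j k (base_part z)) + \<Psi> i j (base_part z)"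

lemma modified_riemann_extension_walker:
  "modified_riemann_extension D \<Psi> T c = walker (extension_coeff (D c) (\<Psi> c) (T c))"
  by (auto simp: fun_eq_iff modified_riemann_extension_def walker_def extension_coeff_def split: sum.splits)

lemma bounded_linear_base_part: "bounded_linear (base_part :: real^('n::finite + 'n) \<Rightarrow> real^'n)"
  unfolding base_part_def
  by (rule linear_conv_bounded_linear[THEN iffD1], rule linearI) (auto simp: vec_eq_iff)

lemma base_part_has_derivative: "(base_part has_derivative base_part) (at (z :: real^('n::finite + 'n)))"
  by (rule bounded_linear_imp_has_derivative[OF bounded_linear_base_part])

lemma base_part_axis [simp]:
  "base_part (axis (Inl m) 1) = axis m 1" "base_part (axis (Inr m) 1) = 0"
  by (auto simp: base_part_def axis_def vec_eq_iff)

lemma open_base_part_vimage: "open X \<Longrightarrow> open {z. base_part z \<in> X}"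
  using continuous_open_vimage[OF _ linear_continuous_at[OF bounded_linear_base_part]]
  by (simp add: vimage_def)

lemma smooth_on_base_part:
  assumes "open X" "smooth_on X f"
  shows "smooth_on {z. base_part z \<in> X} (\<lambda>z. f (base_part z))"
  by (rule smooth_on_compose[OF open_base_part_vimage assms(1) _ _ assms(2)])
    (auto intro: assms smooth_on_linear bounded_linear_base_part open_base_part_vimage)

lemma base_part_differentiable:
  assumes "smooth_on X f" "base_part z \<in> X"
  shows "(\<lambda>z. f (base_part z)) differentiable (at z)"
  using has_derivative_compose[OF base_part_has_derivative smooth_on_has_derivative[OF assms]]
  by (auto simp: differentiable_def)

lemma pd_base_part:
  assumes "smooth_on X f" "base_part z \<in> X"
  shows "pd (Inl m) (\<lambda>z. f (base_part z)) z = pd m f (base_part z)"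
    "pd (Inr m) (\<lambda>z. f (base_part z)) z = 0"
  using has_derivative_pd[OF has_derivative_compose[OF base_part_has_derivative smooth_on_has_derivative[OF assms]]]
    linear_frechet_derivative[OF smooth_on_differentiable[OF assms]]
  by (simp_all add: pd_def linear_0)

lemma coordinate_differentiable [simp]: "(\<lambda>z. z $ a) differentiable (at (z :: real^'n::finite))"
  using bounded_linear_imp_has_derivative[OF bounded_linear_vec_nth] by (auto simp: differentiable_def)

text \<open>The hypotheses on the surface as seen in one chart. Both parallelism conditions are
  solved for the partial derivatives, the form in which they act as rewrite rules.\<close>

locale parallel_chart =
  fixes X :: "(real^2) set" and \<Gamma> :: "2 field3" and T \<Phi> :: "2 field2"
  assumes open_X: "open X"
    and smooth_\<Gamma>: "smooth_on X (\<Gamma> i j k)" and smooth_T: "smooth_on X (T i j)" and smooth_\<Phi>: "smooth_on X (\<Phi> i j)"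
    and sym_\<Gamma>: "x \<in> X \<Longrightarrow> \<Gamma> i j k x = \<Gamma> j i k x"
    and T_sq: "x \<in> X \<Longrightarrow> (\<Sum>k\<in>UNIV. T i k x * T k j x) = 0"
    and par_T: "x \<in> X \<Longrightarrow> pd k (T i j) x =
      (\<Sum>m\<in>UNIV. \<Gamma> k i m x * T m j x) - (\<Sum>m\<in>UNIV. T i m x * \<Gamma> k m j x)"
    and sym_\<Phi>: "x \<in> X \<Longrightarrow> \<Phi> i j x = \<Phi> j i x"
    and par_\<Phi>: "x \<in> X \<Longrightarrow> pd k (\<Phi> i j) x =
      (\<Sum>m\<in>UNIV. \<Gamma> k i m x * \<Phi> m j x) + (\<Sum>m\<in>UNIV. \<Gamma> k j m x * \<Phi> i m x)"
begin

definition \<Psi> :: "2 field2" where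
  "\<Psi> i j x = (\<Sum>r\<in>UNIV. \<Sum>s\<in>UNIV. T i r x * T j s x * \<Phi> r s x)"

definition A where "A = extension_coeff \<Gamma> \<Psi> T"

definition U :: "(real^(2 + 2)) set" where "U = {z. base_part z \<in> X}"

lemma open_U: "open U" unfolding U_def by (rule open_base_part_vimage[OF open_X])

lemma diff_X [simp]:
  "x \<in> X \<Longrightarrow> \<Gamma> i j k differentiable (at x)" "x \<in> X \<Longrightarrow> T i j differentiable (at x)"
  "x \<in> X \<Longrightarrow> \<Phi> i j differentiable (at x)" "x \<in> X \<Longrightarrow> pd m (\<Gamma> i j k) differentiable (at x)"
  using smooth_\<Gamma> smooth_T smooth_\<Phi> smooth_on_differentiable smooth_on_pd by blast+

lemma smooth_\<Psi>: "smooth_on X (\<Psi> i j)"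
  unfolding \<Psi>_def[abs_def] by (intro smooth_intros open_X smooth_T smooth_\<Phi>)

text \<open>The lifted tensor is parallel because T and \<Phi> are; thus its derivatives can also be
  eliminated in favour of \<Gamma>.\<close>

lemma par_\<Psi>: "x \<in> X \<Longrightarrow> pd k (\<Psi> i j) x =
      (\<Sum>m\<in>UNIV. \<Gamma> k i m x * \<Psi> m j x) + (\<Sum>m\<in>UNIV. \<Gamma> k j m x * \<Psi> i m x)"
  unfolding \<Psi>_def[abs_def] sum_2
  by (simp add: pd_add pd_mult differentiable_add differentiable_mult par_T par_\<Phi> sum_2 algebra_simps)

lemma pd_sym_\<Gamma>: "x \<in> X \<Longrightarrow> pd m (\<Gamma> i j k) x = pd m (\<Gamma> j i k) x"
  by (rule pd_cong_open[OF open_X _ sym_\<Gamma>])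

lemma ppd_sym_\<Gamma>: "x \<in> X \<Longrightarrow> pd n (pd m (\<Gamma> i j k)) x = pd n (pd m (\<Gamma> j i k)) x"
  by (rule pd_cong_open[OF open_X _ pd_sym_\<Gamma>])

lemma ppd_commute_\<Gamma>: "x \<in> X \<Longrightarrow> pd n (pd m (\<Gamma> i j k)) x = pd m (pd n (\<Gamma> i j k)) x"
  by (rule pd_commute[OF open_X _ smooth_\<Gamma>])

lemma smooth_A: "smooth_on U (A i j)"
  unfolding A_def extension_coeff_def[abs_def] U_def
  by (intro smooth_intros smooth_on_base_part smooth_\<Gamma> smooth_T smooth_\<Psi> open_X open_base_part_vimage
      smooth_on_linear bounded_linear_vec_nth)

section \<open>Jets of the extension coefficients up to second order\<close>

lemma extension_coeff_2:
  "A i j z = (z $ Inr 1 * T i 1 (base_part z) + z $ Inr 2 * T i 2 (base_part z)) *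
      (z $ Inr 1 * T j 1 (base_part z) + z $ Inr 2 * T j 2 (base_part z))
     - 2 * (z $ Inr 1 * \<Gamma> i j 1 (base_part z) + z $ Inr 2 * \<Gamma> i j 2 (base_part z)) + \<Psi> i j (base_part z)"
  by (simp add: A_def extension_coeff_def sum_2 algebra_simps)

lemma base_diff [simp]:
  assumes "z \<in> U"
  shows "(\<lambda>z. T i j (base_part z)) differentiable (at z)"
    "(\<lambda>z. \<Gamma> i j k (base_part z)) differentiable (at z)"
    "(\<lambda>z. \<Psi> i j (base_part z)) differentiable (at z)"
    "(\<lambda>z. pd m (\<Gamma> i j k) (base_part z)) differentiable (at z)"
  using assms base_part_differentiable smooth_\<Gamma> smooth_T smooth_\<Psi> smooth_on_pd unfolding U_def by blast+

lemma pd_base [simp]: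
  assumes "z \<in> U"
  shows "pd (Inl m) (\<lambda>z. T i j (base_part z)) z = pd m (T i j) (base_part z)"
    "pd (Inl m) (\<lambda>z. \<Gamma> i j k (base_part z)) z = pd m (\<Gamma> i j k) (base_part z)"
    "pd (Inl m) (\<lambda>z. \<Psi> i j (base_part z)) z = pd m (\<Psi> i j) (base_part z)"
    "pd (Inl m) (\<lambda>z. pd n (\<Gamma> i j k) (base_part z)) z = pd m (pd n (\<Gamma> i j k)) (base_part z)"
    "pd (Inr m) (\<lambda>z. T i j (base_part z)) z = 0"
    "pd (Inr m) (\<lambda>z. \<Gamma> i j k (base_part z)) z = 0"
    "pd (Inr m) (\<lambda>z. \<Psi> i j (base_part z)) z = 0"
    "pd (Inr m) (\<lambda>z. pd n (\<Gamma> i j k) (base_part z)) z = 0"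
  using assms pd_base_part smooth_\<Gamma> smooth_T smooth_\<Psi> smooth_on_pd unfolding U_def by blast+

lemmas pd_rules = pd_add pd_diff pd_mult pd_uminus pd_coordinate differentiable_add differentiable_diff
  differentiable_mult

text \<open>\<open>Tp i\<close> is the i-th component of the one-form iota T, linear in the fibre.
  \<open>dT\<close> is the right-hand side of \<open>par_T\<close> pulled back to the bundle, so
  \<open>dT\<close> and \<open>dTp\<close> stand for derivatives of T and \<open>Tp\<close> already
  rewritten through \<Gamma> and T.\<close>

definition Tp where "Tp i z = z $ Inr 1 * T i 1 (base_part z) + z $ Inr 2 * T i 2 (base_part z)"
definition dT where "dT m i k z = \<Gamma> m i 1 (base_part z) * T 1 k (base_part z) + \<Gamma> m i 2 (base_part z) * T 2 k (base_part z)
   - (T i 1 (base_part z) * \<Gamma> m 1 k (base_part z) + T i 2 (base_part z) * \<Gamma> m 2 k (base_part z))"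
definition dTp where "dTp m i z = z $ Inr 1 * dT m i 1 z + z $ Inr 2 * dT m i 2 z"

lemma differentiable_T [simp]: "z \<in> U \<Longrightarrow> Tp i differentiable (at z)" "z \<in> U \<Longrightarrow> dT m i k differentiable (at z)"
  "z \<in> U \<Longrightarrow> dTp m i differentiable (at z)"
  unfolding Tp_def[abs_def] dT_def[abs_def] dTp_def[abs_def] by (simp_all add: pd_rules)

lemma pd_T:
  assumes "z \<in> U"
  shows "pd (Inl m) (\<lambda>z. T i k (base_part z)) z = dT m i k z"
    "pd (Inr k) (Tp i) z = T i k (base_part z)" "pd (Inl m) (Tp i) z = dTp m i z"
    "pd (Inr k) (dT m i l) z = 0" "pd (Inr k) (dTp m i) z = dT m i k z"
proof -
  have x: "base_part z \<in> X" using assms by (simp add: U_def)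
  show *: "pd (Inl m) (\<lambda>z. T i k (base_part z)) z = dT m i k z" for m i k
    using assms by (simp add: dT_def par_T[OF x] sum_2)
  show "pd (Inr k) (Tp i) z = T i k (base_part z)"
    using assms exhaust_2[of k] unfolding Tp_def[abs_def] by (auto simp: pd_rules)
  show "pd (Inl m) (Tp i) z = dTp m i z"
    using assms unfolding Tp_def[abs_def] dTp_def by (simp add: pd_rules * del: pd_base)
  show **: "pd (Inr k) (dT m i l) z = 0" for k l
    using assms unfolding dT_def[abs_def] by (simp add: pd_rules)
  show "pd (Inr k) (dTp m i) z = dT m i k z"
    using assms exhaust_2[of k] unfolding dTp_def[abs_def] by (auto simp: pd_rules **)
qed

lemma A_eq: "A i j = (\<lambda>z. Tp i z * Tp j z
     - 2 * (z $ Inr 1 * \<Gamma> i j 1 (base_part z) + z $ Inr 2 * \<Gamma> i j 2 (base_part z)) + \<Psi> i j (base_part z))"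
  by (simp add: fun_eq_iff extension_coeff_2 Tp_def)

definition d\<Psi> where "d\<Psi> m i j z = \<Gamma> m i 1 (base_part z) * \<Psi> 1 j (base_part z) + \<Gamma> m i 2 (base_part z) * \<Psi> 2 j (base_part z)
  + (\<Gamma> m j 1 (base_part z) * \<Psi> i 1 (base_part z) + \<Gamma> m j 2 (base_part z) * \<Psi> i 2 (base_part z))"

lemma pd_\<Psi>: "z \<in> U \<Longrightarrow> pd m (\<Psi> i j) (base_part z) = d\<Psi> m i j z"
  by (simp add: U_def par_\<Psi> d\<Psi>_def sum_2)

lemma differentiable_d\<Psi> [simp]: "z \<in> U \<Longrightarrow> d\<Psi> m i k differentiable (at z)"
  unfolding d\<Psi>_def[abs_def] by (simp add: pd_rules)

lemma pd_A:
  assumes "z \<in> U"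
  shows "pd (Inr k) (A i j) z = T i k (base_part z) * Tp j z + Tp i z * T j k (base_part z) - 2 * \<Gamma> i j k (base_part z)"
   "pd (Inl m) (A i j) z = dTp m i z * Tp j z + Tp i z * dTp m j z
     - 2 * (z $ Inr 1 * pd m (\<Gamma> i j 1) (base_part z) + z $ Inr 2 * pd m (\<Gamma> i j 2) (base_part z))
     + d\<Psi> m i j z"
  unfolding A_eq using assms exhaust_2[of k] by (auto simp: pd_rules pd_T pd_\<Psi>)

definition ddT where "ddT n m i k z = pd (Inl n) (dT m i k) z"
definition ddTp where "ddTp n m i z = z $ Inr 1 * ddT n m i 1 z + z $ Inr 2 * ddT n m i 2 z"

lemma pd_dTp: "z \<in> U \<Longrightarrow> pd (Inl n) (dTp m i) z = ddTp n m i z"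
  unfolding dTp_def[abs_def] ddTp_def ddT_def by (simp add: pd_rules)

lemma ddT_eq:
  assumes "z \<in> U"
  shows "ddT n m i k z = pd n (\<Gamma> m i 1) (base_part z) * T 1 k (base_part z) + \<Gamma> m i 1 (base_part z) * dT n 1 k z
    + pd n (\<Gamma> m i 2) (base_part z) * T 2 k (base_part z) + \<Gamma> m i 2 (base_part z) * dT n 2 k z
   - (dT n i 1 z * \<Gamma> m 1 k (base_part z) + T i 1 (base_part z) * pd n (\<Gamma> m 1 k) (base_part z)
    + dT n i 2 z * \<Gamma> m 2 k (base_part z) + T i 2 (base_part z) * pd n (\<Gamma> m 2 k) (base_part z))"
  using assms unfolding ddT_def dT_def[abs_def]
  by (simp add: pd_rules pd_T(1) dT_def del: pd_base(1))

lemma pd_d\<Psi>: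
  assumes "z \<in> U"
  shows "pd (Inr k) (d\<Psi> m i j) z = 0"
  "pd (Inl n) (d\<Psi> m i j) z = pd n (\<Gamma> m i 1) (base_part z) * \<Psi> 1 j (base_part z) + \<Gamma> m i 1 (base_part z) * d\<Psi> n 1 j z
    + pd n (\<Gamma> m i 2) (base_part z) * \<Psi> 2 j (base_part z) + \<Gamma> m i 2 (base_part z) * d\<Psi> n 2 j z
  + (pd n (\<Gamma> m j 1) (base_part z) * \<Psi> i 1 (base_part z) + \<Gamma> m j 1 (base_part z) * d\<Psi> n i 1 z
    + pd n (\<Gamma> m j 2) (base_part z) * \<Psi> i 2 (base_part z) + \<Gamma> m j 2 (base_part z) * d\<Psi> n i 2 z)"
  using assms unfolding d\<Psi>_def[abs_def]
  by (simp_all add: pd_rules pd_\<Psi> d\<Psi>_def)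

lemma ppd_A:
  assumes z: "z \<in> U"
  shows "pd (Inr l) (pd (Inr k) (A i j)) z = T i k (base_part z) * T j l (base_part z) + T i l (base_part z) * T j k (base_part z)"
   "pd (Inl m) (pd (Inr k) (A i j)) z = dT m i k z * Tp j z + T i k (base_part z) * dTp m j z
      + dTp m i z * T j k (base_part z) + Tp i z * dT m j k z - 2 * pd m (\<Gamma> i j k) (base_part z)"
   "pd (Inr k) (pd (Inl m) (A i j)) z = dT m i k z * Tp j z + T i k (base_part z) * dTp m j z
      + dTp m i z * T j k (base_part z) + Tp i z * dT m j k z - 2 * pd m (\<Gamma> i j k) (base_part z)"
   "pd (Inl n) (pd (Inl m) (A i j)) z = ddTp n m i z * Tp j z + dTp m i z * dTp n j z + dTp n i z * dTp m j z + Tp i z * ddTp n m j z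
     - 2 * (z $ Inr 1 * pd n (pd m (\<Gamma> i j 1)) (base_part z) + z $ Inr 2 * pd n (pd m (\<Gamma> i j 2)) (base_part z))
     + pd (Inl n) (d\<Psi> m i j) z"
proof -
  show "pd (Inr l) (pd (Inr k) (A i j)) z = T i k (base_part z) * T j l (base_part z) + T i l (base_part z) * T j k (base_part z)"
    by (subst pd_cong_open[OF open_U z pd_A(1)]) (use z in \<open>auto simp: pd_rules pd_T\<close>)
  show mixed: "pd (Inl m) (pd (Inr k) (A i j)) z = dT m i k z * Tp j z + T i k (base_part z) * dTp m j z
      + dTp m i z * T j k (base_part z) + Tp i z * dT m j k z - 2 * pd m (\<Gamma> i j k) (base_part z)"
    by (subst pd_cong_open[OF open_U z pd_A(1)]) (use z in \<open>auto simp: pd_rules pd_T simp del: pd_base(1)\<close>)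
  then show "pd (Inr k) (pd (Inl m) (A i j)) z = dT m i k z * Tp j z + T i k (base_part z) * dTp m j z
      + dTp m i z * T j k (base_part z) + Tp i z * dT m j k z - 2 * pd m (\<Gamma> i j k) (base_part z)"
    by (subst pd_commute[OF open_U z smooth_A])
  show "pd (Inl n) (pd (Inl m) (A i j)) z = ddTp n m i z * Tp j z + dTp m i z * dTp n j z + dTp n i z * dTp m j z + Tp i z * ddTp n m j z
     - 2 * (z $ Inr 1 * pd n (pd m (\<Gamma> i j 1)) (base_part z) + z $ Inr 2 * pd n (pd m (\<Gamma> i j 2)) (base_part z))
     + pd (Inl n) (d\<Psi> m i j) z"
    by (subst pd_cong_open[OF open_U z pd_A(2)]) (use z in \<open>auto simp: pd_rules pd_T pd_dTp\<close>)
qed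


text \<open>A nilpotent 2x2 matrix has the form T_i^k = w_i v^k with v = s (-w2, w1) in the kernel
  of w, and then \<Psi>_ij = \<Phi>(v, v) w_i w_j. The parametrisation includes T = 0 and replaces
  the relation T^2 = 0 by free variables, as polynomial normalisation requires.\<close>

lemma rank_one:
  assumes "x \<in> X"
  obtains w1 w2 s \<psi> where
    "T 1 1 x = - s * w1 * w2" "T 1 2 x = s * w1\<^sup>2" "T 2 1 x = - s * w2\<^sup>2" "T 2 2 x = s * w1 * w2"
    "\<Psi> 1 1 x = \<psi> * w1\<^sup>2" "\<Psi> 1 2 x = \<psi> * w1 * w2" "\<Psi> 2 1 x = \<psi> * w1 * w2" "\<Psi> 2 2 x = \<psi> * w2\<^sup>2"
proof -
  have sq: "T 1 1 x * T 1 1 x + T 1 2 x * T 2 1 x = 0" "T 1 2 x * (T 1 1 x + T 2 2 x) = 0"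
    "T 2 1 x * T 1 2 x + T 2 2 x * T 2 2 x = 0"
    using T_sq[OF assms, of 1 1] T_sq[OF assms, of 1 2] T_sq[OF assms, of 2 2] by (simp_all add: sum_2 algebra_simps)
  \<comment> \<open>If \<open>T 1 2 x\<close> vanishes, so does the diagonal, and w = (0, 1) works;
    otherwise w is normalised by w1 = 1 and s is the entry \<open>T 1 2 x\<close>.\<close>
  obtain w1 w2 s where T: "T 1 1 x = - s * w1 * w2" "T 1 2 x = s * w1\<^sup>2" "T 2 1 x = - s * w2\<^sup>2" "T 2 2 x = s * w1 * w2"
  proof (cases "T 1 2 x = 0")
    case True
    then show ?thesis using sq that[of "- T 2 1 x" 0 1] by simp
  next
    case False
    then have tr: "T 2 2 x = - T 1 1 x" using sq(2) unfolding mult_eq_0_iff by linarith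
    have "T 2 1 x = - (T 1 1 x)\<^sup>2 / T 1 2 x"
      using sq(1) False by (simp add: field_simps power2_eq_square)
    with tr show ?thesis using False that[of "T 1 2 x" 1 "- T 1 1 x / T 1 2 x"]
      by (simp add: power_divide power2_eq_square)
  qed
  have "\<Psi> 1 1 x = s\<^sup>2 * (w2\<^sup>2 * \<Phi> 1 1 x - 2 * w1 * w2 * \<Phi> 1 2 x + w1\<^sup>2 * \<Phi> 2 2 x) * w1\<^sup>2"
    "\<Psi> 1 2 x = s\<^sup>2 * (w2\<^sup>2 * \<Phi> 1 1 x - 2 * w1 * w2 * \<Phi> 1 2 x + w1\<^sup>2 * \<Phi> 2 2 x) * w1 * w2"
    "\<Psi> 2 1 x = s\<^sup>2 * (w2\<^sup>2 * \<Phi> 1 1 x - 2 * w1 * w2 * \<Phi> 1 2 x + w1\<^sup>2 * \<Phi> 2 2 x) * w1 * w2"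
    "\<Psi> 2 2 x = s\<^sup>2 * (w2\<^sup>2 * \<Phi> 1 1 x - 2 * w1 * w2 * \<Phi> 1 2 x + w1\<^sup>2 * \<Phi> 2 2 x) * w2\<^sup>2"
    by (simp_all add: \<Psi>_def sum_2 T sym_\<Phi>[OF assms, of 2 1] power2_eq_square algebra_simps)
  with T show ?thesis by (rule that)
qed

section \<open>Horizontal Ricci curvature of the extension\<close>

context
  fixes z :: "real^(2 + 2)"
  assumes z: "z \<in> U"
begin

lemma base_part_mem: "base_part z \<in> X" using z by (simp add: U_def)

text \<open>Puts lower indices and derivatives into a fixed order, so that jets of \<Gamma> which
  are equal become syntactically equal.\<close>

lemmas symmetric_jets =
  sym_\<Gamma>[OF base_part_mem, of 2 1] pd_sym_\<Gamma>[OF base_part_mem, of _ 2 1] ppd_sym_\<Gamma>[OF base_part_mem, of _ _ 2 1] ppd_commute_\<Gamma>[OF base_part_mem, of 2 1]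

lemmas curvature_A = curvature_walker_mixed[OF open_U z smooth_A]
  curvature_walker_horizontal[OF open_U z smooth_A]
  curvature_walker_horizontal_vertical[OF open_U z smooth_A] levi_civita_walker(7)

lemmas jets_A = ppd_A[OF z] pd_d\<Psi>[OF z] ddTp_def ddT_eq[OF z] pd_A[OF z] fun_cong[OF A_eq, of _ _ z] d\<Psi>_def dTp_def dT_def Tp_def

text \<open>All terms depending on the fibre or on \<Psi> cancel once T is in rank-one form and the
  derivatives of T and \<Psi> are expressed through \<Gamma>.\<close>

lemma ricci_A_horizontal:
  "ricci (levi_civita (walker A)) (Inl j) (Inl k) z = ricci \<Gamma> j k (base_part z) + ricci \<Gamma> k j (base_part z)"
proof -
  obtain w1 w2 s \<psi> where T:
    "T 1 1 (base_part z) = - s * w1 * w2" "T 1 2 (base_part z) = s * w1\<^sup>2"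
    "T 2 1 (base_part z) = - s * w2\<^sup>2" "T 2 2 (base_part z) = s * w1 * w2"
    "\<Psi> 1 1 (base_part z) = \<psi> * w1\<^sup>2" "\<Psi> 1 2 (base_part z) = \<psi> * w1 * w2"
    "\<Psi> 2 1 (base_part z) = \<psi> * w1 * w2" "\<Psi> 2 2 (base_part z) = \<psi> * w2\<^sup>2"
    using rank_one[OF base_part_mem] .
  have "j = 1 \<or> j = 2" "k = 1 \<or> k = 2" using exhaust_2 by auto
  then show ?thesis
    apply (elim disjE; hypsubst)
    apply (simp_all only: ricci_walker(4)[OF open_U z smooth_A] curvature_A sum_2 jets_A T symmetric_jets ricci_def[of \<Gamma>] curvature_def[of \<Gamma>])
    apply (simp_all add: algebra_simps power2_eq_square)
    done
qed

end

end

text \<open>Components of the surface identity R(X,Y)Z = \<rho>(Y,Z)X - \<rho>(X,Z)Y; the curvature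
  of D can be recovered from its Ricci tensor.\<close>

lemma ricci_2:
  "ricci G 1 1 x = - curvature G 1 2 1 2 x" "ricci G 1 2 x = - curvature G 1 2 2 2 x"
  "ricci G 2 1 x = curvature G 1 2 1 1 x" "ricci G 2 2 x = curvature G 1 2 2 1 x"
  for G :: "2 field3"
  by (simp_all add: ricci_def sum_2 curvature_def)

context parallel_chart
begin

text \<open>As \<open>T\<close> is parallel, the curvature endomorphisms commute with \<open>T\<close>; being traceless, they are multiples of \<open>T\<close>.\<close>

lemma curvature_commutes:
  assumes x: "x \<in> X"
  shows "(\<Sum>m\<in>UNIV. curvature \<Gamma> 1 2 i m x * T m k x) = (\<Sum>m\<in>UNIV. T i m x * curvature \<Gamma> 1 2 m k x)"
proof -
  have second: "pd n (pd j (T i k)) x =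
     pd n (\<lambda>x. (\<Sum>m\<in>UNIV. \<Gamma> j i m x * T m k x) - (\<Sum>m\<in>UNIV. T i m x * \<Gamma> j m k x)) x" for n j
    by (rule pd_cong_open[OF open_X x par_T])
  \<comment> \<open>Symmetry of the second derivatives of T, with all first derivatives replaced by
    \<open>par_T\<close>, is exactly the vanishing of the commutator of R(d_1, d_2) with T.\<close>
  have "pd 1 (pd 2 (T i k)) x = pd 2 (pd 1 (T i k)) x"
    by (rule pd_commute[OF open_X x smooth_T])
  then show ?thesis
    unfolding second sum_2 using x
    by (simp add: pd_add pd_diff pd_mult differentiable_add differentiable_diff differentiable_mult
        par_T sum_2 curvature_def algebra_simps)
qed

text \<open>The trace of R(d_1, d_2) equals \<rho>(d_2, d_1) - \<rho>(d_1, d_2), which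
  \<open>ric\<close> makes zero. The factor r is read off at an entry of T known to be
  nonzero.\<close>

lemma curvature_multiple:
  assumes x: "x \<in> X" and T: "\<exists>i k. T i k x \<noteq> 0" and ric: "ricci \<Gamma> 1 2 x = ricci \<Gamma> 2 1 x"
  obtains r where "\<And>i k. curvature \<Gamma> 1 2 i k x = r * T i k x"
proof -
  let ?C = "\<lambda>i k. curvature \<Gamma> 1 2 i k x"
  obtain w1 w2 s where T': "T 1 1 x = - s * w1 * w2" "T 1 2 x = s * w1\<^sup>2" "T 2 1 x = - s * w2\<^sup>2" "T 2 2 x = s * w1 * w2"
    using rank_one[OF x] by metis
  have s: "s \<noteq> 0" and w: "w1 \<noteq> 0 \<or> w2 \<noteq> 0"
    using T T' by (auto; metis (full_types) exhaust_2 T' mult_zero_left mult_zero_right power_zero_numeral minus_zero)+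
  have tr: "?C 2 2 = - ?C 1 1" using ric by (simp add: ricci_2)
  have c: "s * w1 * (w1 * ?C 1 1 + w2 * ?C 1 2) = 0" "s * w2 * (w2 * ?C 1 1 - w1 * ?C 2 1) = 0"
    "s * (w1\<^sup>2 * ?C 2 1 + w2\<^sup>2 * ?C 1 2) = 0"
    using curvature_commutes[OF x, of 1 2] curvature_commutes[OF x, of 2 1] curvature_commutes[OF x, of 1 1]
    by (simp_all add: sum_2 T' tr algebra_simps power2_eq_square)
  show ?thesis
  proof (cases "w1 = 0")
    case True
    then have "?C 1 1 = 0" "?C 1 2 = 0" "?C 2 2 = 0" using c w s tr by auto
    then have "\<forall>i k. ?C i k = - ?C 2 1 / (s * w2\<^sup>2) * T i k x"
      using True s w by (simp add: forall_2 T')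
    then show ?thesis using that by blast
  next
    case False
    have "w1 * ?C 1 1 + w2 * ?C 1 2 = 0" "w1\<^sup>2 * ?C 2 1 + w2\<^sup>2 * ?C 1 2 = 0"
      using c(1,3) False s unfolding mult_eq_0_iff by simp_all
    then have "?C 1 1 = - w2 * ?C 1 2 / w1" "?C 2 1 = - w2\<^sup>2 * ?C 1 2 / w1\<^sup>2"
      using False by (subst nonzero_eq_divide_eq, simp, algebra)+
    then have "\<forall>i k. ?C i k = ?C 1 2 / (s * w1\<^sup>2) * T i k x"
      using False s tr by (simp add: forall_2 T' power2_eq_square)
    then show ?thesis using that by blast
  qed
qed

section \<open>Ricci tensor, scalar curvature and Weyl tensor of the extension\<close>

context
  fixes z :: "real^(2 + 2)"
  assumes z: "z \<in> U"
begin

lemma ricci_A: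
  "ricci (levi_civita (walker A)) (Inl j) (Inl k) z = ricci \<Gamma> j k (base_part z) + ricci \<Gamma> k j (base_part z)"
  "ricci (levi_civita (walker A)) (Inl j) (Inr k) z = 0"
  "ricci (levi_civita (walker A)) (Inr j) (Inl k) z = 0"
  "ricci (levi_civita (walker A)) (Inr j) (Inr k) z = 0"
proof -
  obtain w1 w2 s where T:
    "T 1 1 (base_part z) = - s * w1 * w2" "T 1 2 (base_part z) = s * w1\<^sup>2"
    "T 2 1 (base_part z) = - s * w2\<^sup>2" "T 2 2 (base_part z) = s * w1 * w2"
    using rank_one[OF base_part_mem[OF z]] by metis
  have "j = 1 \<or> j = 2" "k = 1 \<or> k = 2" using exhaust_2 by auto
  then show "ricci (levi_civita (walker A)) (Inl j) (Inr k) z = 0"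
    "ricci (levi_civita (walker A)) (Inr j) (Inl k) z = 0"
    by (auto simp: ricci_walker[OF open_U z smooth_A] sum_2 ppd_A[OF z] T algebra_simps power2_eq_square)
qed (simp_all add: ricci_A_horizontal[OF z] ricci_walker(1)[OF open_U z smooth_A])

text \<open>The Ricci tensor lives on the \<open>Inl\<close> block, where the inverse metric is
  zero. Hence the Weyl tensor carries no scalar curvature term.\<close>

lemma scalar_curvature_A: "scalar_curvature (walker A) z = 0"
  by (simp add: scalar_curvature_def sum_UNIV_Plus ricci_A ginv_walker)

lemma weyl_A:
  "weyl (walker A) a b c d z = riemann (walker A) a b c d z
    - (walker A a d z * ricci (levi_civita (walker A)) b c z - walker A a c z * ricci (levi_civita (walker A)) b d z
     + ricci (levi_civita (walker A)) a d z * walker A b c z - ricci (levi_civita (walker A)) a c z * walker A b d z) / 2"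
  by (simp add: weyl_def scalar_curvature_A Let_def)

lemma riemann_A:
  "riemann (walker A) a b c (Inr k) z = curvature (levi_civita (walker A)) a b c (Inl k) z"
  "riemann (walker A) a b c (Inl k) z = curvature (levi_civita (walker A)) a b c (Inl 1) z * A 1 k z
     + curvature (levi_civita (walker A)) a b c (Inl 2) z * A 2 k z + curvature (levi_civita (walker A)) a b c (Inr k) z"
  using exhaust_2[of k] by (auto simp: riemann_def sum_UNIV_Plus sum_2 if_mult_real)

lemma weyl_A_vertical: "weyl (walker A) (Inr i) (Inr j) c d z = 0"
  by (cases c; cases d) (simp_all add: weyl_A riemann_A ricci_A curvature_walker_vertical[OF open_U z smooth_A])

end


text \<open>The component along d_k of (D_1 R)(d_1, d_2) d_2 - (D_2 R)(d_1, d_2) d_1; the terms that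
  differentiate the third argument cancel by torsion-freeness, and the trace terms come from the
  first two slots. For symmetric \<rho> this is, up to sign and exchange of the index k, the Codazzi
  defect (D_1 \<rho>)(d_2, .) - (D_2 \<rho>)(d_1, .).\<close>

definition codazzi where
  "codazzi k x = pd 1 (curvature \<Gamma> 1 2 2 k) x - pd 2 (curvature \<Gamma> 1 2 1 k) x
     + (\<Sum>m\<in>UNIV. \<Gamma> 1 m k x * curvature \<Gamma> 1 2 2 m x - \<Gamma> 2 m k x * curvature \<Gamma> 1 2 1 m x)
     - (\<Gamma> 1 1 1 x + \<Gamma> 1 2 2 x) * curvature \<Gamma> 1 2 2 k x
     + (\<Gamma> 1 2 1 x + \<Gamma> 2 2 2 x) * curvature \<Gamma> 1 2 1 k x"

lemma pd_curvature:
  "x \<in> X \<Longrightarrow> pd n (curvature \<Gamma> i j k l) x = pd n (pd i (\<Gamma> j k l)) x - pd n (pd j (\<Gamma> i k l)) x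
     + (\<Sum>m\<in>UNIV. \<Gamma> j k m x * pd n (\<Gamma> i m l) x + pd n (\<Gamma> j k m) x * \<Gamma> i m l x
         - (\<Gamma> i k m x * pd n (\<Gamma> j m l) x + pd n (\<Gamma> i k m) x * \<Gamma> j m l x))"
  unfolding curvature_def[abs_def] sum_2
  by (simp add: pd_add pd_diff pd_mult differentiable_add differentiable_diff differentiable_mult)

section \<open>Mixed Weyl components at a point\<close>

context
  fixes z :: "real^(2 + 2)"
  assumes z: "z \<in> U"
begin

context
  fixes w1 w2 s \<psi> r :: real
  assumes T:
    "T 1 1 (base_part z) = - s * w1 * w2" "T 1 2 (base_part z) = s * w1\<^sup>2"
    "T 2 1 (base_part z) = - s * w2\<^sup>2" "T 2 2 (base_part z) = s * w1 * w2"
    "\<Psi> 1 1 (base_part z) = \<psi> * w1\<^sup>2" "\<Psi> 1 2 (base_part z) = \<psi> * w1 * w2"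
    "\<Psi> 2 1 (base_part z) = \<psi> * w1 * w2" "\<Psi> 2 2 (base_part z) = \<psi> * w2\<^sup>2"
    and r: "\<And>i k. curvature \<Gamma> 1 2 i k (base_part z) = r * T i k (base_part z)"
begin

text \<open>R = r T solved for derivatives of \<Gamma> in direction 1, so that the relation is used
  by plain substitution in polynomial identities.\<close>

lemma curvature_jets:
  fixes G defines "G \<equiv> \<lambda>i j k. \<Gamma> i j k (base_part z)"
  shows "pd 1 (\<Gamma> 1 2 k) (base_part z) = pd 2 (\<Gamma> 1 1 k) (base_part z) + r * T 1 k (base_part z)
       - (G 1 2 1 * G 1 1 k + G 1 2 2 * G 1 2 k - G 1 1 1 * G 1 2 k - G 1 1 2 * G 2 2 k)"
    "pd 1 (\<Gamma> 2 2 k) (base_part z) = pd 2 (\<Gamma> 1 2 k) (base_part z) + r * T 2 k (base_part z)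
       - (G 2 2 1 * G 1 1 k + G 2 2 2 * G 1 2 k - G 1 2 1 * G 1 2 k - G 1 2 2 * G 2 2 k)"
  using r[of 1 k] r[of 2 k] by (simp_all add: G_def curvature_def sum_2 symmetric_jets[OF z] algebra_simps)

lemmas ricci_values = ricci_2[of \<Gamma> "base_part z", unfolded r T]

lemmas weyl_expand = weyl_A[OF z] riemann_A[OF z] curvature_A[OF z] ricci_A[OF z] ricci_values
  walker_simps sum_2 jets_A[OF z] T symmetric_jets[OF z] curvature_jets

text \<open>Equals (A_2k T_1^k - A_1k T_2^k) / 2, a skew contraction of the metric block with T.
  Through it alone A enters the mixed Weyl components below.\<close>

definition q where "q = s * (A 1 1 z * w2\<^sup>2 - 2 * A 1 2 z * w1 * w2 + A 2 2 z * w1\<^sup>2) / 2"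

lemma T_rank_one: "T i l (base_part z) * T k j (base_part z) = T i j (base_part z) * T k l (base_part z)"
proof -
  have "\<forall>i j k l. T i l (base_part z) * T k j (base_part z) = T i j (base_part z) * T k l (base_part z)"
    by (simp add: forall_2 T power2_eq_square)
  then show ?thesis by blast
qed

text \<open>Only the part of A that is quadratic in the fibre has second vertical derivatives; the
  rank-one identity makes their symmetrised product a single one.\<close>

lemma weyl_mixed_mixed:
  "weyl (walker A) (Inl i) (Inr j) (Inl k) (Inr l) z = T i j (base_part z) * T k l (base_part z)"
  "weyl (walker A) (Inl i) (Inr j) (Inr l) (Inl k) z = - (T i j (base_part z) * T k l (base_part z))"
  "weyl (walker A) (Inl i) (Inr j) (Inr k) (Inr l) z = 0"
  by (simp_all add: weyl_A[OF z] riemann_A[OF z] curvature_walker_mixed[OF open_U z smooth_A] ricci_A[OF z]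
      ppd_A(1)[OF z] T_rank_one[of i l k j])

text \<open>Here and in the next lemmas the index pairs are treated one at a time, which keeps each
  polynomial identity small.\<close>

lemma weyl_mixed_horizontal_11:
  "weyl (walker A) (Inl i) (Inr j) (Inl 1) (Inl 1) z = 0"
  using exhaust_2[of i] exhaust_2[of j]
  apply (elim disjE; hypsubst)
  apply (simp_all only: weyl_expand q_def)
  apply (simp_all add: algebra_simps power2_eq_square add_divide_distrib diff_divide_distrib)
  done

lemma weyl_mixed_horizontal_12:
  "weyl (walker A) (Inl i) (Inr j) (Inl 1) (Inl 2) z = T i j (base_part z) * q"
  using exhaust_2[of i] exhaust_2[of j]
  apply (elim disjE; hypsubst)
  apply (simp_all only: weyl_expand q_def)
  apply (simp_all add: algebra_simps power2_eq_square add_divide_distrib diff_divide_distrib)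
  done

lemma weyl_mixed_horizontal_21:
  "weyl (walker A) (Inl i) (Inr j) (Inl 2) (Inl 1) z = - (T i j (base_part z) * q)"
  using exhaust_2[of i] exhaust_2[of j]
  apply (elim disjE; hypsubst)
  apply (simp_all only: weyl_expand q_def)
  apply (simp_all add: algebra_simps power2_eq_square add_divide_distrib diff_divide_distrib)
  done

lemma weyl_mixed_horizontal_22:
  "weyl (walker A) (Inl i) (Inr j) (Inl 2) (Inl 2) z = 0"
  using exhaust_2[of i] exhaust_2[of j]
  apply (elim disjE; hypsubst)
  apply (simp_all only: weyl_expand q_def)
  apply (simp_all add: algebra_simps power2_eq_square add_divide_distrib diff_divide_distrib)
  done

lemma weyl_horizontal_mixed:
  "weyl (walker A) (Inl 1) (Inl 2) (Inl k) (Inr l) z = T k l (base_part z) * q"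
  using exhaust_2[of k] exhaust_2[of l]
  apply (elim disjE; hypsubst)
  apply (simp_all only: weyl_expand q_def)
  apply (simp_all add: algebra_simps power2_eq_square add_divide_distrib diff_divide_distrib)
  done

lemma weyl_horizontal_mixed':
  "weyl (walker A) (Inl 1) (Inl 2) (Inr l) (Inl k) z = - (T k l (base_part z) * q)"
  using exhaust_2[of k] exhaust_2[of l]
  apply (elim disjE; hypsubst)
  apply (simp_all only: weyl_expand q_def)
  apply (simp_all add: algebra_simps power2_eq_square add_divide_distrib diff_divide_distrib)
  done

lemma weyl_horizontal_vertical: "weyl (walker A) (Inl 1) (Inl 2) (Inr k) (Inr l) z = 0"
  by (simp add: weyl_A[OF z] riemann_A[OF z] curvature_walker_horizontal[OF open_U z smooth_A] ricci_A[OF z])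

end
end

section \<open>The all-horizontal Weyl components\<close>

context
  fixes z :: "real^(2 + 2)"
  assumes z: "z \<in> U"
begin

lemma A_sym: "y \<in> U \<Longrightarrow> A i j y = A j i y"
  by (simp add: A_eq U_def sym_\<Gamma>[of "base_part y" i j] \<Psi>_def sum_2 sym_\<Phi>[of "base_part y" 2 1] algebra_simps)

lemma pd_A_sym: "y \<in> U \<Longrightarrow> pd a (A i j) y = pd a (A j i) y"
  by (rule pd_cong_open[OF open_U _ A_sym])

lemma ppd_A_sym: "pd b (pd a (A i j)) z = pd b (pd a (A j i)) z"
  by (rule pd_cong_open[OF open_U z pd_A_sym])

lemmas A_symmetric = A_sym[OF z, of 2 1] pd_A_sym[OF z, of _ 2 1] ppd_A_sym[of _ _ 2 1]
  pd_commute[OF open_U z smooth_A, of "Inl 2" "Inl 1"]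

lemmas curvature_horizontal = curvature_walker_horizontal[OF open_U z smooth_A]
  curvature_walker_horizontal_vertical[OF open_U z smooth_A] levi_civita_walker(7)

lemma riemann_A_1211: "riemann (walker A) (Inl 1) (Inl 2) (Inl 1) (Inl 1) z = 0"
  by (simp only: riemann_A[OF z] curvature_horizontal sum_2 A_symmetric) (simp add: algebra_simps)

lemma riemann_A_1222: "riemann (walker A) (Inl 1) (Inl 2) (Inl 2) (Inl 2) z = 0"
  by (simp only: riemann_A[OF z] curvature_horizontal sum_2 A_symmetric) (simp add: algebra_simps)

text \<open>\<open>F\<close> is the Christoffel symbol of the first kind built from horizontal
  derivatives of A. Stated for abstract jets of A, so that the cancellations by symmetry of A happen
  before anything is expanded in \<Gamma> and T.\<close>

lemma riemann_A_1212:
  fixes F defines "F \<equiv> \<lambda>i j k. (pd (Inl i) (A j k) z + pd (Inl j) (A i k) z - pd (Inl k) (A i j) z) / 2"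
  shows "riemann (walker A) (Inl 1) (Inl 2) (Inl 1) (Inl 2) z =
    (pd (Inl 1) (pd (Inl 1) (A 2 2)) z + pd (Inl 2) (pd (Inl 2) (A 1 1)) z) / 2 - pd (Inl 1) (pd (Inl 2) (A 1 2)) z
    + (\<Sum>m\<in>UNIV. F 1 2 m * pd (Inr m) (A 1 2) z - (F 2 2 m * pd (Inr m) (A 1 1) z + F 1 1 m * pd (Inr m) (A 2 2) z) / 2)
    + (\<Sum>m\<in>UNIV. \<Sum>n\<in>UNIV. A m n z * (pd (Inr n) (A 1 2) z * pd (Inr m) (A 1 2) z - pd (Inr n) (A 1 1) z * pd (Inr m) (A 2 2) z)) / 4"
  unfolding F_def
  by (simp only: riemann_A[OF z] curvature_horizontal sum_2 A_symmetric)
    (simp add: algebra_simps add_divide_distrib diff_divide_distrib)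

lemma riemann_A_1221:
  "riemann (walker A) (Inl 1) (Inl 2) (Inl 2) (Inl 1) z = - riemann (walker A) (Inl 1) (Inl 2) (Inl 1) (Inl 2) z"
  unfolding riemann_A_1212
  by (simp only: riemann_A[OF z] curvature_horizontal sum_2 A_symmetric)
    (simp add: algebra_simps add_divide_distrib diff_divide_distrib)

context
  fixes w1 w2 s \<psi> r :: real
  assumes T:
    "T 1 1 (base_part z) = - s * w1 * w2" "T 1 2 (base_part z) = s * w1\<^sup>2"
    "T 2 1 (base_part z) = - s * w2\<^sup>2" "T 2 2 (base_part z) = s * w1 * w2"
    "\<Psi> 1 1 (base_part z) = \<psi> * w1\<^sup>2" "\<Psi> 1 2 (base_part z) = \<psi> * w1 * w2"
    "\<Psi> 2 1 (base_part z) = \<psi> * w1 * w2" "\<Psi> 2 2 (base_part z) = \<psi> * w2\<^sup>2"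
    and r: "\<And>i k. curvature \<Gamma> 1 2 i k (base_part z) = r * T i k (base_part z)"
begin

lemmas ricci_values' = ricci_values[OF z T r]

lemma weyl_horizontal_11: "weyl (walker A) (Inl 1) (Inl 2) (Inl 1) (Inl 1) z = 0"
  by (simp add: weyl_A[OF z] riemann_A_1211 A_symmetric ricci_A[OF z] ricci_values')

lemma weyl_horizontal_22: "weyl (walker A) (Inl 1) (Inl 2) (Inl 2) (Inl 2) z = 0"
  by (simp add: weyl_A[OF z] riemann_A_1222 A_symmetric ricci_A[OF z] ricci_values')

text \<open>Second derivatives of \<Gamma> occur only in all-horizontal components; here the term of
  A that is linear in the fibre collects them into the Codazzi tensor. The term q^2 is the one that
  self-duality compensates later.\<close>

lemma weyl_horizontal_12: "weyl (walker A) (Inl 1) (Inl 2) (Inl 1) (Inl 2) z =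
   (q z w1 w2 s)\<^sup>2 - (z $ Inr 1 * codazzi 1 (base_part z) + z $ Inr 2 * codazzi 2 (base_part z))"
proof -
  \<comment> \<open>The abbreviations are contractions: T_i^k = w_i v^k, \<tau> = p(v), the g terms
    contract \<Gamma> with w, the gam terms with p, and the pi and dd terms contract p with first
    and second derivatives of \<Gamma>.\<close>
  define G where "G i j k = \<Gamma> i j k (base_part z)" for i j k
  define p1 where "p1 = z $ Inr 1"
  define p2 where "p2 = z $ Inr 2"
  define v1 where "v1 = - s * w2"
  define v2 where "v2 = s * w1"
  define \<tau> where "\<tau> = p1 * v1 + p2 * v2"
  define g11 where "g11 = G 1 1 1 * w1 + G 1 1 2 * w2"
  define gam11 where "gam11 = p1 * G 1 1 1 + p2 * G 1 1 2"
  define g12 where "g12 = G 1 2 1 * w1 + G 1 2 2 * w2"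
  define gam12 where "gam12 = p1 * G 1 2 1 + p2 * G 1 2 2"
  define g22 where "g22 = G 2 2 1 * w1 + G 2 2 2 * w2"
  define gam22 where "gam22 = p1 * G 2 2 1 + p2 * G 2 2 2"
  define pi111 where "pi111 = p1 * pd 1 (\<Gamma> 1 1 1) (base_part z) + p2 * pd 1 (\<Gamma> 1 1 2) (base_part z)"
  define pi112 where "pi112 = p1 * pd 1 (\<Gamma> 1 2 1) (base_part z) + p2 * pd 1 (\<Gamma> 1 2 2) (base_part z)"
  define pi122 where "pi122 = p1 * pd 1 (\<Gamma> 2 2 1) (base_part z) + p2 * pd 1 (\<Gamma> 2 2 2) (base_part z)"
  define pi211 where "pi211 = p1 * pd 2 (\<Gamma> 1 1 1) (base_part z) + p2 * pd 2 (\<Gamma> 1 1 2) (base_part z)"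
  define pi212 where "pi212 = p1 * pd 2 (\<Gamma> 1 2 1) (base_part z) + p2 * pd 2 (\<Gamma> 1 2 2) (base_part z)"
  define pi222 where "pi222 = p1 * pd 2 (\<Gamma> 2 2 1) (base_part z) + p2 * pd 2 (\<Gamma> 2 2 2) (base_part z)"
  define dd1122 where "dd1122 = p1 * pd 1 (pd 1 (\<Gamma> 2 2 1)) (base_part z) + p2 * pd 1 (pd 1 (\<Gamma> 2 2 2)) (base_part z)"
  define dd2211 where "dd2211 = p1 * pd 2 (pd 2 (\<Gamma> 1 1 1)) (base_part z) + p2 * pd 2 (pd 2 (\<Gamma> 1 1 2)) (base_part z)"
  define dd1212 where "dd1212 = p1 * pd 1 (pd 2 (\<Gamma> 1 2 1)) (base_part z) + p2 * pd 1 (pd 2 (\<Gamma> 1 2 2)) (base_part z)"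
  \<comment> \<open>Although w and v are values at one point, the bookkeeping treats them as a
    parallel one-form and vector: the derivative of w_j in direction i is g_ij, that of \<tau> is
    -N_i. \<open>Dg\<close> and \<open>DN\<close> are the resulting derivatives of g and N, the
    first index being the direction.\<close>
  define N1 where "N1 = p1 * v1 * G 1 1 1 + p2 * v1 * G 1 1 2 + p1 * v2 * G 1 2 1 + p2 * v2 * G 1 2 2"
  define N2 where "N2 = p1 * v1 * G 1 2 1 + p2 * v1 * G 1 2 2 + p1 * v2 * G 2 2 1 + p2 * v2 * G 2 2 2"
  define Dg112 where "Dg112 = pd 1 (\<Gamma> 1 2 1) (base_part z) * w1 + G 1 2 1 * g11 + pd 1 (\<Gamma> 1 2 2) (base_part z) * w2 + G 1 2 2 * g12"
  define Dg212 where "Dg212 = pd 2 (\<Gamma> 1 2 1) (base_part z) * w1 + G 1 2 1 * g12 + pd 2 (\<Gamma> 1 2 2) (base_part z) * w2 + G 1 2 2 * g22"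
  define Dg122 where "Dg122 = pd 1 (\<Gamma> 2 2 1) (base_part z) * w1 + G 2 2 1 * g11 + pd 1 (\<Gamma> 2 2 2) (base_part z) * w2 + G 2 2 2 * g12"
  define Dg211 where "Dg211 = pd 2 (\<Gamma> 1 1 1) (base_part z) * w1 + G 1 1 1 * g12 + pd 2 (\<Gamma> 1 1 2) (base_part z) * w2 + G 1 1 2 * g22"
  define DN11 where "DN11 = p1 * (v1 * pd 1 (\<Gamma> 1 1 1) (base_part z) - (G 1 1 1 * v1 + G 1 2 1 * v2) * G 1 1 1) + p2 * (v1 * pd 1 (\<Gamma> 1 1 2) (base_part z) - (G 1 1 1 * v1 + G 1 2 1 * v2) * G 1 1 2) + p1 * (v2 * pd 1 (\<Gamma> 1 2 1) (base_part z) - (G 1 1 2 * v1 + G 1 2 2 * v2) * G 1 2 1) + p2 * (v2 * pd 1 (\<Gamma> 1 2 2) (base_part z) - (G 1 1 2 * v1 + G 1 2 2 * v2) * G 1 2 2)"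
  define DN22 where "DN22 = p1 * (v1 * pd 2 (\<Gamma> 1 2 1) (base_part z) - (G 1 2 1 * v1 + G 2 2 1 * v2) * G 1 2 1) + p2 * (v1 * pd 2 (\<Gamma> 1 2 2) (base_part z) - (G 1 2 1 * v1 + G 2 2 1 * v2) * G 1 2 2) + p1 * (v2 * pd 2 (\<Gamma> 2 2 1) (base_part z) - (G 1 2 2 * v1 + G 2 2 2 * v2) * G 2 2 1) + p2 * (v2 * pd 2 (\<Gamma> 2 2 2) (base_part z) - (G 1 2 2 * v1 + G 2 2 2 * v2) * G 2 2 2)"
  define DN12 where "DN12 = p1 * (v1 * pd 1 (\<Gamma> 1 2 1) (base_part z) - (G 1 1 1 * v1 + G 1 2 1 * v2) * G 1 2 1) + p2 * (v1 * pd 1 (\<Gamma> 1 2 2) (base_part z) - (G 1 1 1 * v1 + G 1 2 1 * v2) * G 1 2 2) + p1 * (v2 * pd 1 (\<Gamma> 2 2 1) (base_part z) - (G 1 1 2 * v1 + G 1 2 2 * v2) * G 2 2 1) + p2 * (v2 * pd 1 (\<Gamma> 2 2 2) (base_part z) - (G 1 1 2 * v1 + G 1 2 2 * v2) * G 2 2 2)"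
  note atoms = G_def p1_def p2_def v1_def v2_def \<tau>_def g11_def gam11_def g12_def gam12_def g22_def gam22_def pi111_def pi112_def pi122_def pi211_def pi212_def pi222_def dd1122_def dd2211_def dd1212_def N1_def N2_def Dg112_def Dg212_def Dg122_def Dg211_def DN11_def DN22_def DN12_def
  \<comment> \<open>With this \<kappa> the block is A_ij = \<kappa> w_i w_j - 2 gam_ij. Since \<psi>
    behaves like a constant, only \<tau> contributes when \<kappa> is differentiated.\<close>
  define \<kappa> where "\<kappa> = \<tau> * \<tau> + \<psi>"
  have T': "T 1 1 (base_part z) = w1 * v1" "T 1 2 (base_part z) = w1 * v2" "T 2 1 (base_part z) = w2 * v1" "T 2 2 (base_part z) = w2 * v2"
    by (simp_all add: T v1_def v2_def power2_eq_square)
  have \<Psi>': "\<Psi> 1 1 (base_part z) = \<psi> * w1 * w1" "\<Psi> 1 2 (base_part z) = \<psi> * w1 * w2" "\<Psi> 2 1 (base_part z) = \<psi> * w2 * w1" "\<Psi> 2 2 (base_part z) = \<psi> * w2 * w2"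
    by (simp_all add: T power2_eq_square)
  have Tp: "Tp 1 z = \<tau> * w1" "Tp 2 z = \<tau> * w2"
    by (simp_all add: Tp_def T' \<tau>_def p1_def p2_def algebra_simps)
  have dTp: "dTp 1 1 z = \<tau> * g11 - w1 * N1"
    "dTp 1 2 z = \<tau> * g12 - w2 * N1"
    "dTp 2 1 z = \<tau> * g12 - w1 * N2"
    "dTp 2 2 z = \<tau> * g22 - w2 * N2"
    by (simp_all add: dTp_def dT_def T' symmetric_jets[OF z] atoms algebra_simps)
  have ddTp: "ddTp 1 1 2 z = \<tau> * Dg112 - N1 * g12 - N1 * g12 - w2 * DN11"
    "ddTp 2 2 1 z = \<tau> * Dg212 - N2 * g12 - N2 * g12 - w1 * DN22"
    "ddTp 1 2 1 z = \<tau> * Dg112 - N1 * g12 - N2 * g11 - w1 * DN12"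
    "ddTp 1 2 2 z = \<tau> * Dg122 - N1 * g22 - N2 * g12 - w2 * DN12"
    by (simp_all add: ddTp_def ddT_eq[OF z] dT_def T' symmetric_jets[OF z] atoms algebra_simps)
  have d\<Psi>': "d\<Psi> 1 1 1 z = \<psi> * (g11 * w1 + w1 * g11)"
    "d\<Psi> 1 1 2 z = \<psi> * (g11 * w2 + w1 * g12)"
    "d\<Psi> 1 2 2 z = \<psi> * (g12 * w2 + w2 * g12)"
    "d\<Psi> 2 1 1 z = \<psi> * (g12 * w1 + w1 * g12)"
    "d\<Psi> 2 1 2 z = \<psi> * (g12 * w2 + w1 * g22)"
    "d\<Psi> 2 2 2 z = \<psi> * (g22 * w2 + w2 * g22)"
    by (simp_all add: d\<Psi>_def \<Psi>' symmetric_jets[OF z] atoms algebra_simps)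
  have dd\<Psi>: "pd (Inl 1) (d\<Psi> 1 2 2) z = \<psi> * (Dg112 * w2 + g12 * g12 + g12 * g12 + w2 * Dg112)"
    "pd (Inl 2) (d\<Psi> 2 1 1) z = \<psi> * (Dg212 * w1 + g12 * g12 + g12 * g12 + w1 * Dg212)"
    "pd (Inl 1) (d\<Psi> 2 1 2) z = \<psi> * (Dg112 * w2 + g12 * g12 + g11 * g22 + w1 * Dg122)"
    by (simp_all add: pd_d\<Psi>[OF z] d\<Psi>_def \<Psi>' symmetric_jets[OF z] atoms algebra_simps)
  have A0: "A 1 1 z = \<kappa> * w1 * w1 - 2 * gam11"
    "A 1 2 z = \<kappa> * w1 * w2 - 2 * gam12"
    "A 2 2 z = \<kappa> * w2 * w2 - 2 * gam22"
    by (simp_all add: fun_cong[OF A_eq, of _ _ z] Tp \<Psi>' \<kappa>_def gam11_def gam12_def gam22_def G_def p1_def p2_def algebra_simps)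
  have Ap: "pd (Inr 1) (A 1 1) z = 2 * \<tau> * v1 * w1 * w1 - 2 * G 1 1 1"
    "pd (Inr 1) (A 1 2) z = 2 * \<tau> * v1 * w1 * w2 - 2 * G 1 2 1"
    "pd (Inr 1) (A 2 2) z = 2 * \<tau> * v1 * w2 * w2 - 2 * G 2 2 1"
    "pd (Inr 2) (A 1 1) z = 2 * \<tau> * v2 * w1 * w1 - 2 * G 1 1 2"
    "pd (Inr 2) (A 1 2) z = 2 * \<tau> * v2 * w1 * w2 - 2 * G 1 2 2"
    "pd (Inr 2) (A 2 2) z = 2 * \<tau> * v2 * w2 * w2 - 2 * G 2 2 2"
    by (simp_all add: pd_A[OF z] T' Tp G_def)
  have dA: "pd (Inl 1) (A 1 1) z = \<kappa> * (g11 * w1 + w1 * g11) - 2 * \<tau> * N1 * w1 * w1 - 2 * pi111"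
    "pd (Inl 1) (A 1 2) z = \<kappa> * (g11 * w2 + w1 * g12) - 2 * \<tau> * N1 * w1 * w2 - 2 * pi112"
    "pd (Inl 1) (A 2 2) z = \<kappa> * (g12 * w2 + w2 * g12) - 2 * \<tau> * N1 * w2 * w2 - 2 * pi122"
    "pd (Inl 2) (A 1 1) z = \<kappa> * (g12 * w1 + w1 * g12) - 2 * \<tau> * N2 * w1 * w1 - 2 * pi211"
    "pd (Inl 2) (A 1 2) z = \<kappa> * (g12 * w2 + w1 * g22) - 2 * \<tau> * N2 * w1 * w2 - 2 * pi212"
    "pd (Inl 2) (A 2 2) z = \<kappa> * (g22 * w2 + w2 * g22) - 2 * \<tau> * N2 * w2 * w2 - 2 * pi222"
    by (simp_all add: pd_A[OF z] Tp dTp d\<Psi>' \<kappa>_def pi111_def pi112_def pi122_def pi211_def pi212_def pi222_def p1_def p2_def algebra_simps)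
  have ddA: "pd (Inl 1) (pd (Inl 1) (A 2 2)) z = \<kappa> * (Dg112 * w2 + g12 * g12 + g12 * g12 + w2 * Dg112) - 2 * \<tau> * N1 * (g12 * w2 + w2 * g12) + 2 * N1 * N1 * w2 * w2 - 2 * \<tau> * DN11 * w2 * w2 - 2 * \<tau> * N1 * (g12 * w2 + w2 * g12) - 2 * dd1122"
    "pd (Inl 2) (pd (Inl 2) (A 1 1)) z = \<kappa> * (Dg212 * w1 + g12 * g12 + g12 * g12 + w1 * Dg212) - 2 * \<tau> * N2 * (g12 * w1 + w1 * g12) + 2 * N2 * N2 * w1 * w1 - 2 * \<tau> * DN22 * w1 * w1 - 2 * \<tau> * N2 * (g12 * w1 + w1 * g12) - 2 * dd2211"
    "pd (Inl 1) (pd (Inl 2) (A 1 2)) z = \<kappa> * (Dg112 * w2 + g12 * g12 + g11 * g22 + w1 * Dg122) - 2 * \<tau> * N1 * (g12 * w2 + w1 * g22) + 2 * N1 * N2 * w1 * w2 - 2 * \<tau> * DN12 * w1 * w2 - 2 * \<tau> * N2 * (g11 * w2 + w1 * g12) - 2 * dd1212"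
    by (simp_all add: ppd_A[OF z] Tp dTp ddTp dd\<Psi> \<kappa>_def dd1122_def dd2211_def dd1212_def p1_def p2_def algebra_simps)
  \<comment> \<open>\<open>K\<close>, \<open>L\<close>, \<open>M\<close> and \<open>R0\<close> are
    the coefficients of \<kappa> \<tau>, \<kappa>, \<tau> and 1 in twice the Riemann component. The
    first three vanish separately, so that each is expanded into raw jets on its own.\<close>
  define K where "K =
       2 * G 1 1 1 * v1 * w1 * w1 * w2 * w2 + 2 * G 1 1 1 * v2 * w1 * w2 * w2 * w2 + 2 * G 1 1 2 * v1 * w1 * w2 * w2 * w2
       + 2 * G 1 1 2 * v2 * w2 * w2 * w2 * w2 - 4 * G 1 2 1 * v1 * w1 * w1 * w1 * w2 - 4 * G 1 2 1 * v2 * w1 * w1 * w2 * w2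
       - 4 * G 1 2 2 * v1 * w1 * w1 * w2 * w2 - 4 * G 1 2 2 * v2 * w1 * w2 * w2 * w2 + 2 * G 2 2 1 * v1 * w1 * w1 * w1 * w1
       + 2 * G 2 2 1 * v2 * w1 * w1 * w1 * w2 + 2 * G 2 2 2 * v1 * w1 * w1 * w1 * w2 + 2 * G 2 2 2 * v2 * w1 * w1 * w2 * w2
       - 2 * v1 * g11 * w1 * w2 * w2 + 4 * v1 * g12 * w1 * w1 * w2 - 2 * v1 * g22 * w1 * w1 * w1 - 2 * v2 * g11 * w2 * w2 * w2
       + 4 * v2 * g12 * w1 * w2 * w2 - 2 * v2 * g22 * w1 * w1 * w2"
  define L where "L =
       - 2 * Dg122 * w1 + 2 * Dg212 * w1 - 2 * G 1 1 1 * G 2 2 1 * w1 * w1 - 2 * G 1 1 1 * G 2 2 2 * w1 * w2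
       + 2 * G 1 1 1 * g22 * w1 - 2 * G 1 1 2 * G 2 2 1 * w1 * w2 - 2 * G 1 1 2 * G 2 2 2 * w2 * w2
       + 2 * G 1 1 2 * g22 * w2 + 2 * G 1 2 1 * G 1 2 1 * w1 * w1 + 4 * G 1 2 1 * G 1 2 2 * w1 * w2
       - 4 * G 1 2 1 * g12 * w1 + 2 * G 1 2 2 * G 1 2 2 * w2 * w2 - 4 * G 1 2 2 * g12 * w2 + 2 * G 2 2 1 * g11 * w1
       + 2 * G 2 2 2 * g11 * w2 - 2 * g11 * g22 + 2 * g12 * g12"
  define M where "M =
       - 2 * DN11 * w2 * w2 + 4 * DN12 * w1 * w2 - 2 * DN22 * w1 * w1 + 2 * G 1 1 1 * N1 * w2 * w2
       - 4 * G 1 1 1 * N2 * w1 * w2 - 4 * G 1 1 1 * v1 * gam11 * w2 * w2 - 4 * G 1 1 1 * v2 * gam12 * w2 * w2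
       - 2 * G 1 1 2 * N2 * w2 * w2 - 4 * G 1 1 2 * v1 * gam12 * w2 * w2 - 4 * G 1 1 2 * v2 * gam22 * w2 * w2
       + 4 * G 1 2 1 * N2 * w1 * w1 + 8 * G 1 2 1 * v1 * gam11 * w1 * w2 + 8 * G 1 2 1 * v2 * gam12 * w1 * w2
       + 4 * G 1 2 2 * N1 * w2 * w2 + 8 * G 1 2 2 * v1 * gam12 * w1 * w2 + 8 * G 1 2 2 * v2 * gam22 * w1 * w2
       - 2 * G 2 2 1 * N1 * w1 * w1 - 4 * G 2 2 1 * v1 * gam11 * w1 * w1 - 4 * G 2 2 1 * v2 * gam12 * w1 * w1
       - 4 * G 2 2 2 * N1 * w1 * w2 + 2 * G 2 2 2 * N2 * w1 * w1 - 4 * G 2 2 2 * v1 * gam12 * w1 * w1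
       - 4 * G 2 2 2 * v2 * gam22 * w1 * w1 - 4 * N1 * g12 * w2 + 4 * N1 * g22 * w1 + 4 * N2 * g11 * w2
       - 4 * N2 * g12 * w1 + 2 * v1 * pi111 * w2 * w2 - 2 * v1 * pi122 * w1 * w1 - 4 * v1 * pi211 * w1 * w2
       + 4 * v1 * pi212 * w1 * w1 + 4 * v2 * pi112 * w2 * w2 - 4 * v2 * pi122 * w1 * w2 - 2 * v2 * pi211 * w2 * w2
       + 2 * v2 * pi222 * w1 * w1"
  define R0 where "R0 =
       4 * G 1 1 1 * G 2 2 1 * gam11 + 4 * G 1 1 1 * G 2 2 2 * gam12 + 2 * G 1 1 1 * pi122 - 4 * G 1 1 1 * pi212
       + 4 * G 1 1 2 * G 2 2 1 * gam12 + 4 * G 1 1 2 * G 2 2 2 * gam22 - 2 * G 1 1 2 * pi222 - 4 * G 1 2 1 * G 1 2 1 * gam11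
       - 8 * G 1 2 1 * G 1 2 2 * gam12 + 4 * G 1 2 1 * pi211 - 4 * G 1 2 2 * G 1 2 2 * gam22 + 4 * G 1 2 2 * pi122
       - 2 * G 2 2 1 * pi111 - 4 * G 2 2 2 * pi112 + 2 * G 2 2 2 * pi211 + 2 * N1 * N1 * w2 * w2 - 4 * N1 * N2 * w1 * w2
       + 2 * N2 * N2 * w1 * w1 - 2 * dd1122 + 4 * dd1212 - 2 * dd2211"
  have split: "2 * riemann (walker A) (Inl 1) (Inl 2) (Inl 1) (Inl 2) z = \<kappa> * \<tau> * K + \<kappa> * L + \<tau> * M + R0"
    unfolding riemann_A_1212 K_def L_def M_def R0_def
    by (simp only: sum_2 A_symmetric A0 Ap dA ddA)
      (simp add: algebra_simps add_divide_distrib diff_divide_distrib)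
  have K: "K = 0"
    unfolding K_def by (simp only: symmetric_jets[OF z] curvature_jets[OF z T r] T' atoms) (simp add: algebra_simps)
  have L: "L = 0"
    unfolding L_def by (simp only: symmetric_jets[OF z] curvature_jets[OF z T r] T' atoms) (simp add: algebra_simps)
  have M: "M = 0"
    unfolding M_def by (simp only: symmetric_jets[OF z] curvature_jets[OF z T r] T' atoms) (simp add: algebra_simps)
  show ?thesis
    apply (simp only: weyl_A[OF z] q_def[OF z T r] codazzi_def pd_curvature[OF base_part_mem[OF z]]
      r walker_simps ricci_A[OF z] ricci_values' A_symmetric)
    using split[unfolded K L M]
    apply (simp add: A0 power2_eq_square field_simps)
    apply (simp only: R0_def sum_2 symmetric_jets[OF z] curvature_jets[OF z T r] T' atoms)
    apply (simp add: algebra_simps)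
    done
qed

lemma weyl_horizontal_21: "weyl (walker A) (Inl 1) (Inl 2) (Inl 2) (Inl 1) z =
   - weyl (walker A) (Inl 1) (Inl 2) (Inl 1) (Inl 2) z"
  by (simp add: weyl_A[OF z] riemann_A_1221 A_symmetric ricci_A[OF z] ricci_values' field_simps)

end
end
end

section \<open>Self-dual bivectors\<close>

lemma UNIV_4: "(UNIV :: (2 + 2) set) = {Inl 1, Inl 2, Inr 1, Inr 2}"
proof -
  have "a \<in> {Inl 1, Inl 2, Inr 1, Inr 2}" for a :: "2 + 2"
    using exhaust_2 by (cases a) auto
  then show ?thesis by blast
qed

lemma det_4:
  fixes M :: "real^(2 + 2)^(2 + 2)"
  shows "det M =
    M$Inl 1$Inl 1 * (M$Inl 2$Inl 2 * (M$Inr 1$Inr 1 * M$Inr 2$Inr 2 - M$Inr 1$Inr 2 * M$Inr 2$Inr 1)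
      - M$Inl 2$Inr 1 * (M$Inr 1$Inl 2 * M$Inr 2$Inr 2 - M$Inr 1$Inr 2 * M$Inr 2$Inl 2)
      + M$Inl 2$Inr 2 * (M$Inr 1$Inl 2 * M$Inr 2$Inr 1 - M$Inr 1$Inr 1 * M$Inr 2$Inl 2))
  - M$Inl 1$Inl 2 * (M$Inl 2$Inl 1 * (M$Inr 1$Inr 1 * M$Inr 2$Inr 2 - M$Inr 1$Inr 2 * M$Inr 2$Inr 1)
      - M$Inl 2$Inr 1 * (M$Inr 1$Inl 1 * M$Inr 2$Inr 2 - M$Inr 1$Inr 2 * M$Inr 2$Inl 1)
      + M$Inl 2$Inr 2 * (M$Inr 1$Inl 1 * M$Inr 2$Inr 1 - M$Inr 1$Inr 1 * M$Inr 2$Inl 1))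
  + M$Inl 1$Inr 1 * (M$Inl 2$Inl 1 * (M$Inr 1$Inl 2 * M$Inr 2$Inr 2 - M$Inr 1$Inr 2 * M$Inr 2$Inl 2)
      - M$Inl 2$Inl 2 * (M$Inr 1$Inl 1 * M$Inr 2$Inr 2 - M$Inr 1$Inr 2 * M$Inr 2$Inl 1)
      + M$Inl 2$Inr 2 * (M$Inr 1$Inl 1 * M$Inr 2$Inl 2 - M$Inr 1$Inl 2 * M$Inr 2$Inl 1))
  - M$Inl 1$Inr 2 * (M$Inl 2$Inl 1 * (M$Inr 1$Inl 2 * M$Inr 2$Inr 1 - M$Inr 1$Inr 1 * M$Inr 2$Inl 2)
      - M$Inl 2$Inl 2 * (M$Inr 1$Inl 1 * M$Inr 2$Inr 1 - M$Inr 1$Inr 1 * M$Inr 2$Inl 1)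
      + M$Inl 2$Inr 1 * (M$Inr 1$Inl 1 * M$Inr 2$Inl 2 - M$Inr 1$Inl 2 * M$Inr 2$Inl 1))"
proof -
  have f1: "finite {Inl 2, Inr 1, Inr 2 :: 2 + 2}" "(Inl 1 :: 2 + 2) \<notin> {Inl 2, Inr 1, Inr 2}" by auto
  have f2: "finite {Inr 1, Inr 2 :: 2 + 2}" "(Inl 2 :: 2 + 2) \<notin> {Inr 1, Inr 2}" by auto
  have f3: "finite {Inr 2 :: 2 + 2}" "(Inr 1 :: 2 + 2) \<notin> {Inr 2}" by auto
  show ?thesis
    unfolding det_def UNIV_4
    unfolding sum_over_permutations_insert[OF f1]
    unfolding sum_over_permutations_insert[OF f2]
    unfolding sum_over_permutations_insert[OF f3]
    unfolding permutes_sing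
    by (simp add: sign_swap_id permutation_swap_id permutation_compose sign_compose sign_id swap_id_eq)
       (simp add: algebra_simps)
qed

text \<open>With unit determinant the volume form in an induced chart is the Levi-Civita symbol
  times the sign of the frame.\<close>

lemma det_walker: "det (gmat (walker A) (z :: real^(2 + 2))) = 1"
proof -
  have "gmat (walker A) z $ a $ b = walker A a b z" for a b by (simp add: gmat_def)
  then show ?thesis by (simp add: det_4)
qed

lemmas levi_civita_symbol_4 = levi_civita_symbol_def[unfolded det_4]

lemma levi_civita_symbol_equal [simp]:
  "levi_civita_symbol i i k l = 0"
  "levi_civita_symbol i j i l = 0"
  "levi_civita_symbol i j k i = 0"
  "levi_civita_symbol i j j l = 0"
  "levi_civita_symbol i j k j = 0"
  "levi_civita_symbol i j k k = 0"
  unfolding levi_civita_symbol_def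
  subgoal by (rule det_identical_rows[of "Inl 1" "Inl 2"]) (simp_all add: row_def)
  subgoal by (rule det_identical_rows[of "Inl 1" "Inr 1"]) (simp_all add: row_def)
  subgoal by (rule det_identical_rows[of "Inl 1" "Inr 2"]) (simp_all add: row_def)
  subgoal by (rule det_identical_rows[of "Inl 2" "Inr 1"]) (simp_all add: row_def)
  subgoal by (rule det_identical_rows[of "Inl 2" "Inr 2"]) (simp_all add: row_def)
  subgoal by (rule det_identical_rows[of "Inr 1" "Inr 2"]) (simp_all add: row_def)
  done

lemma levi_civita_symbol_distinct [simp]:
  "levi_civita_symbol (Inl 1) (Inl 2) (Inr 1) (Inr 2) = 1"
  "levi_civita_symbol (Inl 1) (Inl 2) (Inr 2) (Inr 1) = - 1"
  "levi_civita_symbol (Inl 1) (Inr 1) (Inl 2) (Inr 2) = - 1"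
  "levi_civita_symbol (Inl 1) (Inr 1) (Inr 2) (Inl 2) = 1"
  "levi_civita_symbol (Inl 1) (Inr 2) (Inl 2) (Inr 1) = 1"
  "levi_civita_symbol (Inl 1) (Inr 2) (Inr 1) (Inl 2) = - 1"
  "levi_civita_symbol (Inl 2) (Inl 1) (Inr 1) (Inr 2) = - 1"
  "levi_civita_symbol (Inl 2) (Inl 1) (Inr 2) (Inr 1) = 1"
  "levi_civita_symbol (Inl 2) (Inr 1) (Inl 1) (Inr 2) = 1"
  "levi_civita_symbol (Inl 2) (Inr 1) (Inr 2) (Inl 1) = - 1"
  "levi_civita_symbol (Inl 2) (Inr 2) (Inl 1) (Inr 1) = - 1"
  "levi_civita_symbol (Inl 2) (Inr 2) (Inr 1) (Inl 1) = 1"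
  "levi_civita_symbol (Inr 1) (Inl 1) (Inl 2) (Inr 2) = 1"
  "levi_civita_symbol (Inr 1) (Inl 1) (Inr 2) (Inl 2) = - 1"
  "levi_civita_symbol (Inr 1) (Inl 2) (Inl 1) (Inr 2) = - 1"
  "levi_civita_symbol (Inr 1) (Inl 2) (Inr 2) (Inl 1) = 1"
  "levi_civita_symbol (Inr 1) (Inr 2) (Inl 1) (Inl 2) = 1"
  "levi_civita_symbol (Inr 1) (Inr 2) (Inl 2) (Inl 1) = - 1"
  "levi_civita_symbol (Inr 2) (Inl 1) (Inl 2) (Inr 1) = - 1"
  "levi_civita_symbol (Inr 2) (Inl 1) (Inr 1) (Inl 2) = 1"
  "levi_civita_symbol (Inr 2) (Inl 2) (Inl 1) (Inr 1) = 1"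
  "levi_civita_symbol (Inr 2) (Inl 2) (Inr 1) (Inl 1) = - 1"
  "levi_civita_symbol (Inr 2) (Inr 1) (Inl 1) (Inl 2) = - 1"
  "levi_civita_symbol (Inr 2) (Inr 1) (Inl 2) (Inl 1) = 1"
  by (simp_all add: levi_civita_symbol_4 axis_def)

text \<open>The contraction in \<open>hodge_star\<close> before indices are raised. Tabulating its
  sixteen values once avoids a fourfold sum in every later computation.\<close>

definition levi_civita_contraction :: "real^(2 + 2)^(2 + 2) \<Rightarrow> 2 + 2 \<Rightarrow> 2 + 2 \<Rightarrow> real" where
  "levi_civita_contraction B a b = (\<Sum>k\<in>UNIV. \<Sum>l\<in>UNIV. levi_civita_symbol k l a b * B $ k $ l)"

lemma levi_civita_contraction_simps [simp]:
  "levi_civita_contraction B (Inl 1) (Inl 1) = 0"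
  "levi_civita_contraction B (Inl 1) (Inl 2) = B $ Inr 1 $ Inr 2 - B $ Inr 2 $ Inr 1"
  "levi_civita_contraction B (Inl 1) (Inr 1) = B $ Inr 2 $ Inl 2 - B $ Inl 2 $ Inr 2"
  "levi_civita_contraction B (Inl 1) (Inr 2) = B $ Inl 2 $ Inr 1 - B $ Inr 1 $ Inl 2"
  "levi_civita_contraction B (Inl 2) (Inl 1) = B $ Inr 2 $ Inr 1 - B $ Inr 1 $ Inr 2"
  "levi_civita_contraction B (Inl 2) (Inl 2) = 0"
  "levi_civita_contraction B (Inl 2) (Inr 1) = B $ Inl 1 $ Inr 2 - B $ Inr 2 $ Inl 1"
  "levi_civita_contraction B (Inl 2) (Inr 2) = B $ Inr 1 $ Inl 1 - B $ Inl 1 $ Inr 1"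
  "levi_civita_contraction B (Inr 1) (Inl 1) = B $ Inl 2 $ Inr 2 - B $ Inr 2 $ Inl 2"
  "levi_civita_contraction B (Inr 1) (Inl 2) = B $ Inr 2 $ Inl 1 - B $ Inl 1 $ Inr 2"
  "levi_civita_contraction B (Inr 1) (Inr 1) = 0"
  "levi_civita_contraction B (Inr 1) (Inr 2) = B $ Inl 1 $ Inl 2 - B $ Inl 2 $ Inl 1"
  "levi_civita_contraction B (Inr 2) (Inl 1) = B $ Inr 1 $ Inl 2 - B $ Inl 2 $ Inr 1"
  "levi_civita_contraction B (Inr 2) (Inl 2) = B $ Inl 1 $ Inr 1 - B $ Inr 1 $ Inl 1"
  "levi_civita_contraction B (Inr 2) (Inr 1) = B $ Inl 2 $ Inl 1 - B $ Inl 1 $ Inl 2"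
  "levi_civita_contraction B (Inr 2) (Inr 2) = 0"
  unfolding levi_civita_contraction_def by (simp_all add: sum_UNIV_Plus sum_2)

lemma hodge_star_walker:
  "hodge_star (walker A) s z B $ i $ j = s / 2 * (\<Sum>a\<in>UNIV. \<Sum>b\<in>UNIV.
     walker_inv A i a z * walker_inv A j b z * levi_civita_contraction B a b)"
  by (simp add: hodge_star_def volume_form_def det_walker ginv_walker levi_civita_contraction_def sum_distrib_left mult_ac)

lemma hodge_star_vertical:
  "hodge_star (walker A) s z (wedge (axis (Inr 1) 1) (axis (Inr 2) 1)) $ Inr 1 $ Inr 2 = s"
  unfolding hodge_star_walker sum_UNIV_Plus sum_2 by (simp add: wedge_def axis_def)

text \<open>The self-duality equations determine B^{12'}, B^{21'} and B^{22'} from B^{12} and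
  B^{11'}. The six components are thus reduced to B^{12}, B^{11'} and B^{1'2'}.\<close>

lemma self_dual_components:
  assumes "self_dual (walker A) 1 z B"
  shows "B $ Inl 1 $ Inr 1 - B $ Inl 2 $ Inr 2 = - A 1 2 z * B $ Inl 1 $ Inl 2"
    "B $ Inl 1 $ Inr 2 = - A 2 2 z / 2 * B $ Inl 1 $ Inl 2"
    "B $ Inl 2 $ Inr 1 = A 1 1 z / 2 * B $ Inl 1 $ Inl 2"
proof -
  have skew: "B $ j $ i = - B $ i $ j" for i j
  proof -
    have "transpose B $ i $ j = (- B) $ i $ j" using assms by (simp add: self_dual_def bivector_def)
    then show ?thesis by (simp add: transpose_def)
  qed
  have star: "B $ i $ j = hodge_star (walker A) 1 z B $ i $ j" for i j
    using assms by (simp add: self_dual_def)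
  have diag: "B $ i $ i = 0" for i using skew[of i i] by simp
  note expand = hodge_star_walker sum_UNIV_Plus sum_2
  note skews = skew[of "Inl 1" "Inl 2"] skew[of "Inl 1" "Inr 1"] skew[of "Inl 1" "Inr 2"] skew[of "Inl 2" "Inr 1"]
    skew[of "Inl 2" "Inr 2"]
  have "hodge_star (walker A) 1 z B $ Inl 1 $ Inr 1 = B $ Inl 2 $ Inr 2 - A 1 2 z * B $ Inl 1 $ Inl 2"
    "hodge_star (walker A) 1 z B $ Inl 1 $ Inr 2 = - B $ Inl 1 $ Inr 2 - A 2 2 z * B $ Inl 1 $ Inl 2"
    "hodge_star (walker A) 1 z B $ Inl 2 $ Inr 1 = - B $ Inl 2 $ Inr 1 + A 1 1 z * B $ Inl 1 $ Inl 2"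
    unfolding expand by (simp_all add: skews field_simps)
  then show "B $ Inl 1 $ Inr 1 - B $ Inl 2 $ Inr 2 = - A 1 2 z * B $ Inl 1 $ Inl 2"
    "B $ Inl 1 $ Inr 2 = - A 2 2 z / 2 * B $ Inl 1 $ Inl 2"
    "B $ Inl 2 $ Inr 1 = A 1 1 z / 2 * B $ Inl 1 $ Inl 2"
    unfolding star[symmetric] by simp_all
qed

text \<open>Translates the orientation convention into the sign s: the (1',2') component of the star
  of the vertical bivector is s, while that of the bivector itself is 1.\<close>

lemma self_dual_vertical_sign:
  assumes "self_dual (walker A) s z (wedge (axis (Inr 1) 1) (axis (Inr 2) 1))"
  shows "s = 1"
proof -
  let ?B = "wedge (axis (Inr 1) 1) (axis (Inr 2) 1) :: real^(2 + 2)^(2 + 2)"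
  have "hodge_star (walker A) s z ?B $ Inr 1 $ Inr 2 = ?B $ Inr 1 $ Inr 2"
    using assms by (simp add: self_dual_def)
  then show ?thesis unfolding hodge_star_vertical by (simp add: wedge_def axis_def)
qed

text \<open>Raising of the two free indices is postponed, so that the inverse metric stays out of
  the component computation.\<close>

lemma weyl_operator_eq_0I:
  assumes "\<And>a b. (\<Sum>k\<in>UNIV. \<Sum>l\<in>UNIV. weyl g k l a b x * B $ k $ l) = 0"
  shows "weyl_operator g x B = 0"
proof -
  have "(\<Sum>a\<in>UNIV. \<Sum>b\<in>UNIV. \<Sum>k\<in>UNIV. \<Sum>l\<in>UNIV.
        ginv g x $ i $ a * ginv g x $ j $ b * weyl g k l a b x * B $ k $ l) =
     (\<Sum>a\<in>UNIV. \<Sum>b\<in>UNIV. ginv g x $ i $ a * ginv g x $ j $ b *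
        (\<Sum>k\<in>UNIV. \<Sum>l\<in>UNIV. weyl g k l a b x * B $ k $ l))" for i j
    by (simp add: sum_distrib_left mult.assoc)
  then show ?thesis by (simp add: weyl_operator_def assms vec_eq_iff)
qed

lemma weyl_swap: "weyl g j i k l x = - weyl g i j k l x"
proof -
  have "riemann g j i k l x = - riemann g i j k l x"
    by (simp add: riemann_def curvature_swap[of _ j i] sum_negf)
  then show ?thesis by (simp add: weyl_def Let_def algebra_simps diff_divide_distrib add_divide_distrib)
qed

section \<open>Vanishing of the self-dual Weyl operator\<close>

context parallel_chart
begin

text \<open>For self-dual B the contraction with W involves only two expressions: a trace of mixed
  components, multiplied by B^{11'}, and a corrected horizontal component, multiplied by B^{12}. The
  parameter B^{1'2'} drops out because W vanishes on vertical pairs.\<close>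

lemma anti_self_dual_at:
  assumes z: "z \<in> U" and T_ne: "\<exists>i k. T i k (base_part z) \<noteq> 0"
    and ric: "ricci \<Gamma> 1 2 (base_part z) = ricci \<Gamma> 2 1 (base_part z)"
    and cod: "\<And>k. codazzi k (base_part z) = 0"
    and B: "self_dual (walker A) 1 z B"
  shows "weyl_operator (walker A) z B = 0"
proof (rule weyl_operator_eq_0I)
  fix a b :: "2 + 2"
  obtain w1 w2 s \<psi> where T:
    "T 1 1 (base_part z) = - s * w1 * w2" "T 1 2 (base_part z) = s * w1\<^sup>2"
    "T 2 1 (base_part z) = - s * w2\<^sup>2" "T 2 2 (base_part z) = s * w1 * w2"
    "\<Psi> 1 1 (base_part z) = \<psi> * w1\<^sup>2" "\<Psi> 1 2 (base_part z) = \<psi> * w1 * w2"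
    "\<Psi> 2 1 (base_part z) = \<psi> * w1 * w2" "\<Psi> 2 2 (base_part z) = \<psi> * w2\<^sup>2"
    using rank_one[OF base_part_mem[OF z]] .
  obtain r where r: "\<And>i k. curvature \<Gamma> 1 2 i k (base_part z) = r * T i k (base_part z)"
    using curvature_multiple[OF base_part_mem[OF z] T_ne ric] by metis
  note weyl = weyl_mixed_mixed[OF z T r] weyl_mixed_horizontal_11[OF z T r] weyl_mixed_horizontal_12[OF z T r]
    weyl_mixed_horizontal_21[OF z T r] weyl_mixed_horizontal_22[OF z T r] weyl_horizontal_mixed[OF z T r]
    weyl_horizontal_mixed'[OF z T r] weyl_horizontal_vertical[OF z T r] weyl_horizontal_11[OF z T r]
    weyl_horizontal_12[OF z T r] weyl_horizontal_21[OF z T r] weyl_horizontal_22[OF z T r] cod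
  have ab: "a = Inl 1 \<or> a = Inl 2 \<or> a = Inr 1 \<or> a = Inr 2" "b = Inl 1 \<or> b = Inl 2 \<or> b = Inr 1 \<or> b = Inr 2"
    using UNIV_I[of a] UNIV_I[of b] unfolding UNIV_4 by auto
  let ?W = "\<lambda>k l. weyl (walker A) k l a b z"
  \<comment> \<open>For fixed a and b every W(d_i, d_j', a, b) is one common multiple of T_i^j, so
    this sum is a multiple of the trace of T.\<close>
  have trace: "?W (Inl 1) (Inr 1) + ?W (Inl 2) (Inr 2) = 0"
    using ab by (elim disjE; hypsubst) (simp_all add: weyl T)
  \<comment> \<open>The sum in brackets is the combination of entries of T produced by the three
    corrections in \<open>horizontal\<close>.\<close>
  have q: "q z w1 w2 s = - (A 1 1 z / 2 * T 2 1 (base_part z) + A 1 2 z * T 2 2 (base_part z) - A 2 2 z / 2 * T 1 2 (base_part z))"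
    by (simp add: q_def[OF z T r] T field_simps)
  \<comment> \<open>The corrections contribute -q times the common multiple of T, which cancels
    T_k^l q in mixed positions and q^2 in the horizontal position; there the remaining Codazzi term
    is zero by \<open>cod\<close>.\<close>
  have horizontal: "?W (Inl 1) (Inl 2) + A 1 2 z * ?W (Inl 2) (Inr 2) + A 1 1 z / 2 * ?W (Inl 2) (Inr 1)
      - A 2 2 z / 2 * ?W (Inl 1) (Inr 2) = 0"
    using ab by (elim disjE; hypsubst) (simp_all only: weyl q mult_zero_right, simp_all add: T algebra_simps power2_eq_square)
  have skew: "B $ j $ i = - B $ i $ j" for i j
  proof -
    have "transpose B $ i $ j = (- B) $ i $ j" using B by (simp add: self_dual_def bivector_def)
    then show ?thesis by (simp add: transpose_def)
  qed
  have diag: "B $ i $ i = 0" for i using skew[of i i] by simp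
  have "(\<Sum>k\<in>UNIV. \<Sum>l\<in>UNIV. ?W k l * B $ k $ l) =
     2 * (?W (Inl 1) (Inl 2) * B $ Inl 1 $ Inl 2 + ?W (Inl 1) (Inr 1) * B $ Inl 1 $ Inr 1
      + ?W (Inl 1) (Inr 2) * B $ Inl 1 $ Inr 2 + ?W (Inl 2) (Inr 1) * B $ Inl 2 $ Inr 1
      + ?W (Inl 2) (Inr 2) * B $ Inl 2 $ Inr 2)"
    by (simp add: sum_UNIV_Plus sum_2 diag weyl_A_vertical[OF z] skew[of "Inl 2" "Inl 1"] skew[of "Inr 1" "Inl 1"]
       skew[of "Inr 1" "Inl 2"] skew[of "Inr 2" "Inl 1"] skew[of "Inr 2" "Inl 2"]
       weyl_swap[of _ "Inl 2" "Inl 1"] weyl_swap[of _ "Inr _" "Inl _"])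
  also have "\<dots> = 2 * ((?W (Inl 1) (Inr 1) + ?W (Inl 2) (Inr 2)) * B $ Inl 1 $ Inr 1
     + (?W (Inl 1) (Inl 2) + A 1 2 z * ?W (Inl 2) (Inr 2) + A 1 1 z / 2 * ?W (Inl 2) (Inr 1)
      - A 2 2 z / 2 * ?W (Inl 1) (Inr 2)) * B $ Inl 1 $ Inl 2)"
  proof -
    have "B $ Inl 2 $ Inr 2 = B $ Inl 1 $ Inr 1 + A 1 2 z * B $ Inl 1 $ Inl 2"
      using self_dual_components(1)[OF B] by simp
    then show ?thesis unfolding self_dual_components(2,3)[OF B] by (simp add: algebra_simps)
  qed
  also have "\<dots> = 0" by (simp only: trace horizontal)  simp
  finally show "(\<Sum>k\<in>UNIV. \<Sum>l\<in>UNIV. ?W k l * B $ k $ l) = 0" .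
qed

end

section \<open>Solitons on the cotangent bundle\<close>

definition join_parts :: "real^'n::finite \<Rightarrow> real^'n \<Rightarrow> real^('n + 'n)" where
  "join_parts x p = (\<chi> a. case a of Inl k \<Rightarrow> x $ k | Inr k \<Rightarrow> p $ k)"

lemma join_parts_simps [simp]:
  "base_part (join_parts x p) = x" "join_parts x p $ Inl k = x $ k" "join_parts x p $ Inr k = p $ k"
  by (simp_all add: join_parts_def base_part_def)

lemma two_ricci_sym: "2 * ricci_sym \<Gamma> i j x = ricci \<Gamma> i j x + ricci \<Gamma> j i x"
  by (simp add: ricci_sym_def)

context parallel_chart
begin

lemma hessian_A:
  assumes f: "smooth_on X f" and z: "z \<in> U"
  defines "F \<equiv> \<lambda>z. f (base_part z)"
  shows "hessian (levi_civita (walker A)) F (Inl i) (Inl j) z = hessian \<Gamma> f i j (base_part z)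
      + 1/2 * ((\<Sum>k\<in>UNIV. T i k (base_part z) * pd k f (base_part z)) * Tp j z
             + (\<Sum>k\<in>UNIV. T j k (base_part z) * pd k f (base_part z)) * Tp i z)"
    "hessian (levi_civita (walker A)) F (Inl i) (Inr j) z = 0"
    "hessian (levi_civita (walker A)) F (Inr i) b z = 0"
proof -
  have F: "pd (Inl m) F y = pd m f (base_part y)" "pd (Inr m) F y = 0" if "y \<in> U" for m y
    unfolding F_def using pd_base_part[OF f] that by (auto simp: U_def)
  have FF: "pd a (pd (Inl m) F) z = pd a (\<lambda>z. pd m f (base_part z)) z" "pd a (pd (Inr m) F) z = 0" for a m
    using pd_cong_open[OF open_U z F(1)] pd_cong_open[OF open_U z F(2)] by simp_all
  have FF': "pd (Inl n) (pd (Inl m) F) z = pd n (pd m f) (base_part z)" "pd (Inr n) (pd (Inl m) F) z = 0" for n m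
    unfolding FF using pd_base_part[OF smooth_on_pd[OF f]] z by (auto simp: U_def)
  show "hessian (levi_civita (walker A)) F (Inl i) (Inl j) z = hessian \<Gamma> f i j (base_part z)
      + 1/2 * ((\<Sum>k\<in>UNIV. T i k (base_part z) * pd k f (base_part z)) * Tp j z
             + (\<Sum>k\<in>UNIV. T j k (base_part z) * pd k f (base_part z)) * Tp i z)"
    unfolding hessian_def sum_UNIV_Plus FF' F[OF z] levi_civita_walker pd_A[OF z] sum_2
    by (simp add: field_simps)
  show "hessian (levi_civita (walker A)) F (Inl i) (Inr j) z = 0"
    unfolding hessian_def sum_UNIV_Plus FF(2) F[OF z] levi_civita_walker by simp
  show "hessian (levi_civita (walker A)) F (Inr i) b z = 0"
    by (cases b) (simp_all add: hessian_def sum_UNIV_Plus FF' FF(2) F[OF z] levi_civita_walker)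
qed

text \<open>A nonzero nilpotent endomorphism of a plane has equal kernel and image, so vanishing on
  ker T amounts to vanishing after composition with T. The latter is the condition that the Hessian
  of the lift produces.\<close>

lemma kernel_condition:
  assumes x: "x \<in> X" and T_ne: "\<exists>i k. T i k x \<noteq> 0"
  shows "(\<forall>v::real^2. (\<forall>k. (\<Sum>a\<in>UNIV. v $ a * T a k x) = 0) \<longrightarrow> (\<Sum>a\<in>UNIV. v $ a * f a) = 0)
    \<longleftrightarrow> (\<forall>i. (\<Sum>k\<in>UNIV. T i k x * f k) = 0)"
proof (intro iffI allI impI)
  fix i
  assume *: "\<forall>v::real^2. (\<forall>k. (\<Sum>a\<in>UNIV. v $ a * T a k x) = 0) \<longrightarrow> (\<Sum>a\<in>UNIV. v $ a * f a) = 0"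
  have "\<forall>k. (\<Sum>a\<in>UNIV. (\<chi> a. T i a x) $ a * T a k x) = 0" using T_sq[OF x] by simp
  with * have "(\<Sum>a\<in>UNIV. (\<chi> a. T i a x) $ a * f a) = 0" by blast
  then show "(\<Sum>k\<in>UNIV. T i k x * f k) = 0" by simp
next
  fix v :: "real^2"
  assume f: "\<forall>i. (\<Sum>k\<in>UNIV. T i k x * f k) = 0" and v: "\<forall>k. (\<Sum>a\<in>UNIV. v $ a * T a k x) = 0"
  obtain w1 w2 s where T: "T 1 1 x = - s * w1 * w2" "T 1 2 x = s * w1\<^sup>2" "T 2 1 x = - s * w2\<^sup>2" "T 2 2 x = s * w1 * w2"
    using rank_one[OF x] by metis
  have s: "s \<noteq> 0" and w: "w1 \<noteq> 0 \<or> w2 \<noteq> 0"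
  proof -
    obtain i k where "T i k x \<noteq> 0" using T_ne by blast
    then have "s \<noteq> 0 \<and> (w1 \<noteq> 0 \<or> w2 \<noteq> 0)" using exhaust_2[of i] exhaust_2[of k] by (auto simp: T)
    then show "s \<noteq> 0" "w1 \<noteq> 0 \<or> w2 \<noteq> 0" by auto
  qed
  have f': "s * w1 * (w1 * f 2 - w2 * f 1) = 0" "s * w2 * (w1 * f 2 - w2 * f 1) = 0"
    using f[rule_format, of 1] f[rule_format, of 2] by (simp_all add: sum_2 T algebra_simps power2_eq_square)
  have v': "s * w2 * (v $ 1 * w1 + v $ 2 * w2) = 0" "s * w1 * (v $ 1 * w1 + v $ 2 * w2) = 0"
    using v[rule_format, of 1] v[rule_format, of 2] by (simp_all add: sum_2 T algebra_simps power2_eq_square)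
  have e: "w1 * f 2 - w2 * f 1 = 0" "v $ 1 * w1 + v $ 2 * w2 = 0"
    using f' v' s w unfolding mult_eq_0_iff by blast+
  have "w1 * (v $ 1 * f 1 + v $ 2 * f 2) = 0" "w2 * (v $ 1 * f 1 + v $ 2 * f 2) = 0"
    using e by algebra+
  then show "(\<Sum>a\<in>UNIV. v $ a * f a) = 0" using w by (auto simp: sum_2)
qed

text \<open>Over each base point the lifted equation is affine in the fibre variable p. Two
  covectors separate its parts: p = 0 gives the affine soliton equation, and p = dx^k with some
  T_i^k nonzero gives df o T = 0.\<close>

lemma soliton_iff:
  assumes f: "smooth_on X f" and T_ne: "\<And>x. x \<in> X \<Longrightarrow> \<exists>i k. T i k x \<noteq> 0"
  defines "F \<equiv> \<lambda>z. f (base_part z)"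
  shows "(\<forall>z\<in>U. \<forall>a b. hessian (levi_civita (walker A)) F a b z + ricci (levi_civita (walker A)) a b z = 0) \<longleftrightarrow>
    (\<forall>x\<in>X. (\<forall>i j. hessian \<Gamma> f i j x + 2 * ricci_sym \<Gamma> i j x = 0) \<and> (\<forall>i. (\<Sum>k\<in>UNIV. T i k x * pd k f x) = 0))"
    (is "?L \<longleftrightarrow> ?R")
proof
  assume R: ?R
  show ?L
  proof (intro ballI allI)
    fix z a b assume z: "z \<in> U"
    then have x: "base_part z \<in> X" by (simp add: U_def)
    show "hessian (levi_civita (walker A)) F a b z + ricci (levi_civita (walker A)) a b z = 0"
      using R x unfolding F_def by (cases a; cases b) (auto simp: hessian_A[OF f z] ricci_A[OF z] two_ricci_sym algebra_simps)
  qed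
next
  assume L: ?L
  show ?R
  proof (intro ballI)
    fix x assume x: "x \<in> X"
    let ?u = "\<lambda>i. \<Sum>k\<in>UNIV. T i k x * pd k f x"
    have eq: "hessian \<Gamma> f i j x + 2 * ricci_sym \<Gamma> i j x
        + 1/2 * (?u i * Tp j (join_parts x p) + ?u j * Tp i (join_parts x p)) = 0" for i j p
    proof -
      have z: "join_parts x p \<in> U" using x by (simp add: U_def)
      show ?thesis
        using L[rule_format, OF z, of "Inl i" "Inl j"] unfolding F_def
        by (simp add: hessian_A[OF f z] ricci_A[OF z] two_ricci_sym)
    qed
    have h: "hessian \<Gamma> f i j x + 2 * ricci_sym \<Gamma> i j x = 0" for i j
      using eq[of i j 0] by (simp add: Tp_def)
    obtain i k where ik: "T i k x \<noteq> 0" using T_ne[OF x] by blast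
    have u: "?u i * Tp j (join_parts x (axis k 1)) + ?u j * Tp i (join_parts x (axis k 1)) = 0" for i j
      using eq[of i j "axis k 1"] h[of i j] by simp
    have Tp: "Tp j (join_parts x (axis k 1)) = T j k x" for j
      using exhaust_2[of k] by (auto simp: Tp_def axis_def)
    \<comment> \<open>The entry (i, i) reads 2 u_i T_i^k = 0; once u_i is gone, the entry (i, j)
      reads u_j T_i^k = 0.\<close>
    have ui: "?u i = 0" using u[of i i] ik by (simp add: Tp)
    have "?u j = 0" for j using u[of i j] ui ik by (simp add: Tp)
    then show "(\<forall>i j. hessian \<Gamma> f i j x + 2 * ricci_sym \<Gamma> i j x = 0) \<and> (\<forall>i. ?u i = 0)"
      using h by blast
  qed
qed

text \<open>By the soliton equation \<rho> is -1/2 times the Hessian of f, so by the Ricci identity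
  its Codazzi defect is, up to sign, half of the curvature acting on df. As the curvature is a
  multiple of T, this is a multiple of df o T = 0.\<close>

lemma codazzi_of_soliton:
  assumes f: "smooth_on X f" and T_ne: "\<And>x. x \<in> X \<Longrightarrow> \<exists>i k. T i k x \<noteq> 0"
    and ric: "\<And>x. x \<in> X \<Longrightarrow> ricci \<Gamma> 1 2 x = ricci \<Gamma> 2 1 x"
    and sol: "\<And>x i j. x \<in> X \<Longrightarrow> hessian \<Gamma> f i j x + 2 * ricci_sym \<Gamma> i j x = 0"
    and df: "\<And>x i. x \<in> X \<Longrightarrow> (\<Sum>k\<in>UNIV. T i k x * pd k f x) = 0"
    and x: "x \<in> X"
  shows "codazzi k x = 0"
proof -
  have C: "curvature \<Gamma> 1 2 1 1 y = - 1/2 * hessian \<Gamma> f 1 2 y" "curvature \<Gamma> 1 2 1 2 y = 1/2 * hessian \<Gamma> f 1 1 y"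
    "curvature \<Gamma> 1 2 2 1 y = - 1/2 * hessian \<Gamma> f 2 2 y" "curvature \<Gamma> 1 2 2 2 y = 1/2 * hessian \<Gamma> f 1 2 y"
    if "y \<in> X" for y
    using sol[OF that, of 1 1] sol[OF that, of 1 2] sol[OF that, of 2 2] ric[OF that]
    unfolding two_ricci_sym ricci_2 by simp_all
  have diff: "pd i f differentiable (at x)" "pd i (pd j f) differentiable (at x)" for i j
    using f x smooth_on_pd smooth_on_differentiable by blast+
  have dH: "pd n (hessian \<Gamma> f i j) x = pd n (pd i (pd j f)) x
     - (\<Sum>k\<in>UNIV. \<Gamma> i j k x * pd n (pd k f) x + pd n (\<Gamma> i j k) x * pd k f x)" for n i j
    unfolding hessian_def[abs_def] sum_2 using x
    by (simp add: pd_diff pd_add pd_mult diff differentiable_add differentiable_mult)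
  have dHc: "pd n (\<lambda>y. c * hessian \<Gamma> f i j y) x = c * pd n (hessian \<Gamma> f i j) x" for n i j c
  proof (rule pd_cmult)
    show "hessian \<Gamma> f i j differentiable at x"
      unfolding hessian_def[abs_def] sum_2 using x
      by (simp add: diff differentiable_add differentiable_diff differentiable_mult)
  qed
  have dC: "pd n (curvature \<Gamma> 1 2 1 1) x = - 1/2 * pd n (hessian \<Gamma> f 1 2) x"
    "pd n (curvature \<Gamma> 1 2 1 2) x = 1/2 * pd n (hessian \<Gamma> f 1 1) x"
    "pd n (curvature \<Gamma> 1 2 2 1) x = - 1/2 * pd n (hessian \<Gamma> f 2 2) x"
    "pd n (curvature \<Gamma> 1 2 2 2) x = 1/2 * pd n (hessian \<Gamma> f 1 2) x" for n
    by (subst pd_cong_open[OF open_X x C(1)], assumption, rule dHc)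
      (subst pd_cong_open[OF open_X x C(2)], assumption, rule dHc,
       subst pd_cong_open[OF open_X x C(3)], assumption, rule dHc,
       subst pd_cong_open[OF open_X x C(4)], assumption, rule dHc)
  obtain r where r: "\<And>i k. curvature \<Gamma> 1 2 i k x = r * T i k x"
    using curvature_multiple[OF x T_ne[OF x] ric[OF x]] by metis
  have dfR: "(\<Sum>m\<in>UNIV. curvature \<Gamma> 1 2 i m x * pd m f x) = 0" for i
    using df[OF x, of i] by (simp add: r mult.assoc flip: sum_distrib_left)
  have sym: "pd 2 (pd 1 f) x = pd 1 (pd 2 f) x" "pd n (pd 2 (pd 1 f)) x = pd n (pd 1 (pd 2 f)) x"
    "pd 2 (pd 1 (pd i f)) x = pd 1 (pd 2 (pd i f)) x" for n i
  proof -
    show "pd 2 (pd 1 f) x = pd 1 (pd 2 f) x" by (rule pd_commute[OF open_X x f])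
    show "pd n (pd 2 (pd 1 f)) x = pd n (pd 1 (pd 2 f)) x"
      by (rule pd_cong_open[OF open_X x]) (rule pd_commute[OF open_X _ f])
    show "pd 2 (pd 1 (pd i f)) x = pd 1 (pd 2 (pd i f)) x"
      by (rule pd_commute[OF open_X x smooth_on_pd[OF f]])
  qed
  note sym\<Gamma> = sym_\<Gamma>[OF x, of 2 1] pd_sym_\<Gamma>[OF x, of _ 2 1]
  \<comment> \<open>E i = df(R(d_1, d_2) d_i) is the curvature term of the Ricci identity; the third
    derivatives of f cancel.\<close>
  define E where "E i = (\<Sum>m\<in>UNIV. curvature \<Gamma> 1 2 i m x * pd m f x)" for i
  have E: "E i = (\<Sum>l\<in>UNIV. (pd 1 (\<Gamma> 2 i l) x - pd 2 (\<Gamma> 1 i l) x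
     + (\<Sum>m\<in>UNIV. \<Gamma> 2 i m x * \<Gamma> 1 m l x - \<Gamma> 1 i m x * \<Gamma> 2 m l x)) * pd l f x)" for i
    by (simp add: E_def curvature_def)
  have "codazzi 1 x = 1/2 * E 2" "codazzi 2 x = - 1/2 * E 1"
    unfolding codazzi_def dC sum_2 C[OF x] dH E
    unfolding hessian_def[of \<Gamma> f] sum_2
    by (simp_all add: sym sym\<Gamma> field_simps)
  then show ?thesis using dfR exhaust_2[of k] by (auto simp: E_def)
qed

end

section \<open>Conformal changes of Walker metrics\<close>

lemma ginv_conformal:
  assumes "c \<noteq> 0" and g': "\<And>a b. g' a b y = c * walker A a b y"
  shows "ginv g' y = (\<chi> i j. walker_inv A i j y / c)"
proof -
  have inv: "(\<Sum>k\<in>UNIV. walker A a k y * walker_inv A k b y) = (if a = b then 1 else 0)"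
    "(\<Sum>k\<in>UNIV. walker_inv A a k y * walker A k b y) = (if a = b then 1 else 0)" for a b
    using walker_mult_inv[of A y] by (simp_all add: gmat_def matrix_matrix_mult_def mat_def vec_eq_iff)
  show ?thesis
    unfolding ginv_def
    by (rule matrix_inv_eqI)
      (use assms(1) in \<open>simp_all add: gmat_def g' matrix_matrix_mult_def mat_def vec_eq_iff inv\<close>)
qed

lemma levi_civita_conformal:
  fixes A :: "'n::finite \<Rightarrow> 'n \<Rightarrow> real^('n + 'n) \<Rightarrow> real"
  assumes \<sigma>: "\<sigma> differentiable (at y)" and A: "\<And>i j. A i j differentiable (at y)"
    and sym: "\<And>i j. A i j y = A j i y"
    and g': "g' = (\<lambda>a b y. exp (2 * \<sigma> y) * walker A a b y)"
  shows "levi_civita g' a b c y = levi_civita (walker A) a b c y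
     + (if b = c then pd a \<sigma> y else 0) + (if a = c then pd b \<sigma> y else 0)
     - walker A a b y * (\<Sum>l\<in>UNIV. walker_inv A c l y * pd l \<sigma> y)"
proof -
  have W: "walker A i j differentiable (at y)" for i j
    by (cases i; cases j) (simp_all add: A)
  have Wsym: "walker A i j y = walker A j i y" for i j
    by (cases i; cases j) (simp_all add: sym)
  have e: "(\<lambda>y. exp (2 * \<sigma> y)) differentiable (at y)"
  proof -
    have "((\<lambda>y. exp (2 * \<sigma> y)) has_derivative (\<lambda>v. exp (2 * \<sigma> y) * (2 * frechet_derivative \<sigma> (at y) v))) (at y)"
      using \<sigma> unfolding frechet_derivative_works by (auto intro!: derivative_eq_intros)
    then show ?thesis by (auto simp: differentiable_def)
  qed
  have pe: "pd i (\<lambda>y. exp (2 * \<sigma> y)) y = 2 * exp (2 * \<sigma> y) * pd i \<sigma> y" for i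
    using \<sigma> by (simp add: pd_exp pd_cmult differentiable_mult)
  have pg: "pd i (g' j k) y = exp (2 * \<sigma> y) * (2 * pd i \<sigma> y * walker A j k y + pd i (walker A j k) y)" for i j k
    unfolding g' pd_mult[OF e W] pe by (simp add: algebra_simps)
  have gi: "ginv g' y $ i $ j = walker_inv A i j y / exp (2 * \<sigma> y)" for i j
    using ginv_conformal[of "exp (2 * \<sigma> y)" g' y A] by (simp add: g')
  have inv: "(\<Sum>l\<in>UNIV. walker_inv A c l y * walker A b l y) = (if c = b then 1 else 0)" for b
  proof -
    have "(\<Sum>l\<in>UNIV. walker_inv A c l y * walker A l b y) = (if c = b then 1 else 0)"
      using walker_mult_inv(2)[of A y] by (simp add: gmat_def matrix_matrix_mult_def mat_def vec_eq_iff)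
    then show ?thesis by (simp add: Wsym[of b])
  qed
  have "levi_civita g' a b c y = (\<Sum>l\<in>UNIV. walker_inv A c l y * (pd a (walker A b l) y + pd b (walker A a l) y - pd l (walker A a b) y)) / 2
     + (pd a \<sigma> y * (\<Sum>l\<in>UNIV. walker_inv A c l y * walker A b l y) + pd b \<sigma> y * (\<Sum>l\<in>UNIV. walker_inv A c l y * walker A a l y)
       - walker A a b y * (\<Sum>l\<in>UNIV. walker_inv A c l y * pd l \<sigma> y))"
    unfolding levi_civita_def pg gi
    by (simp add: sum_distrib_left sum_divide_distrib sum.distrib[symmetric] sum_subtractf[symmetric])
      (rule sum.cong, simp, simp add: field_simps)
  also have "(\<Sum>l\<in>UNIV. walker_inv A c l y * (pd a (walker A b l) y + pd b (walker A a l) y - pd l (walker A a b) y)) / 2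
     = levi_civita (walker A) a b c y"
    by (simp add: levi_civita_def ginv_walker)
  finally show ?thesis unfolding inv by simp
qed

text \<open>Two components of the curvature of a conformally related metric already determine a second
  vertical derivative of the Walker coefficients.\<close>

lemma walker_conformally_flat:
  fixes A :: "2 \<Rightarrow> 2 \<Rightarrow> real^(2 + 2) \<Rightarrow> real"
  assumes V: "open V" "y \<in> V" and \<sigma>: "smooth_on V \<sigma>" and A: "\<And>i j. smooth_on V (A i j)"
    and sym: "\<And>i j y. y \<in> V \<Longrightarrow> A i j y = A j i y"
    and flat: "flat_on V (\<lambda>a b y. exp (2 * \<sigma> y) * walker A a b y)"
    and ij: "i \<noteq> j"
  shows "pd (Inr j) (pd (Inr j) (A i i)) y = 0"
proof -
  define g' where "g' = (\<lambda>a b y. exp (2 * \<sigma> y) * walker A a b y)"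
  \<comment> \<open>Sums run over i and j instead of 1 and 2, so that one computation serves both
    orders of the indices.\<close>
  have U2: "UNIV = {i, j}" using ij exhaust_2 by (auto; metis)
  have sum2: "(\<Sum>k\<in>UNIV. h k) = h i + h j" for h :: "2 \<Rightarrow> real"
    unfolding U2 using ij by simp
  have lc: "levi_civita g' a b c y = levi_civita (walker A) a b c y
     + (if b = c then pd a \<sigma> y else 0) + (if a = c then pd b \<sigma> y else 0)
     - walker A a b y * (\<Sum>l\<in>UNIV. walker_inv A c l y * pd l \<sigma> y)" if "y \<in> V" for a b c y
    by (rule levi_civita_conformal[OF _ _ sym g'_def]) (use \<sigma> A that smooth_on_differentiable in blast)+
  let ?s = "pd (Inr j) \<sigma>"
  have d: "pd a \<sigma> differentiable (at y)" "A k l differentiable (at y)" "pd a (A k l) differentiable (at y)" for a k l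
    using \<sigma> A V smooth_on_pd smooth_on_differentiable by blast+
  have G1: "levi_civita g' (Inr j) (Inl i) (Inl j) y = 0" if "y \<in> V" for y
    using ij that by (simp add: lc levi_civita_walker)
  have G2: "levi_civita g' (Inl i) (Inl i) (Inl j) y = - (1/2) * pd (Inr j) (A i i) y - A i i y * ?s y" if "y \<in> V" for y
    using ij that by (simp add: lc levi_civita_walker sum_UNIV_Plus sum2)
  have G3: "levi_civita g' (Inr j) (Inr i) (Inl j) y = 0" if "y \<in> V" for y
    using ij that by (simp add: lc levi_civita_walker)
  have G4: "levi_civita g' (Inl i) (Inr i) (Inl j) y = - ?s y" if "y \<in> V" for y
    using ij that by (simp add: lc levi_civita_walker sum_UNIV_Plus sum2)
  have G5: "levi_civita g' (Inl i) (Inr j) (Inl j) y = 0" "levi_civita g' (Inr j) (Inl j) (Inl j) y = 0"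
     "levi_civita g' (Inr j) (Inr j) (Inl j) y = 0" if "y \<in> V" for y
    using ij that by (simp_all add: lc levi_civita_walker sum_UNIV_Plus sum2)
  have G6: "levi_civita g' (Inr j) (Inl i) (Inl i) y = ?s y" "levi_civita g' (Inr j) (Inl i) (Inr i) y = 1/2 * pd (Inr j) (A i i) y"
    "levi_civita g' (Inr j) (Inr i) (Inr i) y = ?s y" "levi_civita g' (Inr j) (Inr i) (Inl i) y = 0" if "y \<in> V" for y
    using ij that by (simp_all add: lc levi_civita_walker sum_UNIV_Plus sum2)
  note G = G1[OF V(2)] G2[OF V(2)] G3[OF V(2)] G4[OF V(2)] G5[OF V(2)] G6[OF V(2)]
  have P: "pd a (levi_civita g' (Inr j) (Inl i) (Inl j)) y = 0" "pd a (levi_civita g' (Inr j) (Inr i) (Inl j)) y = 0"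
    "pd a (levi_civita g' (Inl i) (Inr i) (Inl j)) y = - pd a ?s y"
    "pd a (levi_civita g' (Inl i) (Inl i) (Inl j)) y = - (1/2) * pd a (pd (Inr j) (A i i)) y - (A i i y * pd a ?s y + pd a (A i i) y * ?s y)" for a
    subgoal by (subst pd_cong_open[OF V G1]) simp_all
    subgoal by (subst pd_cong_open[OF V G3]) simp_all
    subgoal by (subst pd_cong_open[OF V G4]) (simp_all add: pd_uminus d)
    subgoal by (subst pd_cong_open[OF V G2]) (simp_all only: pd_diff pd_cmult pd_mult d differentiable_mult differentiable_const)
    done
  \<comment> \<open>With s the derivative of \<sigma> along d_j', the first component is the Riccati
    equation d_j' s = s^2. Inserted into the second one it removes every term with \<sigma>, leaving
    half of the second vertical derivative of A_ii.\<close>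
  have "curvature (levi_civita g') (Inl i) (Inr j) (Inr i) (Inl j) y = 0"
    "curvature (levi_civita g') (Inl i) (Inr j) (Inl i) (Inl j) y = 0"
    using flat V(2) by (auto simp: flat_on_def g'_def)
  then have "pd (Inr j) ?s y = ?s y * ?s y"
    "1/2 * pd (Inr j) (pd (Inr j) (A i i)) y + A i i y * (pd (Inr j) ?s y - ?s y * ?s y) = 0"
    unfolding curvature_def P sum_UNIV_Plus sum2 G by (simp_all add: algebra_simps)
  then show ?thesis by simp
qed

context parallel_chart
begin

text \<open>The second derivative of A_ii along d_j' is 2 (T_i^j)^2. Conformal flatness would
  therefore make T diagonal, and a diagonal nilpotent matrix is zero.\<close>

lemma not_conformally_flat_at:
  assumes z: "z \<in> U" and T_ne: "\<exists>i k. T i k (base_part z) \<noteq> 0"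
    and V: "open V" "z \<in> V" "V \<subseteq> U" and \<sigma>: "smooth_on V \<sigma>"
  shows "\<not> flat_on V (\<lambda>a b y. exp (2 * \<sigma> y) * walker A a b y)"
proof
  assume flat: "flat_on V (\<lambda>a b y. exp (2 * \<sigma> y) * walker A a b y)"
  obtain w1 w2 s where T: "T 1 1 (base_part z) = - s * w1 * w2" "T 1 2 (base_part z) = s * w1\<^sup>2"
    "T 2 1 (base_part z) = - s * w2\<^sup>2" "T 2 2 (base_part z) = s * w1 * w2"
    using rank_one[OF base_part_mem[OF z]] by metis
  have "T i j (base_part z) = 0" if "i \<noteq> j" for i j
  proof -
    have "pd (Inr j) (pd (Inr j) (A i i)) z = 0"
      by (rule walker_conformally_flat[OF V(1,2) \<sigma> _ _ flat that])
        (use V(3) smooth_A smooth_on_subset A_sym in blast)+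
    then show ?thesis by (simp add: ppd_A(1)[OF z])
  qed
  from this[of 1 2] this[of 2 1] have "s = 0 \<or> w1 = 0" "s = 0 \<or> w2 = 0" by (auto simp: T)
  then have "T i k (base_part z) = 0" for i k
    using exhaust_2[of i] exhaust_2[of k] by (auto simp: T)
  then show False using T_ne by blast
qed

end

section \<open>Charts and transition maps\<close>

lemma chart_inv_snd: "is_chart c \<Longrightarrow> p \<in> fst c \<Longrightarrow> chart_inv c (snd c p) = p"
  by (simp add: chart_inv_def is_chart_def)

lemma transition_snd: "is_chart c \<Longrightarrow> p \<in> fst c \<Longrightarrow> transition c c' (snd c p) = snd c' p"
  by (simp add: transition_def chart_inv_snd)

lemma overlapE:
  assumes "x \<in> overlap c c'" "is_chart c"
  obtains p where "p \<in> fst c" "p \<in> fst c'" "x = snd c p" "transition c c' x = snd c' p"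
  using assms by (auto simp: overlap_def transition_snd)

lemma compatible_sym: "compatible c c' \<Longrightarrow> compatible c' c"
  by (auto simp: compatible_def)

lemma compatible_refl:
  assumes "is_chart c" shows "compatible c c"
proof -
  have "overlap c c = chart_image c" by (simp add: overlap_def chart_image_def)
  moreover have "open (chart_image c)" using assms by (simp add: is_chart_def)
  moreover have "smooth_on (chart_image c) (transition c c) \<longleftrightarrow> smooth_on (chart_image c) (\<lambda>x. x)"
    using calculation(2) by (rule smooth_on_cong) (use assms in \<open>auto simp: chart_image_def transition_snd\<close>)
  ultimately show ?thesis by (auto simp: compatible_def intro: smooth_on_linear bounded_linear_ident)
qed

lemma jac_nth:
  assumes "transition c c' differentiable (at x)"
  shows "jac c c' x $ a $ i = pd i (\<lambda>x. transition c c' x $ a) x"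
proof -
  have "((\<lambda>x. transition c c' x $ a) has_derivative (\<lambda>v. frechet_derivative (transition c c') (at x) v $ a)) (at x)"
    using assms unfolding frechet_derivative_works
    by (rule bounded_linear.has_derivative[OF bounded_linear_vec_nth])
  then show ?thesis by (simp add: has_derivative_pd jac_def matrix_def)
qed

lemma smooth_on_jac:
  assumes "compatible c c'"
  shows "smooth_on (overlap c c') (\<lambda>x. jac c c' x $ a $ i)"
proof -
  have o: "open (overlap c c')" and s: "smooth_on (overlap c c') (transition c c')"
    using assms by (auto simp: compatible_def)
  have "smooth_on (overlap c c') (pd i (\<lambda>x. transition c c' x $ a))"
    by (rule smooth_on_pd[OF smooth_on_vec_nth[OF o s]])
  then show ?thesis
    by (subst smooth_on_cong[OF o, where g = "pd i (\<lambda>x. transition c c' x $ a)"])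
      (auto simp: jac_nth smooth_on_differentiable[OF s])
qed

lemma pd_jac_commute:
  assumes "compatible c c'" "x \<in> overlap c c'"
  shows "pd i (\<lambda>y. jac c c' y $ a $ j) x = pd j (\<lambda>y. jac c c' y $ a $ i) x"
proof -
  have o: "open (overlap c c')" and s: "smooth_on (overlap c c') (transition c c')"
    using assms by (auto simp: compatible_def)
  have e: "jac c c' y $ a $ j = pd j (\<lambda>x. transition c c' x $ a) y" if "y \<in> overlap c c'" for y j
    by (rule jac_nth[OF smooth_on_differentiable[OF s that]])
  show ?thesis
    using pd_commute[OF o assms(2) smooth_on_vec_nth[OF o s]]
    by (subst (1 2) pd_cong_open[OF o assms(2) e]) auto
qed

text \<open>On the open set where both transitions from \<open>c\<close> are defined, the composed
  map and the direct transition agree, hence so do their derivatives.\<close>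

lemma jac_chain:
  assumes c: "is_chart c" "is_chart c'" and comp: "compatible c c'" "compatible c' c''" "compatible c c''"
    and p: "p \<in> fst c" "p \<in> fst c'" "p \<in> fst c''"
  shows "jac c' c'' (snd c' p) ** jac c c' (snd c p) = jac c c'' (snd c p)"
proof -
  let ?S = "overlap c c' \<inter> overlap c c''"
  have S: "open ?S" "snd c p \<in> ?S" using comp p by (auto simp: compatible_def overlap_def)
  have d1: "(transition c c' has_derivative frechet_derivative (transition c c') (at (snd c p))) (at (snd c p))"
    using comp(1) S(2) by (auto simp: compatible_def intro: smooth_on_has_derivative)
  have "snd c' p \<in> overlap c' c''" using p by (auto simp: overlap_def)
  then have d2: "(transition c' c'' has_derivative frechet_derivative (transition c' c'') (at (snd c' p))) (at (transition c c' (snd c p)))"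
    using comp(2) p c by (auto simp: compatible_def transition_snd intro: smooth_on_has_derivative)
  have der: "((\<lambda>x. transition c' c'' (transition c c' x)) has_derivative
      (\<lambda>v. frechet_derivative (transition c' c'') (at (snd c' p)) (frechet_derivative (transition c c') (at (snd c p)) v))) (at (snd c p))"
    by (rule has_derivative_compose[OF d1 d2])
  have eq: "transition c' c'' (transition c c' x) = transition c c'' x" if x: "x \<in> ?S" for x
  proof -
    obtain q where "q \<in> fst c" "q \<in> fst c'" "x = snd c q" "transition c c' x = snd c' q"
      using overlapE[OF IntD1[OF x] c(1)] by blast
    then show ?thesis using c by (simp add: transition_snd)
  qed
  have "(transition c c'' has_derivative
      (\<lambda>v. frechet_derivative (transition c' c'') (at (snd c' p)) (frechet_derivative (transition c c') (at (snd c p)) v))) (at (snd c p))"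
    using has_derivative_cong_open[OF S eq] der by simp
  from frechet_derivative_at[OF this]
  have fd: "frechet_derivative (transition c c'') (at (snd c p)) =
     frechet_derivative (transition c' c'') (at (snd c' p)) \<circ> frechet_derivative (transition c c') (at (snd c p))"
    by (simp add: o_def)
  have l1: "linear (frechet_derivative (transition c c') (at (snd c p)))"
    using d1 has_derivative_linear by blast
  have l2: "linear (frechet_derivative (transition c' c'') (at (snd c' p)))"
    using d2 has_derivative_linear by blast
  show ?thesis unfolding jac_def fd by (rule matrix_compose[OF l1 l2, symmetric])
qed

lemma jac_refl:
  assumes "is_chart c" "p \<in> fst c"
  shows "jac c c (snd c p) = mat 1"
proof -
  have o: "open (chart_image c)" using assms by (simp add: is_chart_def)
  have x: "snd c p \<in> chart_image c" using assms by (auto simp: chart_image_def)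
  have "frechet_derivative (transition c c) (at (snd c p)) = frechet_derivative (\<lambda>x. x) (at (snd c p))"
    by (rule frechet_derivative_cong_open[OF o x]) (use assms in \<open>auto simp: chart_image_def transition_snd\<close>)
  then show ?thesis by (simp add: jac_def matrix_id_mat_1[unfolded id_def])
qed

lemma jac_inverse:
  assumes "is_chart c" "is_chart c'" "compatible c c'" "p \<in> fst c" "p \<in> fst c'"
  shows "jac c' c (snd c' p) ** jac c c' (snd c p) = mat 1"
  using jac_chain[OF assms(1,2,3) compatible_sym[OF assms(3)] compatible_refl[OF assms(1)] assms(4,5,4)]
    jac_refl[OF assms(1,4)] by simp

context
  fixes M :: "('i, 'p, 'n::finite) atlas"
  assumes charts: "\<And>i. i \<in> index M \<Longrightarrow> is_chart (chart M i)"
begin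

text \<open>\<open>topology\<close> can be unfolded only for a family shown to be a topology.
  Stability under intersection uses that charts are injective.\<close>

lemma openin_atlas_topology:
  "openin (atlas_topology M) V \<longleftrightarrow> V \<subseteq> points M \<and> (\<forall>i\<in>index M. open (snd (chart M i) ` (fst (chart M i) \<inter> V)))"
proof -
  let ?L = "\<lambda>V. V \<subseteq> points M \<and> (\<forall>i\<in>index M. open (snd (chart M i) ` (fst (chart M i) \<inter> V)))"
  have "istopology ?L"
    unfolding istopology_def
  proof (intro conjI allI impI)
    fix S T assume ST: "?L S" "?L T"
    show "S \<inter> T \<subseteq> points M" using ST by auto
    show "\<forall>i\<in>index M. open (snd (chart M i) ` (fst (chart M i) \<inter> (S \<inter> T)))"
    proof
      fix i assume i: "i \<in> index M"
      have "snd (chart M i) ` (fst (chart M i) \<inter> (S \<inter> T)) =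
         snd (chart M i) ` (fst (chart M i) \<inter> S) \<inter> snd (chart M i) ` (fst (chart M i) \<inter> T)"
        using charts[OF i] unfolding is_chart_def
        by (subst inj_on_image_Int[symmetric, where C = "fst (chart M i)"]) (auto simp: Int_ac)
      then show "open (snd (chart M i) ` (fst (chart M i) \<inter> (S \<inter> T)))" using ST i by auto
    qed
  next
    fix K assume K: "\<forall>S\<in>K. ?L S"
    show "\<Union>K \<subseteq> points M" using K by auto
    show "\<forall>i\<in>index M. open (snd (chart M i) ` (fst (chart M i) \<inter> \<Union>K))"
    proof
      fix i assume i: "i \<in> index M"
      have "snd (chart M i) ` (fst (chart M i) \<inter> \<Union>K) = (\<Union>S\<in>K. snd (chart M i) ` (fst (chart M i) \<inter> S))" by auto
      then show "open (snd (chart M i) ` (fst (chart M i) \<inter> \<Union>K))" using K i by auto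
    qed
  qed
  then show ?thesis by (simp add: atlas_topology_def)
qed

lemma topspace_atlas_topology: "topspace (atlas_topology M) = points M"
proof
  show "topspace (atlas_topology M) \<subseteq> points M"
    using openin_topspace openin_atlas_topology by blast
  have "fst (chart M i) \<inter> points M = fst (chart M i)" if "i \<in> index M" for i
    using that by (auto simp: points_def)
  then have "openin (atlas_topology M) (points M)"
    using charts by (auto simp: openin_atlas_topology is_chart_def chart_image_def)
  then show "points M \<subseteq> topspace (atlas_topology M)" by (rule openin_subset)
qed

end

section \<open>Parallel tensor fields\<close>

text \<open>Near a zero, the maximum of the tensor over a small ball is at most half of itself.\<close>

lemma (in parallel_chart) parallel_zero_open:
  assumes x0: "x0 \<in> X" and zero: "\<And>a b. T a b x0 = 0"
  obtains r where "r > 0" "ball x0 r \<subseteq> X" "\<And>x a b. x \<in> ball x0 r \<Longrightarrow> T a b x = 0"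
proof -
  obtain r0 where r0: "r0 > 0" "cball x0 r0 \<subseteq> X" using open_X x0 open_contains_cball by blast
  define G where "G y = (\<Sum>i\<in>UNIV. \<Sum>j\<in>UNIV. \<Sum>k\<in>UNIV. \<bar>\<Gamma> i j k y\<bar>)" for y
  have cont\<Gamma>: "continuous_on S (\<Gamma> i j k)" "continuous_on S (T i j)" if "S \<subseteq> X" for S i j k
    using smooth_on_continuous[OF smooth_\<Gamma>] smooth_on_continuous[OF smooth_T] continuous_on_subset that by blast+
  have "continuous_on (cball x0 r0) G"
    unfolding G_def by (intro continuous_intros cont\<Gamma> r0)
  then obtain y0 where "\<forall>y\<in>cball x0 r0. G y \<le> G y0"
    using continuous_attains_sup[of "cball x0 r0" G] r0 by (auto simp: less_imp_le)
  then obtain K where K: "\<And>y. y \<in> cball x0 r0 \<Longrightarrow> G y \<le> K" "K \<ge> 0"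
    by (metis (no_types, lifting) G_def abs_ge_zero sum_nonneg)
  have \<Gamma>K: "\<bar>\<Gamma> i j k y\<bar> \<le> K" if "y \<in> cball x0 r0" for i j k y
  proof -
    have "\<bar>\<Gamma> i j k y\<bar> \<le> G y"
      unfolding G_def
      by (rule order_trans[OF member_le_sum[of k UNIV "\<lambda>k. \<bar>\<Gamma> i j k y\<bar>"] order_trans[OF
        member_le_sum[of j UNIV "\<lambda>j. \<Sum>k\<in>UNIV. \<bar>\<Gamma> i j k y\<bar>"] member_le_sum[of i UNIV "\<lambda>i. \<Sum>j\<in>UNIV. \<Sum>k\<in>UNIV. \<bar>\<Gamma> i j k y\<bar>"]]])
        (auto intro!: sum_nonneg)
    then show ?thesis using K(1)[OF that] by linarith
  qed
  define N where "N y = (\<Sum>a\<in>UNIV. \<Sum>b\<in>UNIV. \<bar>T a b y\<bar>)" for y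
  \<comment> \<open>64 = 8 * 4 * 2: each entry of T at m is at most 8 K N(m) r, there are four
    entries, and at most N(m) / 2 is to result. K + 1 keeps the denominator positive.\<close>
  define r where "r = min r0 (1 / (64 * (K + 1)))"
  have r: "r > 0" "r \<le> r0" "64 * K * r \<le> 1"
  proof -
    show "r > 0" "r \<le> r0" using r0 K(2) by (auto simp: r_def)
    have "64 * K * r \<le> 64 * (K + 1) * r" using \<open>r > 0\<close> by simp
    also have "\<dots> \<le> 64 * (K + 1) * (1 / (64 * (K + 1)))" using K(2) by (intro mult_left_mono) (auto simp: r_def)
    also have "\<dots> = 1" using K(2) by simp
    finally show "64 * K * r \<le> 1" .
  qed
  have sub: "cball x0 r \<subseteq> cball x0 r0" "cball x0 r \<subseteq> X" using r(2) r0(2) by auto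
  have "continuous_on (cball x0 r) N" unfolding N_def by (intro continuous_intros cont\<Gamma> sub)
  then obtain m where m: "m \<in> cball x0 r" "\<And>y. y \<in> cball x0 r \<Longrightarrow> N y \<le> N m"
    using continuous_attains_sup[of "cball x0 r" N] r(1) by (auto simp: less_imp_le)
  have TN: "\<bar>T a b y\<bar> \<le> N m" if "y \<in> cball x0 r" for a b y
  proof -
    have "\<bar>T a b y\<bar> \<le> N y" unfolding N_def
      by (rule order_trans[OF member_le_sum[of b UNIV "\<lambda>b. \<bar>T a b y\<bar>"]
        member_le_sum[of a UNIV "\<lambda>a. \<Sum>b\<in>UNIV. \<bar>T a b y\<bar>"]]) (auto intro!: sum_nonneg)
    then show ?thesis using m(2)[OF that] by linarith
  qed
  have Nm: "N m \<ge> 0" by (auto simp: N_def intro!: sum_nonneg)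
  \<comment> \<open>\<open>par_T\<close> consists of four products of an entry of \<Gamma> with an
    entry of T, each bounded by K N(m).\<close>
  have pdT: "\<bar>pd k (T a b) y\<bar> \<le> 4 * K * N m" if y: "y \<in> cball x0 r" for k a b y
  proof -
    have y': "y \<in> X" "y \<in> cball x0 r0" using y sub by auto
    have t1: "\<bar>\<Gamma> i j l y * T c d y\<bar> \<le> K * N m" for i j l c d
      unfolding abs_mult using \<Gamma>K[OF y'(2)] TN[OF y] K(2) Nm by (intro mult_mono) auto
    then have t: "\<bar>\<Gamma> i j l y * T c d y\<bar> \<le> K * N m" "\<bar>T c d y * \<Gamma> i j l y\<bar> \<le> K * N m" for i j l c d
      by (simp_all add: mult.commute[of "T c d y"])
    show ?thesis
      unfolding par_T[OF y'(1)] sum_2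
      using t(1)[of k a 1 1 b] t(1)[of k a 2 2 b] t(2)[of a 1 k 1 b] t(2)[of a 2 k 2 b] by (simp add: abs_le_iff)
  qed
  have Tm: "\<bar>T a b m\<bar> \<le> 8 * K * N m * r" for a b
  proof -
    have "norm (T a b m - T a b x0) \<le> (8 * K * N m) * norm (m - x0)"
    proof (rule differentiable_bound[OF convex_cball])
      fix y assume y: "y \<in> cball x0 r"
      then have yX: "y \<in> X" using sub by auto
      show "(T a b has_derivative (\<lambda>v. \<Sum>i\<in>UNIV. v $ i * pd i (T a b) y)) (at y within cball x0 r)"
        using has_derivative_via_pd[OF diff_X(2)[OF yX]] by (rule has_derivative_at_withinI)
      show "onorm (\<lambda>v. \<Sum>i\<in>UNIV. v $ i * pd i (T a b) y) \<le> 8 * K * N m"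
      proof (rule onorm_bound)
        show "0 \<le> 8 * K * N m" using K(2) Nm by simp
        fix v :: "real^2"
        have "\<bar>v $ i * pd i (T a b) y\<bar> \<le> norm v * (4 * K * N m)" for i
          unfolding abs_mult using pdT[OF y, of i a b] component_le_norm_cart[of v i] by (intro mult_mono) auto
        from this[of 1] this[of 2]
        show "norm (\<Sum>i\<in>UNIV. v $ i * pd i (T a b) y) \<le> 8 * K * N m * norm v"
          by (simp add: sum_2 abs_le_iff algebra_simps)
      qed
    qed (use m(1) r(1) in auto)
    also have "\<dots> \<le> (8 * K * N m) * r"
      using m(1) K(2) Nm by (intro mult_left_mono) (auto simp: dist_norm norm_minus_commute)
    finally show ?thesis by (simp add: zero)
  qed
  have "N m = \<bar>T 1 1 m\<bar> + \<bar>T 1 2 m\<bar> + (\<bar>T 2 1 m\<bar> + \<bar>T 2 2 m\<bar>)" by (simp add: N_def sum_2)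
  then have "N m \<le> 32 * K * N m * r" using Tm[of 1 1] Tm[of 1 2] Tm[of 2 1] Tm[of 2 2] by linarith
  also have "\<dots> = (64 * K * r) * N m / 2" by simp
  also have "\<dots> \<le> 1 * N m / 2" using r(3) Nm by (intro divide_right_mono mult_right_mono) auto
  finally have "N m = 0" using Nm by simp
  then have "T a b x = 0" if "x \<in> ball x0 r" for x a b using TN[of x a b] that by auto
  with r(1) sub show ?thesis by (intro that[of r]) (auto intro: subset_trans[OF ball_subset_cball])
qed

section \<open>The cotangent bundle\<close>

definition fibre_part :: "real^('n::finite + 'n) \<Rightarrow> real^'n" where
  "fibre_part z = (\<chi> k. z $ Inr k)"

lemma join_parts_base_fibre [simp]: "join_parts (base_part z) (fibre_part z) = z"
  by (auto simp: join_parts_def base_part_def fibre_part_def vec_eq_iff split: sum.split)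

lemma fibre_part_join_parts [simp]: "fibre_part (join_parts x p) = p"
  by (simp add: fibre_part_def)

locale cotangent_chart =
  fixes M :: "('i, 'p, 'n::finite) atlas"
  assumes charts: "\<And>i. i \<in> index M \<Longrightarrow> is_chart (chart M i)"
    and compat: "\<And>i j. i \<in> index M \<Longrightarrow> j \<in> index M \<Longrightarrow> compatible (chart M i) (chart M j)"
begin

abbreviation "cchart i \<equiv> chart (cotangent_bundle M) i"

lemma cot_fst: "(p, \<omega>) \<in> fst (cchart i) \<longleftrightarrow> p \<in> fst (chart M i) \<and> \<omega> \<in> cotangent_space M p"
  by (simp add: cotangent_bundle_def)

lemma cot_snd: "snd (cchart i) (p, \<omega>) = join_parts (snd (chart M i) p) (\<omega> i)"
  by (simp add: cotangent_bundle_def join_parts_def)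

lemma index_cotangent [simp]: "index (cotangent_bundle M) = index M"
  by (simp add: cotangent_bundle_def)

lemma covector_transform:
  assumes "\<omega> \<in> cotangent_space M p" "i \<in> index M" "j \<in> index M" "p \<in> fst (chart M i)" "p \<in> fst (chart M j)"
  shows "\<omega> j = transpose (jac (chart M j) (chart M i) (snd (chart M j) p)) *v \<omega> i"
  using assms unfolding cotangent_space_def by blast

lemma covector_zero:
  "\<omega> \<in> cotangent_space M p \<Longrightarrow> \<not> (i \<in> index M \<and> p \<in> fst (chart M i)) \<Longrightarrow> \<omega> i = 0"
  unfolding cotangent_space_def by blast

text \<open>A covector may be prescribed in one chart: its components elsewhere are forced by the
  transformation law, and the chain rule makes them consistent. Hence the induced charts cover
  entire coordinate fibres.\<close>

lemma covector_exists:
  assumes i: "i \<in> index M" "p \<in> fst (chart M i)"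
  obtains \<omega> where "\<omega> \<in> cotangent_space M p" "\<omega> i = v"
proof -
  let ?J = "\<lambda>j k. jac (chart M j) (chart M k) (snd (chart M j) p)"
  define \<omega> where "\<omega> j = (if j \<in> index M \<and> p \<in> fst (chart M j) then transpose (?J j i) *v v else 0)" for j
  have "\<omega> j = transpose (?J j k) *v \<omega> k"
    if "j \<in> index M" "k \<in> index M" "p \<in> fst (chart M j)" "p \<in> fst (chart M k)" for j k
  proof -
    have "?J k i ** ?J j k = ?J j i"
      using that i by (intro jac_chain charts compat)
    then have "transpose (?J j i) *v v = transpose (?J j k) *v (transpose (?J k i) *v v)"
      by (simp only: matrix_vector_mul_assoc matrix_transpose_mul[symmetric])
    then show ?thesis using that unfolding \<omega>_def by presburger
  qed
  moreover have "\<omega> j = 0" if "\<not> (j \<in> index M \<and> p \<in> fst (chart M j))" for j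
    using that by (simp only: \<omega>_def if_False)
  ultimately have "\<omega> \<in> cotangent_space M p" unfolding cotangent_space_def by blast
  moreover have "\<omega> i = v" using i by (simp add: \<omega>_def jac_refl[OF charts] transpose_mat)
  ultimately show ?thesis by (rule that)
qed

lemma inj_on_cot: "i \<in> index M \<Longrightarrow> inj_on (snd (cchart i)) (fst (cchart i))"
proof (rule inj_onI)
  fix u v assume i: "i \<in> index M" and uv: "u \<in> fst (cchart i)" "v \<in> fst (cchart i)" "snd (cchart i) u = snd (cchart i) v"
  obtain p \<omega> q \<eta> where u: "u = (p, \<omega>)" and v: "v = (q, \<eta>)" by (cases u; cases v)
  have p: "p \<in> fst (chart M i)" "q \<in> fst (chart M i)" "\<omega> \<in> cotangent_space M p" "\<eta> \<in> cotangent_space M q"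
    using uv by (auto simp: u v cot_fst)
  have e: "snd (chart M i) p = snd (chart M i) q" "\<omega> i = \<eta> i"
    using arg_cong[OF uv(3), of base_part] arg_cong[OF uv(3), of fibre_part] by (simp_all add: u v cot_snd)
  have pq: "p = q" using e(1) p charts[OF i] by (auto simp: is_chart_def inj_on_def)
  have "\<omega> j = \<eta> j" for j
  proof (cases "j \<in> index M \<and> p \<in> fst (chart M j)")
    case True
    then show ?thesis
      using covector_transform[OF p(3) i _ p(1), of j] covector_transform[OF p(4) i _ p(2), of j] e(2) pq by simp
  next
    case False
    then show ?thesis using covector_zero[OF p(3)] covector_zero[OF p(4)] pq by metis
  qed
  then show "u = v" by (simp add: u v pq fun_eq_iff)
qed

lemma chart_inv_cot: "i \<in> index M \<Longrightarrow> u \<in> fst (cchart i) \<Longrightarrow> chart_inv (cchart i) (snd (cchart i) u) = u"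
  by (simp add: chart_inv_def inv_into_f_f[OF inj_on_cot])

lemma cot_image:
  assumes i: "i \<in> index M"
  shows "snd (cchart i) ` (fst (cchart i) \<inter> {u. fst u \<in> S}) = {z. base_part z \<in> snd (chart M i) ` (fst (chart M i) \<inter> S)}"
proof (intro subset_antisym subsetI)
  fix z assume "z \<in> snd (cchart i) ` (fst (cchart i) \<inter> {u. fst u \<in> S})"
  then show "z \<in> {z. base_part z \<in> snd (chart M i) ` (fst (chart M i) \<inter> S)}"
    by (auto simp: cot_fst cot_snd)
next
  fix z assume "z \<in> {z. base_part z \<in> snd (chart M i) ` (fst (chart M i) \<inter> S)}"
  then obtain p where p: "p \<in> fst (chart M i)" "p \<in> S" "base_part z = snd (chart M i) p" by auto
  obtain \<omega> where "\<omega> \<in> cotangent_space M p" "\<omega> i = fibre_part z" using covector_exists[OF i p(1)] .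
  then have "(p, \<omega>) \<in> fst (cchart i) \<inter> {u. fst u \<in> S}" "z = snd (cchart i) (p, \<omega>)"
    using p by (simp_all add: cot_fst cot_snd flip: p(3))
  then show "z \<in> snd (cchart i) ` (fst (cchart i) \<inter> {u. fst u \<in> S})" by blast
qed

lemma chart_image_cot: "i \<in> index M \<Longrightarrow> chart_image (cchart i) = {z. base_part z \<in> chart_image (chart M i)}"
  using cot_image[of i UNIV] by (simp add: chart_image_def)

lemma overlap_cot:
  assumes "i \<in> index M" "j \<in> index M"
  shows "overlap (cchart i) (cchart j) = {z. base_part z \<in> overlap (chart M i) (chart M j)}"
proof -
  have "fst (cchart i) \<inter> fst (cchart j) = fst (cchart i) \<inter> {u. fst u \<in> fst (chart M j)}"
    by (auto simp: cot_fst)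
  then show ?thesis using cot_image[OF assms(1)] by (simp add: overlap_def)
qed

lemma local_rep_cot:
  assumes i: "i \<in> index M" and z: "z \<in> chart_image (cchart i)"
  shows "local_rep (cchart i) (h \<circ> fst) z = local_rep (chart M i) h (base_part z)"
proof -
  obtain p \<omega> where u: "(p, \<omega>) \<in> fst (cchart i)" "z = snd (cchart i) (p, \<omega>)"
    using z by (auto simp: chart_image_def)
  then show ?thesis
    using chart_inv_cot[OF i u(1)] chart_inv_snd[OF charts[OF i], of p]
    by (simp add: local_rep_def cot_fst cot_snd)
qed

context
  fixes i j
  assumes i: "i \<in> index M" and j: "j \<in> index M"
begin

abbreviation "tmap \<equiv> transition (chart M i) (chart M j)"

text \<open>The inverse Jacobian as a function of the source coordinates; new fibre coordinates are
  the sums over l of Km l a times the old ones.\<close>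

definition Km where "Km l a x = jac (chart M j) (chart M i) (tmap x) $ l $ a"

abbreviation "Jm a l x \<equiv> jac (chart M i) (chart M j) x $ a $ l"

lemma transition_cot:
  assumes z: "z \<in> overlap (cchart i) (cchart j)"
  shows "transition (cchart i) (cchart j) z = join_parts (tmap (base_part z)) (\<chi> a. \<Sum>l\<in>UNIV. Km l a (base_part z) * z $ Inr l)"
proof -
  obtain p \<omega> where u: "(p, \<omega>) \<in> fst (cchart i)" "(p, \<omega>) \<in> fst (cchart j)" "z = snd (cchart i) (p, \<omega>)"
    using z by (auto simp: overlap_def)
  have p: "p \<in> fst (chart M i)" "p \<in> fst (chart M j)" "\<omega> \<in> cotangent_space M p" using u by (auto simp: cot_fst)
  have y: "tmap (snd (chart M i) p) = snd (chart M j) p" by (rule transition_snd[OF charts[OF i] p(1)])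
  have "transition (cchart i) (cchart j) z = join_parts (snd (chart M j) p) (\<omega> j)"
  proof -
    have "chart_inv (cchart i) z = (p, \<omega>)" unfolding u(3) by (rule chart_inv_cot[OF i u(1)])
    then show ?thesis by (simp only: transition_def o_def cot_snd)
  qed
  then show ?thesis
    using covector_transform[OF p(3) i j p(1,2)]
    by (simp add: u(3) cot_snd y Km_def matrix_vector_mult_def transpose_def)
qed

lemma overlap_open: "open (overlap (chart M i) (chart M j))"
  using compat[OF i j] by (simp add: compatible_def)

lemma smooth_K: "smooth_on (overlap (chart M i) (chart M j)) (Km l a)"
proof -
  have "tmap ` overlap (chart M i) (chart M j) \<subseteq> overlap (chart M j) (chart M i)"
    using charts[OF i] by (auto elim!: overlapE simp: transition_snd) (auto simp: overlap_def)
  then show ?thesis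
    unfolding Km_def[abs_def] using compat[OF i j]
    by (intro smooth_on_compose[OF overlap_open _ _ _ smooth_on_jac[OF compatible_sym]]) (auto simp: compatible_def)
qed

lemma smooth_J: "smooth_on (overlap (chart M i) (chart M j)) (Jm a l)"
  by (rule smooth_on_jac[OF compat[OF i j]])

lemma K_J:
  assumes "x \<in> overlap (chart M i) (chart M j)"
  shows "(\<Sum>a\<in>UNIV. Km l a x * Jm a m x) = (if l = m then 1 else 0)"
proof -
  obtain p where p: "p \<in> fst (chart M i)" "p \<in> fst (chart M j)" "x = snd (chart M i) p" "tmap x = snd (chart M j) p"
    using overlapE[OF assms charts[OF i]] .
  have "jac (chart M j) (chart M i) (tmap x) ** jac (chart M i) (chart M j) x = mat 1"
    unfolding p(4) unfolding p(3) by (rule jac_inverse[OF charts[OF i] charts[OF j] compat[OF i j] p(1,2)])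
  then show ?thesis by (simp add: Km_def matrix_matrix_mult_def mat_def vec_eq_iff)
qed

text \<open>The derivative of K J = 1. It trades derivatives of the inverse Jacobian for the second
  derivatives of the transition map that occur in the connection law.\<close>

lemma pd_K_J:
  assumes x: "x \<in> overlap (chart M i) (chart M j)"
  shows "(\<Sum>a\<in>UNIV. pd n (Km l a) x * Jm a m x) = - (\<Sum>a\<in>UNIV. Km l a x * pd n (Jm a m) x)"
proof -
  have d: "Km l a differentiable (at x)" "Jm a m differentiable (at x)" for a
    using smooth_K smooth_J x smooth_on_differentiable by blast+
  have "pd n (\<lambda>x. \<Sum>a\<in>UNIV. Km l a x * Jm a m x) x = 0"
    by (subst pd_cong_open[OF overlap_open x K_J]) simp_all
  moreover have "pd n (\<lambda>x. \<Sum>a\<in>UNIV. Km l a x * Jm a m x) x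
      = (\<Sum>a\<in>UNIV. Km l a x * pd n (Jm a m) x) + (\<Sum>a\<in>UNIV. pd n (Km l a) x * Jm a m x)"
    by (subst pd_sum) (simp_all add: pd_mult d differentiable_mult sum.distrib)
  ultimately show ?thesis by simp
qed

lemma jac_cot:
  assumes z: "z \<in> overlap (cchart i) (cchart j)"
  shows "jac (cchart i) (cchart j) z $ Inl a $ Inl m = Jm a m (base_part z)"
    "jac (cchart i) (cchart j) z $ Inl a $ Inr m = 0"
    "jac (cchart i) (cchart j) z $ Inr a $ Inr m = Km m a (base_part z)"
    "jac (cchart i) (cchart j) z $ Inr a $ Inl m = (\<Sum>l\<in>UNIV. pd m (Km l a) (base_part z) * z $ Inr l)"
proof -
  let ?O = "overlap (cchart i) (cchart j)" and ?X = "overlap (chart M i) (chart M j)"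
  have O: "?O = {z. base_part z \<in> ?X}" by (rule overlap_cot[OF i j])
  have opO: "open ?O" unfolding O by (rule open_base_part_vimage[OF overlap_open])
  have x: "base_part z \<in> ?X" using z O by simp
  have sy: "smooth_on ?X tmap" using compat[OF i j] by (simp add: compatible_def)
  have s1: "smooth_on ?O (\<lambda>z. tmap (base_part z) $ a)" for a
    unfolding O by (rule smooth_on_base_part[OF overlap_open smooth_on_vec_nth[OF overlap_open sy]])
  have s2: "smooth_on ?O (\<lambda>z. Km l a (base_part z))" for l a
    unfolding O by (rule smooth_on_base_part[OF overlap_open smooth_K])
  have s2': "smooth_on ?O (\<lambda>z. z $ Inr l)" for l
    by (intro smooth_on_linear bounded_linear_vec_nth opO)
  have s3: "smooth_on ?O (\<lambda>z. \<Sum>l\<in>UNIV. Km l a (base_part z) * z $ Inr l)" for a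
    by (intro smooth_intros s2 s2' opO)
  have "smooth_on ?O (\<lambda>z. \<chi> b. (case b of Inl a \<Rightarrow> tmap (base_part z) $ a | Inr a \<Rightarrow> \<Sum>l\<in>UNIV. Km l a (base_part z) * z $ Inr l))"
  proof (rule smooth_on_vec[OF opO])
    show "smooth_on ?O (\<lambda>z. case b of Inl a \<Rightarrow> tmap (base_part z) $ a | Inr a \<Rightarrow> \<Sum>l\<in>UNIV. Km l a (base_part z) * z $ Inr l)" for b
      using s1 s3 by (cases b) simp_all
  qed
  moreover have "(\<lambda>z. \<chi> b. (case b of Inl a \<Rightarrow> tmap (base_part z) $ a | Inr a \<Rightarrow> \<Sum>l\<in>UNIV. Km l a (base_part z) * z $ Inr l)) =
      (\<lambda>z. join_parts (tmap (base_part z)) (\<chi> a. \<Sum>l\<in>UNIV. Km l a (base_part z) * z $ Inr l))"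
    by (auto simp: join_parts_def fun_eq_iff vec_eq_iff split: sum.split)
  ultimately have st: "smooth_on ?O (transition (cchart i) (cchart j))"
    by (subst smooth_on_cong[OF opO transition_cot]) simp_all
  have dt: "transition (cchart i) (cchart j) differentiable (at z)"
    by (rule smooth_on_differentiable[OF st z])
  have c1: "pd b (\<lambda>z. transition (cchart i) (cchart j) z $ Inl a) z = pd b (\<lambda>z. tmap (base_part z) $ a) z" for a b
    by (rule pd_cong_open[OF opO z]) (simp add: transition_cot)
  have c2: "pd b (\<lambda>z. transition (cchart i) (cchart j) z $ Inr a) z = pd b (\<lambda>z. \<Sum>l\<in>UNIV. Km l a (base_part z) * z $ Inr l) z" for a b
    by (rule pd_cong_open[OF opO z]) (simp add: transition_cot)
  have c3: "pd b (\<lambda>z. \<Sum>l\<in>UNIV. Km l a (base_part z) * z $ Inr l) z =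
     (\<Sum>l\<in>UNIV. Km l a (base_part z) * (if b = Inr l then 1 else 0) + pd b (\<lambda>z. Km l a (base_part z)) z * z $ Inr l)" for a b
    using smooth_on_differentiable[OF s2 z]
    by (subst pd_sum) (simp_all add: pd_mult pd_coordinate differentiable_mult)
  have jn: "jac (chart M i) (chart M j) (base_part z) $ a $ m = pd m (\<lambda>x. tmap x $ a) (base_part z)" for a m
    by (rule jac_nth[OF smooth_on_differentiable[OF sy x]])
  note b1 = pd_base_part[OF smooth_on_vec_nth[OF overlap_open sy] x]
  note b2 = pd_base_part[OF smooth_K x]
  show "jac (cchart i) (cchart j) z $ Inl a $ Inl m = Jm a m (base_part z)"
    "jac (cchart i) (cchart j) z $ Inl a $ Inr m = 0"
    "jac (cchart i) (cchart j) z $ Inr a $ Inr m = Km m a (base_part z)"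
    "jac (cchart i) (cchart j) z $ Inr a $ Inl m = (\<Sum>l\<in>UNIV. pd m (Km l a) (base_part z) * z $ Inr l)"
    by (simp_all add: jac_nth[OF dt] c1 c2 c3 jn b1 b2 if_mult_real)
qed

text \<open>The quadratic part is the square of the one-form iota T; as a product of two linear
  factors it can be transformed factor by factor.\<close>

lemma extension_coeff_product:
  "extension_coeff \<Gamma> \<Psi> T m n z =
     (\<Sum>r\<in>UNIV. z $ Inr r * T m r (base_part z)) * (\<Sum>r\<in>UNIV. z $ Inr r * T n r (base_part z))
     - 2 * (\<Sum>k\<in>UNIV. z $ Inr k * \<Gamma> m n k (base_part z)) + \<Psi> m n (base_part z)"
proof -
  let ?t = "\<lambda>m. \<Sum>r\<in>UNIV. z $ Inr r * T m r (base_part z)"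
  have "(\<Sum>r\<in>UNIV. \<Sum>s\<in>UNIV. z $ Inr r * z $ Inr s *
      (T m r (base_part z) * T n s (base_part z) + T n r (base_part z) * T m s (base_part z))) =
      (\<Sum>r\<in>UNIV. \<Sum>s\<in>UNIV. (z $ Inr r * T m r (base_part z)) * (z $ Inr s * T n s (base_part z))) +
      (\<Sum>r\<in>UNIV. \<Sum>s\<in>UNIV. (z $ Inr r * T n r (base_part z)) * (z $ Inr s * T m s (base_part z)))"
    by (simp add: sum.distrib[symmetric] algebra_simps)
  also have "\<dots> = ?t m * ?t n + ?t n * ?t m" by (simp only: sum_product)
  finally show ?thesis by (simp add: extension_coeff_def)
qed

text \<open>T and \<Psi> transform tensorially. The inhomogeneous term of the connection law enters
  through -2 p_k \<Gamma>_mn^k and is compensated by the derivatives of the new fibre coordinates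
  along the base, which enter through the pairing of dx^i with dx_i'.\<close>

lemma walker_extension_law:
  fixes \<Gamma> \<Gamma>' :: "'n field3" and T T' \<Psi> \<Psi>' :: "'n field2"
  assumes T: "tensor11_law (chart M i) (chart M j) T T'"
    and \<Gamma>: "connection_law (chart M i) (chart M j) \<Gamma> \<Gamma>'"
    and \<Psi>: "tensor02_law (chart M i) (chart M j) \<Psi> \<Psi>'"
  shows "tensor02_law (cchart i) (cchart j) (walker (extension_coeff \<Gamma> \<Psi> T)) (walker (extension_coeff \<Gamma>' \<Psi>' T'))"
  unfolding tensor02_law_def
proof (intro ballI allI)
  fix z a b assume z: "z \<in> overlap (cchart i) (cchart j)"
  define x where "x = base_part z"
  define z' where "z' = transition (cchart i) (cchart j) z"
  have x: "x \<in> overlap (chart M i) (chart M j)" using z by (simp add: overlap_cot[OF i j] x_def)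
  define q where "q a = (\<Sum>l\<in>UNIV. Km l a x * z $ Inr l)" for a
  define Q where "Q a m = (\<Sum>l\<in>UNIV. pd m (Km l a) x * z $ Inr l)" for a m
  have z': "base_part z' = tmap x" "z' $ Inr a = q a" for a
    by (simp_all add: z'_def transition_cot[OF z] x_def q_def)
  have jac: "jac (cchart i) (cchart j) z $ Inl a $ Inl m = Jm a m x" "jac (cchart i) (cchart j) z $ Inl a $ Inr m = 0"
    "jac (cchart i) (cchart j) z $ Inr a $ Inr m = Km m a x" "jac (cchart i) (cchart j) z $ Inr a $ Inl m = Q a m" for a m
    by (simp_all add: jac_cot[OF z] x_def Q_def)
  have qJ: "(\<Sum>a\<in>UNIV. q a * Jm a m x) = z $ Inr m" for m
  proof -
    have "(\<Sum>a\<in>UNIV. q a * Jm a m x) = (\<Sum>a\<in>UNIV. \<Sum>l\<in>UNIV. z $ Inr l * (Km l a x * Jm a m x))"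
      by (simp add: q_def sum_distrib_left sum_distrib_right mult_ac)
    also have "\<dots> = (\<Sum>l\<in>UNIV. z $ Inr l * (\<Sum>a\<in>UNIV. Km l a x * Jm a m x))"
      by (subst sum.swap) (simp add: sum_distrib_left)
    finally show ?thesis by (simp add: K_J[OF x] if_mult_real)
  qed
  \<comment> \<open>Each of the two mixed blocks contributes one such term; by symmetry of second
    derivatives they add up to the opposite of twice the last sum in
    \<open>\<Gamma>J\<close>.\<close>
  have QJ: "(\<Sum>a\<in>UNIV. Q a n * Jm a m x) = - (\<Sum>a\<in>UNIV. q a * pd n (Jm a m) x)" for m n
  proof -
    have "(\<Sum>a\<in>UNIV. Q a n * Jm a m x) = (\<Sum>a\<in>UNIV. \<Sum>l\<in>UNIV. z $ Inr l * (pd n (Km l a) x * Jm a m x))"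
      by (simp add: Q_def sum_distrib_left sum_distrib_right mult_ac)
    also have "\<dots> = (\<Sum>l\<in>UNIV. z $ Inr l * (\<Sum>a\<in>UNIV. pd n (Km l a) x * Jm a m x))"
      by (subst sum.swap) (simp add: sum_distrib_left)
    also have "\<dots> = (\<Sum>l\<in>UNIV. \<Sum>a\<in>UNIV. - (z $ Inr l * Km l a x * pd n (Jm a m) x))"
      by (simp add: pd_K_J[OF x] sum_distrib_left sum_negf mult_ac)
    also have "\<dots> = - (\<Sum>a\<in>UNIV. q a * pd n (Jm a m) x)"
      by (subst sum.swap) (simp add: q_def sum_distrib_left sum_distrib_right sum_negf mult_ac)
    finally show ?thesis .
  qed
  have tJ: "(\<Sum>a\<in>UNIV. (\<Sum>r\<in>UNIV. q r * T' a r (tmap x)) * Jm a m x) = (\<Sum>k\<in>UNIV. z $ Inr k * T m k x)" for m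
  proof -
    have T': "(\<Sum>b\<in>UNIV. Jm b m x * T' b r (tmap x)) = (\<Sum>k\<in>UNIV. T m k x * Jm r k x)" for r
      using T x by (simp add: tensor11_law_def)
    have "(\<Sum>a\<in>UNIV. (\<Sum>r\<in>UNIV. q r * T' a r (tmap x)) * Jm a m x) =
       (\<Sum>a\<in>UNIV. \<Sum>r\<in>UNIV. q r * (Jm a m x * T' a r (tmap x)))"
      by (simp add: sum_distrib_left sum_distrib_right mult_ac)
    also have "\<dots> = (\<Sum>r\<in>UNIV. q r * (\<Sum>a\<in>UNIV. Jm a m x * T' a r (tmap x)))"
      by (subst sum.swap) (simp add: sum_distrib_left)
    also have "\<dots> = (\<Sum>r\<in>UNIV. \<Sum>k\<in>UNIV. T m k x * (q r * Jm r k x))"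
      unfolding T' by (simp add: sum_distrib_left mult_ac)
    also have "\<dots> = (\<Sum>k\<in>UNIV. T m k x * (\<Sum>r\<in>UNIV. q r * Jm r k x))"
      by (subst sum.swap) (simp add: sum_distrib_left)
    finally show ?thesis by (simp add: qJ mult.commute)
  qed
  have \<Gamma>J: "(\<Sum>a\<in>UNIV. \<Sum>b\<in>UNIV. (\<Sum>c\<in>UNIV. q c * \<Gamma>' a b c (tmap x)) * Jm a m x * Jm b n x) =
     (\<Sum>k\<in>UNIV. z $ Inr k * \<Gamma> m n k x) - (\<Sum>c\<in>UNIV. q c * pd m (Jm c n) x)" for m n
  proof -
    have \<Gamma>': "(\<Sum>a\<in>UNIV. \<Sum>b\<in>UNIV. \<Gamma>' a b c (tmap x) * Jm a m x * Jm b n x) =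
       (\<Sum>k\<in>UNIV. \<Gamma> m n k x * Jm c k x) - pd m (Jm c n) x" for c
      using \<Gamma> x by (simp add: connection_law_def)
    have "(\<Sum>a\<in>UNIV. \<Sum>b\<in>UNIV. (\<Sum>c\<in>UNIV. q c * \<Gamma>' a b c (tmap x)) * Jm a m x * Jm b n x) =
      (\<Sum>a\<in>UNIV. \<Sum>b\<in>UNIV. \<Sum>c\<in>UNIV. q c * (\<Gamma>' a b c (tmap x) * Jm a m x * Jm b n x))"
      by (simp add: sum_distrib_left sum_distrib_right mult_ac)
    also have "\<dots> = (\<Sum>a\<in>UNIV. \<Sum>c\<in>UNIV. q c * (\<Sum>b\<in>UNIV. \<Gamma>' a b c (tmap x) * Jm a m x * Jm b n x))"
      by (rule sum.cong[OF refl], subst sum.swap, simp add: sum_distrib_left)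
    also have "\<dots> = (\<Sum>c\<in>UNIV. q c * (\<Sum>a\<in>UNIV. \<Sum>b\<in>UNIV. \<Gamma>' a b c (tmap x) * Jm a m x * Jm b n x))"
      by (subst sum.swap) (simp add: sum_distrib_left)
    also have "\<dots> = (\<Sum>c\<in>UNIV. \<Sum>k\<in>UNIV. \<Gamma> m n k x * (q c * Jm c k x)) - (\<Sum>c\<in>UNIV. q c * pd m (Jm c n) x)"
      unfolding \<Gamma>' by (simp add: right_diff_distrib sum_subtractf sum_distrib_left mult_ac)
    also have "(\<Sum>c\<in>UNIV. \<Sum>k\<in>UNIV. \<Gamma> m n k x * (q c * Jm c k x)) = (\<Sum>k\<in>UNIV. \<Gamma> m n k x * (\<Sum>c\<in>UNIV. q c * Jm c k x))"
      by (subst sum.swap) (simp add: sum_distrib_left)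
    finally show ?thesis by (simp add: qJ mult.commute)
  qed
  have \<Psi>J: "(\<Sum>a\<in>UNIV. \<Sum>b\<in>UNIV. \<Psi>' a b (tmap x) * Jm a m x * Jm b n x) = \<Psi> m n x" for m n
    using \<Psi> x by (simp add: tensor02_law_def)
  have delta: "(if P then 1 else 0) * a * b = (if P then a * b else 0)" for P and a b :: real by simp
  have pdJ: "pd n (Jm a m) x = pd m (Jm a n) x" for a m n
    by (rule pd_jac_commute[OF compat[OF i j] x])
  show "walker (extension_coeff \<Gamma> \<Psi> T) a b z = (\<Sum>c\<in>UNIV. \<Sum>d\<in>UNIV.
      walker (extension_coeff \<Gamma>' \<Psi>' T') c d (transition (cchart i) (cchart j) z) *
      jac (cchart i) (cchart j) z $ c $ a * jac (cchart i) (cchart j) z $ d $ b)"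
  proof (cases a; cases b)
    fix m n assume ab: "a = Inl m" "b = Inl n"
    let ?t = "\<lambda>a. \<Sum>r\<in>UNIV. q r * T' a r (tmap x)"
    let ?G = "\<lambda>a b. \<Sum>c\<in>UNIV. q c * \<Gamma>' a b c (tmap x)"
    have 1: "(\<Sum>c\<in>UNIV. \<Sum>d\<in>UNIV. extension_coeff \<Gamma>' \<Psi>' T' c d z' * Jm c m x * Jm d n x) =
       (\<Sum>c\<in>UNIV. ?t c * Jm c m x) * (\<Sum>d\<in>UNIV. ?t d * Jm d n x)
       - 2 * (\<Sum>c\<in>UNIV. \<Sum>d\<in>UNIV. ?G c d * Jm c m x * Jm d n x)
       + (\<Sum>c\<in>UNIV. \<Sum>d\<in>UNIV. \<Psi>' c d (tmap x) * Jm c m x * Jm d n x)"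
    proof -
      have "extension_coeff \<Gamma>' \<Psi>' T' c d z' * Jm c m x * Jm d n x =
        (?t c * Jm c m x) * (?t d * Jm d n x) - 2 * (?G c d * Jm c m x * Jm d n x) + \<Psi>' c d (tmap x) * Jm c m x * Jm d n x" for c d
        unfolding extension_coeff_product z' by (simp add: algebra_simps)
      then show ?thesis unfolding sum_product by (simp only: sum.distrib sum_subtractf sum_distrib_left)
    qed
    have 2: "(\<Sum>c\<in>UNIV. \<Sum>d\<in>UNIV. (if c = d then 1 else 0) * Jm c m x * Q d n) = (\<Sum>c\<in>UNIV. Q c n * Jm c m x)"
      "(\<Sum>c\<in>UNIV. \<Sum>d\<in>UNIV. (if c = d then 1 else 0) * Q c m * Jm d n x) = (\<Sum>c\<in>UNIV. Q c m * Jm c n x)"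
    proof -
      show "(\<Sum>c\<in>UNIV. \<Sum>d\<in>UNIV. (if c = d then 1 else 0) * Jm c m x * Q d n) = (\<Sum>c\<in>UNIV. Q c n * Jm c m x)"
        "(\<Sum>c\<in>UNIV. \<Sum>d\<in>UNIV. (if c = d then 1 else 0) * Q c m * Jm d n x) = (\<Sum>c\<in>UNIV. Q c m * Jm c n x)"
        unfolding delta by (simp_all add: mult.commute)
    qed
    have "(\<Sum>c\<in>UNIV. \<Sum>d\<in>UNIV. walker (extension_coeff \<Gamma>' \<Psi>' T') c d z' *
        jac (cchart i) (cchart j) z $ c $ Inl m * jac (cchart i) (cchart j) z $ d $ Inl n) =
      (\<Sum>c\<in>UNIV. \<Sum>d\<in>UNIV. extension_coeff \<Gamma>' \<Psi>' T' c d z' * Jm c m x * Jm d n x) +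
      (\<Sum>c\<in>UNIV. \<Sum>d\<in>UNIV. (if c = d then 1 else 0) * Jm c m x * Q d n) +
      (\<Sum>c\<in>UNIV. \<Sum>d\<in>UNIV. (if c = d then 1 else 0) * Q c m * Jm d n x)"
      unfolding sum_UNIV_Plus jac walker_simps by (simp add: sum.distrib)
    also have "\<dots> = extension_coeff \<Gamma> \<Psi> T m n z"
      unfolding 1 2 tJ \<Gamma>J \<Psi>J QJ extension_coeff_product[of \<Gamma>] pdJ[of n _ m] by (simp add: x_def)
    finally show ?thesis unfolding z'_def by (simp add: ab)
  next
    fix m n assume ab: "a = Inl m" "b = Inr n"
    have "(\<Sum>c\<in>UNIV. Jm c m x * Km n c x) = (if m = n then 1 else 0)"
      using K_J[OF x, of n m] by (auto simp: mult.commute)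
    then show ?thesis unfolding ab sum_UNIV_Plus jac walker_simps delta by simp
  next
    fix m n assume ab: "a = Inr m" "b = Inl n"
    show ?thesis unfolding ab sum_UNIV_Plus jac walker_simps delta
      using K_J[OF x, of m n] by simp
  next
    fix m n assume ab: "a = Inr m" "b = Inr n"
    show ?thesis unfolding ab sum_UNIV_Plus jac by simp
  qed
qed

end

end

lemma matrix_vector_inverse:
  fixes A B :: "real^'n::finite^'n"
  assumes "B ** A = mat 1" "A *v v = 0"
  shows "v = 0"
  using assms by (metis matrix_vector_mul_assoc matrix_vector_mul_lid matrix_vector_mult_0_right)

section \<open>Surfaces with a parallel nilpotent tensor field\<close>

locale parallel_surface =
  fixes M :: "('i, 'p, 2) atlas" and D :: "'i \<Rightarrow> 2 field3" and T \<Phi> :: "'i \<Rightarrow> 2 field2"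
  assumes surface: "affine_surface M D" and T_field: "tensor11_field M T" and nil: "nilpotent_field M T"
    and T_par: "parallel11 M D T" and \<Phi>_field: "tensor02_field M \<Phi>" and \<Phi>_sym: "symmetric_field M \<Phi>"
    and \<Phi>_par: "parallel02 M D \<Phi>" and ricci_symmetric: "symmetric_field M (\<lambda>i. ricci (D i))"
begin

lemma charts: "i \<in> index M \<Longrightarrow> is_chart (chart M i)"
  and compat: "i \<in> index M \<Longrightarrow> j \<in> index M \<Longrightarrow> compatible (chart M i) (chart M j)"
  using surface by (auto simp: affine_surface_def smooth_manifold_def)

sublocale cotangent_chart M
  by unfold_locales (rule charts compat; assumption)+

lemma parallel_chart_at:
  assumes i: "i \<in> index M"
  shows "parallel_chart (chart_image (chart M i)) (D i) (T i) (\<Phi> i)"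
proof
  show "open (chart_image (chart M i))" using charts[OF i] by (simp add: is_chart_def)
  show "smooth_on (chart_image (chart M i)) (D i a b k)" for a b k
    using surface i by (auto simp: affine_surface_def torsion_free_connection_def)
  show "smooth_on (chart_image (chart M i)) (T i a b)" for a b
    using T_field i by (auto simp: tensor11_field_def)
  show "smooth_on (chart_image (chart M i)) (\<Phi> i a b)" for a b
    using \<Phi>_field i by (auto simp: tensor02_field_def)
  fix x assume x: "x \<in> chart_image (chart M i)"
  show "D i a b k x = D i b a k x" for a b k
    using surface i x unfolding affine_surface_def torsion_free_connection_def by blast
  show "(\<Sum>k\<in>UNIV. T i a k x * T i k b x) = 0" for a b
    using nil i x by (auto simp: nilpotent_field_def)
  show "pd k (T i a b) x = (\<Sum>m\<in>UNIV. D i k a m x * T i m b x) - (\<Sum>m\<in>UNIV. T i a m x * D i k m b x)" for k a b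
  proof -
    have "pd k (T i a b) x + (\<Sum>m\<in>UNIV. T i a m x * D i k m b x) - (\<Sum>m\<in>UNIV. D i k a m x * T i m b x) = 0"
      using T_par i x unfolding parallel11_def by blast
    then show ?thesis by simp
  qed
  show "\<Phi> i a b x = \<Phi> i b a x" for a b
    using \<Phi>_sym i x unfolding symmetric_field_def by blast
  show "pd k (\<Phi> i a b) x = (\<Sum>m\<in>UNIV. D i k a m x * \<Phi> i m b x) + (\<Sum>m\<in>UNIV. D i k b m x * \<Phi> i a m x)" for k a b
  proof -
    have "pd k (\<Phi> i a b) x - (\<Sum>m\<in>UNIV. D i k a m x * \<Phi> i m b x) - (\<Sum>m\<in>UNIV. D i k b m x * \<Phi> i a m x) = 0"
      using \<Phi>_par i x unfolding parallel02_def by blast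
    then show ?thesis by simp
  qed
qed

lemma T_zero_transfer:
  assumes i: "i \<in> index M" and j: "j \<in> index M" and p: "p \<in> fst (chart M i)" "p \<in> fst (chart M j)"
    and zero: "\<And>a b. T i a b (snd (chart M i) p) = 0"
  shows "T j a b (snd (chart M j) p) = 0"
proof -
  let ?y = "snd (chart M j) p"
  let ?J = "jac (chart M j) (chart M i) ?y"
  have "?y \<in> overlap (chart M j) (chart M i)" using p by (auto simp: overlap_def)
  moreover have "transition (chart M j) (chart M i) ?y = snd (chart M i) p"
    using transition_snd[OF charts[OF j] p(2)] .
  ultimately have "(\<Sum>k\<in>UNIV. T j a k ?y * ?J $ c $ k) = 0" for c
    using T_field i j zero unfolding tensor11_field_def tensor11_law_def by simp
  then have "?J *v (\<chi> k. T j a k ?y) = 0"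
    by (simp add: matrix_vector_mult_def vec_eq_iff mult.commute)
  then have "(\<chi> k. T j a k ?y) = 0"
    by (rule matrix_vector_inverse[OF jac_inverse[OF charts[OF j] charts[OF i] compat[OF j i] p(2,1)]])
  then show ?thesis by (simp add: vec_eq_iff)
qed

text \<open>\<open>nilpotent_field\<close> provides one point with T \<noteq> 0. The zero set of T
  is open by \<open>parallel_zero_open\<close>, its complement is open by continuity, and the
  surface is connected.\<close>

lemma T_nonzero:
  assumes i: "i \<in> index M" and x: "x \<in> chart_image (chart M i)"
  shows "\<exists>a b. T i a b x \<noteq> 0"
proof (rule ccontr)
  assume contra: "\<not> (\<exists>a b. T i a b x \<noteq> 0)"
  define Z where "Z = {p. \<exists>i\<in>index M. p \<in> fst (chart M i) \<and> (\<forall>a b. T i a b (snd (chart M i) p) = 0)}"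
  define N where "N = {p. \<exists>i\<in>index M. p \<in> fst (chart M i) \<and> (\<exists>a b. T i a b (snd (chart M i) p) \<noteq> 0)}"
  have Z: "p \<in> Z \<longleftrightarrow> (\<forall>a b. T j a b (snd (chart M j) p) = 0)"
    and N: "p \<in> N \<longleftrightarrow> (\<exists>a b. T j a b (snd (chart M j) p) \<noteq> 0)"
    if "j \<in> index M" "p \<in> fst (chart M j)" for p j
    unfolding Z_def N_def using that T_zero_transfer by blast+
  have openin_iff: "openin (atlas_topology M) V \<longleftrightarrow>
      V \<subseteq> points M \<and> (\<forall>i\<in>index M. open (snd (chart M i) ` (fst (chart M i) \<inter> V)))" for V
    by (rule openin_atlas_topology) (rule charts)
  have topspace: "topspace (atlas_topology M) = points M"
    by (rule topspace_atlas_topology) (rule charts)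
  have "openin (atlas_topology M) Z"
    unfolding openin_iff
  proof (intro conjI ballI)
    show "Z \<subseteq> points M" by (auto simp: Z_def points_def)
    fix j assume j: "j \<in> index M"
    interpret pc: parallel_chart "chart_image (chart M j)" "D j" "T j" "\<Phi> j" by (rule parallel_chart_at[OF j])
    have "\<exists>e>0. ball y e \<subseteq> snd (chart M j) ` (fst (chart M j) \<inter> Z)" if y: "y \<in> snd (chart M j) ` (fst (chart M j) \<inter> Z)" for y
    proof -
      obtain p where p: "p \<in> fst (chart M j)" "p \<in> Z" "y = snd (chart M j) p" using y by auto
      then have zero: "T j a b y = 0" for a b using Z[OF j p(1)] by simp
      have "y \<in> chart_image (chart M j)" using p by (auto simp: chart_image_def)
      then obtain r where r: "r > 0" "ball y r \<subseteq> chart_image (chart M j)" "\<And>x a b. x \<in> ball y r \<Longrightarrow> T j a b x = 0"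
        using pc.parallel_zero_open[OF _ zero] by metis
      have "ball y r \<subseteq> snd (chart M j) ` (fst (chart M j) \<inter> Z)"
      proof
        fix u assume u: "u \<in> ball y r"
        then obtain q where q: "q \<in> fst (chart M j)" "u = snd (chart M j) q" using r(2) by (auto simp: chart_image_def)
        then have "q \<in> Z" using Z[OF j q(1)] r(3)[OF u] by simp
        with q show "u \<in> snd (chart M j) ` (fst (chart M j) \<inter> Z)" by auto
      qed
      with r(1) show ?thesis by auto
    qed
    then show "open (snd (chart M j) ` (fst (chart M j) \<inter> Z))" by (simp add: open_contains_ball)
  qed
  moreover have "openin (atlas_topology M) N"
    unfolding openin_iff
  proof (intro conjI ballI)
    show "N \<subseteq> points M" by (auto simp: N_def points_def)
    fix j assume j: "j \<in> index M"
    interpret pc: parallel_chart "chart_image (chart M j)" "D j" "T j" "\<Phi> j" by (rule parallel_chart_at[OF j])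
    have "snd (chart M j) ` (fst (chart M j) \<inter> N) = (\<Union>a. \<Union>b. chart_image (chart M j) \<inter> T j a b -` (- {0}))"
    proof (intro subset_antisym subsetI)
      fix u assume "u \<in> snd (chart M j) ` (fst (chart M j) \<inter> N)"
      then obtain p where p: "p \<in> fst (chart M j)" "p \<in> N" "u = snd (chart M j) p" by auto
      then show "u \<in> (\<Union>a. \<Union>b. chart_image (chart M j) \<inter> T j a b -` (- {0}))"
        using N[OF j p(1)] by (auto simp: chart_image_def)
    next
      fix u assume "u \<in> (\<Union>a. \<Union>b. chart_image (chart M j) \<inter> T j a b -` (- {0}))"
      then obtain p a b where p: "p \<in> fst (chart M j)" "u = snd (chart M j) p" "T j a b u \<noteq> 0" by (auto simp: chart_image_def)
      then have "p \<in> N" using N[OF j p(1)] by auto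
      then show "u \<in> snd (chart M j) ` (fst (chart M j) \<inter> N)" using p by auto
    qed
    moreover have "open (\<Union>a. \<Union>b. chart_image (chart M j) \<inter> T j a b -` (- {0}))"
      by (intro open_UN ballI continuous_open_preimage[OF smooth_on_continuous[OF pc.smooth_T] pc.open_X]) auto
    ultimately show "open (snd (chart M j) ` (fst (chart M j) \<inter> N))" by (simp only:)
  qed
  moreover have "topspace (atlas_topology M) \<subseteq> Z \<union> N"
    unfolding topspace points_def Z_def N_def by auto
  moreover have "Z \<inter> N = {}" using Z N by (auto simp: Z_def)
  moreover have "Z \<noteq> {}" using i x contra by (auto simp: Z_def chart_image_def)
  moreover have "N \<noteq> {}"
    using nil unfolding nilpotent_field_def N_def chart_image_def by blast
  moreover have "connected_space (atlas_topology M)" using surface by (simp add: affine_surface_def)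
  ultimately show False unfolding connected_space_def by blast
qed

section \<open>Reduction of the equivalence to single charts\<close>

abbreviation "g \<equiv> modified_riemann_extension D (hat_field T \<Phi>) T"

context
  fixes i assumes i: "i \<in> index M"
begin

interpretation pc: parallel_chart "chart_image (chart M i)" "D i" "T i" "\<Phi> i"
  by (rule parallel_chart_at[OF i])

lemma g_walker: "g i = walker (parallel_chart.A (D i) (T i) (\<Phi> i))"
proof -
  have "hat_field T \<Phi> i = pc.\<Psi>" by (simp add: fun_eq_iff hat_field_def pc.\<Psi>_def)
  then show ?thesis by (simp add: modified_riemann_extension_walker pc.A_def)
qed

lemma chart_image_cot_U: "chart_image (cchart i) = parallel_chart.U (chart_image (chart M i))"
  by (simp add: chart_image_cot[OF i] pc.U_def)

lemma ricci_sym_at: "x \<in> chart_image (chart M i) \<Longrightarrow> ricci (D i) 1 2 x = ricci (D i) 2 1 x"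
  using ricci_symmetric i unfolding symmetric_field_def by blast

context
  fixes h assumes h: "smooth_function M h"
begin

lemma smooth_h: "smooth_on (chart_image (chart M i)) (local_rep (chart M i) h)"
  using h i by (simp add: smooth_function_def)

lemma smooth_lift: "smooth_on (chart_image (cchart i)) (local_rep (cchart i) (h \<circ> fst))"
proof -
  have "smooth_on (chart_image (cchart i)) (\<lambda>z. local_rep (chart M i) h (base_part z))"
    unfolding chart_image_cot[OF i] by (rule smooth_on_base_part[OF pc.open_X smooth_h])
  then show ?thesis
    by (subst smooth_on_cong[OF _ local_rep_cot[OF i]]) (simp_all add: chart_image_cot_U pc.open_U)
qed

text \<open>The two functions are known to agree only inside the chart image, so first and second
  derivatives are compared by agreement on an open set.\<close>

lemma hessian_lift:
  assumes "z \<in> chart_image (cchart i)"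
  shows "hessian \<Gamma> (local_rep (cchart i) (h \<circ> fst)) a b z = hessian \<Gamma> (\<lambda>z. local_rep (chart M i) h (base_part z)) a b z"
proof -
  have o: "open (chart_image (cchart i))" by (simp add: chart_image_cot_U pc.open_U)
  have 1: "pd k (local_rep (cchart i) (h \<circ> fst)) y = pd k (\<lambda>z. local_rep (chart M i) h (base_part z)) y"
    if "y \<in> chart_image (cchart i)" for k y
    by (rule pd_cong_open[OF o that local_rep_cot[OF i]])
  have 2: "pd l (pd k (local_rep (cchart i) (h \<circ> fst))) z = pd l (pd k (\<lambda>z. local_rep (chart M i) h (base_part z))) z" for k l
    by (rule pd_cong_open[OF o assms 1])
  show ?thesis by (simp add: hessian_def 1[OF assms] 2)
qed

text \<open>The common local form of both sides of the equivalence: the affine soliton equation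
  together with dh o T = 0.\<close>

definition affine_at where
  "affine_at \<longleftrightarrow> (\<forall>x\<in>chart_image (chart M i).
     (\<forall>a b. hessian (D i) (local_rep (chart M i) h) a b x + 2 * ricci_sym (D i) a b x = 0) \<and>
     (\<forall>a. (\<Sum>k\<in>UNIV. T i a k x * pd k (local_rep (chart M i) h) x) = 0))"

lemma steady_iff_affine:
  "(\<forall>z\<in>chart_image (cchart i). \<forall>a b.
     hessian (levi_civita (g i)) (local_rep (cchart i) (h \<circ> fst)) a b z + ricci (levi_civita (g i)) a b z = 0) \<longleftrightarrow> affine_at"
  using pc.soliton_iff[OF smooth_h T_nonzero[OF i]]
  unfolding affine_at_def chart_image_cot_U[symmetric] g_walker
  by (simp add: hessian_lift)

lemma kernel_at:
  "(\<forall>x\<in>chart_image (chart M i). \<forall>v :: real^2. (\<forall>k. (\<Sum>a\<in>UNIV. v $ a * T i a k x) = 0) \<longrightarrow>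
        (\<Sum>a\<in>UNIV. v $ a * pd a (local_rep (chart M i) h) x) = 0) \<longleftrightarrow>
   (\<forall>x\<in>chart_image (chart M i). \<forall>a. (\<Sum>k\<in>UNIV. T i a k x * pd k (local_rep (chart M i) h) x) = 0)"
  by (rule ball_cong[OF refl]) (rule pc.kernel_condition[OF _ T_nonzero[OF i]])

lemma anti_self_dual_chart:
  assumes affine_at and z: "z \<in> chart_image (cchart i)" and B: "self_dual (g i) 1 z B"
  shows "weyl_operator (g i) z B = 0"
proof -
  have zU: "z \<in> pc.U" using z by (simp add: chart_image_cot_U)
  then have x: "base_part z \<in> chart_image (chart M i)" by (simp add: pc.U_def)
  have "pc.codazzi k (base_part z) = 0" for k
    by (rule pc.codazzi_of_soliton[OF smooth_h T_nonzero[OF i] ricci_sym_at _ _ x])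
      (use assms(1) in \<open>auto simp: affine_at_def\<close>)
  then show ?thesis
    using pc.anti_self_dual_at[OF zU T_nonzero[OF i x] ricci_sym_at[OF x]] B by (simp add: g_walker)
qed

end

lemma not_flat_chart:
  assumes z: "z \<in> chart_image (cchart i)" and V: "open V" "z \<in> V" "V \<subseteq> chart_image (cchart i)" "smooth_on V \<sigma>"
  shows "\<not> flat_on V (\<lambda>a b y. exp (2 * \<sigma> y) * g i a b y)"
proof -
  have zU: "z \<in> pc.U" using z by (simp add: chart_image_cot_U)
  then have x: "base_part z \<in> chart_image (chart M i)" by (simp add: pc.U_def)
  show ?thesis
    unfolding g_walker using V by (intro pc.not_conformally_flat_at[OF zU T_nonzero[OF i x]]) (simp_all add: chart_image_cot_U)
qed

lemma smooth_g: "smooth_on (chart_image (cchart i)) (g i a b)"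
  unfolding g_walker chart_image_cot_U using pc.smooth_A by (cases a; cases b) simp_all

lemma symmetric_g: "z \<in> chart_image (cchart i) \<Longrightarrow> g i a b z = g i b a z"
  unfolding g_walker chart_image_cot_U using pc.A_sym by (cases a; cases b) auto

end

lemma hat_field_law:
  assumes i: "i \<in> index M" and j: "j \<in> index M"
  shows "tensor02_law (chart M i) (chart M j) (hat_field T \<Phi> i) (hat_field T \<Phi> j)"
  unfolding tensor02_law_def
proof (intro ballI allI)
  fix x a b assume x: "x \<in> overlap (chart M i) (chart M j)"
  let ?y = "transition (chart M i) (chart M j) x" and ?J = "jac (chart M i) (chart M j) x"
  have T: "(\<Sum>b\<in>UNIV. ?J $ b $ m * T j b r ?y) = (\<Sum>k\<in>UNIV. T i m k x * ?J $ r $ k)" for m r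
    using T_field i j x by (simp add: tensor11_field_def tensor11_law_def)
  have \<Phi>: "\<Phi> i k l x = (\<Sum>r\<in>UNIV. \<Sum>s\<in>UNIV. \<Phi> j r s ?y * ?J $ r $ k * ?J $ s $ l)" for k l
    using \<Phi>_field i j x unfolding tensor02_field_def tensor02_law_def by blast
  have "(\<Sum>c\<in>UNIV. \<Sum>d\<in>UNIV. hat_field T \<Phi> j c d ?y * ?J $ c $ a * ?J $ d $ b) =
    (\<Sum>r\<in>UNIV. \<Sum>s\<in>UNIV. (\<Sum>c\<in>UNIV. ?J $ c $ a * T j c r ?y) * (\<Sum>d\<in>UNIV. ?J $ d $ b * T j d s ?y) * \<Phi> j r s ?y)"
    by (simp add: hat_field_def sum_2 algebra_simps)
  also have "\<dots> = hat_field T \<Phi> i a b x"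
    unfolding T hat_field_def \<Phi> by (simp add: sum_2 algebra_simps)
  finally show "hat_field T \<Phi> i a b x = (\<Sum>c\<in>UNIV. \<Sum>d\<in>UNIV. hat_field T \<Phi> j c d ?y * ?J $ c $ a * ?J $ d $ b)" ..
qed

lemma metric_g: "pseudo_Riemannian_metric (cotangent_bundle M) g"
proof -
  have "tensor02_law (cchart i) (cchart j) (g i) (g j)" if "i \<in> index M" "j \<in> index M" for i j
    unfolding modified_riemann_extension_walker
  proof (rule walker_extension_law[OF that _ _ hat_field_law[OF that]])
    show "tensor11_law (chart M i) (chart M j) (T i) (T j)" using T_field that by (simp add: tensor11_field_def)
    show "connection_law (chart M i) (chart M j) (D i) (D j)"
      using surface that by (simp add: affine_surface_def torsion_free_connection_def)
  qed
  then show ?thesis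
    unfolding pseudo_Riemannian_metric_def tensor02_field_def symmetric_field_def
    using smooth_g symmetric_g by (auto simp: modified_riemann_extension_walker invertible_walker)
qed

text \<open>The affine side and the steady soliton equation both amount to \<open>affine_at\<close>
  in every chart, by \<open>kernel_at\<close> and \<open>steady_iff_affine\<close>.
  Anti-self-duality is then derived from \<open>affine_at\<close>, and the failure of conformal
  flatness from T \<noteq> 0.\<close>

theorem soliton_equivalence:
  assumes h: "smooth_function M h" and orn: "cotangent_orientation M g orn"
  shows "affine_gradient_Ricci_soliton M D h \<and> differential_vanishes_on_kernel M T h \<longleftrightarrow>
           anti_self_dual (cotangent_bundle M) g orn \<and>
           steady_gradient_Ricci_soliton (cotangent_bundle M) g (h \<circ> fst) \<and>
           \<not> locally_conformally_flat (cotangent_bundle M) g"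
proof -
  have L: "affine_gradient_Ricci_soliton M D h \<and> differential_vanishes_on_kernel M T h \<longleftrightarrow> (\<forall>i\<in>index M. affine_at i h)"
    unfolding affine_gradient_Ricci_soliton_def differential_vanishes_on_kernel_def
    using h by (auto simp: kernel_at affine_at_def)
  have R: "steady_gradient_Ricci_soliton (cotangent_bundle M) g (h \<circ> fst) \<longleftrightarrow> (\<forall>i\<in>index M. affine_at i h)"
    unfolding gradient_Ricci_soliton_def
    using metric_g smooth_lift[OF _ h] steady_iff_affine[OF _ h]
    by (simp add: smooth_function_def)
  have "anti_self_dual (cotangent_bundle M) g orn" if aff: "\<forall>i\<in>index M. affine_at i h"
    unfolding anti_self_dual_def
  proof (intro ballI allI impI)
    fix i z B assume i: "i \<in> index (cotangent_bundle M)" and z: "z \<in> chart_image (cchart i)" and B: "self_dual (g i) (orn i z) z B"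
    \<comment> \<open>The fibre coordinate directions are the test vectors by which
      \<open>cotangent_orientation\<close> forces the sign 1.\<close>
    let ?u = "axis (Inr 1) 1 :: real^(2 + 2)" and ?v = "axis (Inr 2) 1 :: real^(2 + 2)"
    have "vertical ?u" "vertical ?v" by (simp_all add: vertical_def)
    moreover have "?u \<noteq> ?v" by (simp add: axis_eq_axis)
    moreover have "independent {?u, ?v}"
      by (rule independent_mono[OF independent_Basis]) (auto simp: axis_in_Basis_iff)
    ultimately have "self_dual (g i) (orn i z) z (wedge ?u ?v)"
      using orn i z unfolding cotangent_orientation_def by simp
    then have "orn i z = 1"
      using i by (simp add: g_walker self_dual_vertical_sign)
    with B show "weyl_operator (g i) z B = 0"
      using anti_self_dual_chart[OF _ h _ z] aff i by simp
  qed
  moreover have "\<not> locally_conformally_flat (cotangent_bundle M) g"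
  proof
    assume lcf: "locally_conformally_flat (cotangent_bundle M) g"
    obtain i x where i: "i \<in> index M" and x: "x \<in> chart_image (chart M i)"
      using nil unfolding nilpotent_field_def by blast
    have z: "join_parts x 0 \<in> chart_image (cchart i)" using x by (simp add: chart_image_cot[OF i])
    show False
      using lcf i z not_flat_chart[OF i z] unfolding locally_conformally_flat_def by fastforce
  qed
  ultimately show ?thesis using L R by blast
qed

end

section \<open>Adapted coordinates\<close>

definition vec2 :: "real \<Rightarrow> real \<Rightarrow> real^2" where
  "vec2 s t = (\<chi> i. if i = 1 then s else t)"

lemma vec2_nth [simp]: "vec2 s t $ 1 = s" "vec2 s t $ 2 = t"
  by (simp_all add: vec2_def)

lemma smooth_on_vec2:
  assumes "open S" "smooth_on S f" "smooth_on S g"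
  shows "smooth_on S (\<lambda>x. vec2 (f x) (g x))"
  unfolding vec2_def
proof (rule smooth_on_vec[OF assms(1)])
  show "smooth_on S (\<lambda>x. if i = 1 then f x else g x)" for i :: 2
    using assms by (cases "i = 1") auto
qed

lemma pd_compose:
  fixes F :: "real^'m::finite \<Rightarrow> real" and g :: "real^'n::finite \<Rightarrow> real^'m"
  assumes g: "g differentiable (at x)" and F: "F differentiable (at (g x))"
  shows "pd i (\<lambda>x. F (g x)) x = (\<Sum>a\<in>UNIV. pd a F (g x) * pd i (\<lambda>x. g x $ a) x)"
proof -
  have g': "(g has_derivative frechet_derivative g (at x)) (at x)"
    using g by (simp add: frechet_derivative_works)
  have "pd i (\<lambda>x. g x $ a) x = frechet_derivative g (at x) (axis i 1) $ a" for a
    using has_derivative_pd[OF bounded_linear.has_derivative[OF bounded_linear_vec_nth g']] .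
  moreover have "pd i (\<lambda>x. F (g x)) x = frechet_derivative F (at (g x)) (frechet_derivative g (at x) (axis i 1))"
    using has_derivative_pd[OF has_derivative_compose[OF g' F[unfolded frechet_derivative_works]]] .
  ultimately show ?thesis
    by (simp add: frechet_derivative_pd[OF F] mult.commute)
qed

lemma box_subset_open:
  fixes c :: "real^2"
  assumes "open W" "c \<in> W"
  obtains a b where "c \<in> box a b" "box a b \<subseteq> W"
proof -
  obtain e where e: "e > 0" "ball c e \<subseteq> W" using assms open_contains_ball by blast
  then show ?thesis using rational_boxes[of e c] that by blast
qed

lemma mem_box_2: "(w::real^2) \<in> box a b \<longleftrightarrow> a $ 1 < w $ 1 \<and> w $ 1 < b $ 1 \<and> a $ 2 < w $ 2 \<and> w $ 2 < b $ 2"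
  by (auto simp: mem_box_cart forall_2)

lemma constant_second_coordinate:
  fixes g :: "real^2 \<Rightarrow> real"
  assumes g: "smooth_on (box a b) g" and zero: "\<And>w. w \<in> box a b \<Longrightarrow> pd 2 g w = 0"
    and w: "w \<in> box a b" and c: "c \<in> box a b"
  shows "g w = g (vec2 (w $ 1) (c $ 2))"
proof -
  let ?p = "\<lambda>t. vec2 (w $ 1) (c $ 2) + t *\<^sub>R vec2 0 (w $ 2 - c $ 2)"
  have inb: "?p t \<in> box a b" if "0 \<le> t" "t \<le> 1" for t
  proof -
    have "c $ 2 + t * (w $ 2 - c $ 2) = (1 - t) * c $ 2 + t * w $ 2" by (simp add: algebra_simps)
    moreover have "convex {a $ 2 <..< b $ 2}" by (rule convex_real_interval)
    ultimately have "c $ 2 + t * (w $ 2 - c $ 2) \<in> {a $ 2 <..< b $ 2}"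
      using w c that convexD[of "{a $ 2 <..< b $ 2}" "c $ 2" "w $ 2" "1 - t" t] by (simp add: mem_box_2)
    then show ?thesis using w by (simp add: mem_box_2)
  qed
  have d: "((\<lambda>t. g (?p t)) has_real_derivative 0) (at t)" if "0 \<le> t" "t \<le> 1" for t
  proof -
    have "((\<lambda>t. ?p t) has_derivative (\<lambda>h. h *\<^sub>R vec2 0 (w $ 2 - c $ 2))) (at t)"
      by (auto intro!: derivative_eq_intros)
    from has_derivative_compose[OF this smooth_on_has_derivative[OF g inb[OF that]]]
    have "((\<lambda>t. g (?p t)) has_derivative (\<lambda>h. 0)) (at t)"
      by (simp add: frechet_derivative_pd[OF smooth_on_differentiable[OF g inb[OF that]]] sum_2 zero[OF inb[OF that]])
    then show ?thesis
      unfolding has_field_derivative_def by (rule has_derivative_eq_rhs) (simp add: fun_eq_iff)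
  qed
  have "g (?p 1) - g (?p 0) = 0"
    using MVT2[of 0 1 "\<lambda>t. g (?p t)" "\<lambda>t. 0"] d by fastforce
  moreover have "?p 1 = w" "?p 0 = vec2 (w $ 1) (c $ 2)" by (simp_all add: vec_eq_iff forall_2)
  ultimately show ?thesis by simp
qed

lemma smooth_on_real_deriv:
  fixes k :: "real \<Rightarrow> real"
  assumes "open J" "smooth_on J k"
  shows "smooth_on J (deriv k)" "\<And>t. t \<in> J \<Longrightarrow> (k has_real_derivative deriv k t) (at t)"
proof -
  have *: "(k has_real_derivative frechet_derivative k (at t) 1) (at t)" if "t \<in> J" for t
  proof -
    have "frechet_derivative k (at t) h = frechet_derivative k (at t) 1 * h" for h
      using linear_cmul[OF linear_frechet_derivative[OF smooth_on_differentiable[OF assms(2) that]], of h 1] by simp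
    then show ?thesis
      unfolding has_field_derivative_def
      by (intro has_derivative_eq_rhs[OF smooth_on_has_derivative[OF assms(2) that]] ext)
  qed
  then have e: "deriv k t = frechet_derivative k (at t) 1" if "t \<in> J" for t
    using that by (simp add: DERIV_imp_deriv)
  show "smooth_on J (deriv k)"
    by (subst smooth_on_cong[OF assms(1) e]) (simp_all add: smooth_on_frechet[OF assms(2)])
  show "(k has_real_derivative deriv k t) (at t)" if "t \<in> J" for t
    using *[OF that] e[OF that] by simp
qed

lemma pd_compose_real:
  fixes k :: "real \<Rightarrow> real" and v :: "real^'n::finite \<Rightarrow> real"
  assumes "open J" "smooth_on J k" "v x \<in> J" "v differentiable (at x)"
  shows "pd i (\<lambda>x. k (v x)) x = deriv k (v x) * pd i v x"
  using has_derivative_pd[OF has_derivative_compose[OF assms(4)[unfolded frechet_derivative_works]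
      smooth_on_real_deriv(2)[OF assms(1,2,3), unfolded has_field_derivative_def]]]
  by (simp add: pd_def)

section \<open>Factorisation of T into a parallel one-form and a parallel vector field\<close>

context parallel_chart
begin

lemma T_product:
  assumes "x \<in> X"
  shows "T i m x * T l k x = T i k x * T l m x"
proof -
  obtain w1 w2 s where T: "T 1 1 x = - s * w1 * w2" "T 1 2 x = s * w1\<^sup>2" "T 2 1 x = - s * w2\<^sup>2" "T 2 2 x = s * w1 * w2"
    using rank_one[OF assms] by metis
  have "\<forall>i m l k. T i m x * T l k x = T i k x * T l m x"
    by (simp add: forall_2 T power2_eq_square)
  then show ?thesis by blast
qed

text \<open>Near x0 some entry T_l^\<kappa> is nonzero. The column T_i^\<kappa>, read as a one-form,
  has covariant derivative -\<theta>_j T_i^\<kappa>. The form \<theta> is closed, so a factor exp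
  \<phi> with d\<phi> = \<theta> makes the column parallel, hence closed by torsion-freeness, hence
  exact.\<close>

lemma parallel_one_form:
  assumes x0: "x0 \<in> X" and T_ne: "\<And>x. x \<in> X \<Longrightarrow> \<exists>i k. T i k x \<noteq> 0"
    and ric: "\<And>x. x \<in> X \<Longrightarrow> ricci \<Gamma> 1 2 x = ricci \<Gamma> 2 1 x"
  obtains r v V \<kappa> where "r > 0" "ball x0 r \<subseteq> X" "smooth_on (ball x0 r) v" "\<And>m. smooth_on (ball x0 r) (V m)"
    "\<And>i m x. x \<in> ball x0 r \<Longrightarrow> pd i v x * V m x = T i m x"
    "\<And>x. x \<in> ball x0 r \<Longrightarrow> V \<kappa> x \<noteq> 0" "\<And>x. x \<in> ball x0 r \<Longrightarrow> \<exists>i. pd i v x \<noteq> 0"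
    "\<And>i j x. x \<in> ball x0 r \<Longrightarrow> pd j (pd i v) x = (\<Sum>m\<in>UNIV. \<Gamma> j i m x * pd m v x)"
    "\<And>j m x. x \<in> ball x0 r \<Longrightarrow> pd j (V m) x = - (\<Sum>n\<in>UNIV. \<Gamma> j n m x * V n x)"
proof -
  obtain l \<kappa> where l\<kappa>: "T l \<kappa> x0 \<noteq> 0" using T_ne[OF x0] by blast
  have "open (X \<inter> T l \<kappa> -` (- {0}))"
    by (rule continuous_open_preimage[OF smooth_on_continuous[OF smooth_T] open_X]) auto
  moreover have inv: "x0 \<in> X \<inter> T l \<kappa> -` (- {0})" using x0 l\<kappa> by simp
  ultimately obtain r where r: "r > 0" "ball x0 r \<subseteq> X \<inter> T l \<kappa> -` (- {0})"
    using inv unfolding open_contains_ball by blast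
  let ?B = "ball x0 r"
  have BX: "x \<in> X" and b: "T l \<kappa> x \<noteq> 0" if "x \<in> ?B" for x using r(2) that by auto
  have sub: "?B \<subseteq> X" using r by auto
  have sT: "smooth_on ?B (T i j)" "smooth_on ?B (\<Gamma> i j k)" for i j k
    using smooth_T smooth_\<Gamma> smooth_on_subset[OF _ sub] by blast+
  \<comment> \<open>Row i of T is T_i^\<kappa> / T_l^\<kappa> times row l, so the term T_i^m
    \<Gamma>_jm^\<kappa> of \<open>par_T\<close> equals \<theta>_j T_i^\<kappa> with the same
    \<theta> for all i.\<close>
  define \<theta> where "\<theta> j x = (\<Sum>m\<in>UNIV. \<Gamma> j m \<kappa> x * T l m x) / T l \<kappa> x" for j x
  have s\<theta>: "smooth_on ?B (\<theta> j)" for j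
    unfolding \<theta>_def by (intro smooth_intros open_ball sT b)
  have d\<omega>0: "pd j (T i \<kappa>) x = (\<Sum>m\<in>UNIV. \<Gamma> j i m x * T m \<kappa> x) - T i \<kappa> x * \<theta> j x" if "x \<in> ?B" for i j x
  proof -
    have e: "T i m x = T i \<kappa> x * T l m x / T l \<kappa> x" for m
      using T_product[OF BX[OF that], of i m l \<kappa>] b[OF that] by (simp add: field_simps)
    have "(\<Sum>m\<in>UNIV. T i m x * \<Gamma> j m \<kappa> x) = (\<Sum>m\<in>UNIV. T i \<kappa> x * T l m x / T l \<kappa> x * \<Gamma> j m \<kappa> x)"
      by (intro sum.cong refl arg_cong[where f = "\<lambda>u. u * _"] e)
    also have "\<dots> = T i \<kappa> x * \<theta> j x"
      unfolding \<theta>_def by (simp add: sum_2 add_divide_distrib algebra_simps)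
    finally show ?thesis by (simp add: par_T[OF BX[OF that]])
  qed
  have dif: "T i j differentiable (at x)" "\<Gamma> i j k differentiable (at x)" "\<theta> j differentiable (at x)" if "x \<in> ?B" for i j k x
    using sT s\<theta> that smooth_on_differentiable by blast+
  have closed: "pd i (\<theta> j) x = pd j (\<theta> i) x" if x: "x \<in> ?B" for i j x
  proof -
    have second: "pd n (pd j (T l \<kappa>)) x = pd n (\<lambda>x. (\<Sum>m\<in>UNIV. \<Gamma> j l m x * T m \<kappa> x) - T l \<kappa> x * \<theta> j x) x" for n j
      by (rule pd_cong_open[OF open_ball x d\<omega>0])
    have t: "pd n (pd j (T l \<kappa>)) x = (\<Sum>m\<in>UNIV. pd n (\<Gamma> j l m) x * T m \<kappa> x + \<Gamma> j l m x * pd n (T m \<kappa>) x)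
        - (pd n (T l \<kappa>) x * \<theta> j x + T l \<kappa> x * pd n (\<theta> j) x)" for n j
      unfolding second sum_2 using dif[OF x]
      by (simp add: pd_diff pd_add pd_mult differentiable_add differentiable_mult)
    have "T l \<kappa> x * (pd 1 (\<theta> 2) x - pd 2 (\<theta> 1) x) = (\<Sum>m\<in>UNIV. curvature \<Gamma> 1 2 l m x * T m \<kappa> x)"
      using pd_commute[OF open_ball x sT(1)[of l \<kappa>], of 1 2] unfolding t
      by (simp add: d\<omega>0[OF x] curvature_def sum_2 algebra_simps)
    \<comment> \<open>The curvature is a multiple of T, so it annihilates the column by T^2 =
      0.\<close>
    also have "\<dots> = 0"
    proof -
      obtain c where "\<And>i k. curvature \<Gamma> 1 2 i k x = c * T i k x"
        using curvature_multiple[OF BX[OF x] T_ne[OF BX[OF x]] ric[OF BX[OF x]]] by metis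
      then show ?thesis using T_sq[OF BX[OF x], of l \<kappa>] by (simp add: mult.assoc flip: sum_distrib_left)
    qed
    finally have "pd 1 (\<theta> 2) x = pd 2 (\<theta> 1) x" using b[OF x] by simp
    then show ?thesis using exhaust_2[of i] exhaust_2[of j] by auto
  qed
  obtain \<phi> where \<phi>: "smooth_on ?B \<phi>" "\<And>i x. x \<in> ?B \<Longrightarrow> pd i \<phi> x = \<theta> i x"
    using poincare_lemma_ball[of x0 r \<theta>, OF s\<theta> closed] by blast
  define \<omega> where "\<omega> i x = exp (\<phi> x) * T i \<kappa> x" for i x
  have s\<omega>: "smooth_on ?B (\<omega> i)" for i unfolding \<omega>_def by (intro smooth_intros open_ball \<phi> sT)
  have d\<omega>: "pd j (\<omega> i) x = (\<Sum>m\<in>UNIV. \<Gamma> j i m x * \<omega> m x)" if x: "x \<in> ?B" for i j x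
  proof -
    have df: "\<phi> differentiable (at x)" using smooth_on_differentiable[OF \<phi>(1) x] .
    have "(\<lambda>x. exp (\<phi> x)) differentiable (at x)"
      by (rule smooth_on_differentiable[OF smooth_on_exp[OF open_ball \<phi>(1)] x])
    then show ?thesis
      unfolding \<omega>_def by (simp add: pd_mult dif[OF x] pd_exp[OF df] \<phi>(2)[OF x] d\<omega>0[OF x] sum_2 algebra_simps)
  qed
  have "pd i (\<omega> j) x = pd j (\<omega> i) x" if "x \<in> ?B" for i j x
    by (simp add: d\<omega>[OF that] sym_\<Gamma>[OF BX[OF that], of i j])
  then obtain v where v: "smooth_on ?B v" "\<And>i x. x \<in> ?B \<Longrightarrow> pd i v x = \<omega> i x"
    using poincare_lemma_ball[of x0 r \<omega>, OF s\<omega>] by blast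
  \<comment> \<open>The scaling is dictated by \<omega>_i V^m = T_i^m; V inherits parallelism from
    this factorisation.\<close>
  define V where "V m x = exp (- \<phi> x) * T l m x / T l \<kappa> x" for m x
  have sV: "smooth_on ?B (V m)" for m
    unfolding V_def by (intro smooth_intros open_ball \<phi> sT b)
  have \<omega>V: "\<omega> i x * V m x = T i m x" if "x \<in> ?B" for i m x
    using T_product[OF BX[OF that], of i m l \<kappa>] b[OF that]
    by (simp add: \<omega>_def V_def field_simps exp_minus)
  have \<omega>l: "\<omega> l x \<noteq> 0" if "x \<in> ?B" for x using b[OF that] by (simp add: \<omega>_def)
  have dV: "pd j (V m) x = - (\<Sum>n\<in>UNIV. \<Gamma> j n m x * V n x)" if x: "x \<in> ?B" for j m x
  proof -
    have "pd j (T l m) x = pd j (\<lambda>x. \<omega> l x * V m x) x"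
      by (rule pd_cong_open[OF open_ball x]) (simp add: \<omega>V)
    also have "\<dots> = \<omega> l x * pd j (V m) x + pd j (\<omega> l) x * V m x"
      by (rule pd_mult) (use s\<omega> sV x smooth_on_differentiable in blast)+
    finally have "\<omega> l x * (pd j (V m) x + (\<Sum>n\<in>UNIV. \<Gamma> j n m x * V n x)) = 0"
      unfolding par_T[OF BX[OF x]] d\<omega>[OF x] \<omega>V[OF x, symmetric] sum_2 by (simp add: algebra_simps)
    then show ?thesis using \<omega>l[OF x] by (simp add: eq_neg_iff_add_eq_0)
  qed
  show ?thesis
  proof (rule that[of r v V \<kappa>])
    show "pd j (pd i v) x = (\<Sum>m\<in>UNIV. \<Gamma> j i m x * pd m v x)" if "x \<in> ?B" for i j x
    proof -
      have "pd j (pd i v) x = pd j (\<omega> i) x" by (rule pd_cong_open[OF open_ball that v(2)])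
      then show ?thesis using d\<omega>[OF that] v(2)[OF that] by simp
    qed
    show "V \<kappa> x \<noteq> 0" if "x \<in> ?B" for x using b[OF that] by (simp add: V_def)
    show "\<exists>i. pd i v x \<noteq> 0" if "x \<in> ?B" for x using v(2)[OF that] \<omega>l[OF that] by metis
  qed (use r sub v sV \<omega>V dV in auto)
qed

end

text \<open>In the coordinates (v, x^\<kappa>) the field V, tangent to the levels of v, is
  V^\<kappa> times the second coordinate field. A solution of V(\<eta>) = 1 is therefore a primitive
  of 1 / V^\<kappa> in the second coordinate.\<close>

lemma flow_coordinate:
  fixes v :: "real^2 \<Rightarrow> real"
  assumes B: "open B" "x0 \<in> B" and v: "smooth_on B v" and V: "\<And>m. smooth_on B (V m)"
    and vV: "(\<Sum>i\<in>UNIV. pd i v x0 * V i x0) = 0" "\<And>x. x \<in> B \<Longrightarrow> (\<Sum>i\<in>UNIV. pd i v x * V i x) = 0"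
    and V0: "\<And>x. x \<in> B \<Longrightarrow> V \<kappa> x \<noteq> 0" and dv: "\<exists>i. pd i v x0 \<noteq> 0"
  obtains U \<eta> where "open U" "x0 \<in> U" "U \<subseteq> B" "smooth_on U \<eta>"
    "\<And>x. x \<in> U \<Longrightarrow> (\<Sum>i\<in>UNIV. pd i \<eta> x * V i x) = 1"
proof -
  define F where "F x = vec2 (v x) (x $ \<kappa>)" for x
  have nth: "F x $ 1 = v x" "F x $ 2 = x $ \<kappa>" for x by (simp_all add: F_def)
  have sF: "smooth_on B F"
    unfolding F_def by (intro smooth_on_vec2 B v smooth_on_linear bounded_linear_vec_nth)
  have "pd 1 (\<lambda>x. F x $ 1) x0 * pd 2 (\<lambda>x. F x $ 2) x0 - pd 2 (\<lambda>x. F x $ 1) x0 * pd 1 (\<lambda>x. F x $ 2) x0 \<noteq> 0"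
  proof -
    obtain i where "pd i v x0 \<noteq> 0" using dv by blast
    then have "pd 1 v x0 \<noteq> 0 \<or> pd 2 v x0 \<noteq> 0" using exhaust_2[of i] by auto
    then show ?thesis
      using vV(1) V0[OF B(2)] exhaust_2[of \<kappa>] by (auto simp: nth pd_coordinate sum_2)
  qed
  from smooth_local_inverse_2[OF sF B this]
  obtain U W G where G: "open U" "x0 \<in> U" "U \<subseteq> B" "open W" "F ` U = W" "G ` W = U"
    "\<And>x. x \<in> U \<Longrightarrow> G (F x) = x" "\<And>y. y \<in> W \<Longrightarrow> F (G y) = y" "smooth_on W G" by blast
  obtain a b where ab: "F x0 \<in> box a b" "box a b \<subseteq> W"
    using box_subset_open[OF G(4)] G(2,5) by blast
  have sG: "smooth_on (box a b) G" by (rule smooth_on_subset[OF G(9) ab(2)])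
  have GB: "G ` box a b \<subseteq> B" using ab(2) G(3,6) by blast
  have s: "smooth_on (box a b) (\<lambda>w. 1 / V \<kappa> (G w))"
    using GB V0 by (intro smooth_intros open_box smooth_on_compose[OF open_box B(1) GB sG V]) auto
  obtain H where H: "smooth_on (box a b) H" "\<And>w. w \<in> box a b \<Longrightarrow> pd 2 H w = 1 / V \<kappa> (G w)"
  proof (rule primitive_second_coordinate[OF s open_box convex_box(2), of "F x0"])
    fix w and t :: real assume w: "w \<in> box a b" and t: "t \<in> {0..1}"
    have "F x0 $ 2 + t * (w $ 2 - F x0 $ 2) = (1 - t) * F x0 $ 2 + t * w $ 2" by (simp add: algebra_simps)
    then have "F x0 $ 2 + t * (w $ 2 - F x0 $ 2) \<in> {a $ 2 <..< b $ 2}"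
      using w ab(1) t convex_real_interval convexD[of "{a $ 2 <..< b $ 2}" "F x0 $ 2" "w $ 2" "1 - t" t]
      by (simp add: mem_box_2)
    then show "(\<chi> i. if i = 1 then w $ 1 else F x0 $ 2 + t * (w $ 2 - F x0 $ 2)) \<in> box a b"
      using w by (simp add: mem_box_2)
  qed blast
  define U' where "U' = U \<inter> F -` box a b"
  have U': "open U'" "U' \<subseteq> B"
    unfolding U'_def using G(3)
    by (auto intro!: continuous_open_preimage smooth_on_continuous smooth_on_subset[OF sF] G(1))
  have sF': "smooth_on U' F" by (rule smooth_on_subset[OF sF U'(2)])
  show ?thesis
  proof (rule that[of U' "\<lambda>x. H (F x)"])
    show "x0 \<in> U'" using G(2) ab(1) by (simp add: U'_def)
    show "smooth_on U' (\<lambda>x. H (F x))"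
      by (rule smooth_on_compose[OF U'(1) open_box _ sF' H(1)]) (auto simp: U'_def)
    fix x assume x: "x \<in> U'"
    then have F: "F x \<in> box a b" "G (F x) = x" "x \<in> B" using U'(2) G(7) by (auto simp: U'_def)
    have "pd i (\<lambda>x. H (F x)) x = pd 1 H (F x) * pd i v x + 1 / V \<kappa> x * (if i = \<kappa> then 1 else 0)" for i
      by (subst pd_compose[OF smooth_on_differentiable[OF sF' x] smooth_on_differentiable[OF H(1) F(1)]])
        (simp add: sum_2 nth pd_coordinate H(2)[OF F(1)] F(2))
    then have "(\<Sum>i\<in>UNIV. pd i (\<lambda>x. H (F x)) x * V i x) =
        pd 1 H (F x) * (\<Sum>i\<in>UNIV. pd i v x * V i x) + 1 / V \<kappa> x * (\<Sum>i\<in>UNIV. (if i = \<kappa> then 1 else 0) * V i x)"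
      by (simp add: sum_2 algebra_simps)
    also have "\<dots> = 1" using vV(2)[OF F(3)] V0[OF F(3)] exhaust_2[of \<kappa>] by (auto simp: sum_2)
    finally show "(\<Sum>i\<in>UNIV. pd i (\<lambda>x. H (F x)) x * V i x) = 1" .
  qed (use U' in auto)
qed

text \<open>The formula for V is Cramer's rule applied to V(v) = 0 and V(\<eta>) = 1. Shrinking the
  image to a box makes the level lines of v intervals, on which functions annihilated by V are
  constant.\<close>

lemma (in parallel_chart) adapted_chart:
  assumes x0: "x0 \<in> X" and T_ne: "\<And>x. x \<in> X \<Longrightarrow> \<exists>i k. T i k x \<noteq> 0"
    and ric: "\<And>x. x \<in> X \<Longrightarrow> ricci \<Gamma> 1 2 x = ricci \<Gamma> 2 1 x"
  obtains U a b v \<eta> G d V where "open U" "x0 \<in> U" "U \<subseteq> X" "smooth_on U v" "smooth_on U \<eta>"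
    "(\<lambda>x. vec2 (v x) (\<eta> x)) ` U = box a b" "G ` box a b = U" "\<And>x. x \<in> U \<Longrightarrow> G (vec2 (v x) (\<eta> x)) = x"
    "\<And>y. y \<in> box a b \<Longrightarrow> vec2 (v (G y)) (\<eta> (G y)) = y" "smooth_on (box a b) G"
    "\<And>x. x \<in> U \<Longrightarrow> d x = pd 1 v x * pd 2 \<eta> x - pd 2 v x * pd 1 \<eta> x"
    "\<And>x. x \<in> U \<Longrightarrow> d x \<noteq> 0" "\<And>x. x \<in> U \<Longrightarrow> V 1 x = - pd 2 v x / d x" "\<And>x. x \<in> U \<Longrightarrow> V 2 x = pd 1 v x / d x"
    "\<And>i m x. x \<in> U \<Longrightarrow> pd i v x * V m x = T i m x" "\<And>m. smooth_on U (V m)"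
    "\<And>i j x. x \<in> U \<Longrightarrow> pd j (pd i v) x = (\<Sum>m\<in>UNIV. \<Gamma> j i m x * pd m v x)"
    "\<And>j m x. x \<in> U \<Longrightarrow> pd j (V m) x = - (\<Sum>n\<in>UNIV. \<Gamma> j n m x * V n x)"
proof -
  obtain r v V \<kappa> where r: "r > 0" "ball x0 r \<subseteq> X" "smooth_on (ball x0 r) v" "\<And>m. smooth_on (ball x0 r) (V m)"
    "\<And>i m x. x \<in> ball x0 r \<Longrightarrow> pd i v x * V m x = T i m x"
    "\<And>x. x \<in> ball x0 r \<Longrightarrow> V \<kappa> x \<noteq> 0" "\<And>x. x \<in> ball x0 r \<Longrightarrow> \<exists>i. pd i v x \<noteq> 0"
    "\<And>i j x. x \<in> ball x0 r \<Longrightarrow> pd j (pd i v) x = (\<Sum>m\<in>UNIV. \<Gamma> j i m x * pd m v x)"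
    "\<And>j m x. x \<in> ball x0 r \<Longrightarrow> pd j (V m) x = - (\<Sum>n\<in>UNIV. \<Gamma> j n m x * V n x)"
    by (rule parallel_one_form[OF x0 T_ne ric]) (assumption | rule that; assumption)+
  \<comment> \<open>For T = dv \<otimes> V the relation T^2 = 0 says dv(V) T = 0, and T does not
    vanish.\<close>
  have vV: "(\<Sum>i\<in>UNIV. pd i v x * V i x) = 0" if x: "x \<in> ball x0 r" for x
  proof -
    obtain j where j: "pd j v x \<noteq> 0" using r(7)[OF x] by blast
    have "pd j v x * V \<kappa> x * (\<Sum>i\<in>UNIV. pd i v x * V i x) = (\<Sum>k\<in>UNIV. (pd j v x * V k x) * (pd k v x * V \<kappa> x))"
      by (simp add: sum_distrib_left mult_ac)
    also have "\<dots> = 0" using T_sq[of x j \<kappa>] r(2) x by (auto simp: r(5))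
    finally show ?thesis using j r(6)[OF x] by simp
  qed
  have x0B: "x0 \<in> ball x0 r" using r(1) by simp
  obtain U0 \<eta> where U0: "open U0" "x0 \<in> U0" "U0 \<subseteq> ball x0 r" "smooth_on U0 \<eta>"
    "\<And>x. x \<in> U0 \<Longrightarrow> (\<Sum>i\<in>UNIV. pd i \<eta> x * V i x) = 1"
    using flow_coordinate[OF open_ball x0B r(3,4) vV[OF x0B] vV r(6) r(7)[OF x0B]] by blast
  define d where "d x = pd 1 v x * pd 2 \<eta> x - pd 2 v x * pd 1 \<eta> x" for x
  have dV: "d x * V 1 x = - pd 2 v x" "d x * V 2 x = pd 1 v x" if "x \<in> U0" for x
  proof -
    have x: "x \<in> ball x0 r" using U0(3) that by auto
    have *: "pd 1 v x * V 1 x + pd 2 v x * V 2 x = 0" "pd 1 \<eta> x * V 1 x + pd 2 \<eta> x * V 2 x = 1"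
      using vV[OF x] U0(5)[OF that] by (simp_all add: sum_2)
    show "d x * V 1 x = - pd 2 v x" unfolding d_def using * by algebra
    show "d x * V 2 x = pd 1 v x" unfolding d_def using * by algebra
  qed
  have d: "d x \<noteq> 0" if "x \<in> U0" for x
  proof
    assume "d x = 0"
    then have "pd 1 v x = 0" "pd 2 v x = 0" using dV[OF that] by simp_all
    then have "pd i v x = 0" for i using exhaust_2[of i] by auto
    then show False using r(7)[of x] U0(3) that by auto
  qed
  have sv: "smooth_on U0 v" by (rule smooth_on_subset[OF r(3) U0(3)])
  have su: "smooth_on U0 (\<lambda>x. vec2 (v x) (\<eta> x))" by (rule smooth_on_vec2[OF U0(1) sv U0(4)])
  obtain U W G where G: "open U" "x0 \<in> U" "U \<subseteq> U0" "open W" "(\<lambda>x. vec2 (v x) (\<eta> x)) ` U = W" "G ` W = U"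
    "\<And>x. x \<in> U \<Longrightarrow> G (vec2 (v x) (\<eta> x)) = x" "\<And>y. y \<in> W \<Longrightarrow> vec2 (v (G y)) (\<eta> (G y)) = y" "smooth_on W G"
    using smooth_local_inverse_2[OF su U0(1,2)] d[OF U0(2)] unfolding d_def vec2_nth by blast
  have "vec2 (v x0) (\<eta> x0) \<in> W" using G(2,5) by blast
  then obtain a b where ab: "vec2 (v x0) (\<eta> x0) \<in> box a b" "box a b \<subseteq> W"
    using box_subset_open[OF G(4)] by blast
  have U': "U \<inter> (\<lambda>x. vec2 (v x) (\<eta> x)) -` box a b = G ` box a b"
  proof (intro subset_antisym subsetI)
    fix x assume "x \<in> U \<inter> (\<lambda>x. vec2 (v x) (\<eta> x)) -` box a b"
    then show "x \<in> G ` box a b" using G(7)[of x] by (metis IntE imageI vimageE)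
  next
    fix x assume "x \<in> G ` box a b"
    then show "x \<in> U \<inter> (\<lambda>x. vec2 (v x) (\<eta> x)) -` box a b" using G(6,8) ab(2) by auto
  qed
  have oU: "open (G ` box a b)"
    unfolding U'[symmetric]
    by (rule continuous_open_preimage[OF smooth_on_continuous[OF smooth_on_subset[OF su G(3)]] G(1) open_box])
  have sub: "G ` box a b \<subseteq> U0" using U' G(3) by blast
  show ?thesis
  proof (rule that[of "G ` box a b" v \<eta> a b G d V])
    show "x0 \<in> G ` box a b" using ab(1) G(2,7) by (metis imageI)
    show "(\<lambda>x. vec2 (v x) (\<eta> x)) ` (G ` box a b) = box a b"
      unfolding image_image using G(8) ab(2) by (auto simp: subset_eq image_iff)
    show "G (vec2 (v x) (\<eta> x)) = x" if "x \<in> G ` box a b" for x using that G(7) U' by auto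
    show "smooth_on (G ` box a b) (V m)" for m
      by (rule smooth_on_subset[OF r(4)]) (use sub U0(3) in blast)
    show "V 1 x = - pd 2 v x / d x" "V 2 x = pd 1 v x / d x" if "x \<in> G ` box a b" for x
      using dV[of x] d[of x] sub that by (auto simp: field_simps)
    show "pd i v x * V m x = T i m x" "pd j (pd i v) x = (\<Sum>m\<in>UNIV. \<Gamma> j i m x * pd m v x)"
      "pd j (V m) x = - (\<Sum>n\<in>UNIV. \<Gamma> j n m x * V n x)" if "x \<in> G ` box a b" for i j m x
      using r(5,8,9) sub U0(3) that by blast+
  qed (use oU sub U0(3) r(2) G(8,9) ab(2) sv U0(4) d in \<open>auto simp: d_def intro: smooth_on_subset\<close>)
qed

lemma (in parallel_chart) adapted_coordinates:
  assumes x0: "x0 \<in> X" and T_ne: "\<And>x. x \<in> X \<Longrightarrow> \<exists>i k. T i k x \<noteq> 0"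
    and ric: "\<And>x. x \<in> X \<Longrightarrow> ricci \<Gamma> 1 2 x = ricci \<Gamma> 2 1 x"
    and f: "smooth_on X f"
    and sol: "\<And>x i j. x \<in> X \<Longrightarrow> hessian \<Gamma> f i j x + 2 * ricci_sym \<Gamma> i j x = 0"
    and df: "\<And>x i. x \<in> X \<Longrightarrow> (\<Sum>k\<in>UNIV. T i k x * pd k f x) = 0"
  obtains U u G J \<alpha> \<beta> k where "open U" "x0 \<in> U" "U \<subseteq> X" "smooth_on U u" "open (u ` U)" "smooth_on (u ` U) G"
    "\<And>x. x \<in> U \<Longrightarrow> G (u x) = x" "model_data J \<alpha> \<beta> k" "\<And>x. x \<in> U \<Longrightarrow> u x $ 1 \<in> J"
    "\<And>x. x \<in> U \<Longrightarrow> f x = k (u x $ 1)"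
    "\<And>i j a x. x \<in> U \<Longrightarrow> (\<Sum>m\<in>UNIV. \<Gamma> i j m x * pd m (\<lambda>x. u x $ a) x) = pd i (pd j (\<lambda>x. u x $ a)) x +
      (\<Sum>b\<in>UNIV. \<Sum>c\<in>UNIV. model_connection \<alpha> \<beta> b c a (u x) * pd i (\<lambda>x. u x $ b) x * pd j (\<lambda>x. u x $ c) x)"
proof -
  obtain U a b v \<eta> G d V where U: "open U" "x0 \<in> U" "U \<subseteq> X" and sv: "smooth_on U v" and s\<eta>: "smooth_on U \<eta>"
    and img: "(\<lambda>x. vec2 (v x) (\<eta> x)) ` U = box a b" "G ` box a b = U" and Gu: "\<And>x. x \<in> U \<Longrightarrow> G (vec2 (v x) (\<eta> x)) = x"
    and uG: "\<And>y. y \<in> box a b \<Longrightarrow> vec2 (v (G y)) (\<eta> (G y)) = y" and sG: "smooth_on (box a b) G"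
    and d_eq: "\<And>x. x \<in> U \<Longrightarrow> d x = pd 1 v x * pd 2 \<eta> x - pd 2 v x * pd 1 \<eta> x"
    and d0: "\<And>x. x \<in> U \<Longrightarrow> d x \<noteq> 0" and V: "\<And>x. x \<in> U \<Longrightarrow> V 1 x = - pd 2 v x / d x" "\<And>x. x \<in> U \<Longrightarrow> V 2 x = pd 1 v x / d x"
    and T_eq: "\<And>i m x. x \<in> U \<Longrightarrow> pd i v x * V m x = T i m x" and sV: "\<And>m. smooth_on U (V m)"
    and dv: "\<And>i j x. x \<in> U \<Longrightarrow> pd j (pd i v) x = (\<Sum>m\<in>UNIV. \<Gamma> j i m x * pd m v x)"
    and dV: "\<And>j m x. x \<in> U \<Longrightarrow> pd j (V m) x = - (\<Sum>n\<in>UNIV. \<Gamma> j n m x * V n x)"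
    by (rule adapted_chart[OF x0 T_ne ric]) (assumption | rule that; assumption)+
  define u where "u x = vec2 (v x) (\<eta> x)" for x
  have un: "u x $ 1 = v x" "u x $ 2 = \<eta> x" for x by (simp_all add: u_def)
  have su: "smooth_on U u" unfolding u_def by (rule smooth_on_vec2[OF U(1) sv s\<eta>])
  have uU: "u ` U = box a b" and Gu: "\<And>x. x \<in> U \<Longrightarrow> G (u x) = x" and uG: "\<And>y. y \<in> box a b \<Longrightarrow> u (G y) = y"
    using img(1) Gu uG by (simp_all add: u_def)
  have GU: "G y \<in> U" if "y \<in> box a b" for y using that img(2) by blast
  have vG: "v (G y) = y $ 1" "\<eta> (G y) = y $ 2" if "y \<in> box a b" for y using uG[OF that] by (auto simp flip: un)
  have xX: "x \<in> X" if "x \<in> U" for x using U(3) that by auto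
  have s\<Gamma>: "smooth_on U (\<Gamma> i j k)" and sf: "smooth_on U f" for i j k
    using smooth_on_subset[OF smooth_\<Gamma> U(3)] smooth_on_subset[OF f U(3)] by auto
  have dif [simp]: "\<eta> differentiable (at x)" "pd i \<eta> differentiable (at x)" "pd i v differentiable (at x)"
    "V i differentiable (at x)" "v differentiable (at x)" "pd i (pd j \<eta>) differentiable (at x)" if "x \<in> U" for x i j
    using that sv s\<eta> sV smooth_on_pd smooth_on_differentiable by metis+
  have e1: "(\<Sum>i\<in>UNIV. pd i \<eta> x * V i x) = 1" if "x \<in> U" for x
  proof -
    have "(\<Sum>i\<in>UNIV. pd i \<eta> x * V i x) = (pd 1 v x * pd 2 \<eta> x - pd 2 v x * pd 1 \<eta> x) / d x"
      by (simp add: sum_2 V[OF that] diff_divide_distrib mult.commute)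
    then show ?thesis using d0[OF that] by (simp flip: d_eq[OF that])
  qed
  have w_ne: "\<exists>j. pd j v x \<noteq> 0" if "x \<in> U" for x
  proof (rule ccontr)
    assume "\<not> (\<exists>j. pd j v x \<noteq> 0)"
    then show False using d_eq[OF that] d0[OF that] by simp
  qed
  \<comment> \<open>S is the covariant Hessian D d\<eta>.\<close>
  define S where "S i j x = pd i (pd j \<eta>) x - (\<Sum>m\<in>UNIV. \<Gamma> i j m x * pd m \<eta> x)" for i j x
  have sS: "smooth_on U (S i j)" for i j unfolding S_def by (intro smooth_intros U(1) s\<Gamma> s\<eta>)
  have S_sym: "S 2 1 x = S 1 2 x" if "x \<in> U" for x
    unfolding S_def using pd_commute[OF U(1) that s\<eta>, of 2 1] sym_\<Gamma>[OF xX[OF that], of 2 1] by simp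
  \<comment> \<open>Differentiating V(\<eta>) = 1 with V parallel gives S(., V) = 0; V is
    proportional to (-v_2, v_1).\<close>
  have SV: "S i 1 x * pd 2 v x = S i 2 x * pd 1 v x" if x: "x \<in> U" for i x
  proof -
    have "pd i (\<lambda>x. \<Sum>j\<in>UNIV. pd j \<eta> x * V j x) x = pd i (\<lambda>x. 1) x"
      by (rule pd_cong_open[OF U(1) x e1])
    then have "S i 1 x * V 1 x + S i 2 x * V 2 x = 0"
      using x by (simp add: sum_2 pd_add pd_mult dV differentiable_mult S_def algebra_simps)
    then show ?thesis using d0[OF x] by (simp add: V[OF x] field_simps)
  qed
  \<comment> \<open>F = -S(W, W) for the vector W with dv(W) = 1 and d\<eta>(W) = 0, that is, W =
    (\<eta>_2, -\<eta>_1) divided by the Jacobian determinant.\<close>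
  define F where "F x = - (S 1 1 x * (pd 2 \<eta> x)\<^sup>2 - 2 * S 1 2 x * pd 1 \<eta> x * pd 2 \<eta> x + S 2 2 x * (pd 1 \<eta> x)\<^sup>2) /
     (pd 1 v x * pd 2 \<eta> x - pd 2 v x * pd 1 \<eta> x)\<^sup>2" for x
  have sF: "smooth_on U F"
    unfolding F_def power2_eq_square using d0 d_eq by (intro smooth_intros U(1) sS s\<eta> sv) auto
  have SF: "S i j x = - F x * pd i v x * pd j v x" if x: "x \<in> U" for i j x
  proof -
    have D: "(pd 1 v x * pd 2 \<eta> x - pd 2 v x * pd 1 \<eta> x)\<^sup>2 \<noteq> 0" using d0[OF x] d_eq[OF x] by simp
    then have Fd: "F x * (pd 1 v x * pd 2 \<eta> x - pd 2 v x * pd 1 \<eta> x)\<^sup>2 =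
      - (S 1 1 x * (pd 2 \<eta> x)\<^sup>2 - 2 * S 1 2 x * pd 1 \<eta> x * pd 2 \<eta> x + S 2 2 x * (pd 1 \<eta> x)\<^sup>2)"
      by (simp add: F_def)
    have s: "S 1 1 x * pd 2 v x = S 1 2 x * pd 1 v x" "S 1 2 x * pd 2 v x = S 2 2 x * pd 1 v x"
      using SV[OF x, of 1] SV[OF x, of 2] S_sym[OF x] by auto
    have "(S 1 1 x + F x * pd 1 v x * pd 1 v x) * (pd 1 v x * pd 2 \<eta> x - pd 2 v x * pd 1 \<eta> x)\<^sup>2 = 0"
      "(S 1 2 x + F x * pd 1 v x * pd 2 v x) * (pd 1 v x * pd 2 \<eta> x - pd 2 v x * pd 1 \<eta> x)\<^sup>2 = 0"
      "(S 2 2 x + F x * pd 2 v x * pd 2 v x) * (pd 1 v x * pd 2 \<eta> x - pd 2 v x * pd 1 \<eta> x)\<^sup>2 = 0"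
      using Fd s by algebra+
    then have "S 1 1 x = - F x * pd 1 v x * pd 1 v x" "S 1 2 x = - F x * pd 1 v x * pd 2 v x"
      "S 2 2 x = - F x * pd 2 v x * pd 2 v x"
      using D unfolding mult_eq_0_iff by (simp_all add: eq_neg_iff_add_eq_0)
    then show ?thesis using S_sym[OF x] exhaust_2[of i] exhaust_2[of j] by auto
  qed
  have d2\<eta>: "pd i (pd j \<eta>) x = (\<Sum>m\<in>UNIV. \<Gamma> i j m x * pd m \<eta> x) - F x * pd i v x * pd j v x" if "x \<in> U" for i j x
    using SF[OF that, of i j] by (simp add: S_def)
  have [simp]: "F differentiable (at x)" "\<Gamma> i j k differentiable (at x)" if "x \<in> U" for x i j k
    using that sF s\<Gamma> smooth_on_differentiable by blast+
  \<comment> \<open>The Ricci identity for d\<eta>: third derivatives of \<eta> commute, while D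
    d\<eta> = -F dv \<otimes> dv with dv parallel.\<close>
  have curv: "(\<Sum>m\<in>UNIV. curvature \<Gamma> 1 2 j m x * pd m \<eta> x) = (pd 1 F x * pd 2 v x - pd 2 F x * pd 1 v x) * pd j v x"
    if x: "x \<in> U" for j x
  proof -
    have second: "pd n (pd i (pd j \<eta>)) x = pd n (\<lambda>x. (\<Sum>m\<in>UNIV. \<Gamma> i j m x * pd m \<eta> x) - F x * pd i v x * pd j v x) x" for n i
      by (rule pd_cong_open[OF U(1) x d2\<eta>])
    have t: "pd n (pd i (pd j \<eta>)) x = (\<Sum>m\<in>UNIV. pd n (\<Gamma> i j m) x * pd m \<eta> x + \<Gamma> i j m x * pd n (pd m \<eta>) x)
       - (pd n F x * pd i v x * pd j v x + F x * pd n (pd i v) x * pd j v x + F x * pd i v x * pd n (pd j v) x)" for n i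
      unfolding second sum_2 using x
      by (simp add: pd_diff pd_add pd_mult differentiable_add differentiable_mult algebra_simps)
    show ?thesis
      using pd_commute[OF U(1) x smooth_on_pd[OF s\<eta>, of j], of 1 2] unfolding t d2\<eta>[OF x] dv[OF x]
      by (simp add: curvature_def sum_2 sym_\<Gamma>[OF xX[OF x], of 2 1] algebra_simps)
  qed
  \<comment> \<open>Comparing \<open>curv\<close> with R = r T and V(\<eta>) = 1 gives r = F_1 v_2 -
    F_2 v_1, which is -d V(F) by Cramer's rule for V.\<close>
  have ric_F: "ricci \<Gamma> j j x = (\<Sum>m\<in>UNIV. pd m F x * V m x) * (pd j v x)\<^sup>2" if x: "x \<in> U" for j x
  proof -
    obtain r where r: "\<And>i k. curvature \<Gamma> 1 2 i k x = r * T i k x"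
      using curvature_multiple[OF xX[OF x] T_ne[OF xX[OF x]] ric[OF xX[OF x]]] by metis
    obtain i where i: "pd i v x \<noteq> 0" using w_ne[OF x] by blast
    have "r * pd i v x * (\<Sum>m\<in>UNIV. pd m \<eta> x * V m x) = (pd 1 F x * pd 2 v x - pd 2 F x * pd 1 v x) * pd i v x"
      using curv[OF x, of i] unfolding r T_eq[OF x, symmetric] sum_2 by (simp add: algebra_simps)
    then have "r = pd 1 F x * pd 2 v x - pd 2 F x * pd 1 v x" using i e1[OF x] by simp
    then have c: "curvature \<Gamma> 1 2 i k x = (pd 1 F x * pd 2 v x - pd 2 F x * pd 1 v x) * (pd i v x * V k x)" for i k
      by (simp add: r T_eq[OF x])
    show ?thesis
      using exhaust_2[of j] d0[OF x] by (auto simp: ricci_2 c V[OF x] sum_2 field_simps power2_eq_square)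
  qed
  define J where "J = {a $ 1 <..< b $ 1}"
  have x0b: "u x0 \<in> box a b" using uU U(2) by blast
  define c where "c = u x0 $ 2"
  have inb: "vec2 t c \<in> box a b" if "t \<in> J" for t
    using that x0b by (simp add: J_def mem_box_2 c_def)
  have wJ: "w $ 1 \<in> J" if "w \<in> box a b" for w using that by (simp add: J_def mem_box_2)
  have oJ: "open J" by (simp add: J_def)
  have s_line: "smooth_on J (\<lambda>t. g (vec2 t c))" if g: "smooth_on (box a b) g" for g :: "real^2 \<Rightarrow> real"
  proof (rule smooth_on_compose[OF oJ open_box _ _ g])
    show "smooth_on J (\<lambda>t. vec2 t c)"
      by (intro smooth_on_vec2 oJ smooth_on_const smooth_on_linear bounded_linear_ident)
  qed (use inb in auto)
  have s_comp: "smooth_on (box a b) (\<lambda>w. g (G w))" if g: "smooth_on U g" for g :: "real^2 \<Rightarrow> real"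
    by (rule smooth_on_compose[OF open_box U(1) _ sG g]) (use img(2) in auto)
  \<comment> \<open>In the new coordinates V is the second coordinate field.\<close>
  have pd_comp: "pd 2 (\<lambda>w. g (G w)) w = (\<Sum>m\<in>UNIV. pd m g (G w) * V m (G w))"
    if g: "smooth_on U g" and w: "w \<in> box a b" for g w
  proof -
    have GV: "pd 2 (\<lambda>w. g (G w)) w = (\<Sum>m\<in>UNIV. pd m g (G w) * pd 2 (\<lambda>w. G w $ m) w)" if "smooth_on U g" for g
      by (rule pd_compose[OF smooth_on_differentiable[OF sG w] smooth_on_differentiable[OF that GU[OF w]]])
    have "pd 2 (\<lambda>w. v (G w)) w = pd 2 (\<lambda>w. w $ 1) w" "pd 2 (\<lambda>w. \<eta> (G w)) w = pd 2 (\<lambda>w. w $ 2) w"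
      by (rule pd_cong_open[OF open_box w], simp add: vG)+
    then have *: "pd 1 v (G w) * pd 2 (\<lambda>w. G w $ 1) w + pd 2 v (G w) * pd 2 (\<lambda>w. G w $ 2) w = 0"
      "pd 1 \<eta> (G w) * pd 2 (\<lambda>w. G w $ 1) w + pd 2 \<eta> (G w) * pd 2 (\<lambda>w. G w $ 2) w = 1"
      by (simp_all add: GV[OF sv] GV[OF s\<eta>] sum_2 pd_coordinate)
    have "d (G w) * pd 2 (\<lambda>w. G w $ 1) w = - pd 2 v (G w)" "d (G w) * pd 2 (\<lambda>w. G w $ 2) w = pd 1 v (G w)"
      unfolding d_eq[OF GU[OF w]] using * by algebra+
    then have "pd 2 (\<lambda>w. G w $ 1) w = V 1 (G w)" "pd 2 (\<lambda>w. G w $ 2) w = V 2 (G w)"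
      using d0[OF GU[OF w]] by (simp_all add: V[OF GU[OF w]] field_simps)
    then show ?thesis by (simp add: GV[OF g] sum_2)
  qed
  \<comment> \<open>As f is constant along V, its profile is read off on the segment u^2 = c through
    the image of x0.\<close>
  define k where "k t = f (G (vec2 t c))" for t
  have sk: "smooth_on J k" unfolding k_def by (rule s_line[OF s_comp[OF sf]])
  have fV: "(\<Sum>m\<in>UNIV. pd m f x * V m x) = 0" if x: "x \<in> U" for x
  proof -
    obtain i where i: "pd i v x \<noteq> 0" using w_ne[OF x] by blast
    have "pd i v x * (\<Sum>m\<in>UNIV. pd m f x * V m x) = (\<Sum>m\<in>UNIV. T i m x * pd m f x)"
      unfolding T_eq[OF x, symmetric] sum_2 by (simp add: algebra_simps)
    then show ?thesis using df[OF xX[OF x]] i by simp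
  qed
  have fk: "f x = k (v x)" if x: "x \<in> U" for x
  proof -
    have ux: "u x \<in> box a b" using uU x by blast
    have "f (G (u x)) = f (G (vec2 (u x $ 1) (u x0 $ 2)))"
      by (rule constant_second_coordinate[OF s_comp[OF sf] _ ux x0b]) (simp add: pd_comp[OF sf] fV[OF GU])
    then show ?thesis using Gu[OF x] by (simp add: k_def c_def un)
  qed
  have vJ: "v x \<in> J" if "x \<in> U" for x using wJ[of "u x"] uU that by (auto simp: un)
  have pf: "pd j f x = deriv k (v x) * pd j v x" if x: "x \<in> U" for j x
  proof -
    have "pd j f x = pd j (\<lambda>x. k (v x)) x" by (rule pd_cong_open[OF U(1) x fk])
    then show ?thesis using pd_compose_real[OF oJ sk vJ[OF x] dif(5)[OF x]] by simp
  qed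
  note k' = smooth_on_real_deriv[OF oJ sk]
  have hess: "hessian \<Gamma> f i j x = deriv (deriv k) (v x) * pd i v x * pd j v x" if x: "x \<in> U" for i j x
  proof -
    have "pd i (pd j f) x = pd i (\<lambda>x. deriv k (v x) * pd j v x) x" by (rule pd_cong_open[OF U(1) x pf])
    also have "\<dots> = deriv k (v x) * pd i (pd j v) x + deriv (deriv k) (v x) * pd i v x * pd j v x"
    proof -
      have "(\<lambda>x. deriv k (v x)) differentiable (at x)"
        by (rule smooth_on_differentiable[OF smooth_on_compose[OF U(1) oJ _ sv k'(1)] x]) (use vJ in auto)
      then show ?thesis by (simp add: pd_mult x pd_compose_real[OF oJ k'(1) vJ[OF x] dif(5)[OF x]])
    qed
    finally show ?thesis by (simp add: hessian_def pf[OF x] dv[OF x] sum_2 algebra_simps)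
  qed
  \<comment> \<open>The equation k'' = -2 \<beta> serves as the definition of \<beta>; \<alpha> is
    what remains of F on the segment u^2 = c after removal of c \<beta>.\<close>
  define \<beta> where "\<beta> t = - deriv (deriv k) t / 2" for t
  define \<alpha> where "\<alpha> t = F (G (vec2 t c)) - c * \<beta> t" for t
  have s\<beta>: "smooth_on J \<beta>" unfolding \<beta>_def
    by (intro smooth_intros oJ smooth_on_real_deriv(1)[OF oJ] sk) simp
  have s\<alpha>: "smooth_on J \<alpha>" unfolding \<alpha>_def
    by (intro smooth_intros oJ s\<beta> s_line[OF s_comp[OF sF]])
  have VF: "(\<Sum>m\<in>UNIV. pd m F x * V m x) = \<beta> (v x)" if x: "x \<in> U" for x
  proof -
    obtain i where i: "pd i v x \<noteq> 0" using w_ne[OF x] by blast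
    have "(deriv (deriv k) (v x) + 2 * (\<Sum>m\<in>UNIV. pd m F x * V m x)) * (pd i v x)\<^sup>2 = 0"
      using sol[OF xX[OF x], of i i]
      by (simp add: two_ricci_sym ric_F[OF x] hess[OF x] power2_eq_square algebra_simps)
    then show ?thesis using i by (simp add: \<beta>_def)
  qed
  \<comment> \<open>V(F) = \<beta>(u^1) means that F - u^2 \<beta>(u^1) has no second partial
    derivative, so it equals its value on u^2 = c.\<close>
  have F_eq: "F x = \<alpha> (v x) + \<eta> x * \<beta> (v x)" if x: "x \<in> U" for x
  proof -
    have ux: "u x \<in> box a b" using uU x by blast
    have s1: "smooth_on (box a b) (\<lambda>w. \<beta> (w $ 1))"
      by (rule smooth_on_compose[OF open_box oJ _ smooth_on_linear[OF bounded_linear_vec_nth open_box] s\<beta>]) (use wJ in auto)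
    have s2: "smooth_on (box a b) (\<lambda>w. F (G w) - w $ 2 * \<beta> (w $ 1))"
      by (intro smooth_intros open_box s1 s_comp[OF sF] smooth_on_linear[OF bounded_linear_vec_nth])
    have "pd 2 (\<lambda>w. F (G w) - w $ 2 * \<beta> (w $ 1)) w = 0" if w: "w \<in> box a b" for w
    proof -
      have "pd 2 (\<lambda>w. \<beta> (w $ 1)) w = 0"
        using pd_compose_real[OF oJ s\<beta> wJ[OF w] coordinate_differentiable] by (simp add: pd_coordinate)
      then show ?thesis
        using VF[OF GU[OF w]] smooth_on_differentiable[OF s1 w] smooth_on_differentiable[OF s_comp[OF sF] w]
        by (simp add: pd_diff pd_mult pd_comp[OF sF w] pd_coordinate vG[OF w] differentiable_mult)
    qed
    from constant_second_coordinate[OF s2 this ux x0b]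
    show ?thesis by (simp add: Gu[OF x] un \<alpha>_def c_def)
  qed
  show ?thesis
  proof (rule that[of U u G J \<alpha> \<beta> k])
    show "model_data J \<alpha> \<beta> k"
      using oJ s\<alpha> s\<beta> sk wJ[OF x0b] is_interval_oo[of "a $ 1" "b $ 1"] by (auto simp: model_data_def \<beta>_def J_def)
    show "(\<Sum>m\<in>UNIV. \<Gamma> i j m x * pd m (\<lambda>x. u x $ e) x) = pd i (pd j (\<lambda>x. u x $ e)) x +
      (\<Sum>b\<in>UNIV. \<Sum>c\<in>UNIV. model_connection \<alpha> \<beta> b c e (u x) * pd i (\<lambda>x. u x $ b) x * pd j (\<lambda>x. u x $ c) x)"
      if x: "x \<in> U" for i j e x
      using exhaust_2[of e] dv[OF x, of i j] d2\<eta>[OF x, of i j] F_eq[OF x]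
      by (auto simp: un sum_2 model_connection_def)
  qed (use U su uU sG Gu vJ fk in \<open>auto simp: un\<close>)
qed

text \<open>The adapted coordinates are compared directly with a single chart; composition with the
  law between two atlas charts yields the comparison with all of them. In that use
  \<open>sub\<close> holds because the new domain lies in the middle chart.\<close>

lemma connection_law_trans:
  fixes c1 c2 c3 :: "('p, 2) chart"
  assumes charts: "is_chart c1" "is_chart c2" "is_chart c3"
    and comp: "compatible c1 c2" "compatible c2 c3" "compatible c1 c3"
    and law: "connection_law c1 c2 \<Gamma>1 \<Gamma>2" "connection_law c2 c3 \<Gamma>2 \<Gamma>3"
    and sub: "fst c1 \<inter> fst c3 \<subseteq> fst c2"
  shows "connection_law c1 c3 \<Gamma>1 \<Gamma>3"
  unfolding connection_law_def
proof (intro ballI allI)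
  fix x i j a assume "x \<in> overlap c1 c3"
  then obtain p where p: "p \<in> fst c1" "p \<in> fst c3" "x = snd c1 p" by (rule overlapE[OF _ charts(1)])
  have p2: "p \<in> fst c2" using sub p by auto
  define S where "S = overlap c1 c2 \<inter> overlap c1 c3"
  have S: "open S" "x \<in> S" "x \<in> overlap c1 c2" using comp p p2 by (auto simp: S_def compatible_def overlap_def)
  define y where "y = snd c2 p"
  have tr: "transition c1 c2 x = y" "transition c1 c3 x = snd c3 p" "transition c2 c3 y = snd c3 p"
    by (simp_all add: p(3) y_def transition_snd charts p(1) p2)
  have y: "y \<in> overlap c2 c3" using p p2 by (auto simp: y_def overlap_def)
  have C: "jac c1 c3 w $ a $ k = (\<Sum>m\<in>UNIV. jac c2 c3 (transition c1 c2 w) $ a $ m * jac c1 c2 w $ m $ k)" if w: "w \<in> S" for w a k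
  proof -
    have "w \<in> overlap c1 c3" using w by (simp add: S_def)
    then obtain q where q: "q \<in> fst c1" "q \<in> fst c3" "w = snd c1 q" by (rule overlapE[OF _ charts(1)])
    have q2: "q \<in> fst c2" using sub q by auto
    have "jac c1 c3 w = jac c2 c3 (transition c1 c2 w) ** jac c1 c2 w"
      using jac_chain[OF charts(1,2) comp q(1) q2 q(2)] by (simp add: q(3) transition_snd[OF charts(1) q(1)])
    then show ?thesis by (simp add: matrix_matrix_mult_def)
  qed
  let ?A = "\<lambda>m k. jac c1 c2 x $ m $ k" and ?B = "\<lambda>a m. jac c2 c3 y $ a $ m"
  have A: "pd k (\<lambda>w. transition c1 c2 w $ m) x = ?A m k" for k m
    using comp(1) S(3) by (intro jac_nth[symmetric]) (auto simp: compatible_def intro: smooth_on_differentiable)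
  have dB: "(\<lambda>y. jac c2 c3 y $ a $ m) differentiable (at (transition c1 c2 x))" for m
    using smooth_on_differentiable[OF smooth_on_jac[OF comp(2)]] y tr by auto
  have dt: "transition c1 c2 differentiable (at x)"
    using comp(1) S(3) by (auto simp: compatible_def intro: smooth_on_differentiable)
  have dBt: "(\<lambda>w. jac c2 c3 (transition c1 c2 w) $ a $ m) differentiable (at x)" for m
    using differentiable_chain_at[OF dt dB] by (simp add: o_def)
  have dA: "(\<lambda>w. jac c1 c2 w $ m $ k) differentiable (at x)" for m k
    using smooth_on_differentiable[OF smooth_on_jac[OF comp(1)] S(3)] .
  have "pd i (\<lambda>w. jac c1 c3 w $ a $ j) x =
      pd i (\<lambda>w. \<Sum>m\<in>UNIV. jac c2 c3 (transition c1 c2 w) $ a $ m * jac c1 c2 w $ m $ j) x"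
    by (rule pd_cong_open[OF S(1,2) C])
  also have "\<dots> = (\<Sum>m\<in>UNIV. ?B a m * pd i (\<lambda>w. jac c1 c2 w $ m $ j) x
      + (\<Sum>n\<in>UNIV. pd n (\<lambda>y. jac c2 c3 y $ a $ m) y * ?A n i) * ?A m j)"
    by (simp add: sum_2 pd_add pd_mult differentiable_mult dBt dA pd_compose[OF dt dB] A tr)
  finally have pdC: "pd i (\<lambda>w. jac c1 c3 w $ a $ j) x = \<dots>" .
  have law1: "(\<Sum>k\<in>UNIV. \<Gamma>1 i j k x * ?A m k) = pd i (\<lambda>w. jac c1 c2 w $ m $ j) x
      + (\<Sum>b\<in>UNIV. \<Sum>d\<in>UNIV. \<Gamma>2 b d m y * ?A b i * ?A d j)" for m
    using law(1) S(3) by (simp add: connection_law_def tr)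
  have law2: "(\<Sum>k\<in>UNIV. \<Gamma>2 b d k y * ?B a k) = pd b (\<lambda>w. jac c2 c3 w $ a $ d) y
      + (\<Sum>e\<in>UNIV. \<Sum>f\<in>UNIV. \<Gamma>3 e f a (snd c3 p) * ?B e b * ?B f d)" for b d
    using law(2) y by (simp add: connection_law_def tr)
  have "(\<Sum>k\<in>UNIV. \<Gamma>1 i j k x * jac c1 c3 x $ a $ k) = (\<Sum>m\<in>UNIV. ?B a m * (\<Sum>k\<in>UNIV. \<Gamma>1 i j k x * ?A m k))"
    by (simp add: C[OF S(2)] tr sum_2 algebra_simps)
  also have "\<dots> = (\<Sum>m\<in>UNIV. ?B a m * pd i (\<lambda>w. jac c1 c2 w $ m $ j) x)
      + (\<Sum>b\<in>UNIV. \<Sum>d\<in>UNIV. (\<Sum>k\<in>UNIV. \<Gamma>2 b d k y * ?B a k) * (?A b i * ?A d j))"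
    unfolding law1 by (simp add: sum_2 algebra_simps)
  also have "\<dots> = pd i (\<lambda>w. jac c1 c3 w $ a $ j) x + (\<Sum>b\<in>UNIV. \<Sum>d\<in>UNIV.
          \<Gamma>3 b d a (snd c3 p) * jac c1 c3 x $ b $ i * jac c1 c3 x $ d $ j)"
    unfolding law2 pdC by (simp add: C[OF S(2)] tr sum_2 algebra_simps)
  finally show "(\<Sum>k\<in>UNIV. \<Gamma>1 i j k x * jac c1 c3 x $ a $ k) = pd i (\<lambda>w. jac c1 c3 w $ a $ j) x + (\<Sum>b\<in>UNIV. \<Sum>d\<in>UNIV.
          \<Gamma>3 b d a (transition c1 c3 x) * jac c1 c3 x $ b $ i * jac c1 c3 x $ d $ j)"
    by (simp add: tr)
qed

section \<open>Changing coordinates inside a chart\<close>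

definition reparametrize :: "('p, 'n::finite) chart \<Rightarrow> (real^'n) set \<Rightarrow> (real^'n \<Rightarrow> real^'n) \<Rightarrow> ('p, 'n) chart" where
  "reparametrize c U u = ({p \<in> fst c. snd c p \<in> U}, u \<circ> snd c)"

context
  fixes c :: "('p, 'n::finite) chart" and U and u G :: "real^'n \<Rightarrow> real^'n"
  assumes c: "is_chart c" and U: "open U" "U \<subseteq> chart_image c" and u: "smooth_on U u"
    and uU: "open (u ` U)" and G: "smooth_on (u ` U) G" "\<And>x. x \<in> U \<Longrightarrow> G (u x) = x"
begin

lemma is_chart_reparametrize: "is_chart (reparametrize c U u)"
proof -
  have "inj_on u U" using G(2) by (rule inj_on_inverseI)
  moreover have "inj_on (snd c) (fst c)" using c by (simp add: is_chart_def)
  ultimately have "inj_on (u \<circ> snd c) {p \<in> fst c. snd c p \<in> U}" by (auto simp: inj_on_def)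
  moreover have "(u \<circ> snd c) ` {p \<in> fst c. snd c p \<in> U} = u ` U"
    using U(2) by (auto simp: chart_image_def)
  ultimately show ?thesis using uU by (simp add: is_chart_def reparametrize_def chart_image_def)
qed

text \<open>The transitions are those of \<open>c\<close> composed with u or with its smooth inverse
  G, on preimages that are open by continuity.\<close>

lemma compatible_reparametrize:
  assumes c': "is_chart c'" and comp: "compatible c' c"
  shows "compatible c' (reparametrize c U u)"
proof -
  have 1: "overlap c' (reparametrize c U u) = overlap c' c \<inter> transition c' c -` U"
  proof (intro subset_antisym subsetI)
    fix x assume "x \<in> overlap c' (reparametrize c U u)"
    then obtain p where "p \<in> fst c'" "p \<in> fst c" "snd c p \<in> U" "x = snd c' p"
      by (auto simp: overlap_def reparametrize_def)
    then show "x \<in> overlap c' c \<inter> transition c' c -` U" using transition_snd[OF c'] by (auto simp: overlap_def)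
  next
    fix x assume x: "x \<in> overlap c' c \<inter> transition c' c -` U"
    then obtain p where "p \<in> fst c'" "p \<in> fst c" "x = snd c' p" "transition c' c x = snd c p"
      using overlapE[OF _ c'] by blast
    with x show "x \<in> overlap c' (reparametrize c U u)" by (auto simp: overlap_def reparametrize_def)
  qed
  have 2: "overlap (reparametrize c U u) c' = u ` U \<inter> G -` overlap c c'"
  proof (intro subset_antisym subsetI)
    fix x assume "x \<in> overlap (reparametrize c U u) c'"
    then show "x \<in> u ` U \<inter> G -` overlap c c'" using G(2) by (auto simp: overlap_def reparametrize_def)
  next
    fix x assume "x \<in> u ` U \<inter> G -` overlap c c'"
    then obtain y where "y \<in> U" "x = u y" "y \<in> overlap c c'" using G(2) by auto
    then show "x \<in> overlap (reparametrize c U u) c'" by (auto simp: overlap_def reparametrize_def)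
  qed
  have t1: "transition c' (reparametrize c U u) x = u (transition c' c x)" for x
    by (simp add: transition_def reparametrize_def)
  have t2: "transition (reparametrize c U u) c' x = transition c c' (G x)" if x: "x \<in> overlap (reparametrize c U u) c'" for x
  proof -
    obtain p where "p \<in> fst (reparametrize c U u)" "x = snd (reparametrize c U u) p"
      "transition (reparametrize c U u) c' x = snd c' p"
      using overlapE[OF x is_chart_reparametrize] by blast
    then show ?thesis using transition_snd[OF c] G(2) by (auto simp: reparametrize_def)
  qed
  have s: "smooth_on (overlap c' c) (transition c' c)" "smooth_on (overlap c c') (transition c c')"
    and o: "open (overlap c' c)" "open (overlap c c')"
    using comp by (auto simp: compatible_def)
  have o1: "open (overlap c' (reparametrize c U u))"
    unfolding 1 by (rule continuous_open_preimage[OF smooth_on_continuous[OF s(1)] o(1) U(1)])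
  have o2: "open (overlap (reparametrize c U u) c')"
    unfolding 2 by (rule continuous_open_preimage[OF smooth_on_continuous[OF G(1)] uU o(2)])
  have "smooth_on (overlap c' (reparametrize c U u)) (\<lambda>x. u (transition c' c x))"
    using o1 by (rule smooth_on_compose[OF _ U(1) _ smooth_on_subset[OF s(1)] u]) (auto simp: 1)
  moreover have "smooth_on (overlap (reparametrize c U u) c') (\<lambda>x. transition c c' (G x))"
    using o2 by (rule smooth_on_compose[OF _ o(2) _ smooth_on_subset[OF G(1)] s(2)]) (auto simp: 2)
  ultimately show ?thesis
    using o1 o2 smooth_on_cong[OF o2 t2] by (simp add: compatible_def t1[abs_def])
qed

lemma
  assumes "x \<in> U"
  shows transition_reparametrize: "transition c (reparametrize c U u) x = u x"
    and jac_reparametrize: "jac c (reparametrize c U u) x $ a $ i = pd i (\<lambda>x. u x $ a) x"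
proof -
  have t: "transition c (reparametrize c U u) y = u y" if y: "y \<in> U" for y
  proof -
    obtain p where "p \<in> fst c" "y = snd c p" using y U(2) unfolding chart_image_def by blast
    then show ?thesis using transition_snd[OF c] by (simp add: reparametrize_def)
  qed
  then show "transition c (reparametrize c U u) x = u x" using assms .
  have "smooth_on U (transition c (reparametrize c U u))" using smooth_on_cong[OF U(1) t] u by simp
  then have "jac c (reparametrize c U u) x $ a $ i = pd i (\<lambda>x. transition c (reparametrize c U u) x $ a) x"
    using assms by (intro jac_nth) (rule smooth_on_differentiable)
  also have "\<dots> = pd i (\<lambda>x. u x $ a) x" by (rule pd_cong_open[OF U(1) assms]) (simp add: t)
  finally show "jac c (reparametrize c U u) x $ a $ i = pd i (\<lambda>x. u x $ a) x" .
qed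

end

section \<open>Adapted coordinates as local coordinates of the surface\<close>

context parallel_surface
begin

lemma soliton_coordinates:
  assumes h: "affine_gradient_Ricci_soliton M D h" "differential_vanishes_on_kernel M T h" and p: "p \<in> points M"
  obtains c J \<alpha> \<beta> k where "local_coordinates M c" "p \<in> fst c" "model_data J \<alpha> \<beta> k"
    "\<And>q. q \<in> fst c \<Longrightarrow> snd c q $ 1 \<in> J"
    "\<And>i. i \<in> index M \<Longrightarrow> connection_law (chart M i) c (D i) (model_connection \<alpha> \<beta>)"
    "\<And>q. q \<in> fst c \<Longrightarrow> h q = k (snd c q $ 1)"
proof -
  obtain i where i: "i \<in> index M" and pi: "p \<in> fst (chart M i)" using p by (auto simp: points_def)
  let ?c = "chart M i"
  let ?f = "local_rep ?c h"
  interpret pc: parallel_chart "chart_image ?c" "D i" "T i" "\<Phi> i" by (rule parallel_chart_at[OF i])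
  have x0: "snd ?c p \<in> chart_image ?c" using pi by (auto simp: chart_image_def)
  have ric: "ricci (D i) 1 2 x = ricci (D i) 2 1 x" if "x \<in> chart_image ?c" for x
    using ricci_symmetric i that by (auto simp: symmetric_field_def)
  have f: "smooth_on (chart_image ?c) ?f"
    using h(1) i by (auto simp: affine_gradient_Ricci_soliton_def smooth_function_def)
  have sol: "hessian (D i) ?f a b x + 2 * ricci_sym (D i) a b x = 0" if "x \<in> chart_image ?c" for x a b
    using h(1) i that by (auto simp: affine_gradient_Ricci_soliton_def)
  have df: "(\<Sum>k\<in>UNIV. T i a k x * pd k ?f x) = 0" if "x \<in> chart_image ?c" for x a
  proof -
    have "\<forall>v::real^2. (\<forall>k. (\<Sum>a\<in>UNIV. v $ a * T i a k x) = 0) \<longrightarrow> (\<Sum>a\<in>UNIV. v $ a * pd a ?f x) = 0"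
      using h(2) i that unfolding differential_vanishes_on_kernel_def by blast
    then show ?thesis
      using pc.kernel_condition[OF that T_nonzero[OF i that], where f = "\<lambda>k. pd k ?f x"] by blast
  qed
  obtain U u G J \<alpha> \<beta> k where U: "open U" "snd ?c p \<in> U" "U \<subseteq> chart_image ?c" and u: "smooth_on U u" "open (u ` U)"
    and G: "smooth_on (u ` U) G" "\<And>x. x \<in> U \<Longrightarrow> G (u x) = x" and model: "model_data J \<alpha> \<beta> k"
    and J: "\<And>x. x \<in> U \<Longrightarrow> u x $ 1 \<in> J" and k: "\<And>x. x \<in> U \<Longrightarrow> ?f x = k (u x $ 1)"
    and conn: "\<And>b d a x. x \<in> U \<Longrightarrow> (\<Sum>m\<in>UNIV. D i b d m x * pd m (\<lambda>x. u x $ a) x) = pd b (pd d (\<lambda>x. u x $ a)) x +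
      (\<Sum>e\<in>UNIV. \<Sum>l\<in>UNIV. model_connection \<alpha> \<beta> e l a (u x) * pd b (\<lambda>x. u x $ e) x * pd d (\<lambda>x. u x $ l) x)"
    by (rule pc.adapted_coordinates[OF x0 T_nonzero[OF i] ric f sol df]) (assumption | rule that; assumption)+
  let ?r = "reparametrize ?c U u"
  note rep = charts[OF i] U(1,3) u G
  have r: "is_chart ?r" by (rule is_chart_reparametrize[OF rep])
  have comp: "compatible (chart M j) ?r" if "j \<in> index M" for j
    by (rule compatible_reparametrize[OF rep charts[OF that] compat[OF that i]])
  have law_i: "connection_law ?c ?r (D i) (model_connection \<alpha> \<beta>)"
    unfolding connection_law_def
  proof (intro ballI allI)
    fix x b d a assume "x \<in> overlap ?c ?r"
    then have x: "x \<in> U" by (auto simp: overlap_def reparametrize_def)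
    have "pd b (\<lambda>y. jac ?c ?r y $ a $ d) x = pd b (pd d (\<lambda>x. u x $ a)) x"
      by (rule pd_cong_open[OF U(1) x]) (rule jac_reparametrize[OF rep])
    then show "(\<Sum>m\<in>UNIV. D i b d m x * jac ?c ?r x $ a $ m) = pd b (\<lambda>y. jac ?c ?r y $ a $ d) x +
        (\<Sum>e\<in>UNIV. \<Sum>l\<in>UNIV. model_connection \<alpha> \<beta> e l a (transition ?c ?r x) * jac ?c ?r x $ e $ b * jac ?c ?r x $ l $ d)"
      using conn[OF x] by (simp add: jac_reparametrize[OF rep x] transition_reparametrize[OF rep x])
  qed
  show ?thesis
  proof (rule that[of ?r J \<alpha> \<beta> k])
    show "local_coordinates M ?r"
      using r comp i by (auto simp: local_coordinates_def points_def reparametrize_def)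
    show "connection_law (chart M j) ?r (D j) (model_connection \<alpha> \<beta>)" if j: "j \<in> index M" for j
    proof (rule connection_law_trans[OF charts[OF j] charts[OF i] r compat[OF j i] comp[OF i] comp[OF j] _ law_i])
      show "connection_law (chart M j) ?c (D j) (D i)"
        using surface i j by (auto simp: affine_surface_def torsion_free_connection_def)
    qed (auto simp: reparametrize_def)
    show "h q = k (snd ?r q $ 1)" if "q \<in> fst ?r" for q
      using k[of "snd ?c q"] that chart_inv_snd[OF charts[OF i]] by (simp add: reparametrize_def local_rep_def)
  qed (use pi U(2) model J in \<open>auto simp: reparametrize_def\<close>)
qed

end

section \<open>The local models\<close>


lemma hessian_cong_open:
  assumes "open S" "x \<in> S" "\<And>y. y \<in> S \<Longrightarrow> f y = g y"
  shows "hessian \<Gamma> f i j x = hessian \<Gamma> g i j x"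
proof -
  have "pd j f y = pd j g y" if "y \<in> S" for j y by (rule pd_cong_open[OF assms(1) that assms(3)])
  then show ?thesis
    using pd_cong_open[OF assms(1,2), of "pd j f" "pd j g" i] assms(2) by (simp add: hessian_def)
qed

lemma single_chart:
  assumes "is_chart c" "fst c = S" "snd c = id"
  shows "overlap c c = S" "chart_image c = S" "\<And>x. x \<in> S \<Longrightarrow> transition c c x = x"
    "\<And>x. x \<in> S \<Longrightarrow> jac c c x = mat 1" "\<And>x. x \<in> S \<Longrightarrow> local_rep c h x = h x"
  using assms transition_snd[OF assms(1)] jac_refl[OF assms(1)] chart_inv_snd[OF assms(1)]
  by (auto simp: overlap_def chart_image_def local_rep_def)

locale local_model =
  fixes J :: "real set" and \<alpha> \<beta> k :: "real \<Rightarrow> real"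
  assumes model: "model_data J \<alpha> \<beta> k"
begin

abbreviation "M \<equiv> model_strip J"
abbreviation "S \<equiv> {u :: real^2. u $ 1 \<in> J}"
abbreviation "c \<equiv> (S, id :: real^2 \<Rightarrow> real^2)"
abbreviation "\<Gamma> \<equiv> model_connection \<alpha> \<beta>"

lemma data: "open J" "is_interval J" "J \<noteq> {}" "smooth_on J \<alpha>" "smooth_on J \<beta>" "smooth_on J k"
    "\<And>t. t \<in> J \<Longrightarrow> deriv (deriv k) t = - 2 * \<beta> t"
  using model by (auto simp: model_data_def)

lemma M_simps [simp]: "index M = UNIV" "chart M i = c"
  by (simp_all add: model_strip_def)

lemma open_S: "open S"
  using continuous_open_vimage[OF data(1) linear_continuous_at[OF bounded_linear_vec_nth[of 1]]]
  by (simp add: vimage_def)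

lemma S_convex: "convex S"
  using is_interval_convex[OF data(2)] unfolding convex_alt by simp

lemma S_ne: "S \<noteq> {}"
proof -
  obtain t where "t \<in> J" using data(3) by auto
  then have "vec2 t 0 \<in> S" by simp
  then show ?thesis by blast
qed

lemma is_chart_c: "is_chart c"
  using open_S by (simp add: is_chart_def chart_image_def)

lemmas c_simps = single_chart[OF is_chart_c fst_conv snd_conv]

text \<open>With the identity as the only chart the atlas topology is the subspace topology, so the
  topological requirements are inherited from the plane.\<close>

lemma atlas_topology_strip: "atlas_topology M = top_of_set S"
proof -
  have "openin (atlas_topology M) V \<longleftrightarrow> V \<subseteq> S \<and> open V" for V
    by (subst openin_atlas_topology) (auto simp: is_chart_c points_def Int_absorb1)
  then show ?thesis by (simp add: topology_eq openin_open_eq[OF open_S] conj_commute)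
qed

lemma second_countable_strip: "second_countable_space (top_of_set S)"
proof -
  obtain B :: "(real^2) set set" where B: "countable B" "topological_basis B" using ex_countable_basis by blast
  have "\<exists>V\<in>{V\<in>B. V \<subseteq> S}. x \<in> V \<and> V \<subseteq> U" if UV: "openin (top_of_set S) U" "x \<in> U" for U x
  proof -
    have U: "open U" "U \<subseteq> S" using UV(1) openin_open_eq[OF open_S] by auto
    obtain V where "V \<in> B" "x \<in> V" "V \<subseteq> U" using topological_basisE[OF B(2) U(1) UV(2)] .
    with U(2) show ?thesis by blast
  qed
  moreover have "openin (top_of_set S) V" if "V \<in> {V\<in>B. V \<subseteq> S}" for V
    using that topological_basis_open[OF B(2)] openin_open_eq[OF open_S] by auto
  moreover have "countable {V\<in>B. V \<subseteq> S}" using B(1) by (auto intro: countable_subset)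
  ultimately show ?thesis unfolding second_countable_space_def by blast
qed

lemma smooth_first: "smooth_on J g \<Longrightarrow> smooth_on S (\<lambda>u. g (u $ 1))" for g :: "real \<Rightarrow> real"
  by (rule smooth_on_compose[OF open_S data(1) _ smooth_on_linear[OF bounded_linear_vec_nth open_S]]) auto

lemma smooth_model_connection: "smooth_on S (\<Gamma> i j l)"
proof (cases "i = 1 \<and> j = 1 \<and> l = 2")
  case True
  have "smooth_on S (\<lambda>u. \<alpha> (u $ 1) + u $ 2 * \<beta> (u $ 1))"
    by (intro smooth_on_add smooth_on_mult open_S smooth_first data smooth_on_linear[OF bounded_linear_vec_nth])
  with True show ?thesis by (simp add: model_connection_def[abs_def])
qed (auto simp: model_connection_def[abs_def])

lemma pd_jac_strip: "u \<in> S \<Longrightarrow> pd i (\<lambda>u. jac c c u $ a $ j) u = 0"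
  using pd_cong_open[OF open_S, of u "\<lambda>u. jac c c u $ a $ j" "\<lambda>u. mat 1 $ a $ j" i] c_simps(4) by simp

lemma affine_surface_strip: "affine_surface M (\<lambda>_. \<Gamma>)"
proof -
  have "connected_space (top_of_set S)"
    using convex_connected[OF S_convex] connectedin_iff_connected[of S] by (simp add: connectedin_def)
  moreover have "Hausdorff_space (top_of_set S)"
    by (simp add: Hausdorff_space_subtopology)
  moreover have "connection_law c c \<Gamma> \<Gamma>"
    unfolding connection_law_def c_simps(1)
    by (simp add: c_simps(3,4) pd_jac_strip sum_2 forall_2 mat_def)
  ultimately show ?thesis
    using second_countable_strip is_chart_c compatible_refl[OF is_chart_c] smooth_model_connection
    by (auto simp: affine_surface_def smooth_manifold_def torsion_free_connection_def atlas_topology_strip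
      c_simps(2) model_connection_def)
qed

lemma pd_model_connection:
  assumes "u \<in> S"
  shows "pd 2 (\<Gamma> 1 1 2) u = \<beta> (u $ 1)" "\<not> (i = 1 \<and> j = 1 \<and> l = 2) \<Longrightarrow> pd m (\<Gamma> i j l) u = 0"
proof -
  have *: "pd 2 (\<lambda>u. g (u $ 1)) u = 0" "(\<lambda>u. g (u $ 1)) differentiable (at u)" if "smooth_on J g" for g
    using pd_compose_real[OF data(1) that _ coordinate_differentiable, of u 1 2] smooth_on_differentiable[OF smooth_first[OF that] assms] assms
    by (simp_all add: pd_coordinate)
  show "pd 2 (\<Gamma> 1 1 2) u = \<beta> (u $ 1)"
    unfolding model_connection_def[abs_def] using *[OF data(4)] *[OF data(5)]
    by (simp add: pd_add pd_mult differentiable_mult pd_coordinate)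
  show "pd m (\<Gamma> i j l) u = 0" if "\<not> (i = 1 \<and> j = 1 \<and> l = 2)"
    unfolding model_connection_def[abs_def] using that by auto
qed

lemma ricci_strip:
  assumes "u \<in> S"
  shows "ricci \<Gamma> i j u = (if i = 1 \<and> j = 1 then \<beta> (u $ 1) else 0)"
  using exhaust_2[of i] exhaust_2[of j]
  by (auto simp: ricci_2 curvature_def pd_model_connection[OF assms] sum_2) (simp_all add: model_connection_def)

lemma soliton_strip: "affine_gradient_Ricci_soliton M (\<lambda>_. \<Gamma>) (\<lambda>u. k (u $ 1))"
proof -
  note k' = smooth_on_real_deriv(1)[OF data(1,6)]
  have p: "pd i (\<lambda>u. g (u $ 1)) u = deriv g (u $ 1) * (if i = 1 then 1 else 0)" if "smooth_on J g" "u \<in> S" for g i u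
    using pd_compose_real[OF data(1) that(1) _ coordinate_differentiable, of u 1] that by (simp add: pd_coordinate)
  have pp: "pd i (pd j (\<lambda>u. k (u $ 1))) u = - 2 * \<beta> (u $ 1) * (if i = 1 \<and> j = 1 then 1 else 0)" if u: "u \<in> S" for i j u
  proof -
    have "pd i (pd j (\<lambda>u. k (u $ 1))) u = pd i (\<lambda>u. deriv k (u $ 1) * (if j = 1 then 1 else 0)) u"
      by (rule pd_cong_open[OF open_S u p[OF data(6)]])
    then show ?thesis using p[OF k' u, of i] data(7) u by auto
  qed
  have hess: "hessian \<Gamma> (\<lambda>u. k (u $ 1)) i j u + 2 * ricci_sym \<Gamma> i j u = 0" if u: "u \<in> S" for i j u
    using p[OF data(6) u] by (auto simp: hessian_def pp[OF u] ricci_sym_def ricci_strip[OF u] sum_2 model_connection_def)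
  show ?thesis
    unfolding affine_gradient_Ricci_soliton_def smooth_function_def
    using smooth_first[OF data(6)] smooth_on_cong[OF open_S c_simps(5)[of _ "\<lambda>u. k (u $ 1)"]]
      hess hessian_cong_open[OF open_S _ c_simps(5)[of _ "\<lambda>u. k (u $ 1)"]]
    by (simp add: c_simps(2))
qed

text \<open>The tensor du^1 \<otimes> d_2 is parallel because \<open>\<Gamma>\<close> has only the
  component with lower indices 1, 1 and upper index 2, which leaves both du^1 and d_2 parallel. The
  zero tensor serves as the parallel symmetric one.\<close>

lemma model_realization:
  "\<exists>T\<^sub>0 \<Phi>\<^sub>0. affine_surface M (\<lambda>_. \<Gamma>) \<and> tensor11_field M T\<^sub>0 \<and> nilpotent_field M T\<^sub>0 \<and> parallel11 M (\<lambda>_. \<Gamma>) T\<^sub>0 \<and>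
    tensor02_field M \<Phi>\<^sub>0 \<and> symmetric_field M \<Phi>\<^sub>0 \<and> parallel02 M (\<lambda>_. \<Gamma>) \<Phi>\<^sub>0 \<and>
    symmetric_field M (\<lambda>_. ricci \<Gamma>) \<and> affine_gradient_Ricci_soliton M (\<lambda>_. \<Gamma>) (\<lambda>u. k (u $ 1)) \<and>
    differential_vanishes_on_kernel M T\<^sub>0 (\<lambda>u. k (u $ 1))"
proof (intro exI conjI)
  let ?T = "\<lambda>(_::unit) (i::2) (j::2) (u::real^2). if i = 1 \<and> j = 2 then 1 else 0 :: real"
  let ?\<Phi> = "\<lambda>(_::unit) (i::2) (j::2) (u::real^2). 0 :: real"
  show "tensor11_field M ?T"
    by (simp add: tensor11_field_def tensor11_law_def c_simps sum_2 forall_2 mat_def)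
  show "nilpotent_field M ?T"
    using S_ne by (auto simp: nilpotent_field_def c_simps(2) sum_2)
  show "parallel11 M (\<lambda>_. \<Gamma>) ?T"
    by (simp add: parallel11_def sum_2 forall_2 model_connection_def)
  show "tensor02_field M ?\<Phi>" "symmetric_field M ?\<Phi>" "parallel02 M (\<lambda>_. \<Gamma>) ?\<Phi>"
    by (simp_all add: tensor02_field_def tensor02_law_def symmetric_field_def parallel02_def)
  show "symmetric_field M (\<lambda>_. ricci \<Gamma>)"
    by (auto simp: symmetric_field_def c_simps(2) ricci_strip)
  show "differential_vanishes_on_kernel M ?T (\<lambda>u. k (u $ 1))"
    unfolding differential_vanishes_on_kernel_def M_simps c_simps(2)
  proof (intro ballI allI impI)
    fix x v :: "real^2" assume x: "x \<in> S" and v: "\<forall>l. (\<Sum>a\<in>UNIV. v $ a * (if a = 1 \<and> l = (2::2) then 1 else 0)) = 0"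
    have "v $ 1 = 0" using spec[OF v, of 2] by (simp add: sum_2)
    moreover have "pd 2 (local_rep c (\<lambda>u. k (u $ 1))) x = pd 2 (\<lambda>u. k (u $ 1)) x"
      by (rule pd_cong_open[OF open_S x c_simps(5)])
    moreover have "pd 2 (\<lambda>u. k (u $ 1)) x = 0"
      using pd_compose_real[OF data(1,6) _ coordinate_differentiable, of x 1 2] x by (simp add: pd_coordinate)
    ultimately show "(\<Sum>a\<in>UNIV. v $ a * pd a (local_rep c (\<lambda>u. k (u $ 1))) x) = 0"
      by (simp add: sum_2)
  qed
qed (rule affine_surface_strip soliton_strip)+

end

text \<open>The third conjunct gives the word arbitrary its content: every smooth \<alpha> and
  \<beta> on an open interval, with any solution k, come from a surface that satisfies all
  conditions of the affine side.\<close>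

theorem theorem5p3:
  fixes \<Sigma> :: "('i, 'p, 2) atlas"
    and D :: "'i \<Rightarrow> 2 field3"
    and T \<Phi> :: "'i \<Rightarrow> 2 field2"
    and h :: "'p \<Rightarrow> real"
    and orn :: "'i \<Rightarrow> real^(2 + 2) \<Rightarrow> real"
  defines "g \<equiv> modified_riemann_extension D (hat_field T \<Phi>) T"
  assumes "affine_surface \<Sigma> D"
    and "tensor11_field \<Sigma> T" and "nilpotent_field \<Sigma> T" and "parallel11 \<Sigma> D T"
    and "tensor02_field \<Sigma> \<Phi>" and "symmetric_field \<Sigma> \<Phi>" and "parallel02 \<Sigma> D \<Phi>"
    and "symmetric_field \<Sigma> (\<lambda>i. ricci (D i))"
    and "smooth_function \<Sigma> h"
    and "cotangent_orientation \<Sigma> g orn"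
  shows "(affine_gradient_Ricci_soliton \<Sigma> D h \<and> differential_vanishes_on_kernel \<Sigma> T h \<longleftrightarrow>
           anti_self_dual (cotangent_bundle \<Sigma>) g orn \<and>
           steady_gradient_Ricci_soliton (cotangent_bundle \<Sigma>) g (h \<circ> fst) \<and>
           \<not> locally_conformally_flat (cotangent_bundle \<Sigma>) g) \<and>
         (affine_gradient_Ricci_soliton \<Sigma> D h \<and> differential_vanishes_on_kernel \<Sigma> T h \<longrightarrow>
           (\<forall>p\<in>points \<Sigma>. \<exists>c J \<alpha> \<beta> k.
              local_coordinates \<Sigma> c \<and> p \<in> fst c \<and>
              model_data J \<alpha> \<beta> k \<and> (\<forall>q\<in>fst c. snd c q $ 1 \<in> J) \<and>
              (\<forall>i\<in>index \<Sigma>. connection_law (chart \<Sigma> i) c (D i) (model_connection \<alpha> \<beta>)) \<and>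
              (\<forall>q\<in>fst c. h q = k (snd c q $ 1)))) \<and>
         (\<forall>J \<alpha> \<beta> k. model_data J \<alpha> \<beta> k \<longrightarrow>
           (\<exists>T\<^sub>0 \<Phi>\<^sub>0.
              affine_surface (model_strip J) (\<lambda>_. model_connection \<alpha> \<beta>) \<and>
              tensor11_field (model_strip J) T\<^sub>0 \<and> nilpotent_field (model_strip J) T\<^sub>0 \<and>
              parallel11 (model_strip J) (\<lambda>_. model_connection \<alpha> \<beta>) T\<^sub>0 \<and>
              tensor02_field (model_strip J) \<Phi>\<^sub>0 \<and> symmetric_field (model_strip J) \<Phi>\<^sub>0 \<and>
              parallel02 (model_strip J) (\<lambda>_. model_connection \<alpha> \<beta>) \<Phi>\<^sub>0 \<and>
              symmetric_field (model_strip J) (\<lambda>_. ricci (model_connection \<alpha> \<beta>)) \<and>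
              affine_gradient_Ricci_soliton (model_strip J) (\<lambda>_. model_connection \<alpha> \<beta>)
                (\<lambda>u. k (u $ 1)) \<and>
              differential_vanishes_on_kernel (model_strip J) T\<^sub>0 (\<lambda>u. k (u $ 1))))"
proof -
  interpret ps: parallel_surface \<Sigma> D T \<Phi> by unfold_locales (fact assms)+
  have equivalence: "affine_gradient_Ricci_soliton \<Sigma> D h \<and> differential_vanishes_on_kernel \<Sigma> T h \<longleftrightarrow>
      anti_self_dual (cotangent_bundle \<Sigma>) g orn \<and>
      steady_gradient_Ricci_soliton (cotangent_bundle \<Sigma>) g (h \<circ> fst) \<and>
      \<not> locally_conformally_flat (cotangent_bundle \<Sigma>) g"
    using ps.soliton_equivalence assms unfolding g_def by blast
  have coordinates: "\<exists>c J \<alpha> \<beta> k. local_coordinates \<Sigma> c \<and> p \<in> fst c \<and> model_data J \<alpha> \<beta> k \<and> (\<forall>q\<in>fst c. snd c q $ 1 \<in> J) \<and>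
      (\<forall>i\<in>index \<Sigma>. connection_law (chart \<Sigma> i) c (D i) (model_connection \<alpha> \<beta>)) \<and> (\<forall>q\<in>fst c. h q = k (snd c q $ 1))"
    if "affine_gradient_Ricci_soliton \<Sigma> D h" "differential_vanishes_on_kernel \<Sigma> T h" "p \<in> points \<Sigma>" for p
    by (rule ps.soliton_coordinates[OF that]) blast
  show ?thesis
    using equivalence coordinates local_model.model_realization[OF local_model.intro] by (intro conjI impI allI ballI) blast+
qed


end
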